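(* Let $V\subset\mathbf{R}$ be a $\mathbf{Q}$-vector subspace. Every $(\mathbf{Z},V)$-polytope has a polystable subdivision.
   Context: A $V$-affine function on $\mathbf{R}^n$ is a function $x\mapsto v+\sum_i a_ix_i$ with $v\in V$ and $a_i\in\mathbf{Z}$. A $(\mathbf{Z},V)$-polytope in $\mathbf{R}^n$ is a (nonempty) bounded set defined by finitely many inequalities $f_j\ge0$ with $f_j$ $V$-affine; equivalently, a polytope whose vertices lie in $V^n$ and whose edges have rational directions. A polyhedral complex is a finite collection of $k$-dimensional polytopes (fixed $k$) in $\mathbf{R}^n$, called cells, such that the intersection of any two cells is a face of both (the empty set counts as a face). A subdivision of a polytope $P$ is a polyhedral complex whose union of cells equals $P$; it is a $(\mathbf{Z},V)$-subdivision if all cells are $(\mathbf{Z},V)$-polytopes. A polysimplex is a polytope $P=A_1+\dots+A_r$ (Minkowski sum) with each $A_i$ a simplex and $\sum_i\dim A_i=\dim P$. A $(\mathbf{Z},V)$-polytope is polystable if it is a polysimplex and, for each vertex $w$ of it, the primitive integral normals of the facets containing $w$ form a unimodular matrix, i.e. a basis of the lattice of integral linear forms on the affine hull of the polytope (the restrictions of $\mathbf{Z}$-linear forms to the direction space of the affine hull). Equivalently, up to a transformation $x\mapsto Ax+v$ with $A\in\mathrm{GL}_n(\mathbf{Z})$, $v\in V^n$, it is of the form $\Delta_{m_1}(\pi_1)\times\dots\times\Delta_{m_l}(\pi_l)\times\{0\}$ with $\pi_i\in V_{>0}$ and $\Delta_m(\pi)=\{t\in\mathbf{R}^m:t_i\ge0,\sum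 t_i\le\pi\}$. A polystable subdivision is a $(\mathbf{Z},V)$-subdivision all of whose cells are polystable. *)

theory Defs
  imports "HOL-Analysis.Analysis"
begin

definition rat_subspace :: "real set \<Rightarrow> bool" where
  "rat_subspace V \<longleftrightarrow> module.subspace (\<lambda>(q::rat) (x::real). of_rat q * x) V"

lemma rat_subspace_iff:
  "rat_subspace V \<longleftrightarrow>
     0 \<in> V \<and> (\<forall>x\<in>V. \<forall>y\<in>V. x + y \<in> V) \<and> (\<forall>q. \<forall>x\<in>V. of_rat q * x \<in> V)"
proof -
  interpret module "\<lambda>(q::rat) (x::real). of_rat q * x"
    by unfold_locales (simp_all add: algebra_simps of_rat_add of_rat_mult)
  show ?thesis
    by (simp add: rat_subspace_def subspace_def)
qed

definition int_form :: "int ^ 'n \<Rightarrow> real ^ 'n \<Rightarrow> real" where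
  "int_form a x = (\<Sum>i\<in>UNIV. of_int (a $ i) * x $ i)"

definition V_affine :: "real set \<Rightarrow> (real ^ 'n \<Rightarrow> real) \<Rightarrow> bool" where
  "V_affine V f \<longleftrightarrow> (\<exists>v\<in>V. \<exists>a. f = (\<lambda>x. v + int_form a x))"

definition ZV_polytope :: "real set \<Rightarrow> (real ^ 'n) set \<Rightarrow> bool" where
  "ZV_polytope V P \<longleftrightarrow> P \<noteq> {} \<and> bounded P \<and>
     (\<exists>F. finite F \<and> (\<forall>f\<in>F. V_affine V f) \<and> P = {x. \<forall>f\<in>F. 0 \<le> f x})"

text \<open>The dimension \<open>k\<close> is a natural number, so cells are nonempty. The relation \<open>face_of\<close>
  admits both the empty set and the whole polytope as faces.\<close>

definition polyhedral_complex :: "(real ^ 'n) set set \<Rightarrow> bool" where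
  "polyhedral_complex \<C> \<longleftrightarrow> finite \<C> \<and>
     (\<exists>k::nat. \<forall>C\<in>\<C>. polytope C \<and> aff_dim C = int k) \<and>
     (\<forall>C\<in>\<C>. \<forall>D\<in>\<C>. C \<inter> D face_of C \<and> C \<inter> D face_of D)"

definition subdivision :: "(real ^ 'n) set set \<Rightarrow> (real ^ 'n) set \<Rightarrow> bool" where
  "subdivision \<C> P \<longleftrightarrow> polyhedral_complex \<C> \<and> \<Union>\<C> = P"

definition ZV_subdivision :: "real set \<Rightarrow> (real ^ 'n) set set \<Rightarrow> (real ^ 'n) set \<Rightarrow> bool" where
  "ZV_subdivision V \<C> P \<longleftrightarrow> subdivision \<C> P \<and> (\<forall>C\<in>\<C>. ZV_polytope V C)"

text \<open>The sum of the sets \<open>A i\<close> is their Minkowski sum. The predicate \<open>simplex\<close> also holds of the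
  empty set, in dimension \<open>-1\<close>; the condition \<open>0 \<le> m\<close> rules it out.\<close>

definition polysimplex :: "(real ^ 'n) set \<Rightarrow> bool" where
  "polysimplex P \<longleftrightarrow> (\<exists>(r::nat) A. (\<forall>i<r. \<exists>m\<ge>0. m simplex A i) \<and>
     P = (\<Sum>i<r. A i) \<and> (\<Sum>i<r. aff_dim (A i)) = aff_dim P)"

definition direction_space :: "(real ^ 'n) set \<Rightarrow> (real ^ 'n) set" where
  "direction_space P = {x - y | x y. x \<in> affine hull P \<and> y \<in> affine hull P}"

text \<open>Forms on the direction space are extensional functions, so that two integral linear forms
  are identified exactly when their restrictions agree.\<close>

definition form_lattice :: "(real ^ 'n) set \<Rightarrow> (real ^ 'n \<Rightarrow> real) set" where
  "form_lattice P = range (\<lambda>a. restrict (int_form a) (direction_space P))"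

text \<open>Taking \<open>m = l = 0\<close> and \<open>c = 0\<close> shows that primitive forms are nonzero.\<close>

definition primitive_form :: "(real ^ 'n) set \<Rightarrow> (real ^ 'n \<Rightarrow> real) \<Rightarrow> bool" where
  "primitive_form P l \<longleftrightarrow> l \<in> form_lattice P \<and>
     (\<forall>(c::int). \<forall>m\<in>form_lattice P.
        l = restrict (\<lambda>x. of_int c * m x) (direction_space P) \<longrightarrow> \<bar>c\<bar> = 1)"

text \<open>The form \<open>l\<close> attains its minimum over \<open>P\<close> exactly on \<open>F\<close>. It is evaluated on differences
  because it lives on the direction space only.\<close>

definition facet_normal :: "(real ^ 'n) set \<Rightarrow> (real ^ 'n) set \<Rightarrow> (real ^ 'n \<Rightarrow> real) \<Rightarrow> bool" where
  "facet_normal P F l \<longleftrightarrow> primitive_form P l \<and>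
     (\<forall>x\<in>P. \<forall>y\<in>F. 0 \<le> l (x - y) \<and> (l (x - y) = 0 \<longleftrightarrow> x \<in> F))"

definition lattice_basis :: "(real ^ 'n) set \<Rightarrow> (real ^ 'n \<Rightarrow> real) set \<Rightarrow> bool" where
  "lattice_basis P B \<longleftrightarrow> finite B \<and> B \<subseteq> form_lattice P \<and>
     (\<forall>l\<in>form_lattice P. \<exists>c :: (real ^ 'n \<Rightarrow> real) \<Rightarrow> int.
        \<forall>x\<in>direction_space P. l x = (\<Sum>b\<in>B. of_int (c b) * b x)) \<and>
     (\<forall>c :: (real ^ 'n \<Rightarrow> real) \<Rightarrow> int.
        (\<forall>x\<in>direction_space P. (\<Sum>b\<in>B. of_int (c b) * b x) = 0) \<longrightarrow> (\<forall>b\<in>B. c b = 0))"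

text \<open>Each facet of a \<open>(\<int>,V)\<close>-polytope has exactly one \<open>facet_normal\<close> and is determined by it,
  so the set of normals below has one element per facet containing \<open>w\<close>.\<close>

definition polystable :: "real set \<Rightarrow> (real ^ 'n) set \<Rightarrow> bool" where
  "polystable V P \<longleftrightarrow> ZV_polytope V P \<and> polysimplex P \<and>
     (\<forall>w. w extreme_point_of P \<longrightarrow>
        lattice_basis P {l. \<exists>F. F facet_of P \<and> w \<in> F \<and> facet_normal P F l})"

definition polystable_subdivision ::
    "real set \<Rightarrow> (real ^ 'n) set set \<Rightarrow> (real ^ 'n) set \<Rightarrow> bool" where
  "polystable_subdivision V \<C> P \<longleftrightarrow> ZV_subdivision V \<C> P \<and> (\<forall>C\<in>\<C>. polystable V C)"

end

theory Submission
  imports Defs "HOL-Library.Multiset"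
begin

text \<open>The polytope is represented as the set of all \<open>ev a\<close>, where \<open>a\<close> is a nonnegative formal combination of
  integral points labelled \<open>0, \<dots>, r - 1\<close>, is carried by a cone of a fixed simplicial complex, and has
  prescribed mass \<open>lam l\<close> in each label. A cone cuts out a cell which is a sum of simplices, and this cell is
  polystable as soon as the cone is unimodular, because then the edge vectors at each vertex are part of a
  lattice basis and the normals are the dual integral forms.

  Such a representation exists: Euclidean subtraction on the finitely many numbers occurring as vertex
  coordinates and constant terms produces positive \<open>lam l \<in> V\<close> in which all of them have integral coefficients and
  all slacks at the vertices have nonnegative ones. The coefficient vectors of the vertices are the labelled
  points, and the cones carrying only lexicographically minimal combinations triangulate.

  To make all cones unimodular, the masses are changed. Replace the generators of label \<open>k\<close> by words with
  \<open>y l\<close> letters of label \<open>l\<close>; arranging the letters along a fixed order, every point is a unique combination of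
  words whose letter counts interleave, and the index does not grow. Words with the masses of
  a box point \<open>c\<close> can serve as generators of label \<open>k\<close> next to \<open>c\<close> itself, so that \<open>c\<close> can be starred, and the
  index drops for all cones carrying \<open>c\<close>. Treating the labels in increasing order, and the cones of maximal
  index one after the other, leaves only unimodular cones.\<close>

section \<open>Words\<close>

text \<open>Starring at a box point \<open>c\<close> needs a ray through \<open>c\<close>, but the
  masses of \<open>c\<close> spread over several labels, and a generator of mixed mass would destroy
  the Minkowski sum structure of the cells. Words repair this: once the generators of label
  \<open>k\<close> are words with the masses of \<open>c\<close>, the point \<open>c\<close> has the
  same masses as each of them and can join them as one more generator of label \<open>k\<close>. The
  price is paid in mass: words use up letters of the other labels, whose masses stay positive only
  while that of \<open>k\<close> is small beside them, and the new masses arise by division, hence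
  rational multiples in \<open>V\<close>. Refining multiplies the cones, so the cones of maximal
  index cannot be counted down. What decreases is the number of regions: a region passes its
  selection of box points on to all cones that descend from its own without loss of index.\<close>

definition wcount :: "('a \<times> nat \<Rightarrow> nat) \<Rightarrow> ('a \<times> nat) multiset \<Rightarrow> nat \<Rightarrow> nat \<Rightarrow> nat" where
  "wcount rk w l i = size {#x \<in># w. snd x = l \<and> rk x < i#}"

text \<open>In a chain the rank counts of any two words interleave, so a point has a unique expansion into the words
  of a chain, with integral coefficients if the point is integral.\<close>

definition wrel :: "('a \<times> nat \<Rightarrow> nat) \<Rightarrow> ('a \<times> nat) multiset \<Rightarrow> ('a \<times> nat) multiset \<Rightarrow> bool" where
  "wrel rk w w' \<longleftrightarrow> (\<forall>l i. wcount rk w' l i \<le> wcount rk w l i \<and> wcount rk w l i \<le> wcount rk w' l i + 1)"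

definition wchain :: "('a \<times> nat \<Rightarrow> nat) \<Rightarrow> ('a \<times> nat) multiset set \<Rightarrow> bool" where
  "wchain rk F \<longleftrightarrow> (\<forall>w\<in>F. \<forall>w'\<in>F. wrel rk w w' \<or> wrel rk w' w)"

definition rank_inj :: "('a \<times> nat \<Rightarrow> nat) \<Rightarrow> ('a \<times> nat) set \<Rightarrow> bool" where
  "rank_inj rk U \<longleftrightarrow> (\<forall>g\<in>U. \<forall>g'\<in>U. snd g = snd g' \<and> rk g = rk g' \<longrightarrow> g = g')"

lemma rank_inj_subset: "rank_inj rk U \<Longrightarrow> W \<subseteq> U \<Longrightarrow> rank_inj rk W"
  by (auto simp: rank_inj_def)

lemma wchain_subset: "wchain rk F \<Longrightarrow> F' \<subseteq> F \<Longrightarrow> wchain rk F'"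
  by (auto simp: wchain_def)

lemma wcount_sum:
  assumes "finite U" "set_mset w \<subseteq> U"
  shows "wcount rk w l i = (\<Sum>g\<in>{g\<in>U. snd g = l \<and> rk g < i}. count w g)"
proof -
  have "wcount rk w l i = (\<Sum>g\<in>{g\<in>set_mset w. snd g = l \<and> rk g < i}. count w g)"
    unfolding wcount_def size_multiset_overloaded_eq
    by (intro sum.cong) auto
  also have "\<dots> = (\<Sum>g\<in>{g\<in>U. snd g = l \<and> rk g < i}. count w g)"
    by (rule sum.mono_neutral_left) (use assms in \<open>auto simp: count_eq_zero_iff\<close>)
  finally show ?thesis .
qed

lemma wcount_Suc:
  assumes "rank_inj rk U" "g \<in> U" "set_mset w \<subseteq> U" "finite U"
  shows "wcount rk w (snd g) (Suc (rk g)) = wcount rk w (snd g) (rk g) + count w g"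
proof -
  have *: "{g'\<in>U. snd g' = snd g \<and> rk g' < Suc (rk g)} = insert g {g'\<in>U. snd g' = snd g \<and> rk g' < rk g}"
    using assms(1,2) unfolding rank_inj_def by (auto simp: less_Suc_eq)
  show ?thesis
    unfolding wcount_sum[OF assms(4,3)] * using assms(4) by simp
qed

lemma wcount_eqI:
  assumes "rank_inj rk U" "finite U" "set_mset w \<subseteq> U" "set_mset w' \<subseteq> U"
    and "\<And>l i. wcount rk w l i = wcount rk w' l i"
  shows "w = w'"
proof (rule multiset_eqI)
  fix g
  show "count w g = count w' g"
  proof (cases "g \<in> U")
    case True
    from wcount_Suc[OF assms(1) True assms(3,2)] wcount_Suc[OF assms(1) True assms(4,2)]
    show ?thesis using assms(5) by simp
  next
    case False
    then show ?thesis using assms(3,4) by (metis count_eq_zero_iff in_mono)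
  qed
qed

text \<open>\<open>wrel\<close> is not transitive, so the new word \<open>x\<close> has to be
  compared with every member again. If \<open>x\<close> relates to the old top \<open>t\<close> but
  some \<open>w\<close> relates to \<open>x\<close>, the counts of \<open>w\<close>,
  \<open>t\<close>, \<open>x\<close>, \<open>w\<close> increase weakly in this cyclic order, hence
  are equal, and \<open>x\<close> relates to \<open>w\<close> after all.\<close>

lemma wchain_top:
  assumes "finite F" "F \<noteq> {}" "wchain rk F"
  obtains t where "t \<in> F" "\<And>w. w \<in> F \<Longrightarrow> wrel rk t w"
proof -
  have "\<exists>t\<in>F. \<forall>w\<in>F. wrel rk t w"
    using assms
  proof (induction F rule: finite_ne_induct)
    case (singleton x)
    then show ?case by (auto simp: wchain_def)
  next
    case (insert x F)
    then obtain t where t: "t \<in> F" "\<forall>w\<in>F. wrel rk t w"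
      by (meson subset_insertI wchain_subset)
    have ch: "\<And>u v. u \<in> insert x F \<Longrightarrow> v \<in> insert x F \<Longrightarrow> wrel rk u v \<or> wrel rk v u"
      using insert.prems unfolding wchain_def by blast
    have xx: "wrel rk x x" using ch by blast
    show ?case
    proof (cases "wrel rk t x")
      case True
      then show ?thesis using t by auto
    next
      case False
      then have xt: "wrel rk x t" using ch t(1) by blast
      have "wrel rk x w" if "w \<in> F" for w
      proof -
        have "wrel rk x w \<or> wrel rk w x" using ch that by blast
        moreover have "wrel rk x w" if wx: "wrel rk w x"
          unfolding wrel_def
        proof (intro allI)
          fix l i
          have "wcount rk w l i \<le> wcount rk t l i" using t \<open>w \<in> F\<close> by (auto simp: wrel_def)
          moreover have "wcount rk t l i \<le> wcount rk x l i" using xt by (auto simp: wrel_def)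
          moreover have "wcount rk x l i \<le> wcount rk w l i" using wx by (auto simp: wrel_def)
          ultimately show "wcount rk w l i \<le> wcount rk x l i \<and> wcount rk x l i \<le> wcount rk w l i + 1"
            by simp
        qed
        ultimately show ?thesis by blast
      qed
      then show ?thesis using xx by blast
    qed
  qed
  then show ?thesis using that by blast
qed

definition real_subgroup :: "real set \<Rightarrow> bool" where
  "real_subgroup H \<longleftrightarrow> 0 \<in> H \<and> (\<forall>x\<in>H. \<forall>y\<in>H. x - y \<in> H)"

lemma real_subgroup_minus: "real_subgroup H \<Longrightarrow> x \<in> H \<Longrightarrow> y \<in> H \<Longrightarrow> x - y \<in> H"
  by (auto simp: real_subgroup_def)

lemma real_subgroup_add: "real_subgroup H \<Longrightarrow> x \<in> H \<Longrightarrow> y \<in> H \<Longrightarrow> x + y \<in> H"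
  unfolding real_subgroup_def by (metis diff_0 diff_minus_eq_add)

lemma real_subgroup_mult_nat: "real_subgroup H \<Longrightarrow> x \<in> H \<Longrightarrow> x * real n \<in> H"
proof (induction n)
  case 0 then show ?case by (simp add: real_subgroup_def)
next
  case (Suc n) then show ?case using real_subgroup_add[of H "x * real n" x] by (simp add: algebra_simps)
qed

lemma real_subgroup_sum: "real_subgroup H \<Longrightarrow> (\<And>x. x \<in> A \<Longrightarrow> f x \<in> H) \<Longrightarrow> sum f A \<in> H"
proof (induction A rule: infinite_finite_induct)
  case (insert x F)
  then show ?case using real_subgroup_add[of H "f x" "sum f F"] by simp
qed (auto simp: real_subgroup_def)

lemma real_subgroup_Ints: "real_subgroup \<int>" by (auto simp: real_subgroup_def)

text \<open>A threshold \<open>(l, i)\<close> separating the top \<open>t\<close> from the next word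
  \<open>u\<close> isolates the coefficient of \<open>t\<close>: there \<open>t\<close> counts one
  more than \<open>u\<close>, and every other word counts exactly as \<open>u\<close>, being
  squeezed between the two. Removing the top and repeating solves the system without division. This
  triangularity is why words do not increase the index.\<close>

lemma wchain_primitive:
  assumes "real_subgroup H" "rank_inj rk U" "finite U"
  shows "finite F \<Longrightarrow> wchain rk F \<Longrightarrow> (\<And>w. w \<in> F \<Longrightarrow> set_mset w \<subseteq> U) \<Longrightarrow> (\<Sum>w\<in>F. c w) \<in> H \<Longrightarrow>
    (\<And>l i. (\<Sum>w\<in>F. c w * wcount rk w l i) \<in> H) \<Longrightarrow> w0 \<in> F \<Longrightarrow> c w0 \<in> H"
proof (induction "card F" arbitrary: F w0)
  case 0
  then show ?case by simp
next
  case (Suc n)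
  obtain t where t: "t \<in> F" "\<And>w. w \<in> F \<Longrightarrow> wrel rk t w"
    using wchain_top[of F rk] Suc.prems by blast
  let ?F = "F - {t}"
  have s: "(\<Sum>w\<in>F. f w) = f t + (\<Sum>w\<in>?F. f w)" for f :: "_ \<Rightarrow> real"
    using t(1) Suc.prems(1) by (meson sum.remove)
  have ct: "c t \<in> H"
  proof (cases "?F = {}")
    case True
    have "sum c F = c t" using s[of c] unfolding True sum.empty add_0_right .
    then show ?thesis using Suc.prems(4) by (simp only:)
  next
    case False
    have fF: "finite ?F" using Suc.prems(1) by simp
    have chF: "wchain rk ?F" by (rule wchain_subset[OF Suc.prems(2)]) auto
    obtain u where u: "u \<in> ?F" "\<And>w. w \<in> ?F \<Longrightarrow> wrel rk u w"
      using wchain_top[OF fF False chF] by blast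
    have "u \<noteq> t" using u by auto
    then obtain l i where li: "wcount rk u l i \<noteq> wcount rk t l i"
      using wcount_eqI[OF assms(2,3) Suc.prems(3) Suc.prems(3), of u t] u(1) t(1) by blast
    have tu: "wrel rk t u" using t u by auto
    then have e1: "wcount rk t l i = wcount rk u l i + 1"
      using li by (metis wrel_def le_neq_implies_less less_eq_Suc_le Suc_eq_plus1 le_antisym)
    have e2: "wcount rk w l i = wcount rk u l i" if "w \<in> ?F" for w
      using u(2)[OF that] t(2)[of w] that e1 unfolding wrel_def
      by (metis DiffD1 add_le_cancel_right le_antisym)
    have "(\<Sum>w\<in>F. c w * wcount rk w l i) = c t * wcount rk t l i + (\<Sum>w\<in>?F. c w * wcount rk u l i)"
      unfolding s using e2 by simp
    also have "\<dots> = c t + (\<Sum>w\<in>F. c w) * wcount rk u l i"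
      unfolding s[of c] e1 by (simp add: algebra_simps sum_distrib_left)
    finally have "c t = (\<Sum>w\<in>F. c w * wcount rk w l i) - (\<Sum>w\<in>F. c w) * wcount rk u l i" by simp
    then show ?thesis
      using real_subgroup_minus[OF assms(1) Suc.prems(5) real_subgroup_mult_nat[OF assms(1) Suc.prems(4)]] by metis
  qed
  show ?case
  proof (cases "w0 = t")
    case True then show ?thesis using ct by simp
  next
    case False
    show ?thesis
    proof (rule Suc.hyps(1)[of ?F])
      show "n = card ?F" using Suc.hyps(2) t(1) Suc.prems(1) by simp
      show "wchain rk ?F" using Suc.prems(2) wchain_subset by blast
      show "(\<Sum>w\<in>?F. c w) \<in> H" using real_subgroup_minus[OF assms(1) Suc.prems(4) ct] s[of c] by simp
      show "(\<Sum>w\<in>?F. c w * real (wcount rk w l i)) \<in> H" for l i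
        using real_subgroup_minus[OF assms(1) Suc.prems(5)[of l i] real_subgroup_mult_nat[OF assms(1) ct, of "wcount rk t l i"]]
          s[of "\<lambda>w. c w * wcount rk w l i"] by simp
    qed (use Suc.prems False in auto)
  qed
qed

text \<open>Together the two bounds say that each count of the top word is the weighted count
  divided by the total weight, rounded up.\<close>

lemma wchain_top_count:
  fixes b :: "('a \<times> nat) multiset \<Rightarrow> real"
  assumes "finite F" "t \<in> F" "\<And>w. w \<in> F \<Longrightarrow> wrel rk t w" "\<And>w. w \<in> F \<Longrightarrow> 0 < b w"
  shows "(\<Sum>w\<in>F. b w * wcount rk w l i) \<le> sum b F * wcount rk t l i"
    and "sum b F * (real (wcount rk t l i) - 1) < (\<Sum>w\<in>F. b w * wcount rk w l i)"
proof -
  have le: "wcount rk w l i \<le> wcount rk t l i" "wcount rk t l i \<le> wcount rk w l i + 1" if "w \<in> F" for w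
    using assms(3)[OF that] by (auto simp: wrel_def)
  show "(\<Sum>w\<in>F. b w * wcount rk w l i) \<le> sum b F * wcount rk t l i"
    unfolding sum_distrib_right
    using le assms(4) by (intro sum_mono mult_left_mono) (auto simp: less_imp_le)
  have "(\<Sum>w\<in>F. b w * (real (wcount rk t l i) - 1)) < (\<Sum>w\<in>F. b w * wcount rk w l i)"
  proof (rule sum_strict_mono_ex1)
    show "\<forall>w\<in>F. b w * (real (wcount rk t l i) - 1) \<le> b w * real (wcount rk w l i)"
    proof
      fix w assume w: "w \<in> F"
      have "real (wcount rk t l i) - 1 \<le> real (wcount rk w l i)" using le(2)[OF w] by linarith
      then show "b w * (real (wcount rk t l i) - 1) \<le> b w * real (wcount rk w l i)"
        using assms(4)[OF w] by simp
    qed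
    show "\<exists>a\<in>F. b a * (real (wcount rk t l i) - 1) < b a * real (wcount rk a l i)"
      using assms(2,4) by (intro bexI[of _ t]) auto
  qed (fact assms)
  then show "sum b F * (real (wcount rk t l i) - 1) < (\<Sum>w\<in>F. b w * wcount rk w l i)"
    by (simp add: sum_distrib_right)
qed

text \<open>The top word is a rounded average and so depends only on the weighted counts and the
  total weight; both expansions have the same top. Subtracting the smaller of its two coefficients
  removes it from at least one of them, and the number of words drops.\<close>

lemma wchain_unique:
  fixes b1 b2 :: "('a \<times> nat) multiset \<Rightarrow> real"
  assumes "rank_inj rk U" "finite U"
  shows "finite {w. b1 w \<noteq> 0} \<Longrightarrow> finite {w. b2 w \<noteq> 0} \<Longrightarrow> wchain rk {w. b1 w \<noteq> 0} \<Longrightarrow> wchain rk {w. b2 w \<noteq> 0} \<Longrightarrow>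
    (\<And>w. b1 w \<noteq> 0 \<or> b2 w \<noteq> 0 \<Longrightarrow> set_mset w \<subseteq> U) \<Longrightarrow> (\<And>w. b1 w \<ge> 0) \<Longrightarrow> (\<And>w. b2 w \<ge> 0) \<Longrightarrow>
    sum b1 {w. b1 w \<noteq> 0} = sum b2 {w. b2 w \<noteq> 0} \<Longrightarrow>
    (\<And>l i. (\<Sum>w\<in>{w. b1 w \<noteq> 0}. b1 w * wcount rk w l i) = (\<Sum>w\<in>{w. b2 w \<noteq> 0}. b2 w * wcount rk w l i)) \<Longrightarrow>
    b1 = b2"
proof (induction "card {w. b1 w \<noteq> 0} + card {w. b2 w \<noteq> 0}" arbitrary: b1 b2 rule: less_induct)
  case (less b1 b2)
  let ?F1 = "{w. b1 w \<noteq> 0}" and ?F2 = "{w. b2 w \<noteq> 0}"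
  have pos1: "0 < b1 w" if "w \<in> ?F1" for w using less.prems(6)[of w] that by auto
  have pos2: "0 < b2 w" if "w \<in> ?F2" for w using less.prems(7)[of w] that by auto
  have p1: "sum b1 ?F1 > 0" if "?F1 \<noteq> {}" by (rule sum_pos[OF less.prems(1) that pos1])
  have p2: "sum b2 ?F2 > 0" if "?F2 \<noteq> {}" by (rule sum_pos[OF less.prems(2) that pos2])
  have ne: "?F1 = {} \<longleftrightarrow> ?F2 = {}"
  proof
    assume "?F1 = {}"
    then have "sum b1 ?F1 = 0" by (simp only: sum.empty)
    then have "\<not> sum b2 ?F2 > 0" using less.prems(8) by linarith
    then show "?F2 = {}" using p2 by blast
  next
    assume "?F2 = {}"
    then have "sum b2 ?F2 = 0" by (simp only: sum.empty)
    then have "\<not> sum b1 ?F1 > 0" using less.prems(8) by linarith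
    then show "?F1 = {}" using p1 by blast
  qed
  show ?case
  proof (cases "?F1 = {}")
    case True
    then have "b1 = (\<lambda>_. 0)" "b2 = (\<lambda>_. 0)" using ne by auto
    then show ?thesis by simp
  next
    case False
    then have F2: "?F2 \<noteq> {}" using ne by blast
    obtain t1 where t1: "t1 \<in> ?F1" "\<And>w. w \<in> ?F1 \<Longrightarrow> wrel rk t1 w"
      using wchain_top[OF less.prems(1) False less.prems(3)] by blast
    obtain t2 where t2: "t2 \<in> ?F2" "\<And>w. w \<in> ?F2 \<Longrightarrow> wrel rk t2 w"
      using wchain_top[OF less.prems(2) F2 less.prems(4)] by blast
    have al: "sum b1 ?F1 > 0" using sum_pos[OF less.prems(1) False pos1] .
    have "wcount rk t1 l i = wcount rk t2 l i" for l i
    proof -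
      note a = wchain_top_count[of ?F1 t1 rk b1 l i, OF less.prems(1) t1 pos1]
      note b = wchain_top_count[of ?F2 t2 rk b2 l i, OF less.prems(2) t2 pos2]
      have "sum b1 ?F1 * (real (wcount rk t1 l i) - 1) < sum b1 ?F1 * wcount rk t2 l i"
        using a(2) b(1) unfolding less.prems(8) less.prems(9) by (rule less_le_trans)
      moreover have "sum b1 ?F1 * (real (wcount rk t2 l i) - 1) < sum b1 ?F1 * wcount rk t1 l i"
        using b(2) a(1) unfolding less.prems(8) less.prems(9) by (rule less_le_trans)
      ultimately show ?thesis using al by simp
    qed
    then have tt: "t1 = t2" using wcount_eqI[OF assms, of t1 t2] less.prems(5) t1(1) t2(1) by blast
    define e where "e = min (b1 t1) (b2 t1)"
    define c1 where "c1 = b1(t1 := b1 t1 - e)"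
    define c2 where "c2 = b2(t1 := b2 t1 - e)"
    have e: "0 < e" "e \<le> b1 t1" "e \<le> b2 t1" using pos1 pos2 t1 t2 tt by (auto simp: e_def)
    have sub: "{w. c1 w \<noteq> 0} \<subseteq> ?F1" "{w. c2 w \<noteq> 0} \<subseteq> ?F2"
      using t1 t2 tt by (auto simp: c1_def c2_def)
    have lt: "card {w. c1 w \<noteq> 0} + card {w. c2 w \<noteq> 0} < card ?F1 + card ?F2"
    proof (cases "b1 t1 \<le> b2 t1")
      case True
      then have "{w. c1 w \<noteq> 0} \<subset> ?F1" using sub t1 by (auto simp: c1_def e_def)
      then show ?thesis using psubset_card_mono[OF less.prems(1)] card_mono[OF less.prems(2) sub(2)] by (meson add_less_le_mono)
    next
      case False
      then have "{w. c2 w \<noteq> 0} \<subset> ?F2" using sub t2 tt by (auto simp: c2_def e_def)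
      then show ?thesis using psubset_card_mono[OF less.prems(2)] card_mono[OF less.prems(1) sub(1)] by (meson add_le_less_mono)
    qed
    have S: "(\<Sum>w\<in>{w. c w \<noteq> 0}. c w * f w) = (\<Sum>w\<in>{w. b w \<noteq> 0}. b w * f w) - e * f t1"
      if "c = b(t1 := b t1 - e)" "b t1 \<noteq> 0" "finite {w. b w \<noteq> 0}" for b c f :: "_ \<Rightarrow> real"
    proof -
      have "(\<Sum>w\<in>{w. c w \<noteq> 0}. c w * f w) = (\<Sum>w\<in>{w. b w \<noteq> 0}. c w * f w)"
        by (rule sum.mono_neutral_left) (use that in auto)
      also have "\<dots> = (b t1 - e) * f t1 + (\<Sum>w\<in>{w. b w \<noteq> 0} - {t1}. b w * f w)"
        using that by (subst sum.remove[of _ t1]) (auto intro!: sum.cong)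
      also have "\<dots> = (\<Sum>w\<in>{w. b w \<noteq> 0}. b w * f w) - e * f t1"
        using that by (subst (2) sum.remove[of _ t1]) (auto simp: algebra_simps)
      finally show ?thesis .
    qed
    have b0: "b1 t1 \<noteq> 0" "b2 t1 \<noteq> 0" using t1 t2 tt by auto
    note S1 = S[of c1 b1, OF c1_def b0(1) less.prems(1)]
    note S2 = S[of c2 b2, OF c2_def b0(2) less.prems(2)]
    have "c1 = c2"
    proof (rule less.hyps[OF lt])
      show "sum c1 {w. c1 w \<noteq> 0} = sum c2 {w. c2 w \<noteq> 0}"
        using S1[of "\<lambda>_. 1"] S2[of "\<lambda>_. 1"] less.prems(8) unfolding mult_1_right by linarith
      show "(\<Sum>w\<in>{w. c1 w \<noteq> 0}. c1 w * wcount rk w l i) = (\<Sum>w\<in>{w. c2 w \<noteq> 0}. c2 w * wcount rk w l i)" for l i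
        using S1[of "\<lambda>w. wcount rk w l i"] S2[of "\<lambda>w. wcount rk w l i"] less.prems(9)[of l i] by linarith
      show "set_mset w \<subseteq> U" if "c1 w \<noteq> 0 \<or> c2 w \<noteq> 0" for w using less.prems(5)[of w] that sub by blast
      show "0 \<le> c1 w" "0 \<le> c2 w" for w using less.prems(6,7)[of w] e by (auto simp: c1_def c2_def)
      show "finite {w. c1 w \<noteq> 0}" "finite {w. c2 w \<noteq> 0}"
        using sub less.prems(1,2) by (meson finite_subset)+
      show "wchain rk {w. c1 w \<noteq> 0}" by (rule wchain_subset[OF less.prems(3) sub(1)])
      show "wchain rk {w. c2 w \<noteq> 0}" by (rule wchain_subset[OF less.prems(4) sub(2)])
    qed
    moreover have "b1 = c1(t1 := c1 t1 + e)" "b2 = c2(t1 := c2 t1 + e)" by (auto simp: c1_def c2_def)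
    ultimately show ?thesis by (simp only:)
  qed
qed

section \<open>Word families: chains of words together with leftover letters\<close>

definition supp :: "('b \<Rightarrow> real) \<Rightarrow> 'b set" where
  "supp a = {g. a g \<noteq> 0}"

lemma supp_iff: "g \<in> supp a \<longleftrightarrow> a g \<noteq> 0" by (simp add: supp_def)

definition wtype :: "(nat \<Rightarrow> nat) \<Rightarrow> ('a \<times> nat) multiset \<Rightarrow> bool" where
  "wtype y w \<longleftrightarrow> (\<forall>l. size {#x \<in># w. snd x = l#} = y l)"

text \<open>The words use up label \<open>k\<close> completely, while letters \<open>A\<close> of
  other labels are left over. A leftover must not precede any letter of its label in a word: the
  words consume an initial stretch of the ordered letters. The letter in which this stretch ends may
  belong to both, hence \<open>\<le>\<close> between the ranks.\<close>

definition word_family :: "(nat \<Rightarrow> nat) \<Rightarrow> nat \<Rightarrow> ('a \<times> nat \<Rightarrow> nat) \<Rightarrow> ('a \<times> nat) set \<Rightarrow>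
    ('a \<times> nat) multiset set \<Rightarrow> ('a \<times> nat) set \<Rightarrow> bool" where
  "word_family y k rk U F A \<longleftrightarrow> finite F \<and> A \<subseteq> U \<and> (\<forall>w\<in>F. set_mset w \<subseteq> U \<and> wtype y w) \<and> wchain rk F \<and>
     (\<forall>x\<in>A. snd x \<noteq> k) \<and> (\<forall>w\<in>F. \<forall>x\<in>A. \<forall>u. u \<in># w \<and> snd u = snd x \<longrightarrow> rk u \<le> rk x)"

lemma word_family_subset: "word_family y k rk U F A \<Longrightarrow> F' \<subseteq> F \<Longrightarrow> A' \<subseteq> A \<Longrightarrow> word_family y k rk U F' A'"
  unfolding word_family_def using wchain_subset[of rk F F'] finite_subset[of F' F] by blast

lemma wcount_le_type: "wtype y w \<Longrightarrow> wcount rk w l i \<le> y l"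
proof -
  assume w: "wtype y w"
  have "wcount rk w l i \<le> size {#x \<in># w. snd x = l#}"
    unfolding wcount_def by (intro size_mset_mono) (auto intro!: mset_subset_eqI)
  then show ?thesis using w by (simp add: wtype_def)
qed

lemma wcount_full:
  assumes "wtype y w" "\<And>u. u \<in># w \<Longrightarrow> snd u = l \<Longrightarrow> rk u < i"
  shows "wcount rk w l i = y l"
proof -
  have "{#x \<in># w. snd x = l \<and> rk x < i#} = {#x \<in># w. snd x = l#}"
    by (intro filter_mset_cong) (use assms(2) in auto)
  then show ?thesis using assms(1) by (simp add: wcount_def wtype_def)
qed

lemma sum_wcount:
  assumes "finite U" "\<And>w. w \<in> F \<Longrightarrow> set_mset w \<subseteq> U"
  shows "(\<Sum>w\<in>F. (b w :: real) * wcount rk w l i) = (\<Sum>g\<in>{g\<in>U. snd g = l \<and> rk g < i}. \<Sum>w\<in>F. b w * count w g)"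
proof -
  have "(\<Sum>w\<in>F. b w * wcount rk w l i) = (\<Sum>w\<in>F. \<Sum>g\<in>{g\<in>U. snd g = l \<and> rk g < i}. b w * count w g)"
  proof (rule sum.cong[OF refl])
    fix w assume "w \<in> F"
    then show "b w * wcount rk w l i = (\<Sum>g\<in>{g\<in>U. snd g = l \<and> rk g < i}. b w * count w g)"
      using wcount_sum[OF assms(1) assms(2)] by (simp add: sum_distrib_left)
  qed
  also have "\<dots> = (\<Sum>g\<in>{g\<in>U. snd g = l \<and> rk g < i}. \<Sum>w\<in>F. b w * count w g)"
    by (rule sum.swap)
  finally show ?thesis .
qed

text \<open>A leftover below the threshold forces all word letters of its label below it too. So
  leftovers interfere only with counts that are already full and say nothing about the individual
  words.\<close>

lemma word_family_wcount_case:
  assumes "word_family y k rk U F A"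
  shows "(\<forall>w\<in>F. wcount rk w l i = y l) \<or> (\<forall>x\<in>A. snd x = l \<longrightarrow> \<not> rk x < i)"
proof (rule disjCI)
  assume "\<not> (\<forall>x\<in>A. snd x = l \<longrightarrow> \<not> rk x < i)"
  then obtain x where x: "x \<in> A" "snd x = l" "rk x < i" by blast
  show "\<forall>w\<in>F. wcount rk w l i = y l"
  proof
    fix w assume w: "w \<in> F"
    show "wcount rk w l i = y l"
    proof (rule wcount_full)
      show "wtype y w" using assms w by (simp add: word_family_def)
      show "rk u < i" if "u \<in># w" "snd u = l" for u
        using assms w x that unfolding word_family_def by (meson order_le_less_trans)
    qed
  qed
qed

text \<open>Full counts are multiples of the total, and the other counts involve no leftover, so
  that they are sums of letter sums. Both lie in \<open>H\<close>, and the triangular argument for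
  chains gives the coefficients of the words; those of the leftovers follow by subtraction.\<close>

lemma word_family_primitive:
  fixes b :: "('a \<times> nat) multiset \<Rightarrow> real" and c :: "'a \<times> nat \<Rightarrow> real"
  assumes f: "word_family y k rk U F A" and U: "finite U" "rank_inj rk U" and H: "real_subgroup H"
    and int: "\<And>g. (\<Sum>w\<in>F. b w * count w g) + (if g \<in> A then c g else 0) \<in> H"
    and tot: "(\<Sum>w\<in>F. b w) \<in> H"
  shows "w0 \<in> F \<Longrightarrow> b w0 \<in> H" and "x \<in> A \<Longrightarrow> c x \<in> H"
proof -
  have setU: "\<And>w. w \<in> F \<Longrightarrow> set_mset w \<subseteq> U" and ch: "wchain rk F" and fin: "finite F"
    using f by (auto simp: word_family_def)
  have N: "(\<Sum>w\<in>F. b w * wcount rk w l i) \<in> H" for l i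
  proof (cases "\<forall>w\<in>F. wcount rk w l i = y l")
    case True
    then have "(\<Sum>w\<in>F. b w * wcount rk w l i) = (\<Sum>w\<in>F. b w) * y l"
      by (simp add: sum_distrib_right)
    then show ?thesis using real_subgroup_mult_nat[OF H tot] by simp
  next
    case False
    then have "\<forall>x\<in>A. snd x = l \<longrightarrow> \<not> rk x < i" using word_family_wcount_case[OF f] by blast
    then have "(\<Sum>w\<in>F. b w * wcount rk w l i) =
        (\<Sum>g\<in>{g\<in>U. snd g = l \<and> rk g < i}. (\<Sum>w\<in>F. b w * count w g) + (if g \<in> A then c g else 0))"
      by (subst sum_wcount[OF U(1) setU]) (auto intro!: sum.cong)
    also have "\<dots> \<in> H" by (rule real_subgroup_sum[OF H int])
    finally show ?thesis .
  qed
  show *: "b w0 \<in> H" if "w0 \<in> F" for w0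
    by (rule wchain_primitive[OF H U(2,1) fin ch setU tot N that])
  show "c x \<in> H" if "x \<in> A"
  proof -
    have "(\<Sum>w\<in>F. b w * count w x) \<in> H"
      by (rule real_subgroup_sum[OF H real_subgroup_mult_nat[OF H *]])
    from real_subgroup_minus[OF H int[of x] this] show ?thesis using that by simp
  qed
qed

definition letter_sum :: "(('a \<times> nat) multiset \<Rightarrow> real) \<Rightarrow> ('a \<times> nat \<Rightarrow> real) \<Rightarrow> 'a \<times> nat \<Rightarrow> real" where
  "letter_sum b c g = (\<Sum>w\<in>supp b. b w * count w g) + c g"

lemma letter_sum_supp_letters:
  assumes "\<And>w. 0 \<le> b w" "\<And>g. 0 \<le> c g" "finite (supp b)"
  shows "w \<in> supp b \<Longrightarrow> set_mset w \<subseteq> supp (letter_sum b c)" and "supp c \<subseteq> supp (letter_sum b c)"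
proof -
  have nn: "0 \<le> (\<Sum>w\<in>supp b. b w * count w g)" for g by (intro sum_nonneg mult_nonneg_nonneg assms) simp
  show "set_mset w \<subseteq> supp (letter_sum b c)" if "w \<in> supp b"
  proof
    fix g assume "g \<in># w"
    moreover have "0 < b w" using that assms(1)[of w] by (simp add: supp_def)
    ultimately have "0 < b w * count w g" by simp
    also have "\<dots> \<le> (\<Sum>w\<in>supp b. b w * count w g)"
      by (rule member_le_sum[OF that]) (use assms in auto)
    also have "\<dots> \<le> letter_sum b c g" unfolding letter_sum_def using assms(2)[of g] by simp
    finally show "g \<in> supp (letter_sum b c)" by (simp add: supp_def)
  qed
  show "supp c \<subseteq> supp (letter_sum b c)"
  proof
    fix g assume "g \<in> supp c"
    then have "0 < c g" using assms(2)[of g] by (simp add: supp_def)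
    then have "0 < letter_sum b c g" unfolding letter_sum_def using nn[of g] by simp
    then show "g \<in> supp (letter_sum b c)" by (simp add: supp_def)
  qed
qed

lemma wtype_label_size: "wtype y w \<Longrightarrow> set_mset w \<subseteq> U \<Longrightarrow> finite U \<Longrightarrow> (\<Sum>g\<in>{g\<in>U. snd g = l}. count w g) = y l"
proof -
  assume a: "wtype y w" "set_mset w \<subseteq> U" "finite U"
  have "y l = size {#x \<in># w. snd x = l#}" using a by (simp add: wtype_def)
  also have "\<dots> = (\<Sum>g\<in>{g\<in>set_mset w. snd g = l}. count w g)"
    unfolding size_multiset_overloaded_eq by (intro sum.cong) auto
  also have "\<dots> = (\<Sum>g\<in>{g\<in>U. snd g = l}. count w g)"
    by (rule sum.mono_neutral_left) (use a in \<open>auto simp: count_eq_zero_iff\<close>)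
  finally show ?thesis by simp
qed

lemma letter_sum_label_mass:
  fixes b :: "('a \<times> nat) multiset \<Rightarrow> real" and c :: "'a \<times> nat \<Rightarrow> real"
  assumes f: "word_family y k rk U (supp b) (supp c)" and U: "finite U"
  shows "(\<Sum>g\<in>{g\<in>U. snd g = l}. letter_sum b c g) = y l * sum b (supp b) + (\<Sum>g\<in>{g\<in>U. snd g = l}. c g)"
proof -
  have "(\<Sum>g\<in>{g\<in>U. snd g = l}. \<Sum>w\<in>supp b. b w * count w g) = (\<Sum>w\<in>supp b. \<Sum>g\<in>{g\<in>U. snd g = l}. b w * count w g)"
    by (rule sum.swap)
  also have "\<dots> = (\<Sum>w\<in>supp b. b w * y l)"
  proof (rule sum.cong[OF refl])
    fix w assume "w \<in> supp b"
    then have "real (y l) = (\<Sum>g\<in>{g\<in>U. snd g = l}. real (count w g))"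
      using wtype_label_size[of y w U l] f U unfolding word_family_def by (metis of_nat_sum)
    then show "(\<Sum>g\<in>{g\<in>U. snd g = l}. b w * count w g) = b w * y l" by (simp add: sum_distrib_left)
  qed
  finally show ?thesis unfolding letter_sum_def sum.distrib by (simp add: sum_distrib_left mult.commute)
qed

text \<open>The words see the partial sums of the ordered letters, truncated where the words are
  full. The right-hand side involves the expansion only through its letter sum and its total weight,
  which is what uniqueness needs.\<close>

lemma word_family_wcount_min:
  fixes b :: "('a \<times> nat) multiset \<Rightarrow> real" and c :: "'a \<times> nat \<Rightarrow> real"
  assumes f: "word_family y k rk U (supp b) (supp c)" and U: "finite U"
    and nn: "\<And>w. 0 \<le> b w" "\<And>g. 0 \<le> c g"
  shows "(\<Sum>w\<in>supp b. b w * wcount rk w l i) =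
    min (\<Sum>g\<in>{g\<in>U. snd g = l \<and> rk g < i}. letter_sum b c g) (y l * sum b (supp b))"
proof -
  have setU: "\<And>w. w \<in> supp b \<Longrightarrow> set_mset w \<subseteq> U" using f by (auto simp: word_family_def)
  have e: "(\<Sum>g\<in>{g\<in>U. snd g = l \<and> rk g < i}. letter_sum b c g) =
      (\<Sum>w\<in>supp b. b w * wcount rk w l i) + (\<Sum>g\<in>{g\<in>U. snd g = l \<and> rk g < i}. c g)"
    unfolding letter_sum_def sum.distrib by (simp add: sum_wcount[OF U setU, of "supp b"])
  have cn: "0 \<le> (\<Sum>g\<in>{g\<in>U. snd g = l \<and> rk g < i}. c g)" by (intro sum_nonneg nn)
  have le: "(\<Sum>w\<in>supp b. b w * wcount rk w l i) \<le> y l * sum b (supp b)"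
  proof -
    have "(\<Sum>w\<in>supp b. b w * wcount rk w l i) \<le> (\<Sum>w\<in>supp b. b w * y l)"
    proof (intro sum_mono mult_left_mono)
      fix w assume "w \<in> supp b"
      then have "wtype y w" using f by (auto simp: word_family_def)
      then show "real (wcount rk w l i) \<le> real (y l)" using wcount_le_type by auto
    qed (simp add: nn)
    then show ?thesis by (simp add: sum_distrib_left mult.commute)
  qed
  show ?thesis
  proof (cases "\<forall>w\<in>supp b. wcount rk w l i = y l")
    case True
    then have "(\<Sum>w\<in>supp b. b w * wcount rk w l i) = y l * sum b (supp b)"
      by (simp add: sum_distrib_left mult.commute)
    then show ?thesis using e cn by simp
  next
    case False
    then have "\<forall>x\<in>supp c. snd x = l \<longrightarrow> \<not> rk x < i" using word_family_wcount_case[OF f] by blast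
    then have "(\<Sum>g\<in>{g\<in>U. snd g = l \<and> rk g < i}. c g) = 0"
      by (intro sum.neutral) (auto simp: supp_def)
    then show ?thesis using e le by simp
  qed
qed

lemma word_family_restrict: 
  assumes "word_family y k rk U F A" "\<And>w. w \<in> F \<Longrightarrow> set_mset w \<subseteq> U'" "A \<subseteq> U'"
  shows "word_family y k rk U' F A"
  using assms unfolding word_family_def by blast

text \<open>No leftover has label \<open>k\<close>, so the mass of label \<open>k\<close> fixes the
  total weight; the truncated partial sums then fix all weighted counts of the words. Both families
  are first moved into the support of the common letter sum, to have one ambient set.\<close>

lemma word_family_unique:
  assumes f1: "word_family y k rk U1 (supp b1) (supp c1)" and f2: "word_family y k rk U2 (supp b2) (supp c2)"
    and U: "finite U1" "rank_inj rk U1" "finite U2"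
    and nn: "\<And>w. 0 \<le> b1 w" "\<And>g. 0 \<le> c1 g" "\<And>w. 0 \<le> b2 w" "\<And>g. 0 \<le> c2 g"
    and y: "0 < y k" and eq: "letter_sum b1 c1 = letter_sum b2 c2"
  shows "b1 = b2" "c1 = c2"
proof -
  let ?V = "supp (letter_sum b1 c1)"
  have fin: "finite (supp b1)" "finite (supp b2)" using f1 f2 by (auto simp: word_family_def)
  note l1 = letter_sum_supp_letters[of b1 c1, OF nn(1,2) fin(1)]
  note l2 = letter_sum_supp_letters[of b2 c2, OF nn(3,4) fin(2), unfolded eq[symmetric]]
  have F1: "word_family y k rk ?V (supp b1) (supp c1)"
    using l1 by (rule word_family_restrict[OF f1])
  have F2: "word_family y k rk ?V (supp b2) (supp c2)" unfolding eq
    using letter_sum_supp_letters[of b2 c2, OF nn(3,4) fin(2)] by (rule word_family_restrict[OF f2])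
  have VU: "?V \<subseteq> U1"
  proof
    fix g assume "g \<in> ?V"
    then have "c1 g \<noteq> 0 \<or> (\<exists>w\<in>supp b1. b1 w * count w g \<noteq> 0)"
      unfolding supp_iff letter_sum_def by (metis (no_types, lifting) add_0_left sum.neutral)
    then show "g \<in> U1"
    proof
      assume "c1 g \<noteq> 0"
      then show ?thesis using f1 by (auto simp: word_family_def supp_def)
    next
      assume "\<exists>w\<in>supp b1. b1 w * count w g \<noteq> 0"
      then obtain w where "w \<in> supp b1" "g \<in># w" by (metis mult_eq_0_iff not_in_iff of_nat_0)
      then show ?thesis using f1 by (auto simp: word_family_def)
    qed
  qed
  have fV: "finite ?V" using VU U(1) finite_subset by blast
  have iV: "rank_inj rk ?V" using rank_inj_subset[OF U(2) VU] .
  have k0: "(\<Sum>g\<in>{g\<in>?V. snd g = k}. c g) = 0" if "\<forall>x\<in>supp c. snd x \<noteq> k" for c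
    using that by (intro sum.neutral) (auto simp: supp_def)
  have "y k * sum b1 (supp b1) = y k * sum b2 (supp b2)"
  proof -
    have "\<forall>x\<in>supp c1. snd x \<noteq> k" "\<forall>x\<in>supp c2. snd x \<noteq> k" using f1 f2 by (auto simp: word_family_def)
    then show ?thesis
      using letter_sum_label_mass[OF F1 fV, of k] letter_sum_label_mass[OF F2 fV, of k] k0[of c1] k0[of c2]
      unfolding eq by linarith
  qed
  then have S: "sum b1 (supp b1) = sum b2 (supp b2)" using y by simp
  have N: "(\<Sum>w\<in>supp b1. b1 w * wcount rk w l i) = (\<Sum>w\<in>supp b2. b2 w * wcount rk w l i)" for l i
    unfolding word_family_wcount_min[OF F1 fV nn(1,2)] word_family_wcount_min[OF F2 fV nn(3,4)] eq S ..
  show b: "b1 = b2"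
  proof (rule wchain_unique[OF iV fV])
    show "set_mset w \<subseteq> ?V" if "b1 w \<noteq> 0 \<or> b2 w \<noteq> 0" for w
      using that l1(1)[of w] l2(1)[of w] unfolding supp_iff by blast
    show "wchain rk {w. b1 w \<noteq> 0}" "wchain rk {w. b2 w \<noteq> 0}"
      using f1 f2 unfolding word_family_def supp_def by blast+
      show "finite {w. b1 w \<noteq> 0}" "finite {w. b2 w \<noteq> 0}" using fin unfolding supp_def by blast+
    show "sum b1 {w. b1 w \<noteq> 0} = sum b2 {w. b2 w \<noteq> 0}" using S unfolding supp_def .
    show "(\<Sum>w\<in>{w. b1 w \<noteq> 0}. b1 w * wcount rk w l i) = (\<Sum>w\<in>{w. b2 w \<noteq> 0}. b2 w * wcount rk w l i)" for l i
      using N[of l i] unfolding supp_def .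
  qed (fact nn)+
  show "c1 = c2"
  proof
    fix g
    show "c1 g = c2 g" using fun_cong[OF eq, of g] unfolding letter_sum_def b by simp
  qed
qed

section \<open>Existence of expansions: reading ordered letters at distance \<alpha>\<close>

definition steps :: "real set \<Rightarrow> real \<Rightarrow> real \<Rightarrow> real" where
  "steps R \<alpha> r = Min {r' \<in> insert \<alpha> R. r < r'} - r"

lemma steps_pos: "finite R \<Longrightarrow> r < \<alpha> \<Longrightarrow> 0 < steps R \<alpha> r"
  unfolding steps_def by (subst diff_gt_0_iff_gt, subst Min_gr_iff) auto

lemma steps_sum:
  assumes "finite R" "0 \<in> R" "\<And>r. r \<in> R \<Longrightarrow> 0 \<le> r \<and> r < \<alpha>"
  shows "\<rho> \<in> insert \<alpha> R \<Longrightarrow> (\<Sum>r\<in>{r\<in>R. r < \<rho>}. steps R \<alpha> r) = \<rho>"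
proof (induction "card {r\<in>R. r < \<rho>}" arbitrary: \<rho> rule: less_induct)
  case less
  have fin: "finite {r\<in>R. r < \<rho>}" using assms(1) by simp
  have r0: "0 \<le> \<rho>" using less.prems assms(2,3) by fastforce
  show ?case
  proof (cases "\<rho> = 0")
    case True
    then have "{r\<in>R. r < \<rho>} = {}" using assms(3) by fastforce
    then show ?thesis using True by (simp only: sum.empty)
  next
    case False
    define s where "s = Max {r\<in>R. r < \<rho>}"
    have ne: "{r\<in>R. r < \<rho>} \<noteq> {}" using False r0 assms(2) by auto
    have s: "s \<in> R" "s < \<rho>" using Max_in[OF fin ne] by (auto simp: s_def)
    have smax: "r \<le> s" if "r \<in> R" "r < \<rho>" for r unfolding s_def using that fin by simp
    have e: "{r\<in>R. r < \<rho>} = insert s {r\<in>R. r < s}" using s smax by force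
    have "Min {r' \<in> insert \<alpha> R. s < r'} = \<rho>"
    proof (rule Min_eqI)
      show "finite {r' \<in> insert \<alpha> R. s < r'}" using assms(1) by simp
      show "\<rho> \<in> {r' \<in> insert \<alpha> R. s < r'}" using less.prems s by auto
      show "\<rho> \<le> y" if y: "y \<in> {r' \<in> insert \<alpha> R. s < r'}" for y
      proof (rule ccontr)
        assume "\<not> \<rho> \<le> y"
        moreover have "\<rho> \<le> \<alpha>" using less.prems assms(3) by force
        ultimately have "y \<in> R" "y < \<rho>" using y by auto
        then show False using smax y by fastforce
      qed
    qed
    then have st: "steps R \<alpha> s = \<rho> - s" by (simp add: steps_def)
    have "(\<Sum>r\<in>{r\<in>R. r < s}. steps R \<alpha> r) = s"
    proof (rule less.hyps)
      have "{r\<in>R. r < s} \<subset> {r\<in>R. r < \<rho>}" using s by auto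
      then show "card {r\<in>R. r < s} < card {r\<in>R. r < \<rho>}" by (rule psubset_card_mono[OF fin])
    qed (use s in auto)
    then show ?thesis unfolding e using assms(1) st by (subst sum.insert) auto
  qed
qed

text \<open>Counts the points \<open>u\<close>, \<open>u + \<alpha>\<close>,
  \<open>u + 2 * \<alpha>\<close>, ... below \<open>T\<close> as a function of the offset
  \<open>u\<close>: the number jumps only at the remainder of \<open>T\<close> modulo
  \<open>\<alpha>\<close>.\<close>

lemma ceil_frac:
  fixes T \<alpha> u :: real
  assumes "0 < \<alpha>" "0 \<le> T" "0 \<le> u" "u < \<alpha>"
  shows "nat \<lceil>(T - u) / \<alpha>\<rceil> = nat \<lfloor>T / \<alpha>\<rfloor> + (if u < T - \<alpha> * \<lfloor>T / \<alpha>\<rfloor> then 1 else 0)"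
proof -
  let ?n = "\<lfloor>T / \<alpha>\<rfloor>"
  have n: "of_int ?n \<le> T / \<alpha>" "T / \<alpha> < of_int ?n + 1" by linarith+
  have n': "\<alpha> * of_int ?n \<le> T" "T < \<alpha> * of_int ?n + \<alpha>"
    using n assms(1) pos_le_divide_eq[of \<alpha> "of_int ?n" T] pos_divide_less_eq[of \<alpha> T "of_int ?n + 1"]
    by (auto simp: algebra_simps)
  have n0: "0 \<le> ?n" using assms by simp
  show ?thesis
  proof (cases "u < T - \<alpha> * ?n")
    case True
    have "\<lceil>(T - u) / \<alpha>\<rceil> = ?n + 1"
    proof (rule ceiling_unique)
      show "of_int (?n + 1) - 1 < (T - u) / \<alpha>" using True assms(1) by (simp add: field_simps)
      have "T - u \<le> \<alpha> * of_int ?n + \<alpha>" using n' assms by linarith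
      then show "(T - u) / \<alpha> \<le> of_int (?n + 1)" using assms(1) by (simp add: field_simps)
    qed
    then show ?thesis using True n0 by (simp add: nat_add_distrib)
  next
    case False
    have "\<lceil>(T - u) / \<alpha>\<rceil> = ?n"
    proof (rule ceiling_unique)
      have "\<alpha> * of_int ?n - \<alpha> < T - u" using n' assms by linarith
      then show "of_int ?n - 1 < (T - u) / \<alpha>" using assms(1) by (simp add: field_simps)
      show "(T - u) / \<alpha> \<le> of_int ?n" using assms(1) False by (simp add: field_simps)
    qed
    then show ?thesis using False by simp
  qed
qed

text \<open>A discrete form of the fact that integrating the number of such points over all offsets
  in \<open>[0, \<alpha>)\<close> gives \<open>T\<close>. Each element of \<open>R\<close> stands
  for the offsets up to the next element; the number is constant there because the remainder of
  \<open>T\<close>, its only jump, belongs to \<open>R\<close>.\<close>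

lemma steps_ceil_sum:
  fixes T \<alpha> :: real
  assumes "finite R" "0 \<in> R" "\<And>r. r \<in> R \<Longrightarrow> 0 \<le> r \<and> r < \<alpha>" "0 < \<alpha>" "0 \<le> T"
    and "T - \<alpha> * \<lfloor>T / \<alpha>\<rfloor> \<in> R"
  shows "(\<Sum>r\<in>R. steps R \<alpha> r * nat \<lceil>(T - r) / \<alpha>\<rceil>) = T"
proof -
  let ?\<rho> = "T - \<alpha> * \<lfloor>T / \<alpha>\<rfloor>"
  have Ra: "R = {r\<in>R. r < \<alpha>}" using assms(3) by auto
  have tot: "(\<Sum>r\<in>R. steps R \<alpha> r) = \<alpha>"
    using steps_sum[OF assms(1-3), of \<alpha>] Ra by simp
  have "(\<Sum>r\<in>R. steps R \<alpha> r * nat \<lceil>(T - r) / \<alpha>\<rceil>) =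
      (\<Sum>r\<in>R. steps R \<alpha> r * nat \<lfloor>T / \<alpha>\<rfloor> + (if r < ?\<rho> then steps R \<alpha> r else 0))"
  proof (rule sum.cong[OF refl])
    fix r assume "r \<in> R"
    then have "0 \<le> r" "r < \<alpha>" using assms(3) by auto
    then show "steps R \<alpha> r * nat \<lceil>(T - r) / \<alpha>\<rceil> = steps R \<alpha> r * nat \<lfloor>T / \<alpha>\<rfloor> + (if r < ?\<rho> then steps R \<alpha> r else 0)"
      using ceil_frac[OF assms(4,5), of r] by (simp add: algebra_simps)
  qed
  also have "\<dots> = \<alpha> * nat \<lfloor>T / \<alpha>\<rfloor> + (\<Sum>r\<in>{r\<in>R. r < ?\<rho>}. steps R \<alpha> r)"
  proof -
    have "(\<Sum>r\<in>R. steps R \<alpha> r * nat \<lfloor>T / \<alpha>\<rfloor>) = \<alpha> * nat \<lfloor>T / \<alpha>\<rfloor>"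
      using tot by (metis sum_distrib_right)
    then show ?thesis unfolding sum.distrib sum.inter_filter[OF assms(1)] by simp
  qed
  also have "(\<Sum>r\<in>{r\<in>R. r < ?\<rho>}. steps R \<alpha> r) = ?\<rho>"
    by (rule steps_sum[OF assms(1-3)]) (use assms(6) in auto)
  also have "\<alpha> * nat \<lfloor>T / \<alpha>\<rfloor> + ?\<rho> = T"
    using assms(4,5) by simp
  finally show ?thesis .
qed

text \<open>Lay the letters of each label \<open>l\<close> on a line in the order of their ranks,
  \<open>g\<close> with length \<open>a g\<close>, and keep the initial stretch of length
  \<open>y l * \<alpha>\<close>, where \<open>\<alpha> = \<mu> k / y k\<close>; by
  \<open>ineq\<close> the line is long enough. The word at offset \<open>u\<close> collects the
  letters met at \<open>u\<close>, \<open>u + \<alpha>\<close>, \<open>u + 2 * \<alpha>\<close>,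
  ..., which are \<open>y l\<close> letters of label \<open>l\<close>. While \<open>u\<close> runs
  through \<open>[0, \<alpha>)\<close> finitely many words occur, any two interleave, and weighting
  each by its range of offsets recovers the stretch. What lies beyond the stretch is left over, and
  in label \<open>k\<close> this is nothing.\<close>

lemma word_family_exists:
  fixes a :: "'a \<times> nat \<Rightarrow> real"
  assumes nn: "\<And>g. 0 \<le> a g" and fin: "finite (supp a)" and inj: "rank_inj rk (supp a)" and yk: "0 < y k"
    and \<mu>: "\<And>l. \<mu> l = (\<Sum>g\<in>{g\<in>supp a. snd g = l}. a g)"
    and ineq: "\<And>l. y l * \<mu> k \<le> y k * \<mu> l"
  obtains b c where "\<And>w. 0 \<le> b w" "\<And>g. 0 \<le> c g" "word_family y k rk (supp a) (supp b) (supp c)" "letter_sum b c = a"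
proof (cases "\<mu> k = 0")
  case True
  have "a g = 0" if "snd g = k" for g
  proof (rule ccontr)
    assume "a g \<noteq> 0"
    then have "g \<in> {g\<in>supp a. snd g = k}" using that by (simp add: supp_def)
    moreover have "\<forall>g\<in>{g\<in>supp a. snd g = k}. a g = 0"
      using True \<mu>[of k] sum_nonneg_eq_0_iff[of "{g\<in>supp a. snd g = k}" a] fin nn by simp
    ultimately show False using \<open>a g \<noteq> 0\<close> by blast
  qed
  then have "word_family y k rk (supp a) (supp (\<lambda>_. 0)) (supp a)"
    unfolding word_family_def wchain_def by (auto simp: supp_def)
  moreover have "letter_sum (\<lambda>_. 0) a = a" by (auto simp: letter_sum_def supp_def)
  ultimately show ?thesis using that[of "\<lambda>_. 0" a] nn by simp
next
  case False
  have "0 \<le> \<mu> k" unfolding \<mu> by (intro sum_nonneg nn)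
  define \<alpha> where "\<alpha> = \<mu> k / y k"
  have \<alpha>: "0 < \<alpha>" using False \<open>0 \<le> \<mu> k\<close> yk by (simp add: \<alpha>_def)
  have ya: "y l * \<alpha> \<le> \<mu> l" for l using ineq[of l] yk by (simp add: \<alpha>_def field_simps)
  have yka: "y k * \<alpha> = \<mu> k" using yk by (simp add: \<alpha>_def)
  let ?U = "supp a"
  define S where "S l i = (\<Sum>g\<in>{g\<in>?U. snd g = l \<and> rk g < i}. a g)" for l i
  define T where "T l i = min (S l i) (y l * \<alpha>)" for l i
  define f where "f u l i = nat \<lceil>(T l i - u) / \<alpha>\<rceil>" for u l i
  have S0: "0 \<le> S l i" for l i unfolding S_def by (intro sum_nonneg nn)
  have T0: "0 \<le> T l i" for l i unfolding T_def using S0 \<alpha> by simp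
  have Smono: "S l i \<le> S l j" if "i \<le> j" for l i j
    unfolding S_def by (rule sum_mono2) (use that fin nn in auto)
  have Tmono: "T l i \<le> T l j" if "i \<le> j" for l i j
    unfolding T_def using Smono[OF that, of l] by auto
  have fmono: "f u l i \<le> f u l j" if "i \<le> j" for u l i j
    unfolding f_def using Tmono[OF that, of l] \<alpha>
    by (intro nat_mono ceiling_mono divide_right_mono) auto
  have f_0: "f u l 0 = 0" if "0 \<le> u" for u l
  proof -
    have "T l 0 = 0" unfolding T_def S_def using \<alpha> by simp
    then have "(T l 0 - u) / \<alpha> \<le> 0" using that \<alpha> by (simp add: divide_nonpos_pos)
    then show ?thesis unfolding f_def by linarith
  qed
  have f_le: "f u l i \<le> y l" if "0 \<le> u" for u l i
  proof -
    have "T l i - u \<le> y l * \<alpha>" unfolding T_def using that by linarith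
    then have "(T l i - u) / \<alpha> \<le> y l" using \<alpha> pos_divide_le_eq[of \<alpha> "T l i - u" "y l"] by blast
    then have "\<lceil>(T l i - u) / \<alpha>\<rceil> \<le> int (y l)" by linarith
    then show ?thesis unfolding f_def nat_le_iff .
  qed
  have f_top: "f u l i = y l" if "0 \<le> u" "u < \<alpha>" "y l * \<alpha> \<le> S l i" for u l i
  proof -
    have "T l i = y l * \<alpha>" unfolding T_def using that by simp
    then have "(T l i - u) / \<alpha> = y l - u / \<alpha>" using \<alpha> by (simp add: field_simps)
    moreover have "u / \<alpha> < 1" "0 \<le> u / \<alpha>" using that \<alpha> by auto
    ultimately have "\<lceil>(T l i - u) / \<alpha>\<rceil> = int (y l)" by (intro ceiling_unique) auto
    then show ?thesis unfolding f_def by simp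
  qed
  have f_step: "f v l i \<le> f u l i \<and> f u l i \<le> f v l i + 1" if "0 \<le> u" "u \<le> v" "v < \<alpha>" for u v l i
  proof -
    have "(T l i - v) / \<alpha> \<le> (T l i - u) / \<alpha>" using that \<alpha> by (simp add: divide_right_mono)
    then have "\<lceil>(T l i - v) / \<alpha>\<rceil> \<le> \<lceil>(T l i - u) / \<alpha>\<rceil>" by (rule ceiling_mono)
    moreover have "(T l i - u) / \<alpha> \<le> (T l i - v + \<alpha>) / \<alpha>" using that \<alpha> by (intro divide_right_mono) auto
    then have "(T l i - u) / \<alpha> \<le> (T l i - v) / \<alpha> + 1" using \<alpha> by (simp add: add_divide_distrib)
    then have "\<lceil>(T l i - u) / \<alpha>\<rceil> \<le> \<lceil>(T l i - v) / \<alpha>\<rceil> + 1"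
      by (metis ceiling_add_one ceiling_mono)
    ultimately show ?thesis unfolding f_def by linarith
  qed
  define w where "w u = (\<Sum>g\<in>?U. replicate_mset (f u (snd g) (Suc (rk g)) - f u (snd g) (rk g)) g)" for u
  have cw: "count (w u) g = (if g \<in> ?U then f u (snd g) (Suc (rk g)) - f u (snd g) (rk g) else 0)" for u g
    unfolding w_def count_sum using fin by (simp add: sum.delta)
  have setw: "set_mset (w u) \<subseteq> ?U" for u
  proof
    fix g assume "g \<in># w u"
    then have "count (w u) g \<noteq> 0" by simp
    then show "g \<in> ?U" unfolding cw by (auto split: if_splits)
  qed
  have ins: "{g\<in>?U. snd g = l \<and> rk g < Suc i} =
     (if \<exists>g\<in>?U. snd g = l \<and> rk g = i then insert (THE g. g \<in> ?U \<and> snd g = l \<and> rk g = i) {g\<in>?U. snd g = l \<and> rk g < i}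
      else {g\<in>?U. snd g = l \<and> rk g < i})" for l i
  proof (cases "\<exists>g\<in>?U. snd g = l \<and> rk g = i")
    case True
    then obtain g where g: "g \<in> ?U" "snd g = l" "rk g = i" by blast
    have "(THE g. g \<in> ?U \<and> snd g = l \<and> rk g = i) = g"
      using g inj unfolding rank_inj_def by (intro the_equality) auto
    then show ?thesis using True g inj unfolding rank_inj_def by (auto simp: less_Suc_eq)
  qed (auto simp: less_Suc_eq)
  have the: "(THE g. g \<in> ?U \<and> snd g = l \<and> rk g = i) = g" if "g \<in> ?U" "snd g = l" "rk g = i" for g l i
    using that inj unfolding rank_inj_def by (intro the_equality) auto
  have S_Suc: "S (snd g) (Suc (rk g)) = S (snd g) (rk g) + a g" if "g \<in> ?U" for g
  proof -
    have "{g'\<in>?U. snd g' = snd g \<and> rk g' < Suc (rk g)} = insert g {g'\<in>?U. snd g' = snd g \<and> rk g' < rk g}"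
      using ins[of "snd g" "rk g"] the[OF that refl refl] that by auto
    then show ?thesis unfolding S_def using fin by simp
  qed
  have wc: "wcount rk (w u) l i = f u l i" if "0 \<le> u" for u l i
  proof (induction i)
    case 0
    then show ?case using f_0[OF that] by (simp add: wcount_sum[OF fin setw])
  next
    case (Suc i)
    show ?case
    proof (cases "\<exists>g\<in>?U. snd g = l \<and> rk g = i")
      case True
      then obtain g where g: "g \<in> ?U" "snd g = l" "rk g = i" by blast
      have "wcount rk (w u) l (Suc i) = wcount rk (w u) l i + count (w u) g"
        using wcount_Suc[OF inj g(1) setw fin, of u] g by simp
      also have "\<dots> = f u l i + (f u l (Suc i) - f u l i)" unfolding Suc cw using g by simp
      also have "\<dots> = f u l (Suc i)" using fmono[of i "Suc i" u l] by simp
      finally show ?thesis .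
    next
      case False
      then have e: "{g\<in>?U. snd g = l \<and> rk g < Suc i} = {g\<in>?U. snd g = l \<and> rk g < i}"
        using ins[of l i] by (simp only: if_False)
      have "S l (Suc i) = S l i" unfolding S_def e ..
      then have "f u l (Suc i) = f u l i" unfolding f_def T_def by (simp only:)
      moreover have "wcount rk (w u) l (Suc i) = wcount rk (w u) l i"
        unfolding wcount_sum[OF fin setw] e ..
      ultimately show ?thesis using Suc by simp
    qed
  qed
  define B where "B = Suc (\<Sum>g\<in>?U. rk g)"
  have rkB: "rk g < B" if "g \<in> ?U" for g
    unfolding B_def using member_le_sum[OF that, of rk] fin by simp
  have SB: "S l B = \<mu> l" for l
    unfolding S_def \<mu> by (rule sum.cong) (use rkB in auto)
  have wt: "wtype y (w u)" if "0 \<le> u" "u < \<alpha>" for u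
    unfolding wtype_def
  proof
    fix l
    have "{#x \<in># w u. snd x = l#} = {#x \<in># w u. snd x = l \<and> rk x < B#}"
      by (rule filter_mset_cong[OF refl]) (use setw rkB in auto)
    then have "size {#x \<in># w u. snd x = l#} = wcount rk (w u) l B" by (simp add: wcount_def)
    also have "\<dots> = y l" using wc[OF that(1)] f_top[OF that, of l B] SB ya by simp
    finally show "size {#x \<in># w u. snd x = l#} = y l" .
  qed
  \<comment> \<open>The word can change only where the offset passes the remainder modulo
    \<open>\<alpha>\<close> of a truncated partial sum; \<open>0\<close> is added as the first
    offset.\<close>
  define R where "R = insert 0 ((\<lambda>x. x - \<alpha> * \<lfloor>x / \<alpha>\<rfloor>) ` {T l i | l i. True} \<inter> {0..<\<alpha>})"
  have Tfin: "finite {T l i | l i. True}"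
  proof -
    have "finite {l. 0 < S l B}"
    proof (rule finite_subset)
      show "{l. 0 < S l B} \<subseteq> snd ` ?U"
      proof
        fix l assume "l \<in> {l. 0 < S l B}"
        then have "{g\<in>?U. snd g = l} \<noteq> {}" using SB[of l] \<mu>[of l] by fastforce
        then show "l \<in> snd ` ?U" by force
      qed
    qed (use fin in simp)
    moreover have "{T l i | l i. True} \<subseteq> insert 0 ((\<lambda>(l, i). T l i) ` ({l. 0 < S l B} \<times> {..B}))"
    proof
      fix x assume "x \<in> {T l i | l i. True}"
      then obtain l i where x: "x = T l i" by blast
      have e: "S l i = S l (min i B)" unfolding S_def by (rule sum.cong) (use rkB in auto)
      show "x \<in> insert 0 ((\<lambda>(l, i). T l i) ` ({l. 0 < S l B} \<times> {..B}))"
      proof (cases "0 < S l B")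
        case True
        then have "x = (\<lambda>(l, i). T l i) (l, min i B)" using e x by (simp add: T_def)
        then show ?thesis using True by auto
      next
        case False
        then have "S l i = 0" using Smono[of "min i B" B l] S0[of l "min i B"] e by simp
        then show ?thesis using x \<alpha> by (simp add: T_def)
      qed
    qed
    ultimately show ?thesis by (meson finite_SigmaI finite_atMost finite_imageI finite_insert finite_subset)
  qed
  have R: "finite R" "0 \<in> R" "\<And>r. r \<in> R \<Longrightarrow> 0 \<le> r \<and> r < \<alpha>"
    using Tfin \<alpha> by (auto simp: R_def)
  have TR: "T l i - \<alpha> * \<lfloor>T l i / \<alpha>\<rfloor> \<in> R" for l i
  proof -
    have "of_int \<lfloor>T l i / \<alpha>\<rfloor> \<le> T l i / \<alpha>" "T l i / \<alpha> < of_int \<lfloor>T l i / \<alpha>\<rfloor> + 1" by linarith+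
    then have "\<alpha> * of_int \<lfloor>T l i / \<alpha>\<rfloor> \<le> T l i" "T l i < \<alpha> * of_int \<lfloor>T l i / \<alpha>\<rfloor> + \<alpha>"
      using \<alpha> pos_le_divide_eq[of \<alpha> "of_int \<lfloor>T l i / \<alpha>\<rfloor>" "T l i"]
        pos_divide_less_eq[of \<alpha> "T l i" "of_int \<lfloor>T l i / \<alpha>\<rfloor> + 1"]
      by (auto simp: algebra_simps)
    then show ?thesis unfolding R_def by auto
  qed
  \<comment> \<open>Different offsets may read the same word, which then receives the sum of their
    gaps.\<close>
  define b where "b v = (\<Sum>r\<in>{r\<in>R. w r = v}. steps R \<alpha> r)" for v
  have spos: "0 < steps R \<alpha> r" if "r \<in> R" for r using steps_pos[OF R(1)] R(3)[OF that] by blast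
  have b0: "0 \<le> b v" for v unfolding b_def by (intro sum_nonneg) (use spos in \<open>auto intro: less_imp_le\<close>)
  have sb: "supp b = w ` R"
  proof
    show "supp b \<subseteq> w ` R"
    proof
      fix v assume "v \<in> supp b"
      then have "{r\<in>R. w r = v} \<noteq> {}" unfolding supp_iff b_def by fastforce
      then show "v \<in> w ` R" by auto
    qed
    show "w ` R \<subseteq> supp b"
    proof
      fix v assume "v \<in> w ` R"
      then obtain r where "r \<in> R" "v = w r" by blast
      then have "0 < b v" unfolding b_def by (intro sum_pos) (use R(1) spos in auto)
      then show "v \<in> supp b" by (simp add: supp_def)
    qed
  qed
  have bsum: "(\<Sum>v\<in>supp b. b v * h v) = (\<Sum>r\<in>R. steps R \<alpha> r * h (w r))" for h :: "('a \<times> nat) multiset \<Rightarrow> real"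
  proof -
    have "(\<Sum>r\<in>R. steps R \<alpha> r * h (w r)) = (\<Sum>v\<in>w ` R. \<Sum>r\<in>{r\<in>R. w r = v}. steps R \<alpha> r * h (w r))"
      by (rule sum.image_gen[OF R(1)])
    also have "\<dots> = (\<Sum>v\<in>supp b. b v * h v)"
      unfolding sb b_def sum_distrib_right by (intro sum.cong) auto
    finally show ?thesis by simp
  qed
  have bN: "(\<Sum>v\<in>supp b. b v * wcount rk v l i) = T l i" for l i
  proof -
    have "(\<Sum>r\<in>R. steps R \<alpha> r * wcount rk (w r) l i) = (\<Sum>r\<in>R. steps R \<alpha> r * nat \<lceil>(T l i - r) / \<alpha>\<rceil>)"
      using wc R(3) unfolding f_def by (intro sum.cong) auto
    also have "\<dots> = T l i" by (rule steps_ceil_sum[OF R \<alpha> T0 TR])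
    finally show ?thesis unfolding bsum .
  qed
  have bc: "(\<Sum>v\<in>supp b. b v * count v g) = (if g \<in> ?U then T (snd g) (Suc (rk g)) - T (snd g) (rk g) else 0)" for g
  proof (cases "g \<in> ?U")
    case True
    have "(\<Sum>v\<in>supp b. b v * count v g) =
      (\<Sum>v\<in>supp b. b v * wcount rk v (snd g) (Suc (rk g)) - b v * wcount rk v (snd g) (rk g))"
    proof (rule sum.cong[OF refl])
      fix v assume "v \<in> supp b"
      then obtain u where "v = w u" unfolding sb by blast
      then have "wcount rk v (snd g) (Suc (rk g)) = wcount rk v (snd g) (rk g) + count v g"
        using wcount_Suc[OF inj True setw fin] by simp
      then show "b v * count v g = b v * wcount rk v (snd g) (Suc (rk g)) - b v * wcount rk v (snd g) (rk g)"
        by (simp add: algebra_simps)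
    qed
    then show ?thesis using True by (simp add: sum_subtractf bN)
  next
    case False
    have "(\<Sum>v\<in>supp b. b v * count v g) = 0"
    proof (rule sum.neutral, rule ballI)
      fix v assume "v \<in> supp b"
      then obtain u where "v = w u" unfolding sb by blast
      then show "b v * count v g = 0" using False by (simp add: cw)
    qed
    then show ?thesis using False by simp
  qed
  define c where "c g = a g - (\<Sum>v\<in>supp b. b v * count v g)" for g
  have c_out: "c g = 0" if "g \<notin> ?U" for g unfolding c_def bc using that by (simp add: supp_def)
  have c_in: "c g = a g - (T (snd g) (Suc (rk g)) - T (snd g) (rk g))" if "g \<in> ?U" for g
    unfolding c_def bc using that by simp
  have c0: "0 \<le> c g" for g
  proof (cases "g \<in> ?U")
    case True
    then show ?thesis unfolding c_in[OF True] T_def using S_Suc[OF True] nn[of g] by auto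
  qed (simp add: c_out)
  have c_supp: "supp c \<subseteq> ?U"
  proof
    fix g assume "g \<in> supp c"
    then show "g \<in> ?U" using c_out[of g] unfolding supp_iff[of g c] by blast
  qed
  have c_pos: "y (snd g) * \<alpha> < S (snd g) (Suc (rk g))" if "g \<in> supp c" for g
  proof (rule ccontr)
    assume *: "\<not> y (snd g) * \<alpha> < S (snd g) (Suc (rk g))"
    have U: "g \<in> ?U" using that c_supp by blast
    have "c g = 0" unfolding c_in[OF U] T_def using * S_Suc[OF U] nn[of g] by auto
    then show False using that by (simp add: supp_def)
  qed
  have ch: "wchain rk (supp b)"
    unfolding wchain_def sb
  proof (intro ballI)
    fix v v' assume "v \<in> w ` R" "v' \<in> w ` R"
    then obtain r r' where r: "r \<in> R" "v = w r" "r' \<in> R" "v' = w r'" by blast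
    have "wrel rk (w s) (w s')" if "s \<in> R" "s' \<in> R" "s \<le> s'" for s s'
      unfolding wrel_def using f_step[of s s'] wc[of s] wc[of s'] R(3) that by simp
    then show "wrel rk v v' \<or> wrel rk v' v" using r by (cases "r \<le> r'") auto
  qed
  have "word_family y k rk ?U (supp b) (supp c)"
    unfolding word_family_def
  proof (intro conjI ballI allI impI)
    show "finite (supp b)" unfolding sb using R(1) by simp
    show "supp c \<subseteq> ?U" by (rule c_supp)
    show "set_mset v \<subseteq> ?U" if "v \<in> supp b" for v using that setw unfolding sb by blast
    show "wtype y v" if "v \<in> supp b" for v using that wt R(3) unfolding sb by blast
    show "wchain rk (supp b)" by (rule ch)
    show "snd x \<noteq> k" if "x \<in> supp c" for x
    proof
      assume k: "snd x = k"
      have "S k (Suc (rk x)) \<le> S k (max B (Suc (rk x)))" by (rule Smono) simp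
      also have "S k (max B (Suc (rk x))) = \<mu> k" unfolding S_def \<mu>
        by (rule sum.cong) (use rkB in \<open>force+\<close>)
      finally show False using c_pos[OF that] yka k by simp
    qed
    show "rk u \<le> rk x" if vxu: "v \<in> supp b" "x \<in> supp c" "u \<in># v \<and> snd u = snd x" for v x u
    proof (rule ccontr)
      assume "\<not> rk u \<le> rk x"
      then have le: "Suc (rk x) \<le> rk u" by simp
      obtain r where r: "r \<in> R" "v = w r" using vxu(1) unfolding sb by blast
      have "f r (snd x) (Suc (rk x)) = y (snd x)"
        by (rule f_top) (use R(3)[OF r(1)] c_pos[OF vxu(2)] in auto)
      then have "y (snd x) \<le> f r (snd x) (rk u)" using fmono[OF le, of r "snd x"] by simp
      moreover have "f r (snd x) (Suc (rk u)) \<le> y (snd x)" using f_le R(3)[OF r(1)] by blast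
      ultimately have "count v u = 0" unfolding r(2) cw using vxu(3) by simp
      then show False using vxu(3) by (metis count_eq_zero_iff)
    qed
  qed
  moreover have "letter_sum b c = a" by (auto simp: letter_sum_def c_def)
  ultimately show ?thesis using that[of b c] b0 c0 by blast
qed

section \<open>Labelled integral points\<close>

type_synonym 'n gen = "(real ^ 'n) \<times> nat"

definition ev :: "('n::finite gen \<Rightarrow> real) \<Rightarrow> real ^ 'n" where
  "ev a = (\<Sum>g\<in>supp a. a g *\<^sub>R fst g)"

definition mass :: "('n::finite gen \<Rightarrow> real) \<Rightarrow> nat \<Rightarrow> real" where
  "mass a l = (\<Sum>g\<in>{g\<in>supp a. snd g = l}. a g)"

definition carried :: "'n::finite gen set set \<Rightarrow> ('n gen \<Rightarrow> real) \<Rightarrow> bool" where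
  "carried T a \<longleftrightarrow> (\<forall>g. 0 \<le> a g) \<and> supp a \<in> T"

definition simplicial :: "'n::finite gen set set \<Rightarrow> bool" where
  "simplicial T \<longleftrightarrow> finite T \<and> (\<forall>S\<in>T. finite S) \<and> (\<forall>S\<in>T. \<forall>S'. S' \<subseteq> S \<longrightarrow> S' \<in> T)"

text \<open>Encodes that the cones over the sets in \<open>T\<close> are simplicial and meet in
  common faces: a vector together with its masses has at most one nonnegative representation over
  all of \<open>T\<close>.\<close>

definition cone_unique :: "'n::finite gen set set \<Rightarrow> bool" where
  "cone_unique T \<longleftrightarrow> (\<forall>a b. carried T a \<and> carried T b \<and> ev a = ev b \<and> mass a = mass b \<longrightarrow> a = b)"

lemma cone_uniqueD: "cone_unique T \<Longrightarrow> carried T a \<Longrightarrow> carried T b \<Longrightarrow> ev a = ev b \<Longrightarrow> mass a = mass b \<Longrightarrow> a = b"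
  by (auto simp: cone_unique_def)

lemma simplicial_sub: "simplicial T \<Longrightarrow> S \<in> T \<Longrightarrow> S' \<subseteq> S \<Longrightarrow> S' \<in> T"
  by (auto simp: simplicial_def)

lemma simplicial_fin: "simplicial T \<Longrightarrow> S \<in> T \<Longrightarrow> finite S"
  by (auto simp: simplicial_def)

lemma ev_sum: "finite U \<Longrightarrow> supp a \<subseteq> U \<Longrightarrow> ev a = (\<Sum>g\<in>U. a g *\<^sub>R fst g)"
  unfolding ev_def by (rule sum.mono_neutral_left) (auto simp: supp_def)

lemma mass_sum: "finite U \<Longrightarrow> supp a \<subseteq> U \<Longrightarrow> mass a l = (\<Sum>g\<in>{g\<in>U. snd g = l}. a g)"
  unfolding mass_def by (rule sum.mono_neutral_left) (auto simp: supp_def)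

lemma supp_add: "supp (\<lambda>g. a g + b g) \<subseteq> supp a \<union> supp b" by (auto simp: supp_def)
lemma supp_diff: "supp (\<lambda>g. a g - b g) \<subseteq> supp a \<union> supp b" by (auto simp: supp_def)
lemma supp_scale: "supp (\<lambda>g. t * a g) \<subseteq> supp a" by (auto simp: supp_def)

lemma ev_add: assumes "finite (supp a)" "finite (supp b)"
  shows "ev (\<lambda>g. a g + b g) = ev a + ev b" "mass (\<lambda>g. a g + b g) l = mass a l + mass b l"
proof -
  let ?U = "supp a \<union> supp b"
  have U: "finite ?U" using assms by simp
  show "ev (\<lambda>g. a g + b g) = ev a + ev b"
    using ev_sum[OF U supp_add] ev_sum[OF U, of a] ev_sum[OF U, of b]
    by (simp add: scaleR_add_left sum.distrib)
  show "mass (\<lambda>g. a g + b g) l = mass a l + mass b l"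
    using mass_sum[OF U supp_add, of l] mass_sum[OF U, of a l] mass_sum[OF U, of b l]
    by (simp add: sum.distrib)
qed

lemma ev_scale: assumes "finite (supp a)"
  shows "ev (\<lambda>g. t * a g) = t *\<^sub>R ev a" "mass (\<lambda>g. t * a g) l = t * mass a l"
  using ev_sum[OF assms supp_scale, of t] mass_sum[OF assms supp_scale, of t l]
  by (simp_all add: ev_def mass_def scaleR_sum_right sum_distrib_left)

lemma ev_diff: assumes "finite (supp a)" "finite (supp b)"
  shows "ev (\<lambda>g. a g - b g) = ev a - ev b" "mass (\<lambda>g. a g - b g) l = mass a l - mass b l"
proof -
  let ?U = "supp a \<union> supp b"
  have U: "finite ?U" using assms by simp
  show "ev (\<lambda>g. a g - b g) = ev a - ev b"
    using ev_sum[OF U supp_diff] ev_sum[OF U, of a] ev_sum[OF U, of b]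
    by (simp add: scaleR_diff_left sum_subtractf)
  show "mass (\<lambda>g. a g - b g) l = mass a l - mass b l"
    using mass_sum[OF U supp_diff, of l] mass_sum[OF U, of a l] mass_sum[OF U, of b l]
    by (simp add: sum_subtractf)
qed

lemma carried_subset: "carried T a \<Longrightarrow> T \<subseteq> T' \<Longrightarrow> carried T' a" by (auto simp: carried_def)

lemma cone_unique_subset: "cone_unique T' \<Longrightarrow> T \<subseteq> T' \<Longrightarrow> cone_unique T"
  unfolding cone_unique_def using carried_subset by blast

text \<open>The positive and the negative part of a relation are both carried by subsets of
  \<open>S\<close> and have the same value and masses, hence coincide.\<close>

lemma cone_unique_independent:
  assumes "simplicial T" "cone_unique T" "S \<in> T" "supp c \<subseteq> S" "ev c = 0" "\<And>l. mass c l = 0"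
  shows "c g = 0"
proof -
  define p where "p g = max (c g) 0" for g
  define q where "q g = max (- c g) 0" for g
  have sub: "supp p \<subseteq> S" "supp q \<subseteq> S" using assms(4) by (auto simp: supp_def p_def q_def max_def split: if_splits)
  then have fin: "finite (supp p)" "finite (supp q)" using simplicial_fin[OF assms(1,3)] finite_subset by blast+
  have pq: "(\<lambda>g. p g - q g) = c" by (auto simp: p_def q_def max_def)
  have "p = q"
  proof (rule cone_uniqueD[OF assms(2)])
    show "carried T p" "carried T q" unfolding carried_def using sub simplicial_sub[OF assms(1,3)] by (auto simp: p_def q_def)
    show "ev p = ev q" using ev_diff(1)[OF fin] pq assms(5) by simp
    show "mass p = mass q" using ev_diff(2)[OF fin] pq assms(6) by (metis eq_iff_diff_eq_0 ext)
  qed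
  then show ?thesis using pq by (metis diff_self)
qed

section \<open>Words as new generators and the complex formed by them\<close>

definition word_gen :: "nat \<Rightarrow> 'n::finite gen multiset \<Rightarrow> 'n gen" where
  "word_gen k w = (sum_mset (image_mset fst w), k)"

lemma snd_word_gen [simp]: "snd (word_gen k w) = k" by (simp add: word_gen_def)

definition word_vec :: "'b multiset \<Rightarrow> 'b \<Rightarrow> real" where
  "word_vec w g = count w g"

lemma supp_word_vec [simp]: "supp (word_vec w) = set_mset w"
  by (auto simp: supp_def word_vec_def)

definition unit_mass :: "'b \<Rightarrow> 'b \<Rightarrow> real" where
  "unit_mass x g = (if g = x then 1 else 0)"

lemma supp_unit_mass [simp]: "supp (unit_mass x) = {x}" by (auto simp: supp_def unit_mass_def)

lemma ev_unit_mass [simp]: "ev (unit_mass x) = fst x" by (simp add: ev_def) (simp add: unit_mass_def)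

lemma mass_unit_mass: "mass (unit_mass x) l = (if snd x = l then 1 else 0)"
proof -
  have "{g. g = x \<and> snd g = l} = (if snd x = l then {x} else {})" by auto
  then show ?thesis by (simp add: mass_def) (simp add: unit_mass_def)
qed

lemma supp_zero [simp]: "supp (\<lambda>_. 0) = {}" by (simp add: supp_def)
lemma ev_zero [simp]: "ev (\<lambda>_. 0) = 0" "mass (\<lambda>_. 0) l = 0" by (simp_all add: ev_def mass_def)

lemma supp_sumf: "supp (\<lambda>g. \<Sum>i\<in>I. t i * a i g) \<subseteq> (\<Union>i\<in>I. supp (a i))"
proof
  fix g assume "g \<in> supp (\<lambda>g. \<Sum>i\<in>I. t i * a i g)"
  then have "(\<Sum>i\<in>I. t i * a i g) \<noteq> 0" by (simp add: supp_def)
  then obtain i where "i \<in> I" "t i * a i g \<noteq> 0" by (meson sum.neutral)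
  then show "g \<in> (\<Union>i\<in>I. supp (a i))" by (auto simp: supp_def)
qed

lemma ev_sumf:
  assumes "finite I" "\<And>i. i \<in> I \<Longrightarrow> finite (supp (a i))"
  shows "ev (\<lambda>g. \<Sum>i\<in>I. t i * a i g) = (\<Sum>i\<in>I. t i *\<^sub>R ev (a i))"
    "mass (\<lambda>g. \<Sum>i\<in>I. t i * a i g) l = (\<Sum>i\<in>I. t i * mass (a i) l)"
proof -
  have "ev (\<lambda>g. \<Sum>i\<in>I. t i * a i g) = (\<Sum>i\<in>I. t i *\<^sub>R ev (a i)) \<and>
    mass (\<lambda>g. \<Sum>i\<in>I. t i * a i g) l = (\<Sum>i\<in>I. t i * mass (a i) l)"
    using assms
  proof (induction I rule: finite_induct)
    case empty
    then show ?case by simp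
  next
    case (insert i I)
    have f1: "finite (supp (\<lambda>g. t i * a i g))" using insert.prems finite_subset[OF supp_scale] by blast
    have f2: "finite (supp (\<lambda>g. \<Sum>i\<in>I. t i * a i g))"
      by (rule finite_subset[OF supp_sumf]) (use insert in auto)
    have fi: "finite (supp (a i))" using insert.prems by blast
    show ?case
      using ev_add[OF f1 f2] ev_scale[OF fi] insert by simp
  qed
  then show "ev (\<lambda>g. \<Sum>i\<in>I. t i * a i g) = (\<Sum>i\<in>I. t i *\<^sub>R ev (a i))"
    "mass (\<lambda>g. \<Sum>i\<in>I. t i * a i g) l = (\<Sum>i\<in>I. t i * mass (a i) l)" by auto
qed

lemma word_vec_add: "word_vec (add_mset x w) = (\<lambda>g. word_vec w g + unit_mass x g)"
  by (auto simp: word_vec_def unit_mass_def)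

lemma ev_word_vec: "ev (word_vec w) = fst (word_gen k w)"
proof (induction w)
  case empty
  then show ?case by (simp add: word_gen_def ev_def)
next
  case (add x w)
  have "ev (word_vec (add_mset x w)) = ev (word_vec w) + ev (unit_mass x)"
    unfolding word_vec_add by (rule ev_add(1)) simp_all
  then show ?case using add by (simp add: word_gen_def)
qed

lemma mass_word_vec: "mass (word_vec w) l = size {#x \<in># w. snd x = l#}"
proof (induction w)
  case empty
  then show ?case by (simp add: mass_def)
next
  case (add x w)
  have "mass (word_vec (add_mset x w)) l = mass (word_vec w) l + mass (unit_mass x) l"
    unfolding word_vec_add by (rule ev_add(2)) simp_all
  then show ?case using add by (simp add: mass_unit_mass)
qed

lemma mass_word_vec_type: "wtype y w \<Longrightarrow> mass (word_vec w) l = y l"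
  by (simp add: mass_word_vec wtype_def)

text \<open>A word is a carried combination with natural coefficients, and its masses are given by
  its type; uniqueness of carried representations therefore recovers the word from the sum of its
  letters.\<close>

lemma word_gen_inj:
  assumes "cone_unique K" "wtype y w" "wtype y w'" "set_mset w \<in> K" "set_mset w' \<in> K" "word_gen k w = word_gen k' w'"
  shows "w = w'"
proof -
  have "word_vec w = word_vec w'"
  proof (rule cone_uniqueD[OF assms(1)])
    show "carried K (word_vec w)" "carried K (word_vec w')" using assms by (auto simp: carried_def word_vec_def[abs_def] supp_word_vec[unfolded word_vec_def[abs_def]])
    show "ev (word_vec w) = ev (word_vec w')" using assms(6) ev_word_vec[of w k] ev_word_vec[of w' k'] by simp
    show "mass (word_vec w) = mass (word_vec w')" using mass_word_vec_type[OF assms(2)] mass_word_vec_type[OF assms(3)] by auto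
  qed
  then show ?thesis by (intro multiset_eqI) (metis of_nat_eq_iff word_vec_def)
qed

definition expand :: "nat \<Rightarrow> 'n::finite gen multiset set \<Rightarrow> 'n gen set \<Rightarrow> ('n gen \<Rightarrow> real) \<Rightarrow> 'n gen \<Rightarrow> real" where
  "expand k F A b g = (\<Sum>w\<in>F. b (word_gen k w) * word_vec w g) + (if g \<in> A then b g else 0)"

text \<open>The masses of a point after each new generator of label \<open>k\<close> is expanded into a word with
  \<open>y l\<close> letters of label \<open>l\<close>.\<close>

definition mass_map :: "(nat \<Rightarrow> nat) \<Rightarrow> nat \<Rightarrow> (nat \<Rightarrow> real) \<Rightarrow> nat \<Rightarrow> real" where
  "mass_map y k d l = (if l = k then y k * d k else d l + y l * d k)"

lemma mass_map_inj: "0 < y k \<Longrightarrow> mass_map y k d = mass_map y k d' \<Longrightarrow> d = d'"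
proof
  fix l assume y: "0 < y k" and e: "mass_map y k d = mass_map y k d'"
  have "d k = d' k" using fun_cong[OF e, of k] y by (simp add: mass_map_def)
  then show "d l = d' l" using fun_cong[OF e, of l] by (simp add: mass_map_def split: if_splits)
qed

lemma word_family_fin: "word_family y k rk U F A \<Longrightarrow> finite F" "word_family y k rk U F A \<Longrightarrow> A \<subseteq> U"
  "word_family y k rk U F A \<Longrightarrow> w \<in> F \<Longrightarrow> set_mset w \<subseteq> U" "word_family y k rk U F A \<Longrightarrow> w \<in> F \<Longrightarrow> wtype y w"
  "word_family y k rk U F A \<Longrightarrow> x \<in> A \<Longrightarrow> snd x \<noteq> k"
  by (auto simp: word_family_def)

lemma word_family_word_gen_inj: "word_family y k rk U F A \<Longrightarrow> cone_unique K \<Longrightarrow> simplicial K \<Longrightarrow> U \<in> K \<Longrightarrow> inj_on (word_gen k) F"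
  by (intro inj_onI) (meson simplicial_sub word_family_fin word_gen_inj)

lemma supp_expand:
  assumes "word_family y k rk U F A" shows "supp (expand k F A b) \<subseteq> U"
proof
  fix g assume "g \<in> supp (expand k F A b)"
  then have "(\<Sum>w\<in>F. b (word_gen k w) * word_vec w g) \<noteq> 0 \<or> g \<in> A" by (auto simp: supp_def expand_def split: if_splits)
  then show "g \<in> U"
  proof
    assume "(\<Sum>w\<in>F. b (word_gen k w) * word_vec w g) \<noteq> 0"
    then obtain w where "w \<in> F" "b (word_gen k w) * word_vec w g \<noteq> 0" by (meson sum.neutral)
    then have "g \<in> supp (word_vec w)" by (simp add: supp_def)
    then show "g \<in> U" using word_family_fin(3)[OF assms \<open>w \<in> F\<close>] by auto
  qed (use word_family_fin(2)[OF assms] in blast)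
qed

lemma ev_expand:
  assumes f: "word_family y k rk U F A" and U: "finite U" and inj: "inj_on (word_gen k) F" and b: "supp b \<subseteq> word_gen k ` F \<union> A"
  shows "ev (expand k F A b) = ev b" and "mass (expand k F A b) = mass_map y k (mass b)"
proof -
  have fF: "finite F" and fA: "finite A" using word_family_fin[OF f] U finite_subset by blast+
  have fG: "finite (word_gen k ` F)" using fF by simp
  define b1 where "b1 g = (if g \<in> word_gen k ` F then b g else 0)" for g
  define b2 where "b2 g = (if g \<in> A then b g else 0)" for g
  have disj: "g \<notin> A" if "g \<in> word_gen k ` F" for g using that word_family_fin(5)[OF f, of g] by auto
  have nz: "b g = 0" if "g \<notin> word_gen k ` F" "g \<notin> A" for g using b that unfolding supp_def by blast
  have b12: "b = (\<lambda>g. b1 g + b2 g)"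
  proof
    fix g show "b g = b1 g + b2 g" using disj[of g] nz[of g] by (simp add: b1_def b2_def)
  qed
  have s1: "supp b1 \<subseteq> word_gen k ` F" "supp b2 \<subseteq> A" by (auto simp: b1_def b2_def supp_def)
  have f12: "finite (supp b1)" "finite (supp b2)" using s1 fG fA finite_subset by blast+
  define u where "u = (\<lambda>g. \<Sum>w\<in>F. b (word_gen k w) * word_vec w g)"
  have upe: "expand k F A b = (\<lambda>g. u g + b2 g)" by (auto simp: expand_def u_def b2_def)
  have fu: "finite (supp u)" unfolding u_def by (rule finite_subset[OF supp_sumf]) (use fF in auto)
  have eu: "ev u = ev b1"
  proof -
    have "ev u = (\<Sum>w\<in>F. b (word_gen k w) *\<^sub>R fst (word_gen k w))" unfolding u_def by (subst ev_sumf(1)[OF fF]) (simp_all add: ev_word_vec[of _ k])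
    also have "\<dots> = (\<Sum>g\<in>word_gen k ` F. b g *\<^sub>R fst g)" using inj by (simp add: sum.reindex)
    also have "\<dots> = ev b1" unfolding ev_sum[OF fG s1(1)] by (intro sum.cong) (auto simp: b1_def)
    finally show ?thesis .
  qed
  have mb1: "mass b1 l = (if l = k then (\<Sum>w\<in>F. b (word_gen k w)) else 0)" for l
  proof -
    have "mass b1 l = (\<Sum>g\<in>{g\<in>word_gen k ` F. snd g = l}. b1 g)" by (rule mass_sum[OF fG s1(1)])
    also have "{g\<in>word_gen k ` F. snd g = l} = (if l = k then word_gen k ` F else {})" by (auto simp: word_gen_def)
    finally have "mass b1 l = (if l = k then sum b1 (word_gen k ` F) else 0)" by auto
    moreover have "sum b1 (word_gen k ` F) = (\<Sum>w\<in>F. b (word_gen k w))" using inj by (simp add: sum.reindex b1_def)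
    ultimately show ?thesis by simp
  qed
  have mu: "mass u l = y l * mass b1 k" for l
  proof -
    have "mass u l = (\<Sum>w\<in>F. b (word_gen k w) * mass (word_vec w) l)" unfolding u_def by (rule ev_sumf(2)[OF fF]) simp
    also have "\<dots> = (\<Sum>w\<in>F. b (word_gen k w) * y l)" using mass_word_vec_type word_family_fin(4)[OF f] by (intro sum.cong) auto
    also have "\<dots> = y l * mass b1 k" unfolding mb1 by (simp add: sum_distrib_left mult.commute)
    finally show ?thesis .
  qed
  have mb2: "mass b2 k = 0"
    unfolding mass_sum[OF fA s1(2)] by (rule sum.neutral) (use word_family_fin(5)[OF f] in blast)
  have eb: "ev b = ev b1 + ev b2" "mass b l = mass b1 l + mass b2 l" for l
    using ev_add[OF f12] b12 by metis+
  show "ev (expand k F A b) = ev b" unfolding upe ev_add(1)[OF fu f12(2)] eb eu ..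
  show "mass (expand k F A b) = mass_map y k (mass b)"
  proof
    fix l
    show "mass (expand k F A b) l = mass_map y k (mass b) l"
      unfolding upe ev_add(2)[OF fu f12(2)] mu mass_map_def eb using mb2 mb1[of l] by auto
  qed
qed

text \<open>If \<open>y\<close> vanishes outside \<open>k\<close>, this is the edgewise subdivision
  of the simplices of label \<open>k\<close> with \<open>y k\<close> parts on each edge; in general
  words mix several labels.\<close>

definition word_complex :: "(nat \<Rightarrow> nat) \<Rightarrow> nat \<Rightarrow> ('n::finite gen \<Rightarrow> nat) \<Rightarrow> 'n gen set set \<Rightarrow> 'n gen set set" where
  "word_complex y k rk K = {word_gen k ` F \<union> A | F A U. U \<in> K \<and> word_family y k rk U F A}"

definition rank_inj_on :: "('n::finite gen \<Rightarrow> nat) \<Rightarrow> 'n gen set set \<Rightarrow> bool" where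
  "rank_inj_on rk K \<longleftrightarrow> (\<forall>U\<in>K. rank_inj rk U)"

lemma carried_nonneg: "carried T a \<Longrightarrow> 0 \<le> a g" unfolding carried_def by blast

lemma carried_supp: "carried T a \<Longrightarrow> supp a \<in> T" unfolding carried_def by blast

lemma carriedI: "(\<And>g. 0 \<le> a g) \<Longrightarrow> supp a \<in> T \<Longrightarrow> carried T a" unfolding carried_def by blast

lemma word_complex_I: "U \<in> K \<Longrightarrow> word_family y k rk U F A \<Longrightarrow> word_gen k ` F \<union> A \<in> word_complex y k rk K"
  by (auto simp: word_complex_def)

lemma word_complex_E:
  assumes "S' \<in> word_complex y k rk K" obtains F A U where "U \<in> K" "word_family y k rk U F A" "S' = word_gen k ` F \<union> A"
  using assms by (auto simp: word_complex_def)

lemma wtype_size: "wtype y w \<Longrightarrow> set_mset w \<subseteq> U \<Longrightarrow> finite U \<Longrightarrow> size w = sum y (snd ` U)"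
proof -
  assume a: "wtype y w" "set_mset w \<subseteq> U" "finite U"
  have "size w = (\<Sum>g\<in>U. count w g)"
    unfolding size_multiset_overloaded_eq
    by (rule sum.mono_neutral_left) (use a in \<open>auto simp: count_eq_zero_iff\<close>)
  also have "\<dots> = (\<Sum>l\<in>snd ` U. \<Sum>g\<in>{g\<in>U. snd g = l}. count w g)"
    by (rule sum.image_gen[OF a(3)])
  also have "\<dots> = sum y (snd ` U)"
    using wtype_label_size[OF a] by simp
  finally show ?thesis .
qed

lemma simplicial_word_complex:
  assumes K: "simplicial K" shows "simplicial (word_complex y k rk K)"
  unfolding simplicial_def
proof (intro conjI ballI allI impI)
  have fin: "finite U" if "U \<in> K" for U using simplicial_fin[OF K that] .
  have "finite (\<Union>U\<in>K. Pow (word_gen k ` multisets_of_size U (sum y (snd ` U)) \<union> U))"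
    using K fin by (auto simp: simplicial_def intro!: finite_imageI finite_multisets_of_size)
  moreover have "word_complex y k rk K \<subseteq> (\<Union>U\<in>K. Pow (word_gen k ` multisets_of_size U (sum y (snd ` U)) \<union> U))"
  proof
    fix S assume "S \<in> word_complex y k rk K"
    then obtain F A U where f: "U \<in> K" "word_family y k rk U F A" "S = word_gen k ` F \<union> A" by (rule word_complex_E)
    have "F \<subseteq> multisets_of_size U (sum y (snd ` U))"
      using word_family_fin(3,4)[OF f(2)] wtype_size fin[OF f(1)] unfolding multisets_of_size_def by blast
    then show "S \<in> (\<Union>U\<in>K. Pow (word_gen k ` multisets_of_size U (sum y (snd ` U)) \<union> U))"
      using f word_family_fin(2)[OF f(2)] by blast
  qed
  ultimately show "finite (word_complex y k rk K)" by (rule rev_finite_subset)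
  show "finite S" if SB: "S \<in> word_complex y k rk K" for S
  proof -
    obtain F A U where f: "U \<in> K" "word_family y k rk U F A" "S = word_gen k ` F \<union> A" using SB by (rule word_complex_E)
    have "finite F" "finite A" using word_family_fin(1,2)[OF f(2)] fin[OF f(1)] finite_subset by blast+
    then show ?thesis using f(3) by simp
  qed
  show "S' \<in> word_complex y k rk K" if SB: "S \<in> word_complex y k rk K" "S' \<subseteq> S" for S S'
  proof -
    obtain F A U where f: "U \<in> K" "word_family y k rk U F A" "S = word_gen k ` F \<union> A" using SB(1) by (rule word_complex_E)
    have "S' = word_gen k ` {w\<in>F. word_gen k w \<in> S'} \<union> (A \<inter> S')" using f(3) SB(2) by blast
    moreover have "word_family y k rk U {w\<in>F. word_gen k w \<in> S'} (A \<inter> S')" by (rule word_family_subset[OF f(2)]) auto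
    from word_complex_I[OF f(1) this] have "word_gen k ` {w\<in>F. word_gen k w \<in> S'} \<union> (A \<inter> S') \<in> word_complex y k rk K" .
    ultimately show ?thesis by (simp only:)
  qed
qed

lemma carried_word_complex:
  assumes K: "simplicial K" "cone_unique K" and b: "carried (word_complex y k rk K) b"
  obtains F A U where "U \<in> K" "word_family y k rk U F A" "supp b = word_gen k ` F \<union> A"
    "carried K (expand k F A b)" "supp (expand k F A b) \<subseteq> U" "ev (expand k F A b) = ev b" "mass (expand k F A b) = mass_map y k (mass b)"
proof -
  from b have "supp b \<in> word_complex y k rk K" by (simp add: carried_def)
  then obtain F A U where f: "U \<in> K" "word_family y k rk U F A" "supp b = word_gen k ` F \<union> A" by (rule word_complex_E)
  have s: "supp (expand k F A b) \<subseteq> U" by (rule supp_expand[OF f(2)])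
  have "0 \<le> expand k F A b g" for g
    unfolding expand_def by (intro add_nonneg_nonneg sum_nonneg mult_nonneg_nonneg) (use carried_nonneg[OF b] in \<open>auto simp: word_vec_def\<close>)
  then have "carried K (expand k F A b)" using s simplicial_sub[OF K(1) f(1)] by (simp add: carried_def)
  moreover have "ev (expand k F A b) = ev b" "mass (expand k F A b) = mass_map y k (mass b)"
    using ev_expand[OF f(2) simplicial_fin[OF K(1) f(1)] word_family_word_gen_inj[OF f(2) K(2,1) f(1)]] f(3) by simp_all
  ultimately show ?thesis using that f s by blast
qed

lemma expand_letter_sum:
  assumes f: "word_family y k rk U F A" and inj: "inj_on (word_gen k) F" and s: "supp b = word_gen k ` F \<union> A"
  shows "expand k F A b = letter_sum (\<lambda>w. if w \<in> F then b (word_gen k w) else 0) (\<lambda>g. if g \<in> A then b g else 0)"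
    "supp (\<lambda>w. if w \<in> F then b (word_gen k w) else 0) = F" "supp (\<lambda>g. if g \<in> A then b g else 0) = A"
proof -
  show s1: "supp (\<lambda>w. if w \<in> F then b (word_gen k w) else 0) = F"
    using s unfolding supp_def by auto
  show "supp (\<lambda>g. if g \<in> A then b g else 0) = A"
    using s unfolding supp_def by auto
  show "expand k F A b = letter_sum (\<lambda>w. if w \<in> F then b (word_gen k w) else 0) (\<lambda>g. if g \<in> A then b g else 0)"
    by (intro ext) (simp add: expand_def letter_sum_def s1 word_vec_def)
qed

text \<open>Two combinations of new generators with the same value and masses expand to the same old
  combination, because \<open>mass_map\<close> determines the old masses from the new ones. The
  expansion into words and leftovers is unique.\<close>

lemma cone_unique_word_complex:
  assumes K: "simplicial K" "cone_unique K" "rank_inj_on rk K" and y: "0 < y k"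
  shows "cone_unique (word_complex y k rk K)"
  unfolding cone_unique_def
proof (intro allI impI, elim conjE)
  fix b1 b2
  assume b: "carried (word_complex y k rk K) b1" "carried (word_complex y k rk K) b2" and e: "ev b1 = ev b2" "mass b1 = mass b2"
  obtain F1 A1 U1 where f1: "U1 \<in> K" "word_family y k rk U1 F1 A1" "supp b1 = word_gen k ` F1 \<union> A1"
    "carried K (expand k F1 A1 b1)" "supp (expand k F1 A1 b1) \<subseteq> U1" "ev (expand k F1 A1 b1) = ev b1" "mass (expand k F1 A1 b1) = mass_map y k (mass b1)"
    by (rule carried_word_complex[OF K(1,2) b(1)])
  obtain F2 A2 U2 where f2: "U2 \<in> K" "word_family y k rk U2 F2 A2" "supp b2 = word_gen k ` F2 \<union> A2"
    "carried K (expand k F2 A2 b2)" "supp (expand k F2 A2 b2) \<subseteq> U2" "ev (expand k F2 A2 b2) = ev b2" "mass (expand k F2 A2 b2) = mass_map y k (mass b2)"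
    by (rule carried_word_complex[OF K(1,2) b(2)])
  have eq: "expand k F1 A1 b1 = expand k F2 A2 b2"
    by (rule cone_uniqueD[OF K(2) f1(4) f2(4)]) (use f1 f2 e in auto)
  note u1 = expand_letter_sum[OF f1(2) word_family_word_gen_inj[OF f1(2) K(2,1) f1(1)] f1(3)]
  note u2 = expand_letter_sum[OF f2(2) word_family_word_gen_inj[OF f2(2) K(2,1) f2(1)] f2(3)]
  let ?b1 = "\<lambda>w. if w \<in> F1 then b1 (word_gen k w) else 0" and ?c1 = "\<lambda>g. if g \<in> A1 then b1 g else 0"
  let ?b2 = "\<lambda>w. if w \<in> F2 then b2 (word_gen k w) else 0" and ?c2 = "\<lambda>g. if g \<in> A2 then b2 g else 0"
  have nn: "0 \<le> b1 g" "0 \<le> b2 g" for g using b carried_nonneg by blast+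
  have fam1: "word_family y k rk U1 (supp ?b1) (supp ?c1)" unfolding u1(2,3) by (rule f1(2))
  have fam2: "word_family y k rk U2 (supp ?b2) (supp ?c2)" unfolding u2(2,3) by (rule f2(2))
  have be: "?b1 = ?b2" and ce: "?c1 = ?c2"
  proof -
    have *: "rank_inj rk U1" using K(3) f1(1) by (auto simp: rank_inj_on_def)
    show "?b1 = ?b2" "?c1 = ?c2"
      by (rule word_family_unique[OF fam1 fam2 simplicial_fin[OF K(1) f1(1)] * simplicial_fin[OF K(1) f2(1)]];
          use nn y eq u1(1) u2(1) in simp)+
  qed
  have FF: "F1 = F2" using u1(2) u2(2) be by simp
  have AA: "A1 = A2" using u1(3) u2(3) ce by simp
  show "b1 = b2"
  proof
    fix g
    consider w where "w \<in> F1" "g = word_gen k w" | "g \<in> A1" | "g \<notin> supp b1" "g \<notin> supp b2"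
      using f1(3) f2(3) FF AA by blast
    then show "b1 g = b2 g"
    proof cases
      case 1
      then show ?thesis using fun_cong[OF be, of w] FF by simp
    next
      case 2
      then show ?thesis using fun_cong[OF ce, of g] AA by simp
    next
      case 3
      then show ?thesis by (simp add: supp_def)
    qed
  qed
qed

text \<open>\<open>ineq\<close> says that every label has enough mass for
  \<open>mass a k / y k\<close> units of words.\<close>

lemma word_complex_cover:
  assumes K: "simplicial K" "cone_unique K" "rank_inj_on rk K" and y: "0 < y k" and a: "carried K a"
    and ineq: "\<And>l. y l * mass a k \<le> y k * mass a l"
  obtains b where "carried (word_complex y k rk K) b" "ev b = ev a" "mass_map y k (mass b) = mass a"
proof -
  let ?U = "supp a"
  have U: "?U \<in> K" using a by (simp add: carried_def)
  have fU: "finite ?U" using simplicial_fin[OF K(1) U] .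
  obtain bb cc where bc: "\<And>w. 0 \<le> bb w" "\<And>g. 0 \<le> cc g" "word_family y k rk ?U (supp bb) (supp cc)" "letter_sum bb cc = a"
  proof (rule word_family_exists[of a rk y k "mass a"])
    show "mass a l = (\<Sum>g\<in>{g\<in>supp a. snd g = l}. a g)" for l by (simp add: mass_def)
    show "rank_inj rk (supp a)" using K(3) U by (auto simp: rank_inj_on_def)
    show "\<And>g. 0 \<le> a g" by (rule carried_nonneg[OF a])
  qed (use fU y ineq in blast)+
  let ?F = "supp bb" and ?A = "supp cc"
  have inj: "inj_on (word_gen k) ?F" by (rule word_family_word_gen_inj[OF bc(3) K(2,1) U])
  define b where "b g = (if g \<in> word_gen k ` ?F then bb (inv_into ?F (word_gen k) g) else cc g)" for g
  have bF: "b (word_gen k w) = bb w" if "w \<in> ?F" for w using that inj by (simp add: b_def)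
  have bA: "b g = cc g" if "g \<in> ?A" for g
  proof -
    have "g \<notin> word_gen k ` ?F" using word_family_fin(5)[OF bc(3) that] by auto
    then show ?thesis by (simp add: b_def)
  qed
  have sb: "supp b = word_gen k ` ?F \<union> ?A"
  proof
    show "supp b \<subseteq> word_gen k ` ?F \<union> ?A" by (auto simp: supp_def b_def)
    show "word_gen k ` ?F \<union> ?A \<subseteq> supp b" using bF bA by (auto simp: supp_iff)
  qed
  have "expand k ?F ?A b = a"
  proof
    fix g
    have "expand k ?F ?A b g = letter_sum bb cc g"
      unfolding expand_def letter_sum_def using bF bA by (auto simp: word_vec_def supp_iff)
    then show "expand k ?F ?A b g = a g" using bc(4) by simp
  qed
  moreover have "ev (expand k ?F ?A b) = ev b" "mass (expand k ?F ?A b) = mass_map y k (mass b)"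
    using ev_expand[OF bc(3) fU inj] sb by simp_all
  moreover have "0 \<le> b g" for g using bc(1,2) by (simp add: b_def)
  then have "carried (word_complex y k rk K) b" using sb word_complex_I[OF U bc(3)] by (simp add: carried_def)
  ultimately show ?thesis using that by metis
qed

section \<open>Box points and the index of a cone\<close>

definition int_vec :: "real ^ 'n \<Rightarrow> bool" where
  "int_vec v \<longleftrightarrow> (\<forall>i. v $ i \<in> \<int>)"

lemma int_vec_add: "int_vec u \<Longrightarrow> int_vec v \<Longrightarrow> int_vec (u + v)" by (simp add: int_vec_def)
lemma int_vec_diff: "int_vec u \<Longrightarrow> int_vec v \<Longrightarrow> int_vec (u - v)" by (simp add: int_vec_def)
lemma int_vec_zero: "int_vec 0" by (simp add: int_vec_def)
lemma int_vec_scale: "t \<in> \<int> \<Longrightarrow> int_vec v \<Longrightarrow> int_vec (t *\<^sub>R v)" by (simp add: int_vec_def)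
lemma int_vec_sum: "(\<And>x. x \<in> A \<Longrightarrow> int_vec (f x)) \<Longrightarrow> int_vec (sum f A)"
  unfolding int_vec_def by (auto intro: Ints_sum)

text \<open>Representatives of the lattice points of the cone over \<open>S\<close> modulo the lattice spanned by \<open>S\<close>; their
  number is the index of the cone, and \<open>S\<close> is unimodular if only the origin remains.\<close>

definition box_points :: "'n::finite gen set \<Rightarrow> ('n gen \<Rightarrow> real) set" where
  "box_points S = {c. supp c \<subseteq> S \<and> (\<forall>g. 0 \<le> c g \<and> c g < 1) \<and> int_vec (ev c) \<and> (\<forall>l. mass c l \<in> \<int>)}"

lemma boxD:
  assumes "c \<in> box_points S"
  shows "supp c \<subseteq> S" "0 \<le> c g" "c g < 1" "int_vec (ev c)" "mass c l \<in> \<int>"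
  using assms unfolding box_points_def by blast+

lemma boxI: "supp c \<subseteq> S \<Longrightarrow> (\<And>g. 0 \<le> c g) \<Longrightarrow> (\<And>g. c g < 1) \<Longrightarrow> int_vec (ev c) \<Longrightarrow> (\<And>l. mass c l \<in> \<int>) \<Longrightarrow> c \<in> box_points S"
  unfolding box_points_def by blast

lemma int_vec_ev:
  assumes "finite U" "supp z \<subseteq> U" "\<And>g. z g \<in> \<int>" "\<And>g. g \<in> U \<Longrightarrow> int_vec (fst g)"
  shows "int_vec (ev z)" "mass z l \<in> \<int>"
  unfolding ev_sum[OF assms(1,2)] mass_sum[OF assms(1,2)]
  using assms by (auto intro!: int_vec_sum int_vec_scale Ints_sum)

lemma frac_box:
  assumes U: "finite U" "\<And>g. g \<in> U \<Longrightarrow> int_vec (fst g)" and a: "supp a \<subseteq> U" "int_vec (ev a)" "\<And>l. mass a l \<in> \<int>"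
  shows "(\<lambda>g. frac (a g)) \<in> box_points U"
proof -
  have s: "supp (\<lambda>g. of_int \<lfloor>a g\<rfloor>) \<subseteq> supp a" by (auto simp: supp_def)
  have fin: "finite (supp a)" "finite (supp (\<lambda>g. of_int \<lfloor>a g\<rfloor>))" using finite_subset[OF _ U(1)] a(1) s by blast+
  have e: "(\<lambda>g. frac (a g)) = (\<lambda>g. a g - of_int \<lfloor>a g\<rfloor>)" by (simp add: frac_def)
  have i: "int_vec (ev (\<lambda>g. of_int \<lfloor>a g\<rfloor>))" "mass (\<lambda>g. of_int \<lfloor>a g\<rfloor>) l \<in> \<int>" for l
    using int_vec_ev[OF U(1), of "\<lambda>g. of_int \<lfloor>a g\<rfloor>"] s a(1) U(2) by auto
  have "supp (\<lambda>g. frac (a g)) \<subseteq> U" using a(1) by (auto simp: supp_def)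
  moreover have "int_vec (ev (\<lambda>g. frac (a g)))" "mass (\<lambda>g. frac (a g)) l \<in> \<int>" for l
    unfolding e ev_diff[OF fin] using i a by (blast intro: int_vec_diff Ints_diff)+
  ultimately show ?thesis by (intro boxI) (auto simp: frac_lt_1)
qed

lemma mass_word_gen:
  assumes f: "word_family y k rk U F A" and U: "finite U" and inj: "inj_on (word_gen k) F" and b: "supp b \<subseteq> word_gen k ` F \<union> A"
  shows "mass b k = (\<Sum>w\<in>F. b (word_gen k w))"
proof -
  have fin: "finite (word_gen k ` F \<union> A)" using word_family_fin[OF f] U finite_subset by blast
  have "{g \<in> word_gen k ` F \<union> A. snd g = k} = word_gen k ` F" using word_family_fin(5)[OF f] by auto
  then show ?thesis using mass_sum[OF fin b, of k] inj by (simp add: sum.reindex)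
qed

lemma small_int_zero: "(x::real) \<in> \<int> \<Longrightarrow> -1 < x \<Longrightarrow> x < 1 \<Longrightarrow> x = 0"
  by (elim Ints_cases) auto

text \<open>Expanding into letters and reducing modulo the old generators embeds the lattice
  quotient of the new cone into that of the old one, so the index does not grow. If two box points
  have the same image, the expansion of their difference is integral; primitivity makes its
  coefficients integral, and integers strictly between -1 and 1 vanish.\<close>

lemma box_word_complex_inj:
  assumes f: "word_family y k rk U F A" and U: "finite U" "rank_inj rk U" "\<And>g. g \<in> U \<Longrightarrow> int_vec (fst g)"
    and inj: "inj_on (word_gen k) F"
  shows "(\<lambda>c g. frac (expand k F A c g)) ` box_points (word_gen k ` F \<union> A) \<subseteq> box_points U"
    "inj_on (\<lambda>c g. frac (expand k F A c g)) (box_points (word_gen k ` F \<union> A))"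
proof -
  show "(\<lambda>c g. frac (expand k F A c g)) ` box_points (word_gen k ` F \<union> A) \<subseteq> box_points U"
  proof (intro image_subsetI frac_box[OF U(1,3)])
    fix c assume c: "c \<in> box_points (word_gen k ` F \<union> A)"
    then have s: "supp c \<subseteq> word_gen k ` F \<union> A" by (simp add: box_points_def)
    show "supp (expand k F A c) \<subseteq> U" by (rule supp_expand[OF f])
    show "int_vec (ev (expand k F A c))" unfolding ev_expand(1)[OF f U(1) inj s] using c by (simp add: box_points_def)
    show "mass (expand k F A c) l \<in> \<int>" for l
      unfolding ev_expand(2)[OF f U(1) inj s] mass_map_def using c by (auto simp: box_points_def)
  qed
  show "inj_on (\<lambda>c g. frac (expand k F A c g)) (box_points (word_gen k ` F \<union> A))"
  proof (rule inj_onI)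
    fix c c' assume c: "c \<in> box_points (word_gen k ` F \<union> A)" and c': "c' \<in> box_points (word_gen k ` F \<union> A)"
      and e: "(\<lambda>g. frac (expand k F A c g)) = (\<lambda>g. frac (expand k F A c' g))"
    have s: "supp c \<subseteq> word_gen k ` F \<union> A" "supp c' \<subseteq> word_gen k ` F \<union> A" using c c' by (auto simp: box_points_def)
    have i: "(\<Sum>w\<in>F. (c (word_gen k w) - c' (word_gen k w)) * count w g) + (if g \<in> A then c g - c' g else 0) \<in> \<int>" for g
    proof -
      have "(\<Sum>w\<in>F. (c (word_gen k w) - c' (word_gen k w)) * count w g) + (if g \<in> A then c g - c' g else 0)
        = expand k F A c g - expand k F A c' g"
        by (simp add: expand_def word_vec_def left_diff_distrib sum_subtractf)
      also have "\<dots> = of_int \<lfloor>expand k F A c g\<rfloor> - of_int \<lfloor>expand k F A c' g\<rfloor>"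
        using fun_cong[OF e, of g] by (simp add: frac_def)
      finally show ?thesis by (metis Ints_diff Ints_of_int)
    qed
    have "(\<Sum>w\<in>F. c (word_gen k w) - c' (word_gen k w)) = mass c k - mass c' k"
      using mass_word_gen[OF f U(1) inj s(1)] mass_word_gen[OF f U(1) inj s(2)] by (simp add: sum_subtractf)
    then have t: "(\<Sum>w\<in>F. c (word_gen k w) - c' (word_gen k w)) \<in> \<int>" using c c' by (simp add: box_points_def)
    have r: "-1 < c g - c' g" "c g - c' g < 1" for g
    proof -
      have "0 \<le> c g" "c g < 1" "0 \<le> c' g" "c' g < 1" using boxD[OF c] boxD[OF c'] by blast+
      then show "-1 < c g - c' g" "c g - c' g < 1" by auto
    qed
    note p = word_family_primitive[OF f U(1,2) real_subgroup_Ints i t]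
    show "c = c'"
    proof
      fix g
      show "c g = c' g"
      proof (cases "g \<in> word_gen k ` F \<union> A")
        case True
        then have "c g - c' g \<in> \<int>" using p by blast
        then show ?thesis using small_int_zero r[of g] by fastforce
      next
        case False
        then have "g \<notin> supp c" "g \<notin> supp c'" using s by auto
        then show ?thesis by (simp add: supp_def)
      qed
    qed
  qed
qed

text \<open>Values and masses of box points are integral and bounded, and they determine the box
  point.\<close>

lemma finite_box:
  assumes T: "simplicial T" "cone_unique T" and S: "S \<in> T"
  shows "finite (box_points S)"
proof -
  have fS: "finite S" using simplicial_fin[OF T(1) S] .
  define B where "B = (\<Sum>g\<in>S. norm (fst g)) + card S"
  have B0: "(\<Sum>g\<in>S. norm (fst g)) \<le> B" "card S \<le> B" by (simp_all add: B_def sum_nonneg)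
  define Z where "Z = {x \<in> \<int>. \<bar>x\<bar> \<le> B}"
  have fZ: "finite Z" unfolding Z_def by (rule finite_abs_int_segment)
  have "finite {f :: 'a \<Rightarrow> real. \<forall>i. f i \<in> Z}"
    using finite_PiE[of "UNIV::'a set" "\<lambda>_. Z"] fZ by (simp add: PiE_def Pi_def)
  then have fv: "finite (vec_lambda ` {f :: 'a \<Rightarrow> real. \<forall>i. f i \<in> Z})" by simp
  define M where "M = {f. \<forall>x. (x \<in> snd ` S \<longrightarrow> f x \<in> Z) \<and> (x \<notin> snd ` S \<longrightarrow> f x = (0::real))}"
  have fM: "finite M" unfolding M_def by (rule finite_set_of_finite_funs) (use fS fZ in auto)
  have sub: "(\<lambda>c. (ev c, mass c)) ` box_points S \<subseteq> (vec_lambda ` {f :: 'a \<Rightarrow> real. \<forall>i. f i \<in> Z}) \<times> M"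
  proof
    fix p assume "p \<in> (\<lambda>c. (ev c, mass c)) ` box_points S"
    then obtain c where c: "c \<in> box_points S" "p = (ev c, mass c)" by blast
    have cs: "supp c \<subseteq> S" "\<And>g. 0 \<le> c g" "\<And>g. c g < 1" using boxD[OF c(1)] by blast+
    have "norm (ev c) \<le> (\<Sum>g\<in>S. norm (c g *\<^sub>R fst g))" unfolding ev_sum[OF fS cs(1)] by (rule norm_sum)
    also have "\<dots> \<le> (\<Sum>g\<in>S. norm (fst g))"
    proof (rule sum_mono)
      fix g
      have "\<bar>c g\<bar> \<le> 1" using cs(2,3)[of g] by simp
      then show "norm (c g *\<^sub>R fst g) \<le> norm (fst g)" by (simp add: mult_left_le_one_le)
    qed
    finally have "norm (ev c) \<le> B" using B0 by simp
    then have "ev c $ i \<in> Z" for i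
      using c component_le_norm_cart[of "ev c" i] by (auto simp: Z_def box_points_def int_vec_def)
    then have "ev c \<in> vec_lambda ` {f. \<forall>i. f i \<in> Z}" by (intro image_eqI[of _ _ "vec_nth (ev c)"]) auto
    moreover have "mass c \<in> M"
      unfolding M_def
    proof (intro CollectI allI conjI impI)
      fix l assume "l \<in> snd ` S"
      have "0 \<le> mass c l" unfolding mass_def by (intro sum_nonneg cs)
      moreover have "mass c l \<le> (\<Sum>g\<in>{g\<in>S. snd g = l}. 1)"
        unfolding mass_sum[OF fS cs(1)] by (intro sum_mono) (use cs(3) less_imp_le in blast)
      moreover have "(\<Sum>g\<in>{g\<in>S. snd g = l}. 1) \<le> real (card S)"
        using fS by (simp add: card_mono)
      ultimately show "mass c l \<in> Z" using c B0 by (auto simp: Z_def box_points_def)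
    next
      fix l assume "l \<notin> snd ` S"
      then have "{g\<in>S. snd g = l} = {}" by force
      then show "mass c l = 0" unfolding mass_sum[OF fS cs(1)] by (simp only: sum.empty)
    qed
    ultimately show "p \<in> (vec_lambda ` {f. \<forall>i. f i \<in> Z}) \<times> M" using c by blast
  qed
  have "inj_on (\<lambda>c. (ev c, mass c)) (box_points S)"
  proof (rule inj_onI)
    fix c c' assume c: "c \<in> box_points S" "c' \<in> box_points S" "(ev c, mass c) = (ev c', mass c')"
    show "c = c'"
    proof (rule cone_uniqueD[OF T(2)])
      show "carried T c" "carried T c'" using boxD[OF c(1)] boxD[OF c(2)] simplicial_sub[OF T(1) S] by (auto intro!: carriedI)
    qed (use c(3) in auto)
  qed
  then show ?thesis using finite_subset[OF sub] fv fM by (meson finite_SigmaI finite_imageD)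
qed

lemma rkinjsI: "rank_inj rk (\<Union>K) \<Longrightarrow> rank_inj_on rk K"
  unfolding rank_inj_on_def by (meson Union_upper rank_inj_subset)

lemma word_family_shrink:
  assumes "word_family y k rk U F A"
  shows "word_family y k rk (\<Union>(set_mset ` F) \<union> A) F A" "\<Union>(set_mset ` F) \<union> A \<subseteq> U"
proof -
  show "word_family y k rk (\<Union>(set_mset ` F) \<union> A) F A" by (rule word_family_restrict[OF assms]) auto
  show "\<Union>(set_mset ` F) \<union> A \<subseteq> U" using word_family_fin(2,3)[OF assms] by auto
qed

section \<open>Star refinement at box points\<close>

text \<open>\<open>\<Phi>\<close> consists of box points with at most one of them carried by any given cone; each is to become a new
  generator of label \<open>k\<close>.\<close>

locale step =
  fixes T :: "'n::finite gen set set" and \<Phi> :: "('n gen \<Rightarrow> real) set" and k :: nat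
    and rk :: "'n gen \<Rightarrow> nat" and y :: "nat \<Rightarrow> nat"
  assumes simplicial_T: "simplicial T" and cone_unique_T: "cone_unique T" and int_vec_T: "\<And>S g. S \<in> T \<Longrightarrow> g \<in> S \<Longrightarrow> int_vec (fst g)"
    and rk: "rank_inj rk (\<Union>T)"
    and \<Phi>_T: "\<And>c. c \<in> \<Phi> \<Longrightarrow> supp c \<in> T" and \<Phi>_box_points: "\<And>c. c \<in> \<Phi> \<Longrightarrow> c \<in> box_points (supp c)"
    and \<Phi>_uniq: "\<And>S c c'. S \<in> T \<Longrightarrow> c \<in> \<Phi> \<Longrightarrow> c' \<in> \<Phi> \<Longrightarrow> supp c \<subseteq> S \<Longrightarrow> supp c' \<subseteq> S \<Longrightarrow> c = c'"
    and \<Phi>_k: "\<And>c. c \<in> \<Phi> \<Longrightarrow> 0 < mass c k"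
    and \<Phi>_lab: "\<And>c g. c \<in> \<Phi> \<Longrightarrow> g \<in> supp c \<Longrightarrow> snd g \<le> k"
    and y_k: "0 < y k" and y_high: "\<And>l. k < l \<Longrightarrow> y l = 0"
    and h_dvd: "\<And>c. c \<in> \<Phi> \<Longrightarrow> nat \<lfloor>mass c k\<rfloor> dvd y k"
    and h_le: "\<And>c l. c \<in> \<Phi> \<Longrightarrow> nat \<lfloor>mass c l\<rfloor> * y k \<le> y l * nat \<lfloor>mass c k\<rfloor>"
begin

definition h where "h c l = nat \<lfloor>mass c l\<rfloor>"
definition T0 where "T0 = {S\<in>T. \<forall>c\<in>\<Phi>. \<not> supp c \<subseteq> S}"
text \<open>The boundary of the star of \<open>supp c\<close>: faces of cones containing
  \<open>supp c\<close> that do not contain it themselves. Starring at \<open>c\<close> replaces the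
  star by the cone over this boundary.\<close>

definition Lk where "Lk c = {S. S \<union> supp c \<in> T \<and> \<not> supp c \<subseteq> S}"
definition K1 where "K1 c = word_complex (h c) k rk (Lk c)"
text \<open>The star point. It gets label \<open>k\<close> because the boundary of the star is
  refined by words of type \<open>h c\<close> first, and these have the same masses as
  \<open>c\<close>: one unit of label \<open>k\<close> means the same for them and for the
  apex.\<close>

definition M where "M c = (ev c, k)"
definition J where "J c = {R \<union> Z | R Z. R \<in> K1 c \<and> Z \<subseteq> {M c}}"
text \<open>Chosen so that a word of type \<open>y' c\<close> whose letters of label
  \<open>k\<close> are words of type \<open>h c\<close> is altogether a word of type
  \<open>y\<close>: the \<open>y k div h c k\<close> inner words bring \<open>h c l\<close> letters
  of label \<open>l\<close> each, and plain letters supply the rest. Thus starred and unstarred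
  parts end up with the same masses. By \<open>h_le\<close> the subtraction does not
  truncate.\<close>

definition y' where "y' c l = (if l = k then y k div h c k else y l - h c l * (y k div h c k))"

lemma c_bounds: "c \<in> \<Phi> \<Longrightarrow> 0 \<le> c g" "c \<in> \<Phi> \<Longrightarrow> c g < 1"
  using boxD[OF \<Phi>_box_points] by blast+

lemma c_fin: "c \<in> \<Phi> \<Longrightarrow> finite (supp c)"
  using simplicial_fin[OF simplicial_T \<Phi>_T] .

lemma h_mass: "c \<in> \<Phi> \<Longrightarrow> real (h c l) = mass c l"
proof -
  assume c: "c \<in> \<Phi>"
  have "0 \<le> mass c l" unfolding mass_def by (intro sum_nonneg c_bounds[OF c])
  moreover have "mass c l \<in> \<int>" using boxD(5)[OF \<Phi>_box_points[OF c]] .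
  ultimately show ?thesis unfolding h_def by (elim Ints_cases) simp
qed

lemma h_k: "c \<in> \<Phi> \<Longrightarrow> 0 < h c k"
  using h_mass[of c k] \<Phi>_k[of c] by (metis of_nat_0_less_iff)

lemma h_high: "c \<in> \<Phi> \<Longrightarrow> k < l \<Longrightarrow> h c l = 0"
proof -
  assume c: "c \<in> \<Phi>" "k < l"
  have "{g\<in>supp c. snd g = l} = {}" using \<Phi>_lab[OF c(1)] c(2) by force
  then have "mass c l = 0" unfolding mass_def by (simp only: sum.empty)
  then show ?thesis using h_mass[OF c(1), of l] by simp
qed

lemma y'_k: "c \<in> \<Phi> \<Longrightarrow> h c k * y' c k = y k" "c \<in> \<Phi> \<Longrightarrow> 0 < y' c k"
proof -
  assume c: "c \<in> \<Phi>"
  show e: "h c k * y' c k = y k" using h_dvd[OF c] by (simp add: y'_def h_def)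
  show "0 < y' c k" using e y_k by (metis gr0I mult_0_right less_irrefl)
qed

lemma y'_l: "c \<in> \<Phi> \<Longrightarrow> l \<noteq> k \<Longrightarrow> h c l * y' c k + y' c l = y l"
proof -
  assume c: "c \<in> \<Phi>" "l \<noteq> k"
  have "h c l * (h c k * y' c k) \<le> y l * h c k" using h_le[OF c(1), of l] y'_k(1)[OF c(1)] by (simp add: h_def)
  then have "h c k * (h c l * y' c k) \<le> h c k * y l" by (simp add: ac_simps)
  then have "h c l * y' c k \<le> y l" using h_k[OF c(1)] by simp
  then show ?thesis using c by (simp add: y'_def)
qed

lemma mass_map_mass_map: "c \<in> \<Phi> \<Longrightarrow> mass_map (h c) k (mass_map (y' c) k d) = mass_map y k d"
proof
  fix l assume c: "c \<in> \<Phi>"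
  show "mass_map (h c) k (mass_map (y' c) k d) l = mass_map y k d l"
  proof (cases "l = k")
    case True
    then show ?thesis using y'_k(1)[OF c] by (simp add: mass_map_def flip: of_nat_mult)
  next
    case False
    have "real (y l) = h c l * y' c k + y' c l" using y'_l[OF c False] by (metis of_nat_add of_nat_mult)
    then show ?thesis using False by (simp add: mass_map_def algebra_simps)
  qed
qed

lemma T0_sub: "T0 \<subseteq> T" by (auto simp: T0_def)

lemma Lk_T: "S \<in> Lk c \<Longrightarrow> S \<union> supp c \<in> T" "S \<in> Lk c \<Longrightarrow> S \<in> T"
  using simplicial_sub[OF simplicial_T, of "S \<union> supp c" S] by (auto simp: Lk_def)

text \<open>A face of the star of \<open>c\<close> containing the support of another selected point
  would lie in a cone with two selected points.\<close>

lemma Lk_T0: "c \<in> \<Phi> \<Longrightarrow> Lk c \<subseteq> T0"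
proof
  fix S assume c: "c \<in> \<Phi>" and S: "S \<in> Lk c"
  have "\<not> supp c' \<subseteq> S" if "c' \<in> \<Phi>" for c'
  proof
    assume "supp c' \<subseteq> S"
    then have "c' = c" using \<Phi>_uniq[OF Lk_T(1)[OF S] that c] by blast
    then show False using S \<open>supp c' \<subseteq> S\<close> by (simp add: Lk_def)
  qed
  then show "S \<in> T0" using Lk_T(2)[OF S] by (simp add: T0_def)
qed

lemma simplicial_T0: "simplicial T0"
  using simplicial_T unfolding simplicial_def T0_def by (auto 4 3)

lemma simplicial_Lk: "simplicial (Lk c)"
proof -
  have "finite (Lk c)" using simplicial_T Lk_T(2) finite_subset[of "Lk c" T] by (auto simp: simplicial_def)
  moreover have "S' \<in> Lk c" if "S \<in> Lk c" "S' \<subseteq> S" for S S'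
  proof -
    have "S' \<union> supp c \<in> T" by (rule simplicial_sub[OF simplicial_T Lk_T(1)[OF that(1)]]) (use that in auto)
    then show ?thesis using that by (auto simp: Lk_def)
  qed
  moreover have "finite S" if "S \<in> Lk c" for S using simplicial_fin[OF simplicial_T Lk_T(2)[OF that]] .
  ultimately show ?thesis unfolding simplicial_def by blast
qed

lemma cone_unique_T0: "cone_unique T0" by (rule cone_unique_subset[OF cone_unique_T T0_sub])

lemma cone_unique_Lk: "cone_unique (Lk c)" by (rule cone_unique_subset[OF cone_unique_T]) (use Lk_T in blast)

lemma rk_T0: "rank_inj_on rk T0" by (rule rkinjsI, rule rank_inj_subset[OF rk]) (use T0_sub in blast)

lemma rk_Lk: "rank_inj_on rk (Lk c)" by (rule rkinjsI, rule rank_inj_subset[OF rk]) (use Lk_T in blast)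

lemma simplicial_K1: "simplicial (K1 c)" unfolding K1_def by (rule simplicial_word_complex[OF simplicial_Lk])

lemma cone_unique_K1: "c \<in> \<Phi> \<Longrightarrow> cone_unique (K1 c)" unfolding K1_def by (rule cone_unique_word_complex[OF simplicial_Lk cone_unique_Lk rk_Lk]) (rule h_k)

text \<open>Equality would make \<open>c\<close> a combination with natural coefficients, but those
  of \<open>c\<close> are below one, and \<open>c\<close> has positive mass in label
  \<open>k\<close>.\<close>

lemma word_not_c:
  assumes c: "c \<in> \<Phi>" and w: "set_mset w \<in> T" "wtype (h c) w"
  shows "word_gen k w \<noteq> M c"
proof
  assume e: "word_gen k w = M c"
  have "word_vec w = c"
  proof (rule cone_uniqueD[OF cone_unique_T])
    show "carried T (word_vec w)" by (rule carriedI) (use w in \<open>auto simp: word_vec_def[of w] supp_word_vec\<close>)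
    show "carried T c" by (rule carriedI) (use c_bounds[OF c] \<Phi>_T[OF c] in auto)
    show "ev (word_vec w) = ev c" using e ev_word_vec[of w k] by (simp add: M_def)
    show "mass (word_vec w) = mass c" using mass_word_vec_type[OF w(2)] h_mass[OF c] by auto
  qed
  have "c g = 0" for g
  proof -
    have "c g = real (count w g)" using \<open>word_vec w = c\<close> unfolding word_vec_def[abs_def] by auto
    then show ?thesis using c_bounds(2)[OF c, of g] by simp
  qed
  then have "supp c = {}" by (simp add: supp_def)
  then have "mass c k = 0" by (simp add: mass_def)
  then show False using \<Phi>_k[OF c] by simp
qed

lemma M_notin_K1: "c \<in> \<Phi> \<Longrightarrow> R \<in> K1 c \<Longrightarrow> M c \<notin> R"
proof
  assume c: "c \<in> \<Phi>" "R \<in> K1 c" "M c \<in> R"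
  obtain F A U where f: "U \<in> Lk c" "word_family (h c) k rk U F A" "R = word_gen k ` F \<union> A"
    using c(2) unfolding K1_def by (rule word_complex_E)
  have "M c \<notin> A" using word_family_fin(5)[OF f(2), of "M c"] by (auto simp: M_def)
  then obtain w where w: "w \<in> F" "M c = word_gen k w" using c(3) f(3) by blast
  have "set_mset w \<in> T" by (rule simplicial_sub[OF simplicial_T Lk_T(2)[OF f(1)] word_family_fin(3)[OF f(2) w(1)]])
  then show False using word_not_c[OF c(1) _ word_family_fin(4)[OF f(2) w(1)]] w(2) by simp
qed

lemma simplicial_J: "simplicial (J c)"
proof -
  have "J c \<subseteq> (\<lambda>(R, Z). R \<union> Z) ` (K1 c \<times> Pow {M c})" by (auto simp: J_def)
  moreover have "finite (K1 c \<times> Pow {M c})" using simplicial_K1[of c] by (simp add: simplicial_def)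
  ultimately have "finite (J c)" by (meson finite_imageI finite_subset)
  moreover have "finite S" if "S \<in> J c" for S
  proof -
    obtain R Z where "S = R \<union> Z" "R \<in> K1 c" "Z \<subseteq> {M c}" using \<open>S \<in> J c\<close> unfolding J_def by blast
    then show ?thesis using simplicial_fin[OF simplicial_K1] finite_subset[of Z "{M c}"] by simp
  qed
  moreover have "S' \<in> J c" if SS: "S \<in> J c" "S' \<subseteq> S" for S S'
  proof -
    obtain R Z where r: "S = R \<union> Z" "R \<in> K1 c" "Z \<subseteq> {M c}" using SS(1) unfolding J_def by blast
    have "S' = (S' \<inter> R) \<union> (S' \<inter> Z)" using r SS(2) by blast
    moreover have "S' \<inter> R \<in> K1 c" by (rule simplicial_sub[OF simplicial_K1 r(2)]) auto
    moreover have "S' \<inter> Z \<subseteq> {M c}" using r(3) by blast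
    ultimately show ?thesis unfolding J_def by blast
  qed
  ultimately show ?thesis unfolding simplicial_def by blast
qed

text \<open>The usual star decomposition: after expanding the words of type \<open>h c\<close>, a
  combination over the coned complex is one over the boundary of the star plus a multiple of
  \<open>c\<close>.\<close>

lemma J_lift:
  assumes c: "c \<in> \<Phi>" and b: "carried (J c) b"
  obtains a where "carried (Lk c) a" "carried T (\<lambda>g. a g + b (M c) * c g)" "ev (\<lambda>g. a g + b (M c) * c g) = ev b"
    "mass (\<lambda>g. a g + b (M c) * c g) = mass_map (h c) k (mass b)"
    "carried (K1 c) (\<lambda>g. if g = M c then 0 else b g)"
    "b (M c) = 0 \<longrightarrow> supp b \<in> K1 c"
proof -
  define b1 where "b1 = (\<lambda>g. if g = M c then 0 else b g)"
  let ?\<gamma> = "b (M c)"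
  obtain R Z where r: "supp b = R \<union> Z" "R \<in> K1 c" "Z \<subseteq> {M c}" using carried_supp[OF b] unfolding J_def by blast
  have "supp b1 \<subseteq> R"
  proof
    fix g assume "g \<in> supp b1"
    then have "g \<in> supp b" "g \<noteq> M c" by (auto simp: supp_def b1_def split: if_splits)
    then show "g \<in> R" using r by blast
  qed
  then have sb1: "supp b1 \<in> K1 c" using simplicial_sub[OF simplicial_K1 r(2)] by blast
  have fb1: "carried (K1 c) b1" by (rule carriedI[OF _ sb1]) (use carried_nonneg[OF b] in \<open>simp add: b1_def\<close>)
  have fin1: "finite (supp b1)" using simplicial_fin[OF simplicial_K1 sb1] .
  obtain F A U where f: "U \<in> Lk c" "word_family (h c) k rk U F A" "supp b1 = word_gen k ` F \<union> A"
    "carried (Lk c) (expand k F A b1)" "supp (expand k F A b1) \<subseteq> U" "ev (expand k F A b1) = ev b1" "mass (expand k F A b1) = mass_map (h c) k (mass b1)"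
    by (rule carried_word_complex[OF simplicial_Lk cone_unique_Lk fb1[unfolded K1_def]])
  let ?a = "expand k F A b1"
  have fina: "finite (supp ?a)" using simplicial_fin[OF simplicial_Lk carried_supp[OF f(4)]] .
  have fc: "finite (supp (\<lambda>g. ?\<gamma> * c g))" using finite_subset[OF supp_scale c_fin[OF c]] .
  have bd: "b = (\<lambda>g. b1 g + ?\<gamma> * unit_mass (M c) g)" by (auto simp: b1_def unit_mass_def)
  have fd: "finite (supp (\<lambda>g. ?\<gamma> * unit_mass (M c) g))" using finite_subset[OF supp_scale, of "unit_mass (M c)"] by simp
  have evb: "ev b = ev b1 + ?\<gamma> *\<^sub>R ev c"
    using ev_add(1)[OF fin1 fd] ev_scale(1)[of "unit_mass (M c)" ?\<gamma>] bd by (simp add: M_def)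
  have msb: "mass b l = mass b1 l + (if l = k then ?\<gamma> else 0)" for l
    using ev_add(2)[OF fin1 fd, of l] ev_scale(2)[of "unit_mass (M c)" ?\<gamma> l] bd by (auto simp: M_def mass_unit_mass)
  have 1: "ev (\<lambda>g. ?a g + ?\<gamma> * c g) = ev b"
    unfolding ev_add(1)[OF fina fc] ev_scale(1)[OF c_fin[OF c]] evb f(6) ..
  have 2: "mass (\<lambda>g. ?a g + ?\<gamma> * c g) = mass_map (h c) k (mass b)"
  proof
    fix l
    show "mass (\<lambda>g. ?a g + ?\<gamma> * c g) l = mass_map (h c) k (mass b) l"
      unfolding ev_add(2)[OF fina fc] ev_scale(2)[OF c_fin[OF c]] f(7) mass_map_def msb
      using h_mass[OF c, of l] h_mass[OF c, of k] by (simp add: algebra_simps)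
  qed
  have 3: "carried T (\<lambda>g. ?a g + ?\<gamma> * c g)"
  proof (rule carriedI)
    show "0 \<le> ?a g + ?\<gamma> * c g" for g
      using carried_nonneg[OF f(4)] carried_nonneg[OF b] c_bounds[OF c] by simp
    show "supp (\<lambda>g. ?a g + ?\<gamma> * c g) \<in> T"
    proof (rule simplicial_sub[OF simplicial_T Lk_T(1)[OF f(1)]])
      show "supp (\<lambda>g. ?a g + ?\<gamma> * c g) \<subseteq> U \<union> supp c" using f(5) by (auto simp: supp_def)
    qed
  qed
  have 4: "?\<gamma> = 0 \<longrightarrow> supp b \<in> K1 c"
  proof
    assume "?\<gamma> = 0"
    then have "b1 = b" by (auto simp: b1_def)
    then show "supp b \<in> K1 c" using sb1 by simp
  qed
  show ?thesis by (rule that[OF f(4) 3 1 2 fb1[unfolded b1_def] 4])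
qed

text \<open>Some coordinate of \<open>supp c\<close> is missing from \<open>a'\<close>; there the
  right-hand side is \<open>t'\<close> times the coefficient of \<open>c\<close>. So
  \<open>t'\<close> is the largest multiple of \<open>c\<close> that can be split off.\<close>

lemma star_unique:
  assumes c: "c \<in> \<Phi>" and a: "carried (Lk c) a" "carried (Lk c) a'" and e: "(\<lambda>g. a g + t * c g) = (\<lambda>g. a' g + t' * c g)"
  shows "t \<le> t'"
proof -
  have "\<not> supp c \<subseteq> supp a'" using carried_supp[OF a(2)] by (simp add: Lk_def)
  then obtain v where v: "v \<in> supp c" "v \<notin> supp a'" by blast
  have "a v + t * c v = t' * c v" using fun_cong[OF e, of v] v(2) by (simp add: supp_def)
  then have "t * c v \<le> t' * c v" using carried_nonneg[OF a(1), of v] by linarith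
  moreover have "0 < c v" using v(1) c_bounds(1)[OF c, of v] by (simp add: supp_def)
  ultimately show ?thesis by simp
qed

lemma cone_unique_J: assumes c: "c \<in> \<Phi>" shows "cone_unique (J c)"
  unfolding cone_unique_def
proof (intro allI impI, elim conjE)
  fix b b' assume b: "carried (J c) b" "carried (J c) b'" and e: "ev b = ev b'" "mass b = mass b'"
  let ?t = "b (M c)" and ?t' = "b' (M c)"
  obtain a where a: "carried (Lk c) a" "carried T (\<lambda>g. a g + ?t * c g)" "ev (\<lambda>g. a g + ?t * c g) = ev b"
    "mass (\<lambda>g. a g + ?t * c g) = mass_map (h c) k (mass b)" "carried (K1 c) (\<lambda>g. if g = M c then 0 else b g)"
    "b (M c) = 0 \<longrightarrow> supp b \<in> K1 c"
    by (rule J_lift[OF c b(1)])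
  obtain a' where a': "carried (Lk c) a'" "carried T (\<lambda>g. a' g + ?t' * c g)" "ev (\<lambda>g. a' g + ?t' * c g) = ev b'"
    "mass (\<lambda>g. a' g + ?t' * c g) = mass_map (h c) k (mass b')" "carried (K1 c) (\<lambda>g. if g = M c then 0 else b' g)"
    "b' (M c) = 0 \<longrightarrow> supp b' \<in> K1 c"
    by (rule J_lift[OF c b(2)])
  have eq: "(\<lambda>g. a g + ?t * c g) = (\<lambda>g. a' g + ?t' * c g)"
    by (rule cone_uniqueD[OF cone_unique_T a(2) a'(2)]) (use a a' e in auto)
  have tt: "?t = ?t'" using star_unique[OF c a(1) a'(1) eq] star_unique[OF c a'(1) a(1) eq[symmetric]] by simp
  let ?b1 = "\<lambda>g. if g = M c then 0 else b g" and ?b2 = "\<lambda>g. if g = M c then 0 else b' g"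
  have f1: "finite (supp b)" using simplicial_fin[OF simplicial_J carried_supp[OF b(1)]] .
  have f2: "finite (supp b')" using simplicial_fin[OF simplicial_J carried_supp[OF b(2)]] .
  have fd: "finite (supp (\<lambda>g. t * unit_mass (M c) g))" for t using finite_subset[OF supp_scale, of "unit_mass (M c)"] by simp
  have b1: "?b1 = (\<lambda>g. b g - ?t * unit_mass (M c) g)" and b2: "?b2 = (\<lambda>g. b' g - ?t' * unit_mass (M c) g)"
    by (auto simp: unit_mass_def)
  have "?b1 = ?b2"
  proof (rule cone_uniqueD[OF cone_unique_K1[OF c] a(5) a'(5)])
    show "ev ?b1 = ev ?b2" unfolding b1 b2 ev_diff(1)[OF f1 fd] ev_diff(1)[OF f2 fd] tt e ..
    show "mass ?b1 = mass ?b2" unfolding b1 b2 using ev_diff(2)[OF f1 fd] ev_diff(2)[OF f2 fd] tt e by auto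
  qed
  note bb = this
  show "b = b'"
  proof
    fix g show "b g = b' g" using fun_cong[OF bb, of g] tt by (cases "g = M c") auto
  qed
qed

text \<open>This is where the index drops. Box points of the coned cone embed into those of the cone
  that was starred, and the image misses \<open>c\<close>, whose preimage would have coefficient one
  at the apex.\<close>

lemma J_box_points:
  assumes c: "c \<in> \<Phi>" and U: "U \<in> Lk c" and f: "word_family (h c) k rk U F A"
  shows "card (box_points (word_gen k ` F \<union> A \<union> {M c})) < card (box_points (U \<union> supp c))"
proof -
  let ?W = "U \<union> supp c" and ?R = "word_gen k ` F \<union> A"
  have WT: "?W \<in> T" using Lk_T(1)[OF U] .
  have fW: "finite ?W" using simplicial_fin[OF simplicial_T WT] .
  have fU: "finite U" using fW by simp
  have iW: "int_vec (fst g)" if "g \<in> ?W" for g using int_vec_T[OF WT that] .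
  have rU: "rank_inj rk U" using rank_inj_subset[OF rk] Lk_T(2)[OF U] by blast
  have inj: "inj_on (word_gen k) F" by (rule word_family_word_gen_inj[OF f cone_unique_Lk simplicial_Lk U])
  have RK: "?R \<in> K1 c" unfolding K1_def by (rule word_complex_I[OF U f])
  have MR: "M c \<notin> ?R" by (rule M_notin_K1[OF c RK])
  have fR: "finite ?R" using simplicial_fin[OF simplicial_K1 RK] .
  \<comment> \<open>A coordinate of \<open>c\<close> outside \<open>U\<close>. Only the apex
    contributes to it, by \<open>d (M c) * c v\<close>, which is below one; reduction by
    \<open>frac\<close> leaves it unchanged, so it reveals the coefficient of the apex.\<close>
  obtain v where v: "v \<in> supp c" "v \<notin> U" using U by (auto simp: Lk_def)
  have cv: "0 < c v" "c v < 1" using v(1) c_bounds[OF c, of v] by (auto simp: supp_def)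
  define p where "p d g = expand k F A d g + d (M c) * c g" for d :: "_ \<Rightarrow> real" and g
  define d1 where "d1 d g = (if g = M c then 0 else d g)" for d :: "'n gen \<Rightarrow> real" and g
  have MF: "word_gen k w \<noteq> M c" if "w \<in> F" for w using MR that by (metis UnI1 image_eqI)
  have MA: "g \<noteq> M c" if "g \<in> A" for g using MR that by blast
  have upd1: "expand k F A (d1 d) = expand k F A d" for d
  proof
    fix g
    have "(\<Sum>w\<in>F. d1 d (word_gen k w) * word_vec w g) = (\<Sum>w\<in>F. d (word_gen k w) * word_vec w g)"
      by (intro sum.cong) (simp_all add: d1_def MF)
    then show "expand k F A (d1 d) g = expand k F A d g" using MA[of g] by (simp add: expand_def d1_def)
  qed
  have upv: "expand k F A d v = 0" for d using supp_expand[OF f, of d] v(2) by (auto simp: supp_def)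
  have sd1: "supp (d1 d) \<subseteq> ?R" if "d \<in> box_points (?R \<union> {M c})" for d
    using boxD(1)[OF that] unfolding supp_def d1_def by auto
  have fc: "finite (supp (\<lambda>g. t * c g))" for t using finite_subset[OF supp_scale c_fin[OF c]] .
  have dd: "d = (\<lambda>g. d1 d g + d (M c) * unit_mass (M c) g)" for d by (auto simp: d1_def unit_mass_def)
  have fd: "finite (supp (\<lambda>g. t * unit_mass (M c) g))" for t using finite_subset[OF supp_scale, of "unit_mass (M c)"] by simp
  have evd: "ev d = ev (d1 d) + d (M c) *\<^sub>R ev c" "mass d l = mass (d1 d) l + (if l = k then d (M c) else 0)"
    if "d \<in> box_points (?R \<union> {M c})" for d l
  proof -
    have fin: "finite (supp (d1 d))" using finite_subset[OF sd1[OF that] fR] .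
    show "ev d = ev (d1 d) + d (M c) *\<^sub>R ev c"
      using ev_add(1)[OF fin fd, of "d (M c)"] ev_scale(1)[of "unit_mass (M c)" "d (M c)"] dd[of d] by (simp add: M_def)
    show "mass d l = mass (d1 d) l + (if l = k then d (M c) else 0)"
      using ev_add(2)[OF fin fd, of "d (M c)" l] ev_scale(2)[of "unit_mass (M c)" "d (M c)" l] dd[of d] by (auto simp: M_def mass_unit_mass)
  qed
  have img: "(\<lambda>d g. frac (p d g)) ` box_points (?R \<union> {M c}) \<subseteq> box_points ?W"
  proof (intro image_subsetI frac_box[OF fW iW])
    fix d assume d: "d \<in> box_points (?R \<union> {M c})"
    have fin: "finite (supp (expand k F A d))" using finite_subset[OF supp_expand[OF f] fU] .
    have pe: "p d = (\<lambda>g. expand k F A d g + d (M c) * c g)" by (auto simp: p_def)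
    have e: "ev (expand k F A d) = ev (d1 d)" "mass (expand k F A d) = mass_map (h c) k (mass (d1 d))"
      using ev_expand[OF f fU inj sd1[OF d]] upd1 by simp_all
    show "supp (p d) \<subseteq> ?W" using supp_expand[OF f, of d] unfolding supp_def p_def by auto
    have "ev (p d) = ev d"
      unfolding pe ev_add(1)[OF fin fc] ev_scale(1)[OF c_fin[OF c]] e evd(1)[OF d] ..
    then show "int_vec (ev (p d))" using boxD(4)[OF d] by simp
    fix l
    have "mass (p d) l = mass_map (h c) k (mass d) l"
      unfolding pe ev_add(2)[OF fin fc] ev_scale(2)[OF c_fin[OF c]] e mass_map_def evd(2)[OF d]
      using h_mass[OF c, of l] h_mass[OF c, of k] by (simp add: algebra_simps)
    then show "mass (p d) l \<in> \<int>" unfolding mass_map_def using boxD(5)[OF d] by auto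
  qed
  have pv: "frac (p d v) = d (M c) * c v" if "d \<in> box_points (?R \<union> {M c})" for d
  proof -
    have "0 \<le> d (M c)" "d (M c) < 1" using boxD(2,3)[OF that] by auto
    then have "0 \<le> d (M c) * c v" "d (M c) * c v < 1"
      using cv mult_strict_mono[of "d (M c)" 1 "c v" 1] by auto
    then show ?thesis unfolding p_def upv by (simp add: frac_eq)
  qed
  have injp: "inj_on (\<lambda>d g. frac (p d g)) (box_points (?R \<union> {M c}))"
  proof (rule inj_onI)
    fix d d' assume d: "d \<in> box_points (?R \<union> {M c})" "d' \<in> box_points (?R \<union> {M c})" and e: "(\<lambda>g. frac (p d g)) = (\<lambda>g. frac (p d' g))"
    have MM: "d (M c) = d' (M c)" using fun_cong[OF e, of v] pv[OF d(1)] pv[OF d(2)] cv by simp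
    have i: "(\<Sum>w\<in>F. (d (word_gen k w) - d' (word_gen k w)) * count w g) + (if g \<in> A then d g - d' g else 0) \<in> \<int>" for g
    proof -
      have "(\<Sum>w\<in>F. (d (word_gen k w) - d' (word_gen k w)) * count w g) + (if g \<in> A then d g - d' g else 0)
        = p d g - p d' g"
        using MM by (simp add: p_def expand_def word_vec_def left_diff_distrib sum_subtractf)
      also have "\<dots> = of_int \<lfloor>p d g\<rfloor> - of_int \<lfloor>p d' g\<rfloor>"
        using fun_cong[OF e, of g] by (simp add: frac_def)
      finally show ?thesis by (metis Ints_diff Ints_of_int)
    qed
    have Fk: "(\<Sum>w\<in>F. d (word_gen k w)) = mass d k - d (M c)" if d: "d \<in> box_points (?R \<union> {M c})" for d
    proof -
      have "(\<Sum>w\<in>F. d (word_gen k w)) = (\<Sum>w\<in>F. d1 d (word_gen k w))" by (intro sum.cong) (simp_all add: d1_def MF)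
      also have "\<dots> = mass (d1 d) k" using mass_word_gen[OF f fU inj sd1[OF d]] by simp
      finally show ?thesis using evd(2)[OF d, of k] by simp
    qed
    have "(\<Sum>w\<in>F. d (word_gen k w) - d' (word_gen k w)) = mass d k - mass d' k"
      using Fk[OF d(1)] Fk[OF d(2)] MM by (simp add: sum_subtractf)
    then have t: "(\<Sum>w\<in>F. d (word_gen k w) - d' (word_gen k w)) \<in> \<int>" using boxD(5)[OF d(1)] boxD(5)[OF d(2)] by simp
    have r: "-1 < d g - d' g" "d g - d' g < 1" for g
    proof -
      have "0 \<le> d g" "d g < 1" "0 \<le> d' g" "d' g < 1" using boxD[OF d(1)] boxD[OF d(2)] by blast+
      then show "-1 < d g - d' g" "d g - d' g < 1" by auto
    qed
    note q = word_family_primitive[OF f fU rU real_subgroup_Ints i t]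
    show "d = d'"
    proof
      fix g
      consider "g \<in> ?R" | "g = M c" | "g \<notin> supp d" "g \<notin> supp d'" using boxD(1)[OF d(1)] boxD(1)[OF d(2)] by blast
      then show "d g = d' g"
      proof cases
        case 1
        then have "d g - d' g \<in> \<int>" using q by blast
        then show ?thesis using small_int_zero r[of g] by fastforce
      next
        case 2
        then show ?thesis using MM by simp
      next
        case 3
        then show ?thesis by (simp add: supp_def)
      qed
    qed
  qed
  have "c \<in> box_points ?W" using \<Phi>_box_points[OF c] unfolding box_points_def by blast
  moreover have "c \<notin> (\<lambda>d g. frac (p d g)) ` box_points (?R \<union> {M c})"
  proof
    assume "c \<in> (\<lambda>d g. frac (p d g)) ` box_points (?R \<union> {M c})"
    then obtain d where d: "d \<in> box_points (?R \<union> {M c})" "c = (\<lambda>g. frac (p d g))" by blast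
    then have "c v = d (M c) * c v" using pv[OF d(1)] by metis
    then have "d (M c) = 1" using cv by simp
    then show False using boxD(3)[OF d(1), of "M c"] by simp
  qed
  ultimately have "(\<lambda>d g. frac (p d g)) ` box_points (?R \<union> {M c}) \<subset> box_points ?W" using img by blast
  then have "card ((\<lambda>d g. frac (p d g)) ` box_points (?R \<union> {M c})) < card (box_points ?W)"
    by (rule psubset_card_mono[OF finite_box[OF simplicial_T cone_unique_T WT]])
  then show ?thesis using card_image[OF injp] by simp
qed

end

section \<open>A ranking of the coned complex under which words of words are words\<close>

lemma wcount_plus: "wcount rk (v + w) l i = wcount rk v l i + wcount rk w l i"
  by (simp add: wcount_def)

lemma wcount_sum_mset: "wcount rk (\<Sum>g\<in>#W. f g) l i = (\<Sum>g\<in>#W. wcount rk (f g) l i)"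
proof (induction W)
  case empty
  then show ?case by (simp add: wcount_def)
next
  case (add x W)
  then show ?case by (simp add: wcount_plus)
qed

lemma label_size_sum_mset:
  "size {#x \<in># (\<Sum>g\<in>#W. f g). snd x = l#} = (\<Sum>g\<in>#W. size {#x \<in># f g. snd x = l#})"
  by (induction W) auto

lemma indicator_sum_mset: "(\<Sum>g\<in>#W. if P g then (1::nat) else 0) = size {#g \<in># W. P g#}"
  by (induction W) auto

lemma wcount_above:
  assumes "\<And>u. u \<in># w \<Longrightarrow> rk u < B" "B \<le> i"
  shows "wcount rk w l i = wcount rk w l B"
proof -
  have "{#x \<in># w. snd x = l \<and> rk x < i#} = {#x \<in># w. snd x = l \<and> rk x < B#}"
    by (intro filter_mset_cong) (use assms in fastforce)+
  then show ?thesis by (simp add: wcount_def)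
qed

lemma wcount_no_label:
  assumes "\<And>u. u \<in># w \<Longrightarrow> snd u \<noteq> l"
  shows "wcount rk w l i = 0"
proof -
  have "{#x \<in># w. snd x = l \<and> rk x < i#} = {#}"
    using assms by (intro multiset_eqI) (auto simp: count_eq_zero_iff)
  then show ?thesis by (simp add: wcount_def)
qed

lemma in_sum_msetE:
  assumes "u \<in># (\<Sum>g\<in>#W. f g)" obtains g where "g \<in># W" "u \<in># f g"
  using assms by (induction W) auto

context step
begin

definition Bd where "Bd = Suc (\<Sum>g\<in>\<Union>T. rk g)"
definition lm where "lm = Suc (\<Sum>g\<in>\<Union>T. snd g)"
definition Rw where "Rw w = (\<Sum>l<lm. \<Sum>i<Suc Bd. wcount rk w l i)"
definition Cw where "Cw c = (\<Sum>l<lm. \<Sum>i<Suc Bd. h c l)"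
definition dcw where "dcw c g = (THE w. set_mset w \<in> Lk c \<and> wtype (h c) w \<and> word_gen k w = g)"
text \<open>Ranks the words of label \<open>k\<close> along their chain: \<open>Rw\<close> adds up
  all counts of a word and so decreases strictly along \<open>wrel\<close>, and subtracting it from
  the bound \<open>Cw\<close> gives an increasing rank. \<open>dcw\<close> recovers the word from
  the generator. The apex comes last, and the other labels keep their ranks.\<close>

definition rk2 where "rk2 c g = (if snd g \<noteq> k then rk g else if g = M c then Suc (Cw c) else Cw c - Rw (dcw c g))"

lemma fin_UT: "finite (\<Union>T)" using simplicial_T by (auto simp: simplicial_def)

lemma Bd: "g \<in> \<Union>T \<Longrightarrow> rk g < Bd"
  unfolding Bd_def using member_le_sum[of g "\<Union>T" rk] fin_UT by simp

lemma lm: "g \<in> \<Union>T \<Longrightarrow> snd g < lm"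
  unfolding lm_def using member_le_sum[of g "\<Union>T" snd] fin_UT by simp

lemma Rw_le: "wtype (h c) w \<Longrightarrow> Rw w \<le> Cw c"
  unfolding Rw_def Cw_def by (intro sum_mono wcount_le_type)

lemma Rw_less:
  assumes "set_mset w \<subseteq> \<Union>T" "set_mset w' \<subseteq> \<Union>T" "wrel rk w w'" "w \<noteq> w'"
  shows "Rw w' < Rw w"
proof -
  obtain l i where li: "wcount rk w l i \<noteq> wcount rk w' l i"
    using wcount_eqI[OF rk fin_UT assms(1,2)] assms(4) by blast
  have l: "l < lm"
  proof (rule ccontr)
    assume "\<not> l < lm"
    then have "wcount rk w l i = 0" "wcount rk w' l i = 0"
      using wcount_no_label[of w l] wcount_no_label[of w' l] lm assms(1,2) by blast+
    then show False using li by simp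
  qed
  define j where "j = min i Bd"
  have j: "j < Suc Bd" "wcount rk w l j \<noteq> wcount rk w' l j"
  proof -
    show "j < Suc Bd" by (simp add: j_def)
    show "wcount rk w l j \<noteq> wcount rk w' l j"
    proof (cases "i \<le> Bd")
      case True
      then show ?thesis using li by (simp add: j_def)
    next
      case False
      have "wcount rk w l i = wcount rk w l Bd" "wcount rk w' l i = wcount rk w' l Bd"
        using False assms(1,2) Bd by (intro wcount_above; force)+
      then show ?thesis using li False by (simp add: j_def)
    qed
  qed
  have le: "wcount rk w' l i \<le> wcount rk w l i" for l i using assms(3) by (simp add: wrel_def)
  show ?thesis unfolding Rw_def
  proof (rule sum_strict_mono_ex1)
    show "\<forall>x\<in>{..<lm}. (\<Sum>i<Suc Bd. wcount rk w' x i) \<le> (\<Sum>i<Suc Bd. wcount rk w x i)"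
      by (intro ballI sum_mono le)
    have "(\<Sum>i<Suc Bd. wcount rk w' l i) < (\<Sum>i<Suc Bd. wcount rk w l i)"
    proof (rule sum_strict_mono_ex1)
      show "\<exists>a\<in>{..<Suc Bd}. wcount rk w' l a < wcount rk w l a"
        using j le[of l j] by (intro bexI[of _ j]) auto
    qed (use le in auto)
    then show "\<exists>a\<in>{..<lm}. (\<Sum>i<Suc Bd. wcount rk w' a i) < (\<Sum>i<Suc Bd. wcount rk w a i)"
      using l by blast
  qed simp
qed

lemma dcw: "set_mset w \<in> Lk c \<Longrightarrow> wtype (h c) w \<Longrightarrow> dcw c (word_gen k w) = w"
  unfolding dcw_def by (intro the_equality) (auto intro: word_gen_inj[OF cone_unique_Lk])

lemma famL:
  assumes "U \<in> Lk c" "word_family (h c) k rk U F A" "w \<in> F"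
  shows "set_mset w \<in> Lk c" "wtype (h c) w" "set_mset w \<subseteq> \<Union>T" "dcw c (word_gen k w) = w"
    "c \<in> \<Phi> \<Longrightarrow> word_gen k w \<noteq> M c" "c \<in> \<Phi> \<Longrightarrow> rk2 c (word_gen k w) = Cw c - Rw w"
proof -
  show 1: "set_mset w \<in> Lk c" by (rule simplicial_sub[OF simplicial_Lk assms(1) word_family_fin(3)[OF assms(2,3)]])
  show 2: "wtype (h c) w" using word_family_fin(4)[OF assms(2,3)] .
  show "set_mset w \<subseteq> \<Union>T" using Lk_T(2)[OF 1] by blast
  show 3: "dcw c (word_gen k w) = w" using dcw[OF 1 2] .
  show 4: "word_gen k w \<noteq> M c" if "c \<in> \<Phi>" by (rule word_not_c[OF that Lk_T(2)[OF 1] 2])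
  show "rk2 c (word_gen k w) = Cw c - Rw w" if "c \<in> \<Phi>" using 3 4[OF that] by (simp add: rk2_def)
qed

lemma rk2_less:
  assumes "c \<in> \<Phi>" "U \<in> Lk c" "word_family (h c) k rk U F A" "w \<in> F" "w' \<in> F" "wrel rk w w'" "w \<noteq> w'"
  shows "rk2 c (word_gen k w) < rk2 c (word_gen k w')"
proof -
  have "Rw w' < Rw w" by (rule Rw_less[OF famL(3)[OF assms(2,3,4)] famL(3)[OF assms(2,3,5)] assms(6,7)])
  moreover have "Rw w \<le> Cw c" by (rule Rw_le[OF famL(2)[OF assms(2,3,4)]])
  ultimately show ?thesis using famL(6)[OF assms(2,3,4,1)] famL(6)[OF assms(2,3,5,1)] by simp
qed

lemma JE:
  assumes "S \<in> J c"
  obtains U F A Z where "U \<in> Lk c" "word_family (h c) k rk U F A" "S = word_gen k ` F \<union> A \<union> Z" "Z \<subseteq> {M c}"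
proof -
  obtain R Z where r: "S = R \<union> Z" "R \<in> K1 c" "Z \<subseteq> {M c}" using assms unfolding J_def by blast
  from r(2) obtain F A U where "U \<in> Lk c" "word_family (h c) k rk U F A" "R = word_gen k ` F \<union> A" unfolding K1_def by (rule word_complex_E)
  then show ?thesis using that r by blast
qed

lemma rk2_J: assumes c: "c \<in> \<Phi>" shows "rank_inj_on (rk2 c) (J c)"
  unfolding rank_inj_on_def rank_inj_def
proof (intro ballI impI, elim conjE)
  fix S g g' assume S: "S \<in> J c" and g: "g \<in> S" "g' \<in> S" and e: "snd g = snd g'" "rk2 c g = rk2 c g'"
  obtain U F A Z where f: "U \<in> Lk c" "word_family (h c) k rk U F A" "S = word_gen k ` F \<union> A \<union> Z" "Z \<subseteq> {M c}"
    using S by (rule JE)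
  have Mk: "snd (M c) = k" by (simp add: M_def)
  show "g = g'"
  proof (cases "snd g = k")
    case False
    then have "g \<in> A" "g' \<in> A" using f(3,4) g e(1) Mk by auto
    then have "g \<in> \<Union>T" "g' \<in> \<Union>T" using word_family_fin(2)[OF f(2)] Lk_T(2)[OF f(1)] by blast+
    moreover have "rk g = rk g'" using e False by (simp add: rk2_def)
    ultimately show ?thesis using rk e(1) unfolding rank_inj_def by blast
  next
    case True
    have in_F: "x = M c \<or> (\<exists>w\<in>F. x = word_gen k w)" if "x \<in> S" "snd x = k" for x
      using that f(3,4) word_family_fin(5)[OF f(2), of x] by blast
    have ub: "rk2 c (word_gen k w) < Suc (Cw c)" if "w \<in> F" for w using famL(6)[OF f(1,2) that c] by simp
    have RM: "rk2 c (M c) = Suc (Cw c)" by (simp add: rk2_def Mk)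
    consider "g = M c" "g' = M c" | w where "g = M c" "w \<in> F" "g' = word_gen k w" | w where "g' = M c" "w \<in> F" "g = word_gen k w"
      | w w' where "w \<in> F" "w' \<in> F" "g = word_gen k w" "g' = word_gen k w'"
      using in_F[OF g(1) True] in_F[OF g(2)] True e(1) by auto
    then show ?thesis
    proof cases
      case 1
      then show ?thesis by simp
    next
      case 2
      then show ?thesis using ub[OF 2(2)] RM e(2) by simp
    next
      case 3
      then show ?thesis using ub[OF 3(2)] RM e(2) by simp
    next
      case 4
      have "wrel rk w w' \<or> wrel rk w' w" using f(2) 4(1,2) unfolding word_family_def wchain_def by blast
      then have "w = w'"
        using rk2_less[OF c f(1,2) 4(1,2)] rk2_less[OF c f(1,2) 4(2,1)] e(2) 4(3,4) by fastforce
      then show ?thesis using 4 by simp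
    qed
  qed
qed

text \<open>In a chain a fixed count takes at most two consecutive values, the larger one on the
  earlier words. As \<open>rk2\<close> follows the chain, a rank \<open>j\<close> separates the two,
  so counting letters inside the inner words becomes counting inner words below
  \<open>j\<close>.\<close>

lemma rk2_threshold:
  assumes c: "c \<in> \<Phi>" and f: "U \<in> Lk c" "word_family (h c) k rk U F A"
  obtains n j where "\<And>w. w \<in> F \<Longrightarrow> wcount rk w l i = n + (if rk2 c (word_gen k w) < j then 1 else 0)"
proof (cases "F = {}")
  case True
  then show ?thesis using that by blast
next
  case False
  have ch: "wchain rk F" and fin: "finite F" using f(2) by (auto simp: word_family_def)
  obtain t where t: "t \<in> F" "\<And>w. w \<in> F \<Longrightarrow> wrel rk t w" using wchain_top[OF fin False ch] by blast
  have v: "wcount rk w l i \<le> wcount rk t l i \<and> wcount rk t l i \<le> wcount rk w l i + 1" if "w \<in> F" for w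
    using t(2)[OF that] by (simp add: wrel_def)
  show ?thesis
  proof (cases "\<forall>w\<in>F. wcount rk w l i = wcount rk t l i")
    case True
    then show ?thesis using that[of "wcount rk t l i" 0] by simp
  next
    case False
    let ?E = "{w\<in>F. wcount rk w l i \<noteq> wcount rk t l i}"
    define j where "j = Min ((\<lambda>w. rk2 c (word_gen k w)) ` ?E)"
    have E: "finite ?E" "?E \<noteq> {}" using fin False by auto
    then have "j \<in> (\<lambda>w. rk2 c (word_gen k w)) ` ?E" unfolding j_def by (intro Min_in) auto
    then obtain w0 where w0: "w0 \<in> F" "wcount rk w0 l i \<noteq> wcount rk t l i" "j = rk2 c (word_gen k w0)" by blast
    have e0: "wcount rk t l i = wcount rk w0 l i + 1" using v[OF w0(1)] w0(2) by linarith
    show ?thesis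
    proof (rule that[of "wcount rk w0 l i" j])
      fix w assume w: "w \<in> F"
      show "wcount rk w l i = wcount rk w0 l i + (if rk2 c (word_gen k w) < j then 1 else 0)"
      proof (cases "wcount rk w l i = wcount rk t l i")
        case True
        have "\<not> wrel rk w0 w" using True e0 unfolding wrel_def by (metis Suc_eq_plus1 not_less_eq_eq order_refl)
        then have "wrel rk w w0" using ch w w0(1) unfolding wchain_def by blast
        moreover have "w \<noteq> w0" using True w0(2) by blast
        ultimately have "rk2 c (word_gen k w) < j" using rk2_less[OF c f w w0(1)] w0(3) by simp
        then show ?thesis using True e0 by simp
      next
        case False
        then have "j \<le> rk2 c (word_gen k w)" unfolding j_def using E w by (intro Min_le) auto
        moreover have "wcount rk w l i = wcount rk w0 l i" using False v[OF w] e0 by linarith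
        ultimately show ?thesis by simp
      qed
    qed
  qed
qed

definition fl where "fl c W = (\<Sum>g\<in>#W. if snd g = k then dcw c g else {#g#})"

text \<open>The compatibility that allows gluing: away from the apex, refining the boundary of the
  star by type \<open>h c\<close> and then by type \<open>y' c\<close> yields only cones of its
  direct refinement by type \<open>y\<close>. Flattening keeps the sum of a word and gives it type
  \<open>y\<close> by the choice of \<open>y'\<close>. Flattened words interleave because each of
  their counts is a constant plus a single count of the outer word.\<close>

lemma J_std:
  assumes c: "c \<in> \<Phi>" and U2: "U2 \<in> J c" and f2: "word_family (y' c) k (rk2 c) U2 F2 A2"
    and noM: "\<And>W. W \<in> F2 \<Longrightarrow> M c \<notin># W"
  shows "word_gen k ` F2 \<union> A2 \<in> word_complex y k rk (Lk c)"
proof -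
  obtain U F A Z where f: "U \<in> Lk c" "word_family (h c) k rk U F A" "U2 = word_gen k ` F \<union> A \<union> Z" "Z \<subseteq> {M c}"
    using U2 by (rule JE)
  have Mk: "snd (M c) = k" by (simp add: M_def)
  have inA: "g \<in> A" if "g \<in> U2" "snd g \<noteq> k" for g using that f(3,4) Mk by auto
  have A2A: "A2 \<subseteq> A" using word_family_fin(2,5)[OF f2] inA by blast
  have letk: "\<exists>w\<in>F. g = word_gen k w" if "W \<in> F2" "g \<in># W" "snd g = k" for W g
  proof -
    have "g \<in> U2" using word_family_fin(3)[OF f2 that(1)] that(2) by blast
    moreover have "g \<noteq> M c" using noM[OF that(1)] that(2) by blast
    moreover have "g \<notin> A" using word_family_fin(5)[OF f(2)] that(3) by blast
    ultimately show ?thesis using f(3,4) by blast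
  qed
  have letr: "g \<in> A" if "W \<in> F2" "g \<in># W" "snd g \<noteq> k" for W g
    using inA[of g] word_family_fin(3)[OF f2 that(1)] that(2,3) by blast
  have cong: "(\<Sum>g\<in>#W. p g) = (\<Sum>g\<in>#W. q g)" if "\<And>g. g \<in># W \<Longrightarrow> p g = q g" for W and p q :: "'n gen \<Rightarrow> nat"
    by (rule arg_cong[of _ _ sum_mset], rule image_mset_cong) (rule that)
  have lsz: "(\<Sum>g\<in>#W. if snd g = l then 1 else 0) = y' c l" if "W \<in> F2" for W l
    using word_family_fin(4)[OF f2 that] by (simp add: indicator_sum_mset wtype_def)
  have lszf: "size {#g \<in># W. snd g = l#} = y' c l" if "W \<in> F2" for W l
    using word_family_fin(4)[OF f2 that] by (simp add: wtype_def)
  have ty: "wtype y (fl c W)" if W: "W \<in> F2" for W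
    unfolding wtype_def
  proof
    fix l
    have "size {#x \<in># fl c W. snd x = l#} =
        (\<Sum>g\<in>#W. h c l * (if snd g = k then 1 else 0) + (if snd g = l \<and> snd g \<noteq> k then 1 else 0))"
      unfolding fl_def label_size_sum_mset
    proof (rule cong)
      fix g assume g: "g \<in># W"
      show "size {#x \<in># (if snd g = k then dcw c g else {#g#}). snd x = l#} =
         h c l * (if snd g = k then 1 else 0) + (if snd g = l \<and> snd g \<noteq> k then 1 else 0)"
      proof (cases "snd g = k")
        case True
        then obtain w where w: "w \<in> F" "g = word_gen k w" using letk[OF W g] by blast
        then show ?thesis using famL(2,4)[OF f(1,2) w(1)] True by (simp add: wtype_def)
      qed auto
    qed
    also have "\<dots> = h c l * y' c k + (\<Sum>g\<in>#W. if snd g = l \<and> snd g \<noteq> k then 1 else 0)"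
      unfolding sum_mset.distrib by (simp add: lsz[OF W] flip: sum_mset_distrib_left)
    also have "(\<Sum>g\<in>#W. if snd g = l \<and> snd g \<noteq> k then 1 else 0) = (if l = k then 0 else y' c l)"
    proof (cases "l = k")
      case True
      then show ?thesis by (simp add: indicator_sum_mset)
    next
      case False
      then have "(\<Sum>g\<in>#W. if snd g = l \<and> snd g \<noteq> k then (1::nat) else 0) = (\<Sum>g\<in>#W. if snd g = l then 1 else 0)"
        by (intro cong) auto
      then show ?thesis using lsz[OF W] False by simp
    qed
    finally show "size {#x \<in># fl c W. snd x = l#} = y l"
      using y'_k(1)[OF c] y'_l[OF c, of l] by (cases "l = k") auto
  qed
  have setfl: "set_mset (fl c W) \<subseteq> U" if W: "W \<in> F2" for W
  proof
    fix u assume "u \<in># fl c W"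
    then obtain g where g: "g \<in># W" "u \<in># (if snd g = k then dcw c g else {#g#})"
      unfolding fl_def by (rule in_sum_msetE)
    show "u \<in> U"
    proof (cases "snd g = k")
      case True
      then obtain w where w: "w \<in> F" "g = word_gen k w" using letk[OF W g(1)] by blast
      then have "u \<in># w" using g(2) True famL(4)[OF f(1,2) w(1)] by simp
      then show ?thesis using word_family_fin(3)[OF f(2) w(1)] by blast
    next
      case False
      then have "u = g" using g(2) by simp
      then show ?thesis using letr[OF W g(1) False] word_family_fin(2)[OF f(2)] by blast
    qed
  qed
  have gwfl: "word_gen k (fl c W) = word_gen k W" if W: "W \<in> F2" for W
  proof -
    have "sum_mset (image_mset fst (fl c V)) = sum_mset (image_mset fst V)" if "set_mset V \<subseteq> set_mset W" for V
      using that
    proof (induction V)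
      case empty
      then show ?case by (simp add: fl_def)
    next
      case (add g V)
      have g: "g \<in># W" using add.prems by simp
      have "sum_mset (image_mset fst (if snd g = k then dcw c g else {#g#})) = fst g"
      proof (cases "snd g = k")
        case True
        then obtain w where w: "w \<in> F" "g = word_gen k w" using letk[OF W g] by blast
        then show ?thesis using famL(4)[OF f(1,2) w(1)] True by (simp add: word_gen_def)
      qed simp
      then show ?case using add by (simp add: fl_def)
    qed
    then show ?thesis by (simp add: word_gen_def)
  qed
  have wc: "wrel rk (fl c W) (fl c W')" if W: "W \<in> F2" "W' \<in> F2" and r: "wrel (rk2 c) W W'" for W W'
    unfolding wrel_def
  proof (intro allI)
    fix l i
    obtain n j where nj: "\<And>w. w \<in> F \<Longrightarrow> wcount rk w l i = n + (if rk2 c (word_gen k w) < j then 1 else 0)"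
      using rk2_threshold[OF c f(1,2)] by blast
    have cnt: "wcount rk (fl c V) l i = n * y' c k + wcount (rk2 c) V k j + (if l = k then 0 else wcount (rk2 c) V l i)"
      if V: "V \<in> F2" for V
    proof -
      have "wcount rk (fl c V) l i =
        (\<Sum>g\<in>#V. n * (if snd g = k then 1 else 0) + (if snd g = k \<and> rk2 c g < j then 1 else 0)
           + (if snd g = l \<and> snd g \<noteq> k \<and> rk2 c g < i then 1 else 0))"
        unfolding fl_def wcount_sum_mset
      proof (rule cong)
        fix g assume g: "g \<in># V"
        show "wcount rk (if snd g = k then dcw c g else {#g#}) l i =
          n * (if snd g = k then 1 else 0) + (if snd g = k \<and> rk2 c g < j then 1 else 0)
           + (if snd g = l \<and> snd g \<noteq> k \<and> rk2 c g < i then 1 else 0)"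
        proof (cases "snd g = k")
          case True
          then obtain w where w: "w \<in> F" "g = word_gen k w" using letk[OF V g] by blast
          then show ?thesis using famL(4)[OF f(1,2) w(1)] True nj[OF w(1)] by simp
        next
          case False
          then show ?thesis by (simp add: wcount_def rk2_def)
        qed
      qed
      also have "\<dots> = n * y' c k + wcount (rk2 c) V k j + (\<Sum>g\<in>#V. if snd g = l \<and> snd g \<noteq> k \<and> rk2 c g < i then 1 else 0)"
        unfolding sum_mset.distrib
        by (simp add: lsz[OF V] lszf[OF V] indicator_sum_mset wcount_def flip: sum_mset_distrib_left)
      also have "(\<Sum>g\<in>#V. if snd g = l \<and> snd g \<noteq> k \<and> rk2 c g < i then 1 else 0) = (if l = k then 0 else wcount (rk2 c) V l i)"
        unfolding indicator_sum_mset wcount_def by (auto intro!: arg_cong[of _ _ size] filter_mset_cong)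
      finally show ?thesis .
    qed
    have rel: "wcount (rk2 c) W' l i \<le> wcount (rk2 c) W l i \<and> wcount (rk2 c) W l i \<le> wcount (rk2 c) W' l i + 1" for l i
      using r by (simp add: wrel_def)
    \<comment> \<open>Plain letters in outer words are leftovers of the inner family, hence come
      after all inner letters of their label. If one of label \<open>l\<close> lies below
      \<open>i\<close>, the inner words are full there and only plain letters vary; otherwise plain
      letters contribute nothing and only the number of inner words below \<open>j\<close>
      varies.\<close>
    consider "l = k" | "l \<noteq> k" "\<And>V g. V \<in> F2 \<Longrightarrow> g \<in># V \<Longrightarrow> snd g = l \<Longrightarrow> \<not> rk2 c g < i"
      | V g where "l \<noteq> k" "V \<in> F2" "g \<in># V" "snd g = l" "rk2 c g < i" by blast
    then show "wcount rk (fl c W') l i \<le> wcount rk (fl c W) l i \<and> wcount rk (fl c W) l i \<le> wcount rk (fl c W') l i + 1"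
    proof cases
      case 1
      then show ?thesis using cnt[OF W(1)] cnt[OF W(2)] rel[of k j] by simp
    next
      case 2
      have z: "wcount (rk2 c) V l i = 0" if "V \<in> F2" for V
      proof -
        have "{#g \<in># V. snd g = l \<and> rk2 c g < i#} = {#}"
          using 2(2)[OF that] by (intro multiset_eqI) (auto simp: count_eq_zero_iff)
        then show ?thesis by (simp add: wcount_def)
      qed
      show ?thesis using cnt[OF W(1)] cnt[OF W(2)] rel[of k j] z[OF W(1)] z[OF W(2)] by simp
    next
      case 3
      have gA: "g \<in> A" using letr[OF 3(2,3)] 3(1,4) by simp
      have "rk g < i" using 3 by (simp add: rk2_def)
      then have full: "wcount rk w l i = h c l" if "w \<in> F" for w
        using word_family_wcount_case[OF f(2), of l i] gA 3(4) that by blast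
      have cnt': "wcount rk (fl c V) l i = h c l * y' c k + wcount (rk2 c) V l i" if V: "V \<in> F2" for V
      proof -
        have "wcount rk (fl c V) l i =
          (\<Sum>g\<in>#V. h c l * (if snd g = k then 1 else 0) + (if snd g = l \<and> rk2 c g < i then 1 else 0))"
          unfolding fl_def wcount_sum_mset
        proof (rule cong)
          fix g assume g: "g \<in># V"
          show "wcount rk (if snd g = k then dcw c g else {#g#}) l i =
            h c l * (if snd g = k then 1 else 0) + (if snd g = l \<and> rk2 c g < i then 1 else 0)"
          proof (cases "snd g = k")
            case True
            then obtain w where w: "w \<in> F" "g = word_gen k w" using letk[OF V g] by blast
            then show ?thesis using famL(4)[OF f(1,2) w(1)] True full[OF w(1)] 3(1) by simp
          next
            case False
            then show ?thesis by (simp add: wcount_def rk2_def)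
          qed
        qed
        also have "\<dots> = h c l * y' c k + wcount (rk2 c) V l i"
          unfolding sum_mset.distrib
          by (simp add: lsz[OF V] lszf[OF V] indicator_sum_mset wcount_def flip: sum_mset_distrib_left)
        finally show ?thesis .
      qed
      show ?thesis using cnt'[OF W(1)] cnt'[OF W(2)] rel[of l i] by simp
    qed
  qed
  have "word_family y k rk U (fl c ` F2) A2"
    unfolding word_family_def
  proof (intro conjI ballI allI impI)
    show "finite (fl c ` F2)" using word_family_fin(1)[OF f2] by simp
    show "A2 \<subseteq> U" using A2A word_family_fin(2)[OF f(2)] by blast
    show "set_mset w \<subseteq> U" if "w \<in> fl c ` F2" for w using that setfl by blast
    show "wtype y w" if "w \<in> fl c ` F2" for w using that ty by blast
    have "wchain (rk2 c) F2" using f2 by (simp add: word_family_def)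
    then show "wchain rk (fl c ` F2)" unfolding wchain_def using wc by blast
    show "snd x \<noteq> k" if "x \<in> A2" for x using word_family_fin(5)[OF f2 that] .
    show "rk u \<le> rk x" if wxu: "w \<in> fl c ` F2" "x \<in> A2" "u \<in># w \<and> snd u = snd x" for w x u
    proof -
      obtain W where W: "W \<in> F2" "w = fl c W" using wxu(1) by blast
      obtain g where g: "g \<in># W" "u \<in># (if snd g = k then dcw c g else {#g#})"
        using conjunct1[OF wxu(3)] unfolding W(2) fl_def by (rule in_sum_msetE)
      have xk: "snd x \<noteq> k" using word_family_fin(5)[OF f2 wxu(2)] .
      show ?thesis
      proof (cases "snd g = k")
        case True
        then obtain v where v: "v \<in> F" "g = word_gen k v" using letk[OF W(1) g(1)] by blast
        then have "u \<in># v" using g(2) True famL(4)[OF f(1,2) v(1)] by simp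
        then show ?thesis using f(2) v(1) A2A wxu(2,3) unfolding word_family_def by blast
      next
        case False
        then have u: "u = g" using g(2) by simp
        have "rk2 c u \<le> rk2 c x" using f2 W(1) wxu(2,3) g(1) u unfolding word_family_def by blast
        then show ?thesis using xk wxu(3) by (simp add: rk2_def)
      qed
    qed
  qed
  from word_complex_I[OF f(1) this] have "word_gen k ` (fl c ` F2) \<union> A2 \<in> word_complex y k rk (Lk c)" .
  moreover have "word_gen k ` (fl c ` F2) = word_gen k ` F2" unfolding image_image using gwfl by (intro image_cong) auto
  ultimately show ?thesis by simp
qed

end

lemma word_complex_mono: "K \<subseteq> K' \<Longrightarrow> word_complex y k rk K \<subseteq> word_complex y k rk K'"
  unfolding word_complex_def by blast

lemma wtype_label_pos: "wtype y w \<Longrightarrow> g \<in># w \<Longrightarrow> 0 < y (snd g)"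
proof -
  assume a: "wtype y w" "g \<in># w"
  then have "g \<in># {#x \<in># w. snd x = snd g#}" by simp
  then have "0 < size {#x \<in># w. snd x = snd g#}" by (metis nonempty_has_size empty_iff set_mset_empty)
  then show ?thesis using a(1) by (simp add: wtype_def)
qed

section \<open>The refined complex: uniqueness, covering and index\<close>

context step
begin

definition T' where "T' = word_complex y k rk T0 \<union> (\<Union>c\<in>\<Phi>. word_complex (y' c) k (rk2 c) (J c))"

lemma T'_cases:
  assumes "S \<in> T'"
  obtains "S \<in> word_complex y k rk T0" | c where "c \<in> \<Phi>" "S \<in> word_complex (y' c) k (rk2 c) (J c)"
  using assms unfolding T'_def by blast

lemma finite_\<Phi>: "finite \<Phi>"
proof (rule finite_imageD)
  have "supp ` \<Phi> \<subseteq> T" using \<Phi>_T by blast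
  then show "finite (supp ` \<Phi>)" using simplicial_T unfolding simplicial_def by (meson finite_subset)
  show "inj_on supp \<Phi>" by (rule inj_onI) (metis \<Phi>_T \<Phi>_uniq order_refl)
qed

lemma simplicial_T': "simplicial T'"
proof -
  have *: "simplicial (word_complex y k rk T0)" by (rule simplicial_word_complex[OF simplicial_T0])
  have **: "simplicial (word_complex (y' c) k (rk2 c) (J c))" for c by (rule simplicial_word_complex[OF simplicial_J])
  have "finite T'" unfolding T'_def using * ** finite_\<Phi> unfolding simplicial_def by simp
  moreover have "finite S" if "S \<in> T'" for S
    using that simplicial_fin[OF *] simplicial_fin[OF **] by (elim T'_cases) blast+
  moreover have "S' \<in> T'" if "S \<in> T'" "S' \<subseteq> S" for S S'
    using that(1)
  proof (cases rule: T'_cases)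
    case 1
    then show ?thesis using simplicial_sub[OF * 1 that(2)] unfolding T'_def by blast
  next
    case (2 c)
    then show ?thesis using simplicial_sub[OF ** 2(2) that(2)] unfolding T'_def by blast
  qed
  ultimately show ?thesis unfolding simplicial_def by blast
qed

lemma cone_unique_BJ: "c \<in> \<Phi> \<Longrightarrow> cone_unique (word_complex (y' c) k (rk2 c) (J c))"
  by (rule cone_unique_word_complex[OF simplicial_J cone_unique_J rk2_J]) (auto simp: y'_k)

text \<open>Beyond the expansion into old generators, the final alternative records the part of the
  refinement that \<open>b\<close> comes from. A combination over a starred part that does not use
  the apex is moved to the plain part by \<open>J_std\<close>; therefore \<open>supp a\<close> alone
  decides between the alternatives.\<close>

lemma T'_lift:
  assumes b: "carried T' b"
  obtains a where "carried T a" "ev a = ev b" "mass a = mass_map y k (mass b)"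
    "(supp b \<in> word_complex y k rk T0 \<and> supp a \<in> T0) \<or> (\<exists>c\<in>\<Phi>. supp c \<subseteq> supp a \<and> carried (word_complex (y' c) k (rk2 c) (J c)) b)"
proof -
  from carried_supp[OF b] show ?thesis
  proof (cases rule: T'_cases)
    case 1
    have fb: "carried (word_complex y k rk T0) b" by (rule carriedI[OF carried_nonneg[OF b] 1])
    obtain F A U where f: "U \<in> T0" "word_family y k rk U F A" "supp b = word_gen k ` F \<union> A"
      "carried T0 (expand k F A b)" "supp (expand k F A b) \<subseteq> U" "ev (expand k F A b) = ev b" "mass (expand k F A b) = mass_map y k (mass b)"
      by (rule carried_word_complex[OF simplicial_T0 cone_unique_T0 fb])
    show ?thesis
      by (rule that[OF carried_subset[OF f(4) T0_sub] f(6,7)]) (rule disjI1[OF conjI[OF 1 carried_supp[OF f(4)]]])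
  next
    case (2 c)
    note c = 2(1)
    have fb: "carried (word_complex (y' c) k (rk2 c) (J c)) b" by (rule carriedI[OF carried_nonneg[OF b] 2(2)])
    obtain F A U where f: "U \<in> J c" "word_family (y' c) k (rk2 c) U F A" "supp b = word_gen k ` F \<union> A"
      "carried (J c) (expand k F A b)" "supp (expand k F A b) \<subseteq> U" "ev (expand k F A b) = ev b" "mass (expand k F A b) = mass_map (y' c) k (mass b)"
      by (rule carried_word_complex[OF simplicial_J cone_unique_J[OF c] fb])
    let ?\<beta> = "expand k F A b"
    obtain a where a: "carried (Lk c) a" "carried T (\<lambda>g. a g + ?\<beta> (M c) * c g)" "ev (\<lambda>g. a g + ?\<beta> (M c) * c g) = ev ?\<beta>"
      "mass (\<lambda>g. a g + ?\<beta> (M c) * c g) = mass_map (h c) k (mass ?\<beta>)"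
      "carried (K1 c) (\<lambda>g. if g = M c then 0 else ?\<beta> g)" "?\<beta> (M c) = 0 \<longrightarrow> supp ?\<beta> \<in> K1 c"
      by (rule J_lift[OF c f(4)])
    have mass: "mass (\<lambda>g. a g + ?\<beta> (M c) * c g) = mass_map y k (mass b)" unfolding a(4) f(7) mass_map_mass_map[OF c] ..
    have ev: "ev (\<lambda>g. a g + ?\<beta> (M c) * c g) = ev b" unfolding a(3) f(6) ..
    have "(supp b \<in> word_complex y k rk T0 \<and> supp (\<lambda>g. a g + ?\<beta> (M c) * c g) \<in> T0) \<or> supp c \<subseteq> supp (\<lambda>g. a g + ?\<beta> (M c) * c g)"
    proof (cases "?\<beta> (M c) = 0")
      case True
      have "M c \<notin># W" if W: "W \<in> F" for W
      proof
        assume "M c \<in># W"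
        moreover have "0 < b (word_gen k W)" using f(3) W carried_nonneg[OF b, of "word_gen k W"] by (force simp: supp_def)
        ultimately have "0 < b (word_gen k W) * word_vec W (M c)" by (simp add: word_vec_def)
        also have "\<dots> \<le> (\<Sum>w\<in>F. b (word_gen k w) * word_vec w (M c))"
          by (rule member_le_sum[OF W]) (use word_family_fin(1)[OF f(2)] carried_nonneg[OF b] in \<open>auto simp: word_vec_def\<close>)
        also have "\<dots> \<le> ?\<beta> (M c)" unfolding expand_def using carried_nonneg[OF b] by simp
        finally show False using True by simp
      qed
      then have "word_gen k ` F \<union> A \<in> word_complex y k rk (Lk c)" by (rule J_std[OF c f(1,2)])
      then have "supp b \<in> word_complex y k rk T0" unfolding f(3) by (rule subsetD[OF word_complex_mono[OF Lk_T0[OF c]]])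
      moreover have "supp (\<lambda>g. a g + ?\<beta> (M c) * c g) = supp a" using True by simp
      ultimately show ?thesis using subsetD[OF Lk_T0[OF c] carried_supp[OF a(1)]] by simp
    next
      case False
      then have pos: "0 < ?\<beta> (M c)" using carried_nonneg[OF f(4), of "M c"] by simp
      have "supp c \<subseteq> supp (\<lambda>g. a g + ?\<beta> (M c) * c g)"
      proof
        fix g assume "g \<in> supp c"
        then have "0 < c g" using c_bounds(1)[OF c, of g] by (simp add: supp_def)
        then have "0 < ?\<beta> (M c) * c g" using pos by simp
        then have "0 < a g + ?\<beta> (M c) * c g" using carried_nonneg[OF a(1), of g] by simp
        then show "g \<in> supp (\<lambda>g. a g + ?\<beta> (M c) * c g)" by (simp add: supp_def)
      qed
      then show ?thesis by blast
    qed
    then have "(supp b \<in> word_complex y k rk T0 \<and> supp (\<lambda>g. a g + ?\<beta> (M c) * c g) \<in> T0) \<or>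
      (\<exists>c'\<in>\<Phi>. supp c' \<subseteq> supp (\<lambda>g. a g + ?\<beta> (M c) * c g) \<and> carried (word_complex (y' c') k (rk2 c') (J c')) b)"
      using c fb by blast
    then show ?thesis by (rule that[OF a(2) ev mass])
  qed
qed

text \<open>Equal values and masses give the same \<open>a\<close> over \<open>T\<close>. Whether
  \<open>supp a\<close> contains the support of a selected point, and of which one, determines a
  single part for both combinations, and uniqueness holds within each part.\<close>

lemma cone_unique_T': "cone_unique T'"
  unfolding cone_unique_def
proof (intro allI impI, elim conjE)
  fix b b' assume b: "carried T' b" "carried T' b'" and e: "ev b = ev b'" "mass b = mass b'"
  obtain a where a: "carried T a" "ev a = ev b" "mass a = mass_map y k (mass b)"
    "(supp b \<in> word_complex y k rk T0 \<and> supp a \<in> T0) \<or> (\<exists>c\<in>\<Phi>. supp c \<subseteq> supp a \<and> carried (word_complex (y' c) k (rk2 c) (J c)) b)"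
    by (rule T'_lift[OF b(1)])
  obtain a' where a': "carried T a'" "ev a' = ev b'" "mass a' = mass_map y k (mass b')"
    "(supp b' \<in> word_complex y k rk T0 \<and> supp a' \<in> T0) \<or> (\<exists>c\<in>\<Phi>. supp c \<subseteq> supp a' \<and> carried (word_complex (y' c) k (rk2 c) (J c)) b')"
    by (rule T'_lift[OF b(2)])
  have aa: "a = a'" by (rule cone_uniqueD[OF cone_unique_T a(1) a'(1)]) (use a a' e in simp_all)
  have T0n: "\<not> supp c \<subseteq> supp a" if "supp a \<in> T0" "c \<in> \<Phi>" for c using that unfolding T0_def by blast
  show "b = b'"
  proof (cases "supp a \<in> T0")
    case True
    then have sb: "supp b \<in> word_complex y k rk T0" "supp b' \<in> word_complex y k rk T0" using a(4) a'(4) T0n aa by blast+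
    have "carried (word_complex y k rk T0) b" by (rule carriedI[OF carried_nonneg[OF b(1)] sb(1)])
    moreover have "carried (word_complex y k rk T0) b'" by (rule carriedI[OF carried_nonneg[OF b(2)] sb(2)])
    ultimately show ?thesis by (rule cone_uniqueD[OF cone_unique_word_complex[where y=y and k=k, OF simplicial_T0 cone_unique_T0 rk_T0 y_k] _ _ e])
  next
    case False
    then obtain c where c: "c \<in> \<Phi>" "supp c \<subseteq> supp a" "carried (word_complex (y' c) k (rk2 c) (J c)) b" using a(4) by blast
    obtain c' where c': "c' \<in> \<Phi>" "supp c' \<subseteq> supp a" "carried (word_complex (y' c') k (rk2 c') (J c')) b'" using False a'(4) aa by blast
    have "c = c'" by (rule \<Phi>_uniq[OF carried_supp[OF a(1)] c(1) c'(1) c(2) c'(2)])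
    then show ?thesis using cone_uniqueD[OF cone_unique_BJ[OF c(1)] c(3) _ e] c'(3) by blast
  qed
qed

text \<open>If \<open>supp a\<close> contains some \<open>supp c\<close>, split off the largest
  multiple \<open>t\<close> of \<open>c\<close> that leaves \<open>a\<close> nonnegative. The
  remainder lies in the boundary of the star and is expanded into words of type \<open>h c\<close>;
  then \<open>t\<close> returns as coefficient of the apex, and an expansion of type
  \<open>y' c\<close> follows. The mass inequality of the inner expansion comes from
  \<open>ineq\<close> and \<open>h_le\<close>, that of the outer one from \<open>ineq\<close> and
  the choice of \<open>y'\<close>.\<close>

lemma T'_cover:
  assumes a: "carried T a" and ineq: "\<And>l. y l * mass a k \<le> y k * mass a l"
  obtains b where "carried T' b" "ev b = ev a" "mass_map y k (mass b) = mass a"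
proof (cases "\<exists>c\<in>\<Phi>. supp c \<subseteq> supp a")
  case False
  then have "carried T0 a" using a unfolding carried_def T0_def by blast
  then obtain b where b: "carried (word_complex y k rk T0) b" "ev b = ev a" "mass_map y k (mass b) = mass a"
    by (rule word_complex_cover[where y=y and k=k, OF simplicial_T0 cone_unique_T0 rk_T0 y_k _ ineq])
  have "carried T' b" by (rule carried_subset[OF b(1)]) (simp add: T'_def)
  then show ?thesis using that b by blast
next
  case True
  then obtain c where c: "c \<in> \<Phi>" "supp c \<subseteq> supp a" by blast
  have cpos: "0 < c g" if "g \<in> supp c" for g using that c_bounds(1)[OF c(1), of g] by (simp add: supp_def)
  have cne: "supp c \<noteq> {}" using \<Phi>_k[OF c(1)] by (auto simp: mass_def)
  define t where "t = Min ((\<lambda>g. a g / c g) ` supp c)"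
  have fin: "finite ((\<lambda>g. a g / c g) ` supp c)" using c_fin[OF c(1)] by simp
  have "t \<in> (\<lambda>g. a g / c g) ` supp c" unfolding t_def by (rule Min_in[OF fin]) (use cne in simp)
  then obtain v where v: "v \<in> supp c" "t = a v / c v" by blast
  have t0: "0 \<le> t" using v(2) cpos[OF v(1)] carried_nonneg[OF a, of v] by simp
  have tle: "t * c g \<le> a g" for g
  proof (cases "g \<in> supp c")
    case True
    then have "t \<le> a g / c g" unfolding t_def using fin by (intro Min_le) auto
    then show ?thesis using cpos[OF True] by (simp add: pos_le_divide_eq)
  next
    case False
    then show ?thesis using carried_nonneg[OF a, of g] by (simp add: supp_def)
  qed
  define a1 where "a1 = (\<lambda>g. a g - t * c g)"
  have fa: "finite (supp a)" using simplicial_fin[OF simplicial_T carried_supp[OF a]] .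
  have ftc: "finite (supp (\<lambda>g. t * c g))" using finite_subset[OF supp_scale c_fin[OF c(1)]] .
  have s1: "supp a1 \<subseteq> supp a"
  proof
    fix g assume "g \<in> supp a1"
    then show "g \<in> supp a" using c(2) by (cases "g \<in> supp c") (auto simp: a1_def supp_iff)
  qed
  have "a1 v = 0" using v(2) cpos[OF v(1)] by (simp add: a1_def)
  then have "\<not> supp c \<subseteq> supp a1" using v(1) by (auto simp: supp_def)
  moreover have "supp a1 \<union> supp c \<in> T" by (rule simplicial_sub[OF simplicial_T carried_supp[OF a]]) (use s1 c(2) in blast)
  ultimately have sa1: "supp a1 \<in> Lk c" by (simp add: Lk_def)
  have fa1: "carried (Lk c) a1" by (rule carriedI[OF _ sa1]) (use tle in \<open>simp add: a1_def\<close>)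
  have ms1: "mass a1 l = mass a l - t * h c l" for l
    unfolding a1_def ev_diff(2)[OF fa ftc] ev_scale(2)[OF c_fin[OF c(1)]] using h_mass[OF c(1)] by simp
  have ev1: "ev a1 = ev a - t *\<^sub>R ev c"
    unfolding a1_def ev_diff(1)[OF fa ftc] ev_scale(1)[OF c_fin[OF c(1)]] ..
  have hk: "0 < real (h c k)" using h_k[OF c(1)] by simp
  have mk0: "0 \<le> mass a k" unfolding mass_def by (intro sum_nonneg carried_nonneg[OF a])
  have yk: "0 < real (y k)" using y_k by simp
  have hineq: "real (h c l) * mass a k \<le> h c k * mass a l" for l
  proof -
    have "real (h c l * y k) * mass a k \<le> real (y l * h c k) * mass a k"
      using h_le[OF c(1), of l] mk0 unfolding h_def by (intro mult_right_mono) (simp_all only: of_nat_le_iff)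
    also have "\<dots> = h c k * (y l * mass a k)" by simp
    also have "\<dots> \<le> h c k * (y k * mass a l)" using ineq[of l] hk by (intro mult_left_mono) auto
    finally have "y k * (h c l * mass a k) \<le> y k * (h c k * mass a l)" by (simp add: mult.commute mult.left_commute)
    then show ?thesis using yk by simp
  qed
  have ineq1: "real (h c l) * mass a1 k \<le> h c k * mass a1 l" for l
    using hineq[of l] unfolding ms1 by (simp add: algebra_simps)
  obtain b1 where b1: "carried (K1 c) b1" "ev b1 = ev a1" "mass_map (h c) k (mass b1) = mass a1"
    unfolding K1_def by (rule word_complex_cover[where y="h c" and k=k, OF simplicial_Lk cone_unique_Lk rk_Lk h_k[OF c(1)] fa1 ineq1])
  define \<beta> where "\<beta> = (\<lambda>g. b1 g + t * unit_mass (M c) g)"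
  have fb1: "finite (supp b1)" using simplicial_fin[OF simplicial_K1 carried_supp[OF b1(1)]] .
  have fd: "finite (supp (\<lambda>g. t * unit_mass (M c) g))" using finite_subset[OF supp_scale, of "unit_mass (M c)"] by simp
  have s\<beta>: "supp \<beta> \<in> J c"
  proof -
    have "supp \<beta> \<subseteq> supp b1 \<union> {M c}"
    proof
      fix g assume "g \<in> supp \<beta>"
      then show "g \<in> supp b1 \<union> {M c}" by (cases "g = M c") (auto simp: \<beta>_def supp_iff unit_mass_def)
    qed
    moreover have "supp b1 \<union> {M c} \<in> J c" unfolding J_def using carried_supp[OF b1(1)] by blast
    ultimately show ?thesis using simplicial_sub[OF simplicial_J] by blast
  qed
  have f\<beta>: "carried (J c) \<beta>"
    by (rule carriedI[OF _ s\<beta>]) (use carried_nonneg[OF b1(1)] t0 in \<open>simp add: \<beta>_def unit_mass_def\<close>)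
  have ev\<beta>: "ev \<beta> = ev a"
    unfolding \<beta>_def ev_add(1)[OF fb1 fd] using ev_scale(1)[of "unit_mass (M c)" t] b1(2) ev1 by (simp add: M_def)
  have mass\<beta>: "mass \<beta> l = mass b1 l + (if l = k then t else 0)" for l
    unfolding \<beta>_def ev_add(2)[OF fb1 fd] using ev_scale(2)[of "unit_mass (M c)" t l] by (auto simp: M_def mass_unit_mass)
  have mass_map\<beta>: "mass_map (h c) k (mass \<beta>) = mass a"
  proof
    fix l
    have "mass_map (h c) k (mass \<beta>) l = mass_map (h c) k (mass b1) l + t * h c l" unfolding mass_map_def mass\<beta> by (simp add: algebra_simps)
    then show "mass_map (h c) k (mass \<beta>) l = mass a l" unfolding b1(3) ms1 by simp
  qed
  have ineq2: "y' c l * mass \<beta> k \<le> y' c k * mass \<beta> l" for l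
  proof (cases "l = k")
    case False
    have y'k: "0 < real (y' c k)" using y'_k(2)[OF c(1)] by simp
    have ek: "mass a k = h c k * mass \<beta> k" and el: "mass a l = mass \<beta> l + h c l * mass \<beta> k"
      unfolding mass_map\<beta>[symmetric] using False by (simp_all add: mass_map_def)
    have "real (y k) = h c k * y' c k" using y'_k(1)[OF c(1)] by (metis of_nat_mult)
    moreover have "real (y l) = h c l * y' c k + y' c l" using y'_l[OF c(1) False] by (metis of_nat_add of_nat_mult)
    ultimately have "(h c l * y' c k + y' c l) * (h c k * mass \<beta> k) \<le> h c k * y' c k * (mass \<beta> l + h c l * mass \<beta> k)"
      using ineq[of l] unfolding ek el by simp
    then have "h c k * (y' c l * mass \<beta> k) \<le> h c k * (y' c k * mass \<beta> l)" by (simp add: algebra_simps)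
    then show ?thesis using hk by simp
  qed simp
  obtain b where b: "carried (word_complex (y' c) k (rk2 c) (J c)) b" "ev b = ev \<beta>" "mass_map (y' c) k (mass b) = mass \<beta>"
    by (rule word_complex_cover[where y="y' c" and k=k, OF simplicial_J cone_unique_J[OF c(1)] rk2_J[OF c(1)] y'_k(2)[OF c(1)] f\<beta> ineq2])
  have "carried T' b" by (rule carried_subset[OF b(1)]) (use c(1) in \<open>auto simp: T'_def\<close>)
  moreover have "mass_map y k (mass b) = mass a" using mass_map_mass_map[OF c(1), of "mass b"] b(3) mass_map\<beta> by simp
  ultimately show ?thesis using that b(2) ev\<beta> by simp
qed

lemma int_vec_word_gen: "(\<And>g. g \<in># w \<Longrightarrow> int_vec (fst g)) \<Longrightarrow> int_vec (fst (word_gen k w))"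
proof (induction w)
  case empty
  then show ?case by (simp add: word_gen_def int_vec_zero)
next
  case (add x w)
  have "int_vec (fst x)" by (rule add.prems) simp
  moreover have "int_vec (fst (word_gen k w))" by (rule add.IH, rule add.prems) simp
  ultimately show ?case by (simp add: word_gen_def int_vec_add)
qed

lemma int_vec_word_complex:
  assumes "\<And>S g. S \<in> K \<Longrightarrow> g \<in> S \<Longrightarrow> int_vec (fst g)" "S \<in> word_complex yy k rr K" "g \<in> S"
  shows "int_vec (fst g)"
proof -
  obtain F A U where f: "U \<in> K" "word_family yy k rr U F A" "S = word_gen k ` F \<union> A" using assms(2) by (rule word_complex_E)
  show ?thesis
  proof (cases "g \<in> A")
    case True
    then show ?thesis using assms(1)[OF f(1)] word_family_fin(2)[OF f(2)] by blast
  next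
    case False
    then obtain w where w: "w \<in> F" "g = word_gen k w" using f(3) assms(3) by blast
    show ?thesis unfolding w(2) by (rule int_vec_word_gen) (use assms(1)[OF f(1)] word_family_fin(3)[OF f(2) w(1)] in blast)
  qed
qed

lemma int_vec_J: assumes c: "c \<in> \<Phi>" "S \<in> J c" "g \<in> S" shows "int_vec (fst g)"
proof -
  obtain R Z where r: "S = R \<union> Z" "R \<in> K1 c" "Z \<subseteq> {M c}" using c(2) unfolding J_def by blast
  show ?thesis
  proof (cases "g = M c")
    case True
    then show ?thesis using boxD(4)[OF \<Phi>_box_points[OF c(1)]] by (simp add: M_def)
  next
    case False
    then have "g \<in> R" using r c(3) by blast
    then show ?thesis using int_vec_word_complex[of "Lk c" R "h c" rk g] int_vec_T[OF Lk_T(2)] r(2) unfolding K1_def by blast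
  qed
qed

lemma int_vec_T': assumes "S \<in> T'" "g \<in> S" shows "int_vec (fst g)"
  using assms(1)
proof (cases rule: T'_cases)
  case 1
  show ?thesis by (rule int_vec_word_complex[OF _ 1 assms(2)]) (use int_vec_T T0_sub in blast)
next
  case (2 c)
  show ?thesis by (rule int_vec_word_complex[OF _ 2(2) assms(2)]) (use int_vec_J[OF 2(1)] in blast)
qed

text \<open>Word generators and apexes have label \<open>k\<close>, so a cone without this label
  consists of leftovers, which are old generators of one cone. Hence the labels treated earlier stay
  unimodular.\<close>

lemma T'_low:
  assumes S: "S \<in> T'" and low: "\<And>g. g \<in> S \<Longrightarrow> snd g \<noteq> k"
  shows "S \<in> T"
  using S
proof (cases rule: T'_cases)
  case 1
  then obtain F A U where f: "U \<in> T0" "word_family y k rk U F A" "S = word_gen k ` F \<union> A" by (rule word_complex_E)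
  have "F = {}"
  proof (rule equals0I)
    fix w assume "w \<in> F"
    then have "word_gen k w \<in> S" using f(3) by blast
    then show False using low[of "word_gen k w"] by simp
  qed
  then have "S \<subseteq> U" using f(3) word_family_fin(2)[OF f(2)] by simp
  then show ?thesis using simplicial_sub[OF simplicial_T] f(1) T0_sub by blast
next
  case (2 c)
  from 2(2) obtain F A U where f: "U \<in> J c" "word_family (y' c) k (rk2 c) U F A" "S = word_gen k ` F \<union> A" by (rule word_complex_E)
  have "F = {}"
  proof (rule equals0I)
    fix w assume "w \<in> F"
    then have "word_gen k w \<in> S" using f(3) by blast
    then show False using low[of "word_gen k w"] by simp
  qed
  then have S: "S = A" "A \<subseteq> U" using f(3) word_family_fin(2)[OF f(2)] by auto
  obtain U1 F1 A1 Z where g: "U1 \<in> Lk c" "word_family (h c) k rk U1 F1 A1" "U = word_gen k ` F1 \<union> A1 \<union> Z" "Z \<subseteq> {M c}" using f(1) by (rule JE)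
  have "S \<subseteq> A1"
  proof
    fix x assume x: "x \<in> S"
    then have "x \<in> U" "snd x \<noteq> k" using S low by auto
    then show "x \<in> A1" using g(3,4) by (auto simp: M_def)
  qed
  then show ?thesis using simplicial_sub[OF simplicial_T Lk_T(2)[OF g(1)]] word_family_fin(2)[OF g(2)] by blast
qed

lemma T'_labels: assumes "S \<in> T'" "g \<in> S" shows "snd g = k \<or> g \<in> \<Union>T"
proof (cases "snd g = k")
  case False
  have "{g} \<in> T'" using simplicial_sub[OF simplicial_T' assms(1)] assms(2) by simp
  then have "{g} \<in> T" by (rule T'_low) (use False in simp)
  then show ?thesis by blast
qed simp

lemma word_family_card_box_points:
  assumes "simplicial K" "cone_unique K" "\<And>S g. S \<in> K \<Longrightarrow> g \<in> S \<Longrightarrow> int_vec (fst g)" "rank_inj_on rr K" "U \<in> K" "word_family yy k rr U F A"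
  shows "card (box_points (word_gen k ` F \<union> A)) \<le> card (box_points U)"
proof -
  have U: "finite U" "rank_inj rr U" using simplicial_fin[OF assms(1,5)] assms(4,5) by (auto simp: rank_inj_on_def)
  have inj: "inj_on (word_gen k) F" by (rule word_family_word_gen_inj[OF assms(6,2,1,5)])
  note b = box_word_complex_inj[OF assms(6) U assms(3)[OF assms(5)] inj]
  show ?thesis by (rule card_inj_on_le[OF b(2,1) finite_box[OF assms(1,2,5)]])
qed

text \<open>A cone on labels up to \<open>k\<close> either comes from an unstarred cone or involves
  an apex, and then its index is strictly below that of an old cone. The old cones stay within
  labels up to \<open>k\<close> because \<open>y\<close>, \<open>y' c\<close> and \<open>h c\<close>
  vanish above \<open>k\<close>, so that no word has letters there.\<close>

lemma T'_idx:
  assumes S: "S \<in> T'" and low: "\<And>g. g \<in> S \<Longrightarrow> snd g \<le> k"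
  shows "(\<exists>U F A. U \<in> T0 \<and> (\<forall>g\<in>U. snd g \<le> k) \<and> word_family y k rk U F A \<and> S = word_gen k ` F \<union> A) \<or>
    (\<exists>W\<in>T. (\<forall>g\<in>W. snd g \<le> k) \<and> card (box_points S) < card (box_points W))"
proof -
  have std: "\<exists>U F A. U \<in> T0 \<and> (\<forall>g\<in>U. snd g \<le> k) \<and> word_family y k rk U F A \<and> S = word_gen k ` F \<union> A"
    if "S \<in> word_complex y k rk T0"
  proof -
    obtain F A U where f: "U \<in> T0" "word_family y k rk U F A" "S = word_gen k ` F \<union> A" using \<open>S \<in> word_complex y k rk T0\<close> by (rule word_complex_E)
    let ?U = "\<Union>(set_mset ` F) \<union> A"
    note s = word_family_shrink[OF f(2)]
    have "?U \<in> T0" by (rule simplicial_sub[OF simplicial_T0 f(1) s(2)])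
    moreover have "snd g \<le> k" if g: "g \<in> ?U" for g
    proof (cases "g \<in> A")
      case True
      then show ?thesis using low f(3) by blast
    next
      case False
      then obtain w where w: "w \<in> F" "g \<in># w" using g by blast
      then have "0 < y (snd g)" using wtype_label_pos word_family_fin(4)[OF f(2)] by blast
      then show ?thesis using y_high[of "snd g"] by (metis not_le less_irrefl)
    qed
    ultimately show ?thesis using s(1) f(3) by blast
  qed
  show ?thesis
    using S
  proof (cases rule: T'_cases)
    case 1
    then show ?thesis using std by blast
  next
    case (2 c)
    note c = 2(1)
    from 2(2) obtain F2 A2 U2 where f: "U2 \<in> J c" "word_family (y' c) k (rk2 c) U2 F2 A2" "S = word_gen k ` F2 \<union> A2" by (rule word_complex_E)
    show ?thesis
    proof (cases "\<exists>W\<in>F2. M c \<in># W")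
      case False
      then have "S \<in> word_complex y k rk (Lk c)" unfolding f(3) by (intro J_std[OF c f(1,2)]) blast
      then show ?thesis using std word_complex_mono[OF Lk_T0[OF c]] by blast
    next
      case True
      let ?V = "\<Union>(set_mset ` F2) \<union> A2"
      note s = word_family_shrink[OF f(2)]
      have V: "?V \<in> J c" by (rule simplicial_sub[OF simplicial_J f(1) s(2)])
      have MV: "M c \<in> ?V" using True by blast
      have Vlow: "snd g \<le> k" if g: "g \<in> ?V" for g
      proof (cases "g \<in> A2")
        case True
        then show ?thesis using low f(3) by blast
      next
        case False
        then obtain w where w: "w \<in> F2" "g \<in># w" using g by blast
        then have "0 < y' c (snd g)" using wtype_label_pos word_family_fin(4)[OF f(2)] by blast
        then show ?thesis using y_high[of "snd g"] unfolding y'_def by (metis diff_0_eq_0 linorder_not_less nat_neq_iff order_refl less_imp_le)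
      qed
      obtain U F A Z where g: "U \<in> Lk c" "word_family (h c) k rk U F A" "?V = word_gen k ` F \<union> A \<union> Z" "Z \<subseteq> {M c}" using V by (rule JE)
      have "word_gen k ` F \<union> A \<in> K1 c" unfolding K1_def by (rule word_complex_I[OF g(1,2)])
      then have "M c \<notin> word_gen k ` F \<union> A" by (rule M_notin_K1[OF c])
      then have Ve: "?V = word_gen k ` F \<union> A \<union> {M c}" using g(3,4) MV by blast
      let ?U = "\<Union>(set_mset ` F) \<union> A"
      note s1 = word_family_shrink[OF g(2)]
      have U: "?U \<in> Lk c" by (rule simplicial_sub[OF simplicial_Lk g(1) s1(2)])
      have Ulow: "snd x \<le> k" if x: "x \<in> ?U" for x
      proof (cases "x \<in> A")
        case True
        then show ?thesis using Vlow g(3) by blast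
      next
        case False
        then obtain w where w: "w \<in> F" "x \<in># w" using x by blast
        then have "0 < h c (snd x)" using wtype_label_pos word_family_fin(4)[OF g(2)] by blast
        then show ?thesis using h_high[OF c, of "snd x"] by (metis not_le less_irrefl)
      qed
      have "card (box_points S) \<le> card (box_points ?V)"
        unfolding f(3) by (rule word_family_card_box_points[OF simplicial_J cone_unique_J[OF c] int_vec_J[OF c] rk2_J[OF c] V s(1)])
      also have "\<dots> < card (box_points (?U \<union> supp c))"
        unfolding Ve by (rule J_box_points[OF c U s1(1)])
      finally have "card (box_points S) < card (box_points (?U \<union> supp c))" .
      moreover have "\<forall>g\<in>?U \<union> supp c. snd g \<le> k" using Ulow \<Phi>_lab[OF c] by blast
      ultimately show ?thesis using Lk_T(1)[OF U] by blast
    qed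
  qed
qed

end

section \<open>Regions\<close>

text \<open>A cone may carry several box points, but the star refinement needs at most one of them. A region
  \<open>(X, L, Q)\<close> selects it: box points with values in \<open>Q\<close> differ by an element of \<open>L\<close>, and points of cones
  inside \<open>X\<close> with values in \<open>L\<close> have integral coefficients, so two selected box points of one cone coincide.\<close>

type_synonym 'n vlat = "((real ^ 'n) \<times> (nat \<Rightarrow> real)) set"

definition vlat_subgroup :: "'n::finite vlat \<Rightarrow> bool" where
  "vlat_subgroup L \<longleftrightarrow> (0, \<lambda>_. 0) \<in> L \<and>
    (\<forall>p d p' d'. (p, d) \<in> L \<and> (p', d') \<in> L \<longrightarrow> (p - p', \<lambda>l. d l - d' l) \<in> L)"

lemma vlat_subgroup_add: "vlat_subgroup L \<Longrightarrow> (p, d) \<in> L \<Longrightarrow> (p', d') \<in> L \<Longrightarrow> (p + p', \<lambda>l. d l + d' l) \<in> L"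
proof -
  assume L: "vlat_subgroup L" "(p, d) \<in> L" "(p', d') \<in> L"
  have "(0 - p', \<lambda>l. 0 - d' l) \<in> L" using L unfolding vlat_subgroup_def by blast
  then have "(p - (0 - p'), \<lambda>l. d l - (0 - d' l)) \<in> L" using L unfolding vlat_subgroup_def by blast
  then show ?thesis by simp
qed

lemma vlat_subgroup_nat: "vlat_subgroup L \<Longrightarrow> (p, d) \<in> L \<Longrightarrow> (real n *\<^sub>R p, \<lambda>l. real n * d l) \<in> L"
proof (induction n)
  case 0
  then show ?case by (simp add: vlat_subgroup_def)
next
  case (Suc n)
  from vlat_subgroup_add[OF Suc.prems(1) Suc.IH[OF Suc.prems] Suc.prems(2)] show ?case
    by (simp add: algebra_simps)
qed

lemma vlat_subgroup_int: "vlat_subgroup L \<Longrightarrow> (p, d) \<in> L \<Longrightarrow> z \<in> \<int> \<Longrightarrow> (z *\<^sub>R p, \<lambda>l. z * d l) \<in> L"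
proof -
  assume L: "vlat_subgroup L" "(p, d) \<in> L" and "z \<in> \<int>"
  then obtain i where z: "z = of_int i" by (elim Ints_cases)
  show ?thesis
  proof (cases "0 \<le> i")
    case True
    then have "z = real (nat i)" using z by simp
    then show ?thesis using vlat_subgroup_nat[OF L] by simp
  next
    case False
    then have e: "z = - real (nat (- i))" using z by simp
    have "(0 - real (nat (- i)) *\<^sub>R p, \<lambda>l. 0 - real (nat (- i)) * d l) \<in> L"
      using vlat_subgroup_nat[OF L] L(1) unfolding vlat_subgroup_def by blast
    then show ?thesis unfolding e by simp
  qed
qed

lemma vlat_subgroup_comb:
  assumes L: "vlat_subgroup L" and X: "\<And>x. x \<in> X \<Longrightarrow> (fst x, mass (unit_mass x)) \<in> L" and z: "\<And>g. z g \<in> \<int>" and U: "finite U"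
  shows "supp z \<subseteq> U \<Longrightarrow> U \<subseteq> X \<Longrightarrow> (ev z, mass z) \<in> L"
  using U z
proof (induction U arbitrary: z rule: finite_induct)
  case empty
  then have "z = (\<lambda>_. 0)" by (auto simp: supp_def)
  then have "ev z = 0" "mass z = (\<lambda>_. 0)" by auto
  then show ?case using L by (simp add: vlat_subgroup_def)
next
  case (insert x U)
  define z1 where "z1 = (\<lambda>g. if g = x then 0 else z g)"
  have s1: "supp z1 \<subseteq> U" using insert.prems(1) by (auto simp: supp_def z1_def)
  have "(ev z1, mass z1) \<in> L"
    by (rule insert.IH[OF s1]) (use insert.prems in \<open>auto simp: z1_def\<close>)
  moreover have "(z x *\<^sub>R fst x, \<lambda>l. z x * mass (unit_mass x) l) \<in> L"
    by (rule vlat_subgroup_int[OF L X insert.prems(3)]) (use insert.prems in auto)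
  ultimately have *: "(ev z1 + z x *\<^sub>R fst x, \<lambda>l. mass z1 l + z x * mass (unit_mass x) l) \<in> L" by (rule vlat_subgroup_add[OF L])
  have e: "z = (\<lambda>g. z1 g + z x * unit_mass x g)" by (auto simp: z1_def unit_mass_def)
  have f1: "finite (supp z1)" using finite_subset[OF s1 insert.hyps(1)] .
  have f2: "finite (supp (\<lambda>g. z x * unit_mass x g))" using finite_subset[OF supp_scale, of "unit_mass x"] by simp
  have "ev z = ev z1 + z x *\<^sub>R fst x" using ev_add(1)[OF f1 f2] ev_scale(1)[of "unit_mass x" "z x"] e by simp
  moreover have "mass z = (\<lambda>l. mass z1 l + z x * mass (unit_mass x) l)"
  proof
    fix l show "mass z l = mass z1 l + z x * mass (unit_mass x) l"
      using ev_add(2)[OF f1 f2, of l] ev_scale(2)[of "unit_mass x" "z x" l] e by simp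
  qed
  ultimately show ?case using * by simp
qed

text \<open>The last two clauses say that \<open>Q\<close> is empty or a coset of \<open>L\<close>.
  Everything is expressed through values and masses instead of coefficients, so that it makes sense
  for all cones inside \<open>X\<close> at once and can be pulled back along a change of
  masses.\<close>

definition region :: "'n::finite gen set set \<Rightarrow> 'n gen set \<Rightarrow> 'n vlat \<Rightarrow> 'n vlat \<Rightarrow> bool" where
  "region T X L Q \<longleftrightarrow> vlat_subgroup L \<and> (\<forall>x\<in>X. (fst x, mass (unit_mass x)) \<in> L) \<and>
     (\<forall>S\<in>T. \<forall>c. supp c \<subseteq> S \<inter> X \<and> (ev c, mass c) \<in> L \<longrightarrow> (\<forall>g. c g \<in> \<int>)) \<and>
     (\<forall>p d p' d'. (p, d) \<in> Q \<and> (p', d') \<in> Q \<longrightarrow> (p - p', \<lambda>l. d l - d' l) \<in> L) \<and>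
     (\<forall>p d p' d'. (p, d) \<in> Q \<and> (p', d') \<in> L \<longrightarrow> (p + p', \<lambda>l. d l + d' l) \<in> Q)"

definition owned :: "'n::finite gen set \<Rightarrow> 'n vlat \<Rightarrow> 'n gen set \<Rightarrow> bool" where
  "owned X Q S \<longleftrightarrow> S \<subseteq> X \<and> (\<exists>c\<in>box_points S. c \<noteq> (\<lambda>_. 0) \<and> (ev c, mass c) \<in> Q)"

text \<open>The preimage under the change of masses, within integral masses only. In label
  \<open>k\<close> the new mass is the total weight of the words, whose integrality primitivity of
  word families asks for.\<close>

definition pull :: "(nat \<Rightarrow> nat) \<Rightarrow> nat \<Rightarrow> 'n::finite vlat \<Rightarrow> 'n vlat" where
  "pull y k L = {(p, d). (\<forall>l. d l \<in> \<int>) \<and> (p, mass_map y k d) \<in> L}"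

lemma mass_map_diff: "mass_map y k (\<lambda>l. d l - d' l) = (\<lambda>l. mass_map y k d l - mass_map y k d' l)"
  by (auto simp: mass_map_def algebra_simps)

lemma mass_map_add: "mass_map y k (\<lambda>l. d l + d' l) = (\<lambda>l. mass_map y k d l + mass_map y k d' l)"
  by (auto simp: mass_map_def algebra_simps)

lemma mass_map_zero: "mass_map y k (\<lambda>_. 0) = (\<lambda>_. 0)"
  by (auto simp: mass_map_def)

lemma vlat_subgroup_pull: "vlat_subgroup L \<Longrightarrow> vlat_subgroup (pull y k L)"
  unfolding vlat_subgroup_def pull_def by (auto simp: mass_map_diff mass_map_zero)

section \<open>Regions pass to the refinement\<close>

context step
begin

text \<open>The generators descending from \<open>X\<close>: words over unstarred cones with all
  letters in \<open>X\<close>, and old letters that may be left over. Apexes are not intended to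
  belong to it.\<close>

definition X' where "X' X = {word_gen k w | w. wtype y w \<and> set_mset w \<in> T0 \<and> set_mset w \<subseteq> X} \<union> {x\<in>X. snd x \<noteq> k}"

lemma X'_word:
  assumes "word_gen k w \<in> X' X" "wtype y w" "set_mset w \<in> T0" shows "set_mset w \<subseteq> X"
proof -
  obtain w' where w': "word_gen k w = word_gen k w'" "wtype y w'" "set_mset w' \<in> T0" "set_mset w' \<subseteq> X"
    using assms(1) by (auto simp: X'_def word_gen_def)
  have "w = w'" by (rule word_gen_inj[OF cone_unique_T0 assms(2) w'(2) assms(3) w'(3,1)])
  then show ?thesis using w'(4) by simp
qed

lemma X'_rest: "x \<in> X' X \<Longrightarrow> snd x \<noteq> k \<Longrightarrow> x \<in> X"
  by (auto simp: X'_def)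

text \<open>A generator that is both a plain word over a cone of \<open>T0\<close> and a word using
  the apex \<open>M c\<close> would expand in two ways; uniqueness in \<open>T\<close> would put
  \<open>supp c\<close> inside a member of \<open>T0\<close>. So no apex is involved, and
  \<open>J_std\<close> turns the cone into a plain one.\<close>

lemma T'_X'_std:
  assumes S: "S \<in> T'" "S \<subseteq> X' X"
  obtains F A U where "U \<in> T0" "word_family y k rk U F A" "S = word_gen k ` F \<union> A" "\<forall>w\<in>F. set_mset w \<subseteq> X" "A \<subseteq> X"
proof -
  have "S \<in> word_complex y k rk T0"
    using S(1)
  proof (cases rule: T'_cases)
    case (2 c)
    note c = 2(1)
    from 2(2) obtain F2 A2 U2 where f: "U2 \<in> J c" "word_family (y' c) k (rk2 c) U2 F2 A2" "S = word_gen k ` F2 \<union> A2" by (rule word_complex_E)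
    have "M c \<notin># W" if W: "W \<in> F2" for W
    proof
      assume MW: "M c \<in># W"
      have "word_gen k W \<in> X' X" using f(3) W S(2) by blast
      then obtain w where w: "word_gen k W = word_gen k w" "wtype y w" "set_mset w \<in> T0"
        unfolding X'_def by auto
      have tW: "wtype (y' c) W" using word_family_fin(4)[OF f(2) W] .
      have sW: "set_mset W \<in> J c" by (rule simplicial_sub[OF simplicial_J f(1) word_family_fin(3)[OF f(2) W]])
      have fW: "carried (J c) (word_vec W)" by (rule carriedI) (use sW in \<open>simp_all add: word_vec_def[of W] supp_word_vec\<close>)
      obtain a where a: "carried (Lk c) a" "carried T (\<lambda>g. a g + word_vec W (M c) * c g)" "ev (\<lambda>g. a g + word_vec W (M c) * c g) = ev (word_vec W)"
        "mass (\<lambda>g. a g + word_vec W (M c) * c g) = mass_map (h c) k (mass (word_vec W))"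
        "carried (K1 c) (\<lambda>g. if g = M c then 0 else word_vec W g)" "word_vec W (M c) = 0 \<longrightarrow> supp (word_vec W) \<in> K1 c"
        by (rule J_lift[OF c fW])
      have "mass_map (h c) k (mass (word_vec W)) = mass (word_vec w)"
      proof
        fix l
        have "mass (word_vec W) = (\<lambda>l. real (y' c l))" using mass_word_vec_type[OF tW] by auto
        then show "mass_map (h c) k (mass (word_vec W)) l = mass (word_vec w) l"
          using mass_word_vec_type[OF w(2), of l] y'_k(1)[OF c] y'_l[OF c, of l]
          by (cases "l = k") (auto simp: mass_map_def simp flip: of_nat_mult of_nat_add)
      qed
      moreover have "carried T (word_vec w)" by (rule carriedI) (use w(3) T0_sub in \<open>auto simp: word_vec_def[of w] supp_word_vec\<close>)
      moreover have "ev (word_vec W) = ev (word_vec w)" using w(1) ev_word_vec[of W k] ev_word_vec[of w k] by simp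
      ultimately have e: "(\<lambda>g. a g + word_vec W (M c) * c g) = word_vec w"
        using cone_uniqueD[OF cone_unique_T a(2)] a(3,4) by simp
      have "supp c \<subseteq> set_mset w"
      proof
        fix g assume "g \<in> supp c"
        then have "0 < c g" using c_bounds(1)[OF c, of g] by (simp add: supp_def)
        moreover have "0 < word_vec W (M c)" using MW by (simp add: word_vec_def)
        ultimately have "0 < word_vec W (M c) * c g" by simp
        then have "0 < word_vec w g" using carried_nonneg[OF a(1), of g] fun_cong[OF e, of g] by simp
        then show "g \<in># w" by (simp add: word_vec_def)
      qed
      then show False using w(3) c unfolding T0_def by blast
    qed
    then have "S \<in> word_complex y k rk (Lk c)" unfolding f(3) by (intro J_std[OF c f(1,2)])
    then show ?thesis using word_complex_mono[OF Lk_T0[OF c]] by blast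
  qed
  then obtain F A U where f: "U \<in> T0" "word_family y k rk U F A" "S = word_gen k ` F \<union> A" by (rule word_complex_E)
  have 1: "\<forall>w\<in>F. set_mset w \<subseteq> X"
  proof
    fix w assume w: "w \<in> F"
    show "set_mset w \<subseteq> X"
    proof (rule X'_word[OF _ word_family_fin(4)[OF f(2) w] simplicial_sub[OF simplicial_T0 f(1) word_family_fin(3)[OF f(2) w]]])
      show "word_gen k w \<in> X' X" using f(3) w S(2) by blast
    qed
  qed
  have 2: "A \<subseteq> X" using X'_rest word_family_fin(5)[OF f(2)] f(3) S(2) by blast
  show ?thesis by (rule that[OF f 1 2])
qed

text \<open>Expansion sends values in \<open>pull y k L\<close> to values in \<open>L\<close>, where
  \<open>region\<close> gives integral coefficients of letters; primitivity of word families turns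
  these into integral coefficients of words and leftovers.\<close>

lemma region_T':
  assumes R: "region T X L Q"
  shows "region T' (X' X) (pull y k L) (pull y k Q)"
  unfolding region_def
proof (intro conjI ballI allI impI)
  have L: "vlat_subgroup L" using R by (simp add: region_def)
  have XL: "(fst x, mass (unit_mass x)) \<in> L" if "x \<in> X" for x using R that unfolding region_def by blast
  show "vlat_subgroup (pull y k L)" by (rule vlat_subgroup_pull[OF L])
  show "(fst x, mass (unit_mass x)) \<in> pull y k L" if x: "x \<in> X' X" for x
  proof -
    have i: "mass (unit_mass x) l \<in> \<int>" for l by (simp add: mass_unit_mass)
    have "(fst x, mass_map y k (mass (unit_mass x))) \<in> L"
    proof (cases "snd x = k")
      case True
      then obtain w where w: "x = word_gen k w" "wtype y w" "set_mset w \<subseteq> X" using x unfolding X'_def by auto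
      have "(ev (word_vec w), mass (word_vec w)) \<in> L"
        by (rule vlat_subgroup_comb[OF L XL]) (use w(3) in \<open>auto simp: word_vec_def[of w] supp_word_vec\<close>)
      moreover have "mass (word_vec w) = mass_map y k (mass (unit_mass x))"
        using mass_word_vec_type[OF w(2)] True by (auto simp: mass_map_def mass_unit_mass)
      ultimately show ?thesis using w(1) ev_word_vec[of w k] by simp
    next
      case False
      then have "mass_map y k (mass (unit_mass x)) = mass (unit_mass x)" by (auto simp: mass_map_def mass_unit_mass)
      then show ?thesis using XL X'_rest[OF x False] by simp
    qed
    then show ?thesis using i by (simp add: pull_def)
  qed
  show "c g \<in> \<int>" if S: "S \<in> T'" and c: "supp c \<subseteq> S \<inter> X' X \<and> (ev c, mass c) \<in> pull y k L" for S c g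
  proof -
    have st: "supp c \<in> T'" by (rule simplicial_sub[OF simplicial_T' S]) (use c in blast)
    have sx: "supp c \<subseteq> X' X" using c by blast
    obtain F A U where f: "U \<in> T0" "word_family y k rk U F A" "supp c = word_gen k ` F \<union> A"
      "\<forall>w\<in>F. set_mset w \<subseteq> X" "A \<subseteq> X" by (rule T'_X'_std[OF st sx])
    have fU: "finite U" using simplicial_fin[OF simplicial_T0 f(1)] .
    have rU: "rank_inj rk U" using rk_T0 f(1) by (auto simp: rank_inj_on_def)
    have inj: "inj_on (word_gen k) F" by (rule word_family_word_gen_inj[OF f(2) cone_unique_T0 simplicial_T0 f(1)])
    have cL: "(ev c, mass_map y k (mass c)) \<in> L" "\<And>l. mass c l \<in> \<int>" using c by (auto simp: pull_def)
    have "supp c \<subseteq> word_gen k ` F \<union> A" using f(3) by simp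
    note eu = ev_expand[OF f(2) fU inj this]
    have fs: "word_family y k rk (\<Union>(set_mset ` F) \<union> A) F A" "\<Union>(set_mset ` F) \<union> A \<subseteq> U" by (rule word_family_shrink[OF f(2)])+
    have "supp (expand k F A c) \<subseteq> U \<inter> X"
      using supp_expand[OF fs(1), of c] fs(2) f(4,5) by blast
    moreover have "U \<in> T" using f(1) T0_sub by blast
    moreover have "(ev (expand k F A c), mass (expand k F A c)) \<in> L" unfolding eu using cL(1) .
    ultimately have ui: "\<forall>g. expand k F A c g \<in> \<int>" using R unfolding region_def by blast
    have tot: "(\<Sum>w\<in>F. c (word_gen k w)) \<in> \<int>"
      using mass_word_gen[OF f(2) fU inj, of c] f(3) cL(2)[of k] by simp
    have ui': "(\<Sum>w\<in>F. c (word_gen k w) * count w g) + (if g \<in> A then c g else 0) \<in> \<int>" for g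
      using ui[THEN spec, of g] unfolding expand_def word_vec_def .
    note p = word_family_primitive[OF f(2) fU rU real_subgroup_Ints ui' tot]
    show ?thesis
    proof (cases "g \<in> supp c")
      case True
      then consider w where "w \<in> F" "g = word_gen k w" | "g \<in> A" using f(3) by blast
      then show ?thesis
      proof cases
        case 1
        show ?thesis unfolding 1(2) by (rule p(1)[OF 1(1)])
      next
        case 2
        then show ?thesis by (rule p(2))
      qed
    next
      case False
      then show ?thesis by (simp add: supp_def)
    qed
  qed
  show "(p - p', \<lambda>l. d l - d' l) \<in> pull y k L" if q: "(p, d) \<in> pull y k Q \<and> (p', d') \<in> pull y k Q" for p d p' d'
  proof -
    have "(p - p', \<lambda>l. mass_map y k d l - mass_map y k d' l) \<in> L" using q R unfolding region_def pull_def by blast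
    then show ?thesis using q by (simp add: pull_def mass_map_diff)
  qed
  show "(p + p', \<lambda>l. d l + d' l) \<in> pull y k Q" if q: "(p, d) \<in> pull y k Q \<and> (p', d') \<in> pull y k L" for p d p' d'
  proof -
    have "(p + p', \<lambda>l. mass_map y k d l + mass_map y k d' l) \<in> Q" using q R unfolding region_def pull_def by blast
    then show ?thesis using q by (simp add: pull_def mass_map_add)
  qed
qed

text \<open>When the index is preserved, the embedding of box points is a bijection, and the
  selected box point of \<open>U\<close> has a preimage. The expansion of the preimage differs from
  the selected point by an integral combination of generators in \<open>X\<close>, hence by an
  element of \<open>L\<close>, and so stays in the coset \<open>Q\<close>.\<close>

lemma owned_T':
  assumes R: "region T X L Q" and U: "U \<in> T0" and f: "word_family y k rk U F A" and o: "owned X Q U"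
    and card: "card (box_points (word_gen k ` F \<union> A)) = card (box_points U)"
  shows "owned (X' X) (pull y k Q) (word_gen k ` F \<union> A)"
proof -
  let ?S = "word_gen k ` F \<union> A"
  have L: "vlat_subgroup L" using R by (simp add: region_def)
  have XL: "(fst x, mass (unit_mass x)) \<in> L" if "x \<in> X" for x using R that unfolding region_def by blast
  have UX: "U \<subseteq> X" using o by (simp add: owned_def)
  obtain c where c: "c \<in> box_points U" "c \<noteq> (\<lambda>_. 0)" "(ev c, mass c) \<in> Q" using o unfolding owned_def by blast
  have UT: "U \<in> T" using U T0_sub by blast
  have fU: "finite U" using simplicial_fin[OF simplicial_T UT] .
  have rU: "rank_inj rk U" using rk_T0 U by (auto simp: rank_inj_on_def)
  have inj: "inj_on (word_gen k) F" by (rule word_family_word_gen_inj[OF f cone_unique_T0 simplicial_T0 U])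
  have iU: "\<And>g. g \<in> U \<Longrightarrow> int_vec (fst g)" using int_vec_T[OF UT] .
  note b = box_word_complex_inj[OF f fU rU iU inj]
  have "(\<lambda>c g. frac (expand k F A c g)) ` box_points ?S = box_points U"
    by (rule card_subset_eq[OF finite_box[OF simplicial_T cone_unique_T UT] b(1) trans[OF card_image[OF b(2)] card]])
  then have "c \<in> (\<lambda>c g. frac (expand k F A c g)) ` box_points ?S" using c(1) by (simp only:)
  then obtain c' where c': "c' \<in> box_points ?S" "(\<lambda>g. frac (expand k F A c' g)) = c" by blast
  note s' = boxD(1)[OF c'(1)]
  note eu = ev_expand[OF f fU inj s']
  define z where "z g = real_of_int \<lfloor>expand k F A c' g\<rfloor>" for g
  have e: "expand k F A c' = (\<lambda>g. c g + z g)"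
  proof
    fix g show "expand k F A c' g = c g + z g"
      using fun_cong[OF c'(2), of g] by (simp add: z_def frac_def)
  qed
  have sz: "supp z \<subseteq> U" using supp_expand[OF f, of c'] by (auto simp: supp_def z_def)
  have fz: "finite (supp z)" using finite_subset[OF sz fU] .
  have fc: "finite (supp c)" using finite_subset[OF boxD(1)[OF c(1)] fU] .
  have "(ev z, mass z) \<in> L" by (rule vlat_subgroup_comb[OF L XL _ fU sz UX]) (auto simp: z_def)
  then have "(ev c + ev z, \<lambda>l. mass c l + mass z l) \<in> Q" using R c(3) unfolding region_def by blast
  moreover have "ev (expand k F A c') = ev c + ev z" "mass (expand k F A c') = (\<lambda>l. mass c l + mass z l)"
    unfolding e using ev_add[OF fc fz] by auto
  ultimately have "(ev c', mass_map y k (mass c')) \<in> Q" using eu by simp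
  then have q: "(ev c', mass c') \<in> pull y k Q" using boxD(5)[OF c'(1)] by (simp add: pull_def)
  have ne: "c' \<noteq> (\<lambda>_. 0)"
  proof
    assume "c' = (\<lambda>_. 0)"
    then have "c = (\<lambda>_. 0)" using c'(2) by (auto simp: expand_def)
    then show False using c(2) by simp
  qed
  have "?S \<subseteq> X' X"
  proof
    fix x assume "x \<in> ?S"
    then consider w where "w \<in> F" "x = word_gen k w" | "x \<in> A" by blast
    then show "x \<in> X' X"
    proof cases
      case 1
      have "set_mset w \<in> T0" by (rule simplicial_sub[OF simplicial_T0 U word_family_fin(3)[OF f 1(1)]])
      moreover have "set_mset w \<subseteq> X" using word_family_fin(3)[OF f 1(1)] UX by blast
      ultimately show ?thesis using 1 word_family_fin(4)[OF f 1(1)] unfolding X'_def by blast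
    next
      case 2
      then show ?thesis using word_family_fin(2,5)[OF f] UX unfolding X'_def by blast
    qed
  qed
  then show ?thesis unfolding owned_def using c'(1) ne q by blast
qed

end

section \<open>Unimodular refinement\<close>

text \<open>The Cayley trick: the points of mass \<open>lam\<close> in the cone over \<open>S\<close> form the Minkowski sum over \<open>l\<close> of
  \<open>lam l\<close> times the simplex spanned by the points of \<open>S\<close> labelled \<open>l\<close>.\<close>

definition represents :: "nat \<Rightarrow> real set \<Rightarrow> (real ^ 'n::finite) set \<Rightarrow> 'n gen set set \<Rightarrow> (nat \<Rightarrow> real) \<Rightarrow> bool" where
  "represents r V P T lam \<longleftrightarrow> simplicial T \<and> cone_unique T \<and> (\<forall>S\<in>T. \<forall>g\<in>S. int_vec (fst g) \<and> snd g < r) \<and>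
     (\<forall>l<r. 0 < lam l \<and> lam l \<in> V) \<and> (\<forall>l\<ge>r. lam l = 0) \<and> P = {ev a | a. carried T a \<and> mass a = lam}"

text \<open>The solution \<open>d\<close> of \<open>mass_map y k d = lam\<close>: label
  \<open>k\<close> is turned into words completely, and the other labels give up the letters
  used.\<close>

definition new_mass :: "(nat \<Rightarrow> nat) \<Rightarrow> nat \<Rightarrow> (nat \<Rightarrow> real) \<Rightarrow> nat \<Rightarrow> real" where
  "new_mass y k lam l = (if l = k then lam k / y k else lam l - y l * (lam k / y k))"

definition labels_below :: "nat \<Rightarrow> 'n::finite gen set \<Rightarrow> bool" where
  "labels_below k S \<longleftrightarrow> (\<forall>g\<in>S. snd g < k)"

lemma labels_belowI: "(\<And>g. g \<in> S \<Longrightarrow> snd g < k) \<Longrightarrow> labels_below k S" unfolding labels_below_def by blast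
lemma labels_belowD: "labels_below k S \<Longrightarrow> g \<in> S \<Longrightarrow> snd g < k" unfolding labels_below_def by blast

lemma rat_sub_closed:
  assumes "rat_subspace V"
  shows "x \<in> V \<Longrightarrow> of_rat q * x \<in> V" "x \<in> V \<Longrightarrow> y \<in> V \<Longrightarrow> x + y \<in> V" "0 \<in> V"
    "x \<in> V \<Longrightarrow> y \<in> V \<Longrightarrow> x - y \<in> V" "x \<in> V \<Longrightarrow> x / real n \<in> V" "x \<in> V \<Longrightarrow> real n * x \<in> V"
proof -
  note a = assms[unfolded rat_subspace_iff]
  show 1: "x \<in> V \<Longrightarrow> of_rat q * x \<in> V" for x q using a by blast
  show 2: "x \<in> V \<Longrightarrow> y \<in> V \<Longrightarrow> x + y \<in> V" for x y using a by blast
  show "0 \<in> V" using a by blast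
  show "x - y \<in> V" if "x \<in> V" "y \<in> V"
  proof -
    have "x + of_rat (-1) * y \<in> V" by (rule 2[OF that(1) 1[OF that(2)]])
    then show ?thesis by (simp add: of_rat_minus)
  qed
  show "x \<in> V \<Longrightarrow> x / real n \<in> V" using 1[of x "inverse (of_nat n)"] by (simp add: of_rat_inverse divide_inverse mult.commute)
  show "x \<in> V \<Longrightarrow> real n * x \<in> V" using 1[of x "of_nat n"] by simp
qed

context step
begin

lemma mass_map_new_mass: "mass_map y k (new_mass y k lam) = lam"
  using y_k by (auto simp: mass_map_def new_mass_def fun_eq_iff)

text \<open>The strict inequality \<open>ineq\<close> keeps the remaining masses positive;
  \<open>T'_lift\<close> and \<open>T'_cover\<close> show that the represented set is
  unchanged.\<close>

lemma represents_T':
  fixes lam :: "nat \<Rightarrow> real"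
  assumes represents: "represents r V P T lam" and V: "rat_subspace V" and k: "k < r"
    and ineq: "\<And>l. l < r \<Longrightarrow> l \<noteq> k \<Longrightarrow> y l * lam k < y k * lam l"
  shows "represents r V P T' (new_mass y k lam)"
  unfolding represents_def
proof (intro conjI ballI allI impI)
  have lamV: "\<And>l. l < r \<Longrightarrow> lam l \<in> V" and lpos: "\<And>l. l < r \<Longrightarrow> 0 < lam l" and lzero: "\<And>l. r \<le> l \<Longrightarrow> lam l = 0"
    and labr: "\<And>S g. S \<in> T \<Longrightarrow> g \<in> S \<Longrightarrow> snd g < r" and PE: "P = {ev a | a. carried T a \<and> mass a = lam}"
    using represents unfolding represents_def by blast+
  have yk: "0 < real (y k)" using y_k by simp
  show "simplicial T'" "cone_unique T'" by (rule simplicial_T', rule cone_unique_T')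
  show "int_vec (fst g)" if "S \<in> T'" "g \<in> S" for S g using int_vec_T'[OF that] .
  show "snd g < r" if "S \<in> T'" "g \<in> S" for S g using T'_labels[OF that] k labr by blast
  show "0 < new_mass y k lam l" if "l < r" for l
    using ineq[OF that] lpos[OF k] lpos[OF that] yk by (auto simp: new_mass_def field_simps)
  show "new_mass y k lam l \<in> V" if "l < r" for l
    using lamV[OF k] lamV[OF that] rat_sub_closed[OF V] by (simp add: new_mass_def)
  show "new_mass y k lam l = 0" if "r \<le> l" for l
    using lzero[OF that] y_high[of l] k that by (simp add: new_mass_def)
  show "P = {ev b | b. carried T' b \<and> mass b = new_mass y k lam}"
  proof
    show "P \<subseteq> {ev b | b. carried T' b \<and> mass b = new_mass y k lam}"
    proof
      fix x assume "x \<in> P"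
      then obtain a where a: "x = ev a" "carried T a" "mass a = lam" unfolding PE by blast
      have i: "y l * mass a k \<le> y k * mass a l" for l
      proof (cases "l < r \<and> l \<noteq> k")
        case True
        then show ?thesis using ineq[of l] a(3) by simp
      next
        case False
        then show ?thesis using lzero[of l] y_high[of l] k a(3) by (cases "l = k") auto
      qed
      obtain b where b: "carried T' b" "ev b = ev a" "mass_map y k (mass b) = mass a" by (rule T'_cover[OF a(2) i])
      have "mass b = new_mass y k lam" by (rule mass_map_inj[where y = y and k = k, OF y_k]) (simp add: b(3) a(3) mass_map_new_mass)
      then show "x \<in> {ev b | b. carried T' b \<and> mass b = new_mass y k lam}" unfolding a(1) b(2)[symmetric] using b(1) by blast
    qed
    show "{ev b | b. carried T' b \<and> mass b = new_mass y k lam} \<subseteq> P"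
    proof
      fix x assume "x \<in> {ev b | b. carried T' b \<and> mass b = new_mass y k lam}"
      then obtain b where b: "x = ev b" "carried T' b" "mass b = new_mass y k lam" by blast
      obtain a where a: "carried T a" "ev a = ev b" "mass a = mass_map y k (mass b)"
        "(supp b \<in> word_complex y k rk T0 \<and> supp a \<in> T0) \<or> (\<exists>c\<in>\<Phi>. supp c \<subseteq> supp a \<and> carried (word_complex (y' c) k (rk2 c) (J c)) b)"
        by (rule T'_lift[OF b(2)])
      have "mass a = lam" unfolding a(3) b(3) mass_map_new_mass ..
      then show "x \<in> P" unfolding PE b(1) a(2)[symmetric] using a(1) by blast
    qed
  qed
qed

text \<open>A new cone that still has index \<open>D\<close> must come from an unstarred cone of the
  same index, and inherits its owner.\<close>

lemma T'_D:
  assumes D: "\<And>S. S \<in> T \<Longrightarrow> labels_below (Suc k) S \<Longrightarrow> card (box_points S) \<le> D"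
    and O: "\<And>S. S \<in> T0 \<Longrightarrow> labels_below (Suc k) S \<Longrightarrow> card (box_points S) = D \<Longrightarrow> \<exists>X L Q. (X, L, Q) \<in> RR \<and> owned X Q S"
    and R: "\<And>X L Q. (X, L, Q) \<in> RR \<Longrightarrow> region T X L Q"
    and S: "S \<in> T'" "labels_below (Suc k) S"
  shows "card (box_points S) \<le> D" "card (box_points S) = D \<Longrightarrow> \<exists>X L Q. (X, L, Q) \<in> RR \<and> owned (X' X) (pull y k Q) S"
proof -
  have low: "snd g \<le> k" if "g \<in> S" for g using labels_belowD[OF S(2) that] by simp
  have lowI: "labels_below (Suc k) U" if "\<forall>g\<in>U. snd g \<le> k" for U :: "'n gen set" using that by (auto simp: labels_below_def less_Suc_eq_le)
  have "card (box_points S) \<le> D \<and> (card (box_points S) = D \<longrightarrow> (\<exists>X L Q. (X, L, Q) \<in> RR \<and> owned (X' X) (pull y k Q) S))"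
  proof -
    have "(\<exists>U F A. U \<in> T0 \<and> (\<forall>g\<in>U. snd g \<le> k) \<and> word_family y k rk U F A \<and> S = word_gen k ` F \<union> A) \<or>
        (\<exists>W\<in>T. (\<forall>g\<in>W. snd g \<le> k) \<and> card (box_points S) < card (box_points W))"
      by (rule T'_idx[OF S(1)]) (rule low)
    then show ?thesis
  proof (elim disjE exE bexE conjE)
    fix U F A assume f: "U \<in> T0" "\<forall>g\<in>U. snd g \<le> k" "word_family y k rk U F A" "S = word_gen k ` F \<union> A"
    have UT: "U \<in> T" using f(1) T0_sub by blast
    have iT0: "int_vec (fst g)" if "S \<in> T0" "g \<in> S" for S g using int_vec_T that T0_sub by blast
    have le: "card (box_points S) \<le> card (box_points U)"
      unfolding f(4) by (rule word_family_card_box_points[OF simplicial_T0 cone_unique_T0 iT0 rk_T0 f(1,3)])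
    have le2: "card (box_points U) \<le> D" by (rule D[OF UT lowI[OF f(2)]])
    have "\<exists>X L Q. (X, L, Q) \<in> RR \<and> owned (X' X) (pull y k Q) S" if e: "card (box_points S) = D"
    proof -
      have eU: "card (box_points U) = D" using le le2 e by simp
      obtain X L Q where x: "(X, L, Q) \<in> RR" "owned X Q U" using O[OF f(1) lowI[OF f(2)] eU] by blast
      have "owned (X' X) (pull y k Q) S"
        unfolding f(4) by (rule owned_T'[OF R[OF x(1)] f(1,3) x(2)]) (use e eU f(4) in simp)
      then show ?thesis using x(1) by blast
    qed
    then show ?thesis using le le2 by simp
  next
    fix W assume w: "W \<in> T" "\<forall>g\<in>W. snd g \<le> k" "card (box_points S) < card (box_points W)"
    have "card (box_points W) \<le> D" by (rule D[OF w(1) lowI[OF w(2)]])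
    then show ?thesis using w(3) by simp
  qed
  qed
  then show "card (box_points S) \<le> D" "card (box_points S) = D \<Longrightarrow> \<exists>X L Q. (X, L, Q) \<in> RR \<and> owned (X' X) (pull y k Q) S" by blast+
qed

end

text \<open>Labels below \<open>k\<close> are finished, and the cones of maximal index \<open>D\<close> still to be treated are those
  owned by \<open>RR\<close>.\<close>

definition stage_inv :: "nat \<Rightarrow> real set \<Rightarrow> (real ^ 'n::finite) set \<Rightarrow> nat \<Rightarrow> nat \<Rightarrow> 'n gen set set \<Rightarrow> (nat \<Rightarrow> real) \<Rightarrow>
    ('n gen set \<times> 'n vlat \<times> 'n vlat) set \<Rightarrow> bool" where
  "stage_inv r V P k D T lam RR \<longleftrightarrow> represents r V P T lam \<and> (\<forall>S\<in>T. labels_below k S \<longrightarrow> box_points S = {\<lambda>_. 0}) \<and>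
     (\<forall>S\<in>T. labels_below (Suc k) S \<longrightarrow> card (box_points S) \<le> D \<and> (card (box_points S) = D \<longrightarrow> (\<exists>X L Q. (X, L, Q) \<in> RR \<and> owned X Q S))) \<and>
     (\<forall>X L Q. (X, L, Q) \<in> RR \<longrightarrow> region T X L Q)"

text \<open>Only the regions \<open>RR0\<close> that own the unstarred cones of index
  \<open>D\<close> have to be carried along; the other ones are dropped.\<close>

lemma stage_inv_step:
  assumes st: "step T \<Phi> k rk y" and I: "stage_inv r V P k D T lam RR" and V: "rat_subspace V" and k: "k < r"
    and ineq: "\<And>l. l < r \<Longrightarrow> l \<noteq> k \<Longrightarrow> y l * lam k < y k * lam l"
    and O: "\<And>S. S \<in> T \<Longrightarrow> (\<forall>c\<in>\<Phi>. \<not> supp c \<subseteq> S) \<Longrightarrow> labels_below (Suc k) S \<Longrightarrow> card (box_points S) = D \<Longrightarrow> \<exists>X L Q. (X, L, Q) \<in> RR0 \<and> owned X Q S"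
    and sub: "RR0 \<subseteq> RR" and fin: "finite RR0"
  obtains T2 RR2 where "stage_inv r V P k D T2 (new_mass y k lam) RR2" "finite RR2" "card RR2 \<le> card RR0"
proof -
  interpret step T \<Phi> k rk y by (rule st)
  define RR2 where "RR2 = (\<lambda>(X, L, Q). (X' X, pull y k L, pull y k Q)) ` RR0"
  have I1: "represents r V P T lam" and I2: "\<And>S. S \<in> T \<Longrightarrow> labels_below k S \<Longrightarrow> box_points S = {\<lambda>_. 0}"
    and I3: "\<And>S. S \<in> T \<Longrightarrow> labels_below (Suc k) S \<Longrightarrow> card (box_points S) \<le> D" and I4: "\<And>X L Q. (X, L, Q) \<in> RR \<Longrightarrow> region T X L Q"
    using I unfolding stage_inv_def by blast+
  have R0: "region T X L Q" if "(X, L, Q) \<in> RR0" for X L Q using I4 that sub by blast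
  have O0: "\<exists>X L Q. (X, L, Q) \<in> RR0 \<and> owned X Q S" if "S \<in> T0" "labels_below (Suc k) S" "card (box_points S) = D" for S
    using O[of S] that unfolding T0_def by blast
  note D = T'_D[of D RR0, OF I3 O0 R0]
  have "stage_inv r V P k D T' (new_mass y k lam) RR2"
    unfolding stage_inv_def
  proof (intro conjI ballI allI impI)
    show "represents r V P T' (new_mass y k lam)" by (rule represents_T'[OF I1 V k ineq])
    show "box_points S = {\<lambda>_. 0}" if S: "S \<in> T'" "labels_below k S" for S
    proof (rule I2[OF T'_low[OF S(1)] S(2)])
      show "snd g \<noteq> k" if "g \<in> S" for g using labels_belowD[OF S(2) that] by simp
    qed
    show "card (box_points S) \<le> D" if "S \<in> T'" "labels_below (Suc k) S" for S by (rule D(1)) (assumption | rule that)+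
    show "\<exists>X L Q. (X, L, Q) \<in> RR2 \<and> owned X Q S" if s: "S \<in> T'" "labels_below (Suc k) S" "card (box_points S) = D" for S
    proof -
      have "\<exists>X L Q. (X, L, Q) \<in> RR0 \<and> owned (X' X) (pull y k Q) S" by (rule D(2)) (assumption | rule s)+
      then obtain X L Q where x: "(X, L, Q) \<in> RR0" "owned (X' X) (pull y k Q) S" by blast
      have "(X' X, pull y k L, pull y k Q) \<in> RR2" unfolding RR2_def using x(1) by force
      then show ?thesis using x(2) by blast
    qed
    show "region T' X L Q" if "(X, L, Q) \<in> RR2" for X L Q using that region_T'[OF R0] unfolding RR2_def by auto
  qed
  moreover have "finite RR2" unfolding RR2_def using fin by simp
  moreover have "card RR2 \<le> card RR0" unfolding RR2_def by (rule card_image_le[OF fin])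
  ultimately show ?thesis using that by blast
qed

text \<open>Generators of one label in a cone are affinely independent: an affine relation among
  them is a relation of value zero and mass zero in every label. The bound does not depend on the
  complex, so the constants derived from it survive all refinements.\<close>

lemma label_card_bound:
  fixes T :: "'n::finite gen set set"
  assumes T: "simplicial T" "cone_unique T" and S: "S \<in> T"
  shows "card {g\<in>S. snd g = l} \<le> CARD('n) + 1"
proof -
  let ?S = "{g\<in>S. snd g = l}"
  have fS: "finite ?S" using simplicial_fin[OF T(1) S] by simp
  have inj: "inj_on fst ?S" by (rule inj_onI) (auto simp: prod_eq_iff)
  have "\<not> affine_dependent (fst ` ?S)"
  proof
    assume "affine_dependent (fst ` ?S)"
    then obtain u v where u: "sum u (fst ` ?S) = 0" "v \<in> fst ` ?S" "u v \<noteq> 0" "(\<Sum>v\<in>fst ` ?S. u v *\<^sub>R v) = 0"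
      using affine_dependent_explicit_finite[OF finite_imageI[OF fS], of fst] by blast
    define c where "c g = (if g \<in> ?S then u (fst g) else 0)" for g
    have sc: "supp c \<subseteq> ?S" by (auto simp: c_def supp_def)
    have "ev c = (\<Sum>g\<in>?S. u (fst g) *\<^sub>R fst g)" unfolding ev_sum[OF fS sc] by (rule sum.cong) (auto simp: c_def)
    also have "\<dots> = 0" using u(4) inj by (simp add: sum.reindex)
    finally have e: "ev c = 0" .
    have m: "mass c l' = 0" for l'
    proof (cases "l' = l")
      case True
      have "mass c l' = (\<Sum>g\<in>?S. u (fst g))" unfolding mass_sum[OF fS sc] by (rule sum.cong) (auto simp: c_def True)
      also have "\<dots> = 0" using u(1) inj by (simp add: sum.reindex)
      finally show ?thesis .
    next
      case False
      then have "{g\<in>?S. snd g = l'} = {}" by auto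
      then show ?thesis unfolding mass_sum[OF fS sc] by (simp only: sum.empty)
    qed
    obtain g where g: "g \<in> ?S" "v = fst g" using u(2) by blast
    have "c g = 0" by (rule cone_unique_independent[OF T S _ e m]) (use sc in blast)
    then show False using g u(3) by (simp add: c_def)
  qed
  then have "\<not> card (fst ` ?S) \<ge> DIM(real ^ 'n) + 2" using affine_dependent_biggerset[of "fst ` ?S"] fS by blast
  then show ?thesis using card_image[OF inj] by simp
qed

section \<open>Removing the regions one by one, and induction on the index\<close>

lemma box_points_zero: "(\<lambda>_. 0) \<in> box_points S"
  by (rule boxI) (auto simp: int_vec_zero)

lemma pair_diff:
  assumes "finite (supp a)" "finite (supp b)"
  shows "(ev (\<lambda>g. a g - b g), mass (\<lambda>g. a g - b g)) = (ev a - ev b, \<lambda>l. mass a l - mass b l)"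
  using ev_diff[OF assms] by (simp add: fun_eq_iff)

lemma pair_add:
  assumes "finite (supp a)" "finite (supp b)"
  shows "(ev (\<lambda>g. a g + b g), mass (\<lambda>g. a g + b g)) = (ev a + ev b, \<lambda>l. mass a l + mass b l)"
  using ev_add[OF assms] by (simp add: fun_eq_iff)

lemma exists_rank:
  assumes "simplicial T"
  obtains rk :: "'n::finite gen \<Rightarrow> nat" where "rank_inj rk (\<Union>T)"
proof -
  have "finite (\<Union>T)" using assms by (auto simp: simplicial_def)
  from finite_imp_inj_to_nat_seg[OF this] obtain rk :: "'n gen \<Rightarrow> nat" where "inj_on rk (\<Union>T)" by blast
  then have "rank_inj rk (\<Union>T)" unfolding rank_inj_def inj_on_def by blast
  then show ?thesis by (rule that)
qed

text \<open>Starring at all box points selected by one region leaves it without unstarred cones,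
  since a cone owned by it contains the support of such a point. A selected point without mass in
  label \<open>k\<close> would live on smaller labels, where only the zero box point is
  left.\<close>

lemma stage_inv_kill:
  fixes T :: "'n::finite gen set set"
  assumes I: "stage_inv r V P k D T lam RR" and V: "rat_subspace V" and k: "k < r"
    and fin: "finite RR" and ne: "RR \<noteq> {}"
    and big: "\<And>l. l < r \<Longrightarrow> l \<noteq> k \<Longrightarrow> real (CARD('n) + 1) * lam k < lam l"
  obtains T2 lam2 RR2 where "stage_inv r V P k D T2 lam2 RR2" "finite RR2" "card RR2 < card RR"
proof -
  obtain X L Q where R: "(X, L, Q) \<in> RR" using ne by (metis ex_in_conv prod_cases3)
  let ?C = "CARD('n) + 1"
  have represents: "represents r V P T lam" and I2: "\<And>S. S \<in> T \<Longrightarrow> labels_below k S \<Longrightarrow> box_points S = {\<lambda>_. 0}" and region: "region T X L Q"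
    and O: "\<And>S. S \<in> T \<Longrightarrow> labels_below (Suc k) S \<Longrightarrow> card (box_points S) = D \<Longrightarrow> \<exists>X L Q. (X, L, Q) \<in> RR \<and> owned X Q S"
    using I R unfolding stage_inv_def by blast+
  have simplicial: "simplicial T" and cone_unique: "cone_unique T" and int_vec: "\<And>S g. S \<in> T \<Longrightarrow> g \<in> S \<Longrightarrow> int_vec (fst g)"
    and lpos: "\<And>l. l < r \<Longrightarrow> 0 < lam l"
    using represents unfolding represents_def by blast+
  obtain rk :: "'n gen \<Rightarrow> nat" where rk: "rank_inj rk (\<Union>T)" by (rule exists_rank[OF simplicial])
  define \<Phi> where "\<Phi> = {c. c \<noteq> (\<lambda>_. 0) \<and> supp c \<in> T \<and> supp c \<subseteq> X \<and> labels_below (Suc k) (supp c) \<and> c \<in> box_points (supp c) \<and> (ev c, mass c) \<in> Q}"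
  have \<Phi>D: "c \<noteq> (\<lambda>_. 0)" "supp c \<in> T" "supp c \<subseteq> X" "labels_below (Suc k) (supp c)" "c \<in> box_points (supp c)" "(ev c, mass c) \<in> Q"
    if "c \<in> \<Phi>" for c using that unfolding \<Phi>_def by blast+
  \<comment> \<open>A box point has coefficients below one on at most \<open>?C\<close> generators
    of each label, so its masses are at most \<open>?C\<close>, and the factorial is divisible by
    whatever mass it has in label \<open>k\<close>. The further factor \<open>?C\<close> in smaller
    labels covers \<open>h c l\<close> letters for each inner word; this ratio is the one in
    hypothesis \<open>big\<close>.\<close>
  define y where "y l = (if l = k then fact ?C else if l < k then ?C * fact ?C else 0)" for l
  have mk: "0 < mass c k" if c: "c \<in> \<Phi>" for c
  proof (rule ccontr)
    assume n: "\<not> 0 < mass c k"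
    have fc: "finite (supp c)" using simplicial_fin[OF simplicial \<Phi>D(2)[OF c]] .
    have nn: "0 \<le> c g" for g using boxD(2)[OF \<Phi>D(5)[OF c]] .
    have "0 \<le> mass c k" unfolding mass_def by (rule sum_nonneg) (rule nn)
    then have m0: "mass c k = 0" using n by linarith
    have ff: "finite {g\<in>supp c. snd g = k}" using fc by simp
    have z: "\<forall>g\<in>{g\<in>supp c. snd g = k}. c g = 0"
      by (rule iffD1[OF sum_nonneg_eq_0_iff[OF ff nn]]) (rule m0[unfolded mass_def])
    have "labels_below k (supp c)"
    proof (rule labels_belowI)
      fix g assume g: "g \<in> supp c"
      then have "snd g \<noteq> k" using z unfolding supp_def by blast
      then show "snd g < k" using labels_belowD[OF \<Phi>D(4)[OF c] g] by simp
    qed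
    then have "c = (\<lambda>_. 0)" using I2[OF \<Phi>D(2)[OF c]] \<Phi>D(5)[OF c] by blast
    then show False using \<Phi>D(1)[OF c] by blast
  qed
  have ub: "nat \<lfloor>mass c l\<rfloor> \<le> ?C" if c: "c \<in> \<Phi>" for c l
  proof -
    have "mass c l \<le> (\<Sum>g\<in>{g\<in>supp c. snd g = l}. 1)" unfolding mass_def
      by (intro sum_mono) (use boxD(3)[OF \<Phi>D(5)[OF c]] less_imp_le in blast)
    also have "\<dots> \<le> ?C" using label_card_bound[OF simplicial cone_unique \<Phi>D(2)[OF c], of l] by simp
    finally show ?thesis by linarith
  qed
  have hk1: "1 \<le> nat \<lfloor>mass c k\<rfloor>" if c: "c \<in> \<Phi>" for c
  proof -
    have "mass c k \<in> \<int>" using boxD(5)[OF \<Phi>D(5)[OF c]] .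
    then show ?thesis using mk[OF c] by (elim Ints_cases) simp
  qed
  have st: "step T \<Phi> k rk y"
  proof
    show "c = c'" if "S \<in> T" "c \<in> \<Phi>" "c' \<in> \<Phi>" "supp c \<subseteq> S" "supp c' \<subseteq> S" for S c c'
    proof -
      have fc: "finite (supp c)" "finite (supp c')" using simplicial_fin[OF simplicial] \<Phi>D(2) that(2,3) by blast+
      let ?d = "\<lambda>g. c g - c' g"
      have "(ev c - ev c', \<lambda>l. mass c l - mass c' l) \<in> L"
        using region \<Phi>D(6)[OF that(2)] \<Phi>D(6)[OF that(3)] unfolding region_def by blast
      then have "(ev ?d, mass ?d) \<in> L" unfolding pair_diff[OF fc] .
      moreover have "supp ?d \<subseteq> S \<inter> X" using supp_diff[of c c'] \<Phi>D(3)[OF that(2)] \<Phi>D(3)[OF that(3)] that(4,5) by blast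
      ultimately have i: "\<forall>g. ?d g \<in> \<int>" using region that(1) unfolding region_def by blast
      show "c = c'"
      proof
        fix g
        have "0 \<le> c g" "c g < 1" "0 \<le> c' g" "c' g < 1"
          using boxD[OF \<Phi>D(5)[OF that(2)]] boxD[OF \<Phi>D(5)[OF that(3)]] by blast+
        then show "c g = c' g" using small_int_zero[OF i[THEN spec, of g]] by simp
      qed
    qed
    show "snd g \<le> k" if "c \<in> \<Phi>" "g \<in> supp c" for c g using labels_belowD[OF \<Phi>D(4)[OF that(1)] that(2)] by simp
    show "nat \<lfloor>mass c k\<rfloor> dvd y k" if "c \<in> \<Phi>" for c
      unfolding y_def using dvd_fact[OF hk1[OF that] ub[OF that]] by simp
    show "nat \<lfloor>mass c l\<rfloor> * y k \<le> y l * nat \<lfloor>mass c k\<rfloor>" if c: "c \<in> \<Phi>" for c l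
    proof -
      consider "l = k" | "l < k" | "k < l" by linarith
      then show ?thesis
      proof cases
        case 1
        then show ?thesis by simp
      next
        case 2
        have "nat \<lfloor>mass c l\<rfloor> * fact ?C \<le> ?C * fact ?C * nat \<lfloor>mass c k\<rfloor>"
          using mult_le_mono[OF mult_le_mono[OF ub[OF c, of l] order_refl[of "fact ?C"]] hk1[OF c]] by simp
        then show ?thesis using 2 by (simp add: y_def)
      next
        case 3
        have "{g\<in>supp c. snd g = l} = {}" using labels_belowD[OF \<Phi>D(4)[OF c]] 3 by force
        then have "mass c l = 0" unfolding mass_def by (simp only: sum.empty)
        then show ?thesis by simp
      qed
    qed
    show "0 < y k" by (simp add: y_def)
    show "y l = 0" if "k < l" for l using that by (simp add: y_def)
  qed (use simplicial cone_unique int_vec rk mk \<Phi>D in blast)+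
  have ineq: "y l * lam k < y k * lam l" if "l < r" "l \<noteq> k" for l
  proof (cases "l < k")
    case True
    have "real (fact ?C) * (real ?C * lam k) < real (fact ?C) * lam l"
      by (rule mult_strict_left_mono[OF big[OF that]]) (simp only: of_nat_0_less_iff fact_gt_zero)
    then show ?thesis using True that by (simp add: y_def algebra_simps)
  next
    case False
    then have "y l = 0" using that by (simp add: y_def)
    moreover have "0 < real (y k)" by (simp only: y_def if_True of_nat_0_less_iff fact_gt_zero simp_thms)
    ultimately show ?thesis using lpos[OF that(1)] by simp
  qed
  have O': "\<exists>X1 L1 Q1. (X1, L1, Q1) \<in> RR - {(X, L, Q)} \<and> owned X1 Q1 S"
    if S: "S \<in> T" "\<forall>c\<in>\<Phi>. \<not> supp c \<subseteq> S" "labels_below (Suc k) S" "card (box_points S) = D" for S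
  proof -
    obtain X1 L1 Q1 where x: "(X1, L1, Q1) \<in> RR" "owned X1 Q1 S" using O[OF S(1,3,4)] by blast
    have "\<not> owned X Q S"
    proof
      assume "owned X Q S"
      then obtain c where c: "S \<subseteq> X" "c \<in> box_points S" "c \<noteq> (\<lambda>_. 0)" "(ev c, mass c) \<in> Q" unfolding owned_def by blast
      have s: "supp c \<subseteq> S" using boxD(1)[OF c(2)] .
      have "c \<in> box_points (supp c)" using c(2) unfolding box_points_def by blast
      moreover have "labels_below (Suc k) (supp c)" using S(3) s unfolding labels_below_def by blast
      ultimately have "c \<in> \<Phi>" unfolding \<Phi>_def using c s simplicial_sub[OF simplicial S(1) s] by blast
      then show False using S(2) s by blast
    qed
    then have "(X1, L1, Q1) \<noteq> (X, L, Q)" using x(2) by blast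
    then show ?thesis using x by blast
  qed
  have "finite (RR - {(X, L, Q)})" using fin by simp
  from stage_inv_step[OF st I V k ineq O' Diff_subset this]
  obtain T2 RR2 where "stage_inv r V P k D T2 (new_mass y k lam) RR2" "finite RR2" "card RR2 \<le> card (RR - {(X, L, Q)})" by blast
  moreover have "card (RR - {(X, L, Q)}) < card RR" using fin R by (meson card_Diff1_less)
  ultimately show ?thesis using that by (meson order_le_less_trans)
qed

text \<open>With no box points selected and words in label \<open>k\<close> alone, a refinement just
  divides \<open>lam k\<close> by \<open>N\<close> and leaves the other masses as they are. This
  creates the gap between the masses that starring needs.\<close>

lemma stage_inv_shrink:
  fixes T :: "'n::finite gen set set"
  assumes I: "stage_inv r V P k D T lam RR" and V: "rat_subspace V" and k: "k < r" and fin: "finite RR"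
  obtains T2 lam2 RR2 where "stage_inv r V P k D T2 lam2 RR2" "finite RR2" "card RR2 \<le> card RR"
    "\<And>l. l < r \<Longrightarrow> l \<noteq> k \<Longrightarrow> real (CARD('n) + 1) * lam2 k < lam2 l"
proof -
  let ?C = "CARD('n) + 1"
  have represents: "represents r V P T lam" 
    and O: "\<And>S. S \<in> T \<Longrightarrow> labels_below (Suc k) S \<Longrightarrow> card (box_points S) = D \<Longrightarrow> \<exists>X L Q. (X, L, Q) \<in> RR \<and> owned X Q S"
    using I unfolding stage_inv_def by blast+
  have simplicial: "simplicial T" and cone_unique: "cone_unique T" and int_vec: "\<And>S g. S \<in> T \<Longrightarrow> g \<in> S \<Longrightarrow> int_vec (fst g)"
    and lpos: "\<And>l. l < r \<Longrightarrow> 0 < lam l"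
    using represents unfolding represents_def by blast+
  obtain rk :: "'n gen \<Rightarrow> nat" where rk: "rank_inj rk (\<Union>T)" by (rule exists_rank[OF simplicial])
  define N where "N = Suc (\<Sum>l<r. nat \<lceil>real ?C * lam k / lam l\<rceil>)"
  have N: "real ?C * lam k < N * lam l" if "l < r" for l
  proof -
    have "nat \<lceil>real ?C * lam k / lam l\<rceil> \<le> (\<Sum>l<r. nat \<lceil>real ?C * lam k / lam l\<rceil>)"
      by (rule member_le_sum) (use that in auto)
    then have "real ?C * lam k / lam l < N" unfolding N_def by linarith
    then show ?thesis using lpos[OF that] by (simp add: pos_divide_less_eq)
  qed
  have Npos: "0 < N" by (simp add: N_def)
  define y where "y l = (if l = k then N else 0)" for l
  have st: "step T {} k rk y"
    by unfold_locales (use simplicial cone_unique int_vec rk Npos in \<open>auto simp: y_def\<close>)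
  have ineq: "y l * lam k < y k * lam l" if "l < r" "l \<noteq> k" for l
    using that lpos[OF that(1)] Npos by (simp add: y_def)
  from stage_inv_step[OF st I V k ineq _ order_refl fin] O
  obtain T2 RR2 where t: "stage_inv r V P k D T2 (new_mass y k lam) RR2" "finite RR2" "card RR2 \<le> card RR" by blast
  have "real ?C * new_mass y k lam k < new_mass y k lam l" if "l < r" "l \<noteq> k" for l
  proof -
    have "0 < real N" using Npos by simp
    then have "real ?C * lam k / N < lam l" using N[OF that(1)] by (simp add: pos_divide_less_eq mult.commute)
    then show ?thesis using that by (simp add: new_mass_def y_def)
  qed
  then show ?thesis using that t by blast
qed

lemma round_end:
  fixes T :: "'n::finite gen set set"
  assumes V: "rat_subspace V" and k: "k < r"
  shows "finite RR \<Longrightarrow> stage_inv r V P k D T lam RR \<Longrightarrow> \<exists>T2 lam2. stage_inv r V P k D T2 lam2 {}"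
proof (induction "card RR" arbitrary: RR T lam rule: less_induct)
  case less
  show ?case
  proof (cases "RR = {}")
    case True
    then show ?thesis using less.prems by blast
  next
    case False
    obtain T1 lam1 RR1 where 1: "stage_inv r V P k D T1 lam1 RR1" "finite RR1" "card RR1 \<le> card RR"
      "\<And>l. l < r \<Longrightarrow> l \<noteq> k \<Longrightarrow> real (CARD('n) + 1) * lam1 k < lam1 l"
      using stage_inv_shrink[OF less.prems(2) V k less.prems(1)] by blast
    show ?thesis
    proof (cases "RR1 = {}")
      case True
      then show ?thesis using 1(1) by blast
    next
      case False
      obtain T2 lam2 RR2 where 2: "stage_inv r V P k D T2 lam2 RR2" "finite RR2" "card RR2 < card RR1"
        using stage_inv_kill[OF 1(1) V k 1(2) False 1(4)] by blast
      show ?thesis by (rule less.hyps[OF _ 2(2,1)]) (use 1(3) 2(3) in simp)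
    qed
  qed
qed

definition lattice_of :: "'n::finite gen set \<Rightarrow> 'n vlat" where
  "lattice_of S = {(ev z, mass z) | z. supp z \<subseteq> S \<and> (\<forall>g. z g \<in> \<int>)}"

lemma lattice_of_I: "supp z \<subseteq> S \<Longrightarrow> (\<And>g. z g \<in> \<int>) \<Longrightarrow> (ev z, mass z) \<in> lattice_of S"
  unfolding lattice_of_def by blast

lemma lattice_of_E: assumes "(p, d) \<in> lattice_of S" obtains z where "supp z \<subseteq> S" "\<forall>g. z g \<in> \<int>" "p = ev z" "d = mass z"
  using assms unfolding lattice_of_def by blast

lemma lattice_of_diff:
  assumes "finite S" "(p, d) \<in> lattice_of S" "(p', d') \<in> lattice_of S"
  shows "(p - p', \<lambda>l. d l - d' l) \<in> lattice_of S" "(p + p', \<lambda>l. d l + d' l) \<in> lattice_of S"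
proof -
  obtain z where z: "supp z \<subseteq> S" "\<forall>g. z g \<in> \<int>" "p = ev z" "d = mass z" using assms(2) by (rule lattice_of_E)
  obtain z' where z': "supp z' \<subseteq> S" "\<forall>g. z' g \<in> \<int>" "p' = ev z'" "d' = mass z'" using assms(3) by (rule lattice_of_E)
  have f: "finite (supp z)" "finite (supp z')" using z(1) z'(1) assms(1) finite_subset by blast+
  have "(ev (\<lambda>g. z g - z' g), mass (\<lambda>g. z g - z' g)) \<in> lattice_of S"
    by (rule lattice_of_I) (use supp_diff[of z z'] z(1,2) z'(1,2) in auto)
  then show "(p - p', \<lambda>l. d l - d' l) \<in> lattice_of S" unfolding pair_diff[OF f] z(3,4) z'(3,4) .
  have "(ev (\<lambda>g. z g + z' g), mass (\<lambda>g. z g + z' g)) \<in> lattice_of S"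
    by (rule lattice_of_I) (use supp_add[of z z'] z(1,2) z'(1,2) in auto)
  then show "(p + p', \<lambda>l. d l + d' l) \<in> lattice_of S" unfolding pair_add[OF f] z(3,4) z'(3,4) .
qed

text \<open>Take \<open>S\<close> itself for \<open>X\<close>, the lattice spanned by
  \<open>S\<close> for \<open>L\<close> and the coset of \<open>c\<close> for \<open>Q\<close>;
  integrality of coefficients is then independence of \<open>S\<close>.\<close>

lemma initial_region:
  fixes T :: "'n::finite gen set set"
  assumes T: "simplicial T" "cone_unique T" and S: "S \<in> T" and c: "c \<in> box_points S" "c \<noteq> (\<lambda>_. 0)"
  shows "\<exists>X L Q. region T X L Q \<and> owned X Q S"
proof -
  define Q where "Q = {(p, d). (p - ev c, \<lambda>l. d l - mass c l) \<in> lattice_of S}"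
  have fS: "finite S" using simplicial_fin[OF T(1) S] .
  have zero: "(0, \<lambda>_. 0) \<in> lattice_of S"
  proof -
    have "(ev (\<lambda>_::'n gen. 0), mass (\<lambda>_::'n gen. 0)) \<in> lattice_of S" by (rule lattice_of_I) (auto simp: supp_def)
    moreover have "mass (\<lambda>_::'n gen. 0) = (\<lambda>_. 0)" by (simp add: mass_def fun_eq_iff)
    moreover have "ev (\<lambda>_::'n gen. 0) = 0" by (simp add: ev_def)
    ultimately show ?thesis by simp
  qed
  have "region T S (lattice_of S) Q"
    unfolding region_def
  proof (intro conjI ballI allI impI)
    show "vlat_subgroup (lattice_of S)" unfolding vlat_subgroup_def using zero lattice_of_diff(1)[OF fS] by blast
    show "(fst x, mass (unit_mass x)) \<in> lattice_of S" if "x \<in> S" for x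
      using lattice_of_I[of "unit_mass x" S] that by (simp add: unit_mass_def)
    show "a g \<in> \<int>" if "S' \<in> T" and a: "supp a \<subseteq> S' \<inter> S \<and> (ev a, mass a) \<in> lattice_of S" for S' a g
    proof -
      have aL: "(ev a, mass a) \<in> lattice_of S" using a by blast
      obtain z where z: "supp z \<subseteq> S" "\<forall>g. z g \<in> \<int>" "ev a = ev z" "mass a = mass z" using aL by (rule lattice_of_E)
      have sa: "supp a \<subseteq> S" using a by blast
      have f: "finite (supp a)" "finite (supp z)" using sa z(1) fS finite_subset by blast+
      have "a g - z g = 0"
        by (rule cone_unique_independent[OF T S, of "\<lambda>g. a g - z g"])
          (use supp_diff[of a z] sa z ev_diff[OF f] in auto)
      then show ?thesis using z(2)[THEN spec, of g] by (simp del: split_paired_All)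
    qed
    show "(p - p', \<lambda>l. d l - d' l) \<in> lattice_of S" if "(p, d) \<in> Q \<and> (p', d') \<in> Q" for p d p' d'
    proof -
      have "(p - ev c, \<lambda>l. d l - mass c l) \<in> lattice_of S" "(p' - ev c, \<lambda>l. d' l - mass c l) \<in> lattice_of S"
        using that by (auto simp: Q_def)
      from lattice_of_diff(1)[OF fS this] show ?thesis by simp
    qed
    show "(p + p', \<lambda>l. d l + d' l) \<in> Q" if "(p, d) \<in> Q \<and> (p', d') \<in> lattice_of S" for p d p' d'
    proof -
      have "(p - ev c, \<lambda>l. d l - mass c l) \<in> lattice_of S" "(p', d') \<in> lattice_of S" using that by (auto simp: Q_def)
      from lattice_of_diff(2)[OF fS this] show ?thesis by (simp add: Q_def algebra_simps)
    qed
  qed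
  moreover have "owned S Q S" unfolding owned_def
    using c zero by (auto simp: Q_def intro!: bexI[of _ c])
  ultimately show ?thesis by blast
qed

text \<open>\<open>D\<close> bounds the index of the cones on labels up to \<open>k\<close>. Giving
  each cone of index exactly \<open>Suc D\<close> its own region starts the removal of regions; once
  no region is left, no cone of that index is.\<close>

lemma stage:
  fixes P :: "(real ^ 'n::finite) set"
  assumes V: "rat_subspace V" and k: "k < r"
  shows "represents r V P T lam \<Longrightarrow> (\<forall>S\<in>T. labels_below k S \<longrightarrow> box_points S = {\<lambda>_. 0}) \<Longrightarrow> (\<forall>S\<in>T. labels_below (Suc k) S \<longrightarrow> card (box_points S) \<le> D) \<Longrightarrow>
    \<exists>T2 lam2. represents r V P T2 lam2 \<and> (\<forall>S\<in>T2. labels_below (Suc k) S \<longrightarrow> box_points S = {\<lambda>_. 0})"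
proof (induction D arbitrary: T lam)
  case 0
  have "box_points S = {\<lambda>_. 0}" if "S \<in> T" "labels_below (Suc k) S" for S
  proof -
    have "finite (box_points S)" by (rule finite_box) (use 0(1) that in \<open>auto simp: represents_def\<close>)
    then show ?thesis using 0(3) that box_points_zero[of S] by auto
  qed
  then show ?case using 0(1) by blast
next
  case (Suc D)
  have T: "simplicial T" "cone_unique T" using Suc.prems(1) by (auto simp: represents_def)
  show ?case
  proof (cases "D = 0")
    case True
    have "box_points S = {\<lambda>_. 0}" if "S \<in> T" "labels_below (Suc k) S" for S
    proof -
      have f: "finite (box_points S)" by (rule finite_box[OF T that(1)])
      have "card (box_points S) \<le> 1" using Suc.prems(3) that True by auto
      then show ?thesis using box_points_zero[of S] f card_le_Suc0_iff_eq[OF f] by auto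
    qed
    then show ?thesis using Suc.prems(1) by blast
  next
    case False
    let ?DS = "{S\<in>T. labels_below (Suc k) S \<and> card (box_points S) = Suc D}"
    have "\<exists>R. region T (fst R) (fst (snd R)) (snd (snd R)) \<and> owned (fst R) (snd (snd R)) S" if "S \<in> ?DS" for S
    proof -
      have S: "S \<in> T" "card (box_points S) = Suc D" using that by auto
      have "\<exists>c\<in>box_points S. c \<noteq> (\<lambda>_. 0)"
      proof (rule ccontr)
        assume "\<not> (\<exists>c\<in>box_points S. c \<noteq> (\<lambda>_. 0))"
        then have "box_points S \<subseteq> {\<lambda>_. 0}" by blast
        then have "card (box_points S) \<le> 1" using card_mono[of "{\<lambda>_. 0}" "box_points S"] by simp
        then show False using S(2) False by simp
      qed
      then obtain c where "c \<in> box_points S" "c \<noteq> (\<lambda>_. 0)" by blast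
      from initial_region[OF T S(1) this] obtain X L Q where "region T X L Q \<and> owned X Q S" by blast
      then show ?thesis by (intro exI[of _ "(X, L, Q)"]) simp
    qed
    then have "\<forall>S\<in>?DS. \<exists>R. region T (fst R) (fst (snd R)) (snd (snd R)) \<and> owned (fst R) (snd (snd R)) S" by (rule ballI)
    from bchoice[OF this] obtain f where
      f': "\<forall>S\<in>?DS. region T (fst (f S)) (fst (snd (f S))) (snd (snd (f S))) \<and> owned (fst (f S)) (snd (snd (f S))) S" ..
    note f = bspec[OF f']
    have "stage_inv r V P k (Suc D) T lam (f ` ?DS)"
      unfolding stage_inv_def
    proof (intro conjI ballI allI impI)
      show "represents r V P T lam" by (rule Suc.prems(1))
      show "box_points S = {\<lambda>_. 0}" if "S \<in> T" "labels_below k S" for S using Suc.prems(2) that by blast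
      show "card (box_points S) \<le> Suc D" if "S \<in> T" "labels_below (Suc k) S" for S using Suc.prems(3) that by blast
      show "\<exists>X L Q. (X, L, Q) \<in> f ` ?DS \<and> owned X Q S" if "S \<in> T" "labels_below (Suc k) S" "card (box_points S) = Suc D" for S
      proof -
        have S: "S \<in> ?DS" using that by blast
        obtain X L Q where x: "f S = (X, L, Q)" by (cases "f S")
        then have "owned X Q S" using f[OF S] by simp
        moreover have "(X, L, Q) \<in> f ` ?DS" unfolding x[symmetric] using S by (rule imageI)
        ultimately show ?thesis by blast
      qed
      show "region T X L Q" if w: "(X, L, Q) \<in> f ` ?DS" for X L Q
      proof -
        obtain S where S: "(X, L, Q) = f S" "S \<in> ?DS" by (rule imageE[OF w])
        show ?thesis using f[OF S(2)] unfolding S(1)[symmetric] by simp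
      qed
    qed
    moreover have "finite (f ` ?DS)" using T(1) by (simp add: simplicial_def)
    ultimately obtain T2 lam2 where t: "stage_inv r V P k (Suc D) T2 lam2 {}" using round_end[OF V k] by blast
    have "card (box_points S) \<le> D" if "S \<in> T2" "labels_below (Suc k) S" for S
    proof -
      have "card (box_points S) \<le> Suc D \<and> (card (box_points S) = Suc D \<longrightarrow> (\<exists>X L Q. (X, L, Q) \<in> ({} :: ('n gen set \<times> 'n vlat \<times> 'n vlat) set) \<and> owned X Q S))"
        using t that unfolding stage_inv_def by blast
      then show ?thesis by auto
    qed
    moreover have "represents r V P T2 lam2" "\<forall>S\<in>T2. labels_below k S \<longrightarrow> box_points S = {\<lambda>_. 0}" using t unfolding stage_inv_def by blast+
    ultimately show ?thesis using Suc.IH by blast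
  qed
qed

theorem unimodular_refinement:
  fixes P :: "(real ^ 'n::finite) set"
  assumes V: "rat_subspace V" and represents: "represents r V P T lam"
  obtains T2 lam2 where "represents r V P T2 lam2" "\<And>S. S \<in> T2 \<Longrightarrow> box_points S = {\<lambda>_. 0}"
proof -
  have "k \<le> r \<Longrightarrow> \<exists>T2 lam2. represents r V P T2 lam2 \<and> (\<forall>S\<in>T2. labels_below k S \<longrightarrow> box_points S = {\<lambda>_. 0})" for k
  proof (induction k)
    case 0
    have "box_points {} = {\<lambda>_. 0 :: real}" using box_points_zero[of "{}"] by (auto simp: box_points_def supp_def)
    moreover have "S = {}" if "labels_below 0 S" for S :: "'n gen set" using that by (auto simp: labels_below_def)
    ultimately show ?case using represents by blast
  next
    case (Suc k)
    then obtain T1 lam1 where 1: "represents r V P T1 lam1" "\<forall>S\<in>T1. labels_below k S \<longrightarrow> box_points S = {\<lambda>_. 0}" by auto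
    have fT: "finite T1" using 1(1) by (simp add: represents_def simplicial_def)
    have "card (box_points S) \<le> (\<Sum>S\<in>T1. card (box_points S))" if "S \<in> T1" for S by (rule member_le_sum[OF that]) (use fT in auto)
    then have "\<forall>S\<in>T1. labels_below (Suc k) S \<longrightarrow> card (box_points S) \<le> (\<Sum>S\<in>T1. card (box_points S))" by blast
    from stage[OF V _ 1 this] Suc.prems show ?case by simp
  qed
  from this[OF order_refl] obtain T2 lam2 where t: "represents r V P T2 lam2" "\<forall>S\<in>T2. labels_below r S \<longrightarrow> box_points S = {\<lambda>_. 0}" by blast
  have "box_points S = {\<lambda>_. 0}" if "S \<in> T2" for S
  proof -
    have "labels_below r S" using t(1) that unfolding represents_def labels_below_def by blast
    then show ?thesis using t(2) that by blast
  qed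
  then show ?thesis using that t(1) by blast
qed

section \<open>Dual integral forms\<close>

lemma int_form_add: "int_form a (x + y) = int_form a x + int_form a y"
  and int_form_diff: "int_form a (x - y) = int_form a x - int_form a y"
  and int_form_scale: "int_form a (t *\<^sub>R x) = t * int_form a x"
  and int_form_zero: "int_form a 0 = 0"
  by (simp_all add: int_form_def sum.distrib sum_subtractf sum_distrib_left algebra_simps)

lemma int_form_sum: "int_form a (sum f A) = (\<Sum>x\<in>A. int_form a (f x))"
  by (induction A rule: infinite_finite_induct) (simp_all add: int_form_zero int_form_add)

lemma int_form_Ints: "int_vec x \<Longrightarrow> int_form a x \<in> \<int>"
  unfolding int_form_def int_vec_def by (auto intro!: Ints_sum Ints_mult)

lemma int_form_diff_scaled: "int_form (\<chi> i. a $ i - m * b $ i) x = int_form a x - of_int m * int_form b x"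
  by (simp add: int_form_def sum_subtractf sum_distrib_left algebra_simps)

lemma int_form_diff_sum:
  "int_form (\<chi> i. a $ i - (\<Sum>g\<in>B. m g * u g $ i)) x = int_form a x - (\<Sum>g\<in>B. of_int (m g) * int_form (u g) x)"
proof -
  have "(\<Sum>i\<in>UNIV. (\<Sum>g\<in>B. of_int (m g) * of_int (u g $ i)) * x $ i) = (\<Sum>g\<in>B. of_int (m g) * int_form (u g) x)"
    unfolding int_form_def sum_distrib_right sum_distrib_left by (subst sum.swap) (simp add: mult.assoc)
  then show ?thesis by (simp add: int_form_def sum_subtractf left_diff_distrib)
qed

lemma finite_bezout:
  fixes x :: "'i \<Rightarrow> int"
  assumes "finite I"
  shows "\<exists>a. \<forall>i\<in>I. (\<Sum>j\<in>I. a j * x j) dvd x i"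
  using assms
proof (induction I)
  case empty
  then show ?case by simp
next
  case (insert k I)
  then obtain a where a: "\<forall>i\<in>I. (\<Sum>j\<in>I. a j * x j) dvd x i" by blast
  obtain u v where uv: "u * (\<Sum>j\<in>I. a j * x j) + v * x k = gcd (\<Sum>j\<in>I. a j * x j) (x k)" using bezout_int by blast
  define a' where "a' j = (if j = k then v else u * a j)" for j
  have "(\<Sum>j\<in>I. a' j * x j) = u * (\<Sum>j\<in>I. a j * x j)"
    unfolding sum_distrib_left by (rule sum.cong) (use insert.hyps(2) in \<open>auto simp: a'_def\<close>)
  then have e: "(\<Sum>j\<in>insert k I. a' j * x j) = gcd (\<Sum>j\<in>I. a j * x j) (x k)"
    using insert.hyps uv by (simp add: a'_def)
  have "\<forall>i\<in>insert k I. (\<Sum>j\<in>insert k I. a' j * x j) dvd x i"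
    unfolding e using a dvd_trans[OF gcd_dvd1] by auto
  then show ?case by blast
qed

text \<open>For integral vectors on finite \<open>B\<close> this says that they form part of a
  lattice basis. Independence is included, since a nontrivial relation could be rescaled to have a
  coefficient that is not integral.\<close>

definition saturated :: "'b set \<Rightarrow> ('b \<Rightarrow> real ^ 'n) \<Rightarrow> bool" where
  "saturated B e \<longleftrightarrow> (\<forall>c. int_vec (\<Sum>g\<in>B. c g *\<^sub>R e g) \<longrightarrow> (\<forall>g\<in>B. c g \<in> \<int>))"

lemma saturated_subset:
  assumes s: "saturated B e" and B: "finite B" "C \<subseteq> B"
  shows "saturated C e"
  unfolding saturated_def
proof (intro allI impI ballI)
  fix c g assume c: "int_vec (\<Sum>g\<in>C. c g *\<^sub>R e g)" and g: "g \<in> C"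
  define c' where "c' g = (if g \<in> C then c g else 0)" for g
  have "(\<Sum>g\<in>B. c' g *\<^sub>R e g) = (\<Sum>g\<in>C. c g *\<^sub>R e g)"
    by (rule sum.mono_neutral_cong_right) (use B in \<open>auto simp: c'_def\<close>)
  then have "c' g \<in> \<int>" using s c g B(2) unfolding saturated_def by (metis subsetD)
  then show "c g \<in> \<int>" using g by (simp add: c'_def)
qed

text \<open>Subtracting from \<open>e b\<close> its components along the vectors treated so far
  gives \<open>e'\<close>, on which the forms found so far vanish. Saturation, applied to
  \<open>e'\<close> divided by the gcd \<open>d\<close> of its entries, makes \<open>d\<close> a
  unit, and the Bezout coefficients yield a form with value one on \<open>e'\<close>. The old and
  new forms are then corrected against each other.\<close>

lemma dual_forms:
  fixes e :: "'b \<Rightarrow> real ^ 'n"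
  assumes "finite B" "\<And>g. g \<in> B \<Longrightarrow> int_vec (e g)" "saturated B e"
  shows "\<exists>u. \<forall>g\<in>B. \<forall>g'\<in>B. int_form (u g) (e g') = (if g = g' then 1 else 0)"
  using assms
proof (induction B)
  case empty
  then show ?case by simp
next
  case (insert b B)
  have sB: "saturated B e" by (rule saturated_subset[OF insert.prems(2)]) (use insert.hyps in auto)
  obtain u where u: "\<forall>g\<in>B. \<forall>g'\<in>B. int_form (u g) (e g') = (if g = g' then 1 else 0)"
    using insert.IH[OF insert.prems(1) sB] by blast
  define m where "m g = \<lfloor>int_form (u g) (e b)\<rfloor>" for g
  have m: "int_form (u g) (e b) = of_int (m g)" for g
    using int_form_Ints[OF insert.prems(1)[of b], of "u g"] by (simp add: m_def)
  define e' where "e' = e b - (\<Sum>g\<in>B. of_int (m g) *\<^sub>R e g)"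
  have "int_vec e'" unfolding e'_def by (intro int_vec_diff int_vec_sum int_vec_scale) (use insert.prems(1) in auto)
  then have e'f: "e' $ i = of_int \<lfloor>e' $ i\<rfloor>" for i by (simp add: int_vec_def)
  obtain a0 :: "'n \<Rightarrow> int" where a0: "\<forall>i\<in>UNIV. (\<Sum>j\<in>UNIV. a0 j * \<lfloor>e' $ j\<rfloor>) dvd \<lfloor>e' $ i\<rfloor>"
    using finite_bezout[of "UNIV::'n set" "\<lambda>i. \<lfloor>e' $ i\<rfloor>"] by auto
  define d where "d = (\<Sum>j\<in>UNIV. a0 j * \<lfloor>e' $ j\<rfloor>)"
  have div: "int_vec ((1 / t) *\<^sub>R e') \<Longrightarrow> 1 / t \<in> \<int>" for t
  proof -
    assume i: "int_vec ((1 / t) *\<^sub>R e')"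
    define c where "c g = (if g = b then 1 / t else - of_int (m g) / t)" for g
    have "(\<Sum>g\<in>B. c g *\<^sub>R e g) = (\<Sum>g\<in>B. - ((1 / t) *\<^sub>R (of_int (m g) *\<^sub>R e g)))"
      by (rule sum.cong) (use insert.hyps in \<open>auto simp: c_def\<close>)
    also have "\<dots> = - ((1 / t) *\<^sub>R (\<Sum>g\<in>B. of_int (m g) *\<^sub>R e g))" by (simp only: sum_negf scaleR_sum_right)
    finally have "(\<Sum>g\<in>insert b B. c g *\<^sub>R e g) = (1 / t) *\<^sub>R e'"
      using insert.hyps by (simp add: c_def e'_def scaleR_diff_right)
    then have "c b \<in> \<int>" using insert.prems(2) i unfolding saturated_def by (metis insertI1)
    then show "1 / t \<in> \<int>" by (simp add: c_def)
  qed
  have "d \<noteq> 0"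
  proof
    assume "d = 0"
    then have "e' = 0" using a0 e'f unfolding d_def[symmetric] by (simp add: vec_eq_iff)
    \<comment> \<open>Saturation also excludes \<open>e' = 0\<close>: half of such a relation would
      still have an integral value.\<close>
    then have "1 / (2::real) \<in> \<int>" using div[of 2] by (simp add: int_vec_zero)
    then obtain n where "1 / (2::real) = of_int n" by (rule Ints_cases)
    then have "real_of_int (2 * n) = 1" by simp
    then have "2 * n = 1" by linarith
    then show False by presburger
  qed
  have "int_vec ((1 / of_int d) *\<^sub>R e')"
    unfolding int_vec_def
  proof
    fix i
    obtain q where "\<lfloor>e' $ i\<rfloor> = d * q" using a0 unfolding d_def[symmetric] by (auto elim: dvdE)
    then have "e' $ i = of_int d * of_int q" using e'f[of i] by simp
    then show "((1 / of_int d) *\<^sub>R e') $ i \<in> \<int>" using \<open>d \<noteq> 0\<close> by simp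
  qed
  then have "1 / real_of_int d \<in> \<int>" by (rule div)
  then obtain q where "1 / real_of_int d = of_int q" by (rule Ints_cases)
  then have "real_of_int (q * d) = 1" using \<open>d \<noteq> 0\<close> by (simp add: field_simps)
  then have qd: "q * d = 1" by linarith
  define \<beta> :: "int ^ 'n" where "\<beta> = (\<chi> i. q * a0 i)"
  have "int_form \<beta> e' = of_int (q * d)"
    unfolding int_form_def \<beta>_def d_def by (subst e'f) (simp add: sum_distrib_left mult.assoc)
  then have be: "int_form \<beta> e' = 1" using qd by simp
  define n where "n g = \<lfloor>int_form \<beta> (e g)\<rfloor>" for g
  have n: "int_form \<beta> (e g) = of_int (n g)" if "g \<in> B" for g
    using int_form_Ints[OF insert.prems(1)[of g], of \<beta>] that by (simp add: n_def)
  define a where "a = (\<chi> i. \<beta> $ i - (\<Sum>g\<in>B. n g * u g $ i))"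
  have aB: "int_form a (e g') = 0" if "g' \<in> B" for g'
  proof -
    have "(\<Sum>g\<in>B. of_int (n g) * int_form (u g) (e g')) = (\<Sum>g\<in>B. if g = g' then of_int (n g) else 0)"
      by (rule sum.cong) (use u that in auto)
    then show ?thesis unfolding a_def int_form_diff_sum using that insert.hyps(1) by (simp add: n)
  qed
  have ab: "int_form a (e b) = 1"
  proof -
    have "int_form \<beta> e' = int_form \<beta> (e b) - (\<Sum>g\<in>B. of_int (m g) * int_form \<beta> (e g))"
      by (simp add: e'_def int_form_diff int_form_sum int_form_scale)
    also have "(\<Sum>g\<in>B. of_int (m g) * int_form \<beta> (e g)) = (\<Sum>g\<in>B. of_int (n g) * int_form (u g) (e b))"
      by (rule sum.cong) (auto simp: n m)
    finally show ?thesis unfolding a_def int_form_diff_sum using be by simp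
  qed
  define w where "w g = (if g = b then a else (\<chi> i. u g $ i - m g * a $ i))" for g
  have "\<forall>g\<in>insert b B. \<forall>g'\<in>insert b B. int_form (w g) (e g') = (if g = g' then 1 else 0)"
    using u aB ab m insert.hyps(2) by (auto simp: w_def int_form_diff_scaled)
  then show ?case by blast
qed

section \<open>Affine functions with constants in \<open>V\<close>, polytopes, and coverings by
  affine sets\<close>

lemma V_affine_const: "v \<in> V \<Longrightarrow> V_affine V (\<lambda>x. v)"
  unfolding V_affine_def by (intro bexI[of _ v] exI[of _ 0]) (auto simp: int_form_def)

lemma V_affine_form:
  assumes "rat_subspace V" shows "V_affine V (int_form a)"
  unfolding V_affine_def by (rule bexI[of _ 0], rule exI[of _ a]) (auto simp: rat_sub_closed(3)[OF assms])

lemma V_affine_coord: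
  assumes "rat_subspace V" shows "V_affine V (\<lambda>x. x $ i)"
proof -
  have "int_form (\<chi> j. if j = i then 1 else 0) = (\<lambda>x. x $ i)"
    by (auto simp: int_form_def fun_eq_iff if_distrib[of of_int] if_distrib[of "\<lambda>t. t * _"] cong: if_cong)
  then show ?thesis using V_affine_form[OF assms] by metis
qed

lemma V_affine_add:
  assumes V: "rat_subspace V" and f: "V_affine V f" "V_affine V g"
  shows "V_affine V (\<lambda>x. f x + g x)"
proof -
  obtain v a w b where *: "v \<in> V" "f = (\<lambda>x. v + int_form a x)" "w \<in> V" "g = (\<lambda>x. w + int_form b x)"
    using f unfolding V_affine_def by blast
  have "(\<lambda>x. f x + g x) = (\<lambda>x. (v + w) + int_form (a + b) x)"
    unfolding * by (auto simp: int_form_def fun_eq_iff sum.distrib algebra_simps)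
  then show ?thesis unfolding V_affine_def using rat_sub_closed(2)[OF V *(1,3)] by blast
qed

lemma V_affine_mult:
  assumes V: "rat_subspace V" and f: "V_affine V f" and t: "t \<in> \<int>"
  shows "V_affine V (\<lambda>x. t * f x)"
proof -
  obtain v a where *: "v \<in> V" "f = (\<lambda>x. v + int_form a x)" using f unfolding V_affine_def by blast
  obtain m where m: "t = of_int m" using t by (rule Ints_cases)
  have "(\<lambda>x. t * f x) = (\<lambda>x. t * v + int_form (\<chi> i. m * a $ i) x)"
    unfolding * by (auto simp: m int_form_def fun_eq_iff sum_distrib_left algebra_simps)
  moreover have "t * v \<in> V" using rat_sub_closed(1)[OF V *(1), of "of_int m"] by (simp add: m)
  ultimately show ?thesis unfolding V_affine_def by blast
qed

lemma V_affine_diff: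
  assumes V: "rat_subspace V" and f: "V_affine V f" "V_affine V g"
  shows "V_affine V (\<lambda>x. f x - g x)"
  using V_affine_add[OF V f(1) V_affine_mult[OF V f(2), of "-1"]] by simp

lemma V_affine_sum:
  assumes V: "rat_subspace V" and f: "\<And>g. g \<in> B \<Longrightarrow> V_affine V (f g)"
  shows "V_affine V (\<lambda>x. \<Sum>g\<in>B. f g x)"
  using f by (induction B rule: infinite_finite_induct)
    (auto intro!: V_affine_add[OF V] V_affine_const rat_sub_closed(3)[OF V])

lemma V_affine_closed_halfspace:
  assumes "V_affine V f"
  shows "polyhedron {x. 0 \<le> f x}"
proof -
  obtain v a where *: "f = (\<lambda>x. v + int_form a x)" using assms unfolding V_affine_def by blast
  have "{x. 0 \<le> f x} = {x. (\<chi> i. - of_int (a $ i)) \<bullet> x \<le> v}"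
    by (auto simp: * inner_vec_def int_form_def sum_negf)
  then show ?thesis using polyhedron_halfspace_le by metis
qed

lemma ZV_polytope_imp_polytope:
  assumes "ZV_polytope V P" shows "polytope P"
proof -
  obtain F where F: "finite F" "\<forall>f\<in>F. V_affine V f" "P = {x. \<forall>f\<in>F. 0 \<le> f x}" and b: "bounded P"
    using assms unfolding ZV_polytope_def by blast
  have "P = \<Inter>((\<lambda>f. {x. 0 \<le> f x}) ` F)" unfolding F(3) by blast
  moreover have "polyhedron (\<Inter>((\<lambda>f. {x. 0 \<le> f x}) ` F))"
    by (rule polyhedron_Inter) (use F(1,2) V_affine_closed_halfspace in auto)
  ultimately show ?thesis using b polytope_eq_bounded_polyhedron by metis
qed

text \<open>Join a point of \<open>K\<close> outside \<open>A\<close> to a point outside all other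
  members. None of the affine sets contains this segment, so each meets it in at most one point, and
  finitely many points do not fill it.\<close>

lemma convex_covered_by_affine:
  fixes K :: "'a::euclidean_space set"
  assumes "finite F" "\<And>A. A \<in> F \<Longrightarrow> affine A" "convex K" "K \<noteq> {}" "K \<subseteq> \<Union>F"
  shows "\<exists>A\<in>F. K \<subseteq> A"
  using assms
proof (induction F)
  case empty
  then show ?case by simp
next
  case (insert A F)
  show ?case
  proof (cases "K \<subseteq> A \<or> K \<subseteq> \<Union>F")
    case True
    then show ?thesis using insert.IH insert.prems by blast
  next
    case False
    then obtain x y where x: "x \<in> K" "x \<notin> A" and y: "y \<in> K" "y \<notin> \<Union>F" by blast
    define z where "z t = y + t *\<^sub>R (x - y)" for t :: real
    have ya: "y \<in> A" using y insert.prems(4) by blast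
    have key: "t = t'" if B: "B \<in> insert A F" and t: "z t \<in> B" "z t' \<in> B" for B t t'
    proof (rule ccontr)
      assume ne: "t \<noteq> t'"
      have line: "z s \<in> B" for s
      proof -
        define q where "q = (s - t) / (t' - t)"
        have "q * (t' - t) = s - t" using ne by (simp add: q_def)
        then have "s = (1 - q) * t + q * t'" by (simp add: algebra_simps)
        moreover have "z ((1 - q) * t + q * t') = (1 - q) *\<^sub>R z t + q *\<^sub>R z t'" by (simp add: z_def algebra_simps)
        ultimately have "z s = (1 - q) *\<^sub>R z t + q *\<^sub>R z t'" by simp
        then show ?thesis using insert.prems(1)[OF B] t unfolding affine_alt by metis
      qed
      show False using line[of 0] line[of 1] x(2) y(2) B by (auto simp: z_def)
    qed
    have "finite {t. \<exists>B\<in>insert A F. z t \<in> B}"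
    proof -
      have "finite {t. z t \<in> B}" if "B \<in> insert A F" for B
      proof (cases "\<exists>t. z t \<in> B")
        case True
        then obtain t where "z t \<in> B" by blast
        then have "{t. z t \<in> B} \<subseteq> {t}" using key[OF that] by blast
        then show ?thesis using finite_subset by blast
      qed simp
      moreover have "{t. \<exists>B\<in>insert A F. z t \<in> B} = (\<Union>B\<in>insert A F. {t. z t \<in> B})" by blast
      ultimately show ?thesis using insert.hyps(1) by auto
    qed
    moreover have "{0..1} \<subseteq> {t. \<exists>B\<in>insert A F. z t \<in> B}"
    proof
      fix t :: real assume "t \<in> {0..1}"
      then have "z t \<in> K" using convexD_alt[OF insert.prems(2) y(1) x(1), of t] by (simp add: z_def algebra_simps)
      then show "t \<in> {t. \<exists>B\<in>insert A F. z t \<in> B}" using insert.prems(4) by blast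
    qed
    ultimately have "finite {0..1::real}" by (rule finite_subset[rotated])
    then show ?thesis using infinite_Icc[of 0 "1::real"] by simp
  qed
qed

section \<open>Cells\<close>

definition slice :: "'n::finite gen set \<Rightarrow> (nat \<Rightarrow> real) \<Rightarrow> (real ^ 'n) set" where
  "slice S lam = {ev a | a. supp a \<subseteq> S \<and> (\<forall>g. 0 \<le> a g) \<and> mass a = lam}"

lemma sliceI: "supp a \<subseteq> S \<Longrightarrow> (\<And>g. 0 \<le> a g) \<Longrightarrow> mass a = lam \<Longrightarrow> ev a \<in> slice S lam"
  unfolding slice_def by blast

lemma sliceE:
  assumes "x \<in> slice S lam"
  obtains a where "x = ev a" "supp a \<subseteq> S" "\<And>g. 0 \<le> a g" "mass a = lam"
  using assms unfolding slice_def by blast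

lemma slice_mono: "Q \<subseteq> S \<Longrightarrow> slice Q lam \<subseteq> slice S lam"
  unfolding slice_def by blast

lemma slice_comb:
  assumes fS: "finite S" and a: "supp a \<subseteq> S" "\<And>g. 0 \<le> a g" "mass a = lam" and b: "supp b \<subseteq> S" "\<And>g. 0 \<le> b g" "mass b = lam"
    and t: "0 \<le> t" "t \<le> 1"
  shows "supp (\<lambda>g. (1 - t) * a g + t * b g) \<subseteq> supp a \<union> supp b \<and> (\<forall>g. 0 \<le> (1 - t) * a g + t * b g) \<and>
      mass (\<lambda>g. (1 - t) * a g + t * b g) = lam \<and> ev (\<lambda>g. (1 - t) * a g + t * b g) = (1 - t) *\<^sub>R ev a + t *\<^sub>R ev b"
proof -
  have fin: "finite (supp a)" "finite (supp b)" using a(1) b(1) fS finite_subset by blast+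
  have fin2: "finite (supp (\<lambda>g. (1 - t) * a g))" "finite (supp (\<lambda>g. t * b g))"
    using fin by (auto simp: supp_def elim!: rev_finite_subset)
  have "mass (\<lambda>g. (1 - t) * a g + t * b g) = lam"
    unfolding fun_eq_iff ev_add[OF fin2] ev_scale[OF fin(1)] ev_scale[OF fin(2)] a(3) b(3) by (simp add: algebra_simps)
  moreover have "ev (\<lambda>g. (1 - t) * a g + t * b g) = (1 - t) *\<^sub>R ev a + t *\<^sub>R ev b"
    unfolding ev_add[OF fin2] ev_scale[OF fin(1)] ev_scale[OF fin(2)] ..
  moreover have "0 \<le> (1 - t) * a g + t * b g" for g using a(2)[of g] b(2)[of g] t by simp
  ultimately show ?thesis by (auto simp: supp_def)
qed

lemma convex_slice:
  assumes "finite S"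
  shows "convex (slice S lam)"
  unfolding convex_alt
proof (intro ballI allI impI)
  fix x y t assume x: "x \<in> slice S lam" and y: "y \<in> slice S lam" and t: "0 \<le> (t::real) \<and> t \<le> 1"
  obtain a where a: "x = ev a" "supp a \<subseteq> S" "\<And>g. 0 \<le> a g" "mass a = lam" using x by (rule sliceE) blast
  obtain b where b: "y = ev b" "supp b \<subseteq> S" "\<And>g. 0 \<le> b g" "mass b = lam" using y by (rule sliceE) blast
  have c: "supp (\<lambda>g. (1 - t) * a g + t * b g) \<subseteq> supp a \<union> supp b \<and> (\<forall>g. 0 \<le> (1 - t) * a g + t * b g) \<and>
    mass (\<lambda>g. (1 - t) * a g + t * b g) = lam \<and> ev (\<lambda>g. (1 - t) * a g + t * b g) = (1 - t) *\<^sub>R ev a + t *\<^sub>R ev b"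
    by (rule slice_comb[OF assms]) (use a b t in auto)
  have "ev (\<lambda>g. (1 - t) * a g + t * b g) \<in> slice S lam"
    by (rule sliceI) (use c a(2) b(2) in auto)
  then show "(1 - t) *\<^sub>R x + t *\<^sub>R y \<in> slice S lam" using c a(1) b(1) by simp
qed

section \<open>Coordinates of a cell at one of its vertices\<close>

locale frame =
  fixes S :: "'n::finite gen set" and r :: nat and w :: "nat \<Rightarrow> 'n gen"
  assumes finS: "finite S" and lab: "\<And>g. g \<in> S \<Longrightarrow> snd g < r"
    and wS: "\<And>l. l < r \<Longrightarrow> w l \<in> S" and wl: "\<And>l. l < r \<Longrightarrow> snd (w l) = l"
begin

text \<open>\<open>w\<close> chooses one generator of each label and thereby a vertex of the cell.
  The generators not chosen index the edges \<open>E\<close> at this vertex: mass moves along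
  \<open>E g\<close> from the chosen generator of the label to \<open>g\<close>.\<close>

definition B where "B = S - w ` {..<r}"

definition E where "E g = fst g - fst (w (snd g))"

lemma finB: "finite B" and BS: "g \<in> B \<Longrightarrow> g \<in> S" and B_lab: "g \<in> B \<Longrightarrow> snd g < r"
  using finS lab by (auto simp: B_def)

lemma B_iff: "g \<in> S \<Longrightarrow> g \<in> B \<longleftrightarrow> g \<noteq> w (snd g)"
  using lab wl unfolding B_def by fastforce

lemma inj_w: "inj_on w {..<r}"
  by (rule inj_on_inverseI[of _ snd]) (use wl in auto)

lemma card_S: "card S = card B + r"
proof -
  have "w ` {..<r} \<subseteq> S" using wS by auto
  then have "card S = card (w ` {..<r}) + card (S - w ` {..<r})"
    using finS by (metis card_Diff_subset card_mono finite_subset le_add_diff_inverse)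
  then show ?thesis using card_image[OF inj_w] by (simp add: B_def)
qed

lemma class_split: "l < r \<Longrightarrow> {g\<in>S. snd g = l} = insert (w l) {g\<in>B. snd g = l}"
  using wS wl B_iff BS by fastforce

lemma mass_split:
  assumes "supp a \<subseteq> S" "l < r"
  shows "mass a l = a (w l) + (\<Sum>g\<in>{g\<in>B. snd g = l}. a g)"
proof -
  have "w l \<notin> {g\<in>B. snd g = l}" using assms(2) by (simp add: B_def)
  then show ?thesis unfolding mass_sum[OF finS assms(1)] class_split[OF assms(2)] using finB by simp
qed

lemma mass_high:
  assumes "supp a \<subseteq> S" "r \<le> l"
  shows "mass a l = 0"
proof -
  have "{g\<in>S. snd g = l} = {}" using lab assms(2) by fastforce
  then show ?thesis unfolding mass_sum[OF finS assms(1)] by (simp only: sum.empty)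
qed

lemma sum_S: "(\<Sum>g\<in>S. f g) = (\<Sum>l<r. f (w l)) + (\<Sum>g\<in>B. f g)" for f :: "'n gen \<Rightarrow> 'b::comm_monoid_add"
proof -
  have "S = w ` {..<r} \<union> B" "w ` {..<r} \<inter> B = {}" using wS by (auto simp: B_def)
  then have "(\<Sum>g\<in>S. f g) = (\<Sum>g\<in>w ` {..<r}. f g) + (\<Sum>g\<in>B. f g)"
    using finB by (metis finite_imageI finite_lessThan sum.union_disjoint)
  then show ?thesis by (simp add: sum.reindex[OF inj_w])
qed

lemma sum_B: "(\<Sum>l<r. \<Sum>g\<in>{g\<in>B. snd g = l}. f g) = (\<Sum>g\<in>B. f g)" for f :: "'n gen \<Rightarrow> 'b::comm_monoid_add"
  by (rule sum.group) (use finB B_lab in auto)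

text \<open>Given the masses, the coefficients of the chosen generators can be eliminated, and those
  on \<open>B\<close> remain as free coordinates.\<close>

lemma ev_rep:
  assumes a: "supp a \<subseteq> S"
  shows "ev a = (\<Sum>l<r. mass a l *\<^sub>R fst (w l)) + (\<Sum>g\<in>B. a g *\<^sub>R E g)"
proof -
  have "(\<Sum>l<r. a (w l) *\<^sub>R fst (w l)) = (\<Sum>l<r. mass a l *\<^sub>R fst (w l) - (\<Sum>g\<in>{g\<in>B. snd g = l}. a g *\<^sub>R fst (w (snd g))))"
  proof (rule sum.cong[OF refl])
    fix l assume "l \<in> {..<r}"
    then have l: "a (w l) = mass a l - (\<Sum>g\<in>{g\<in>B. snd g = l}. a g)" using mass_split[OF a, of l] by simp
    have "(\<Sum>g\<in>{g\<in>B. snd g = l}. a g *\<^sub>R fst (w (snd g))) = (\<Sum>g\<in>{g\<in>B. snd g = l}. a g) *\<^sub>R fst (w l)"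
      unfolding scaleR_sum_left by (rule sum.cong) auto
    then show "a (w l) *\<^sub>R fst (w l) = mass a l *\<^sub>R fst (w l) - (\<Sum>g\<in>{g\<in>B. snd g = l}. a g *\<^sub>R fst (w (snd g)))"
      unfolding l by (simp add: scaleR_diff_left)
  qed
  also have "\<dots> = (\<Sum>l<r. mass a l *\<^sub>R fst (w l)) - (\<Sum>g\<in>B. a g *\<^sub>R fst (w (snd g)))"
    unfolding sum_subtractf sum_B ..
  finally have 1: "(\<Sum>l<r. a (w l) *\<^sub>R fst (w l)) = (\<Sum>l<r. mass a l *\<^sub>R fst (w l)) - (\<Sum>g\<in>B. a g *\<^sub>R fst (w (snd g)))" .
  have "(\<Sum>g\<in>B. a g *\<^sub>R E g) = (\<Sum>g\<in>B. a g *\<^sub>R fst g) - (\<Sum>g\<in>B. a g *\<^sub>R fst (w (snd g)))"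
    unfolding sum_subtractf[symmetric] by (rule sum.cong) (auto simp: E_def scaleR_diff_right)
  then show ?thesis unfolding ev_sum[OF finS a] sum_S[of "\<lambda>g. a g *\<^sub>R fst g"] 1 by simp
qed

text \<open>The inverse of reading off coordinates: \<open>t\<close> prescribes the coefficients on
  \<open>B\<close>, and the chosen generators receive what the masses \<open>m\<close>
  leave.\<close>

definition lift :: "(nat \<Rightarrow> real) \<Rightarrow> ('n gen \<Rightarrow> real) \<Rightarrow> 'n gen \<Rightarrow> real" where
  "lift m t g = (if g \<in> B then t g else if g \<in> S then m (snd g) - (\<Sum>h\<in>{h\<in>B. snd h = snd g}. t h) else 0)"

lemma supp_lift: "supp (lift m t) \<subseteq> S"
  using BS by (auto simp: supp_def lift_def split: if_splits)

lemma lift_B: "g \<in> B \<Longrightarrow> lift m t g = t g"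
  by (simp add: lift_def)

lemma lift_w: "l < r \<Longrightarrow> lift m t (w l) = m l - (\<Sum>h\<in>{h\<in>B. snd h = l}. t h)"
  using wS wl by (simp add: lift_def B_def)

lemma mass_lift: "mass (lift m t) l = (if l < r then m l else 0)"
proof (cases "l < r")
  case True
  have "(\<Sum>g\<in>{g\<in>B. snd g = l}. lift m t g) = (\<Sum>g\<in>{g\<in>B. snd g = l}. t g)"
    by (rule sum.cong) (auto simp: lift_B)
  then show ?thesis using True mass_split[OF supp_lift True] lift_w[OF True] by simp
next
  case False
  then show ?thesis using mass_high[OF supp_lift] by simp
qed

lemma ev_lift: "ev (lift m t) = (\<Sum>l<r. m l *\<^sub>R fst (w l)) + (\<Sum>g\<in>B. t g *\<^sub>R E g)"
proof -
  have "(\<Sum>l<r. mass (lift m t) l *\<^sub>R fst (w l)) = (\<Sum>l<r. m l *\<^sub>R fst (w l))"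
    by (rule sum.cong) (auto simp: mass_lift)
  moreover have "(\<Sum>g\<in>B. lift m t g *\<^sub>R E g) = (\<Sum>g\<in>B. t g *\<^sub>R E g)"
    by (rule sum.cong) (auto simp: lift_B)
  ultimately show ?thesis unfolding ev_rep[OF supp_lift] by simp
qed

lemma eq_on_B:
  assumes "supp a \<subseteq> S" "supp b \<subseteq> S" "mass a = mass b" "\<And>g. g \<in> B \<Longrightarrow> a g = b g"
  shows "a = b"
proof
  fix g
  consider "g \<notin> S" | "g \<in> B" | l where "g = w l" "l < r" unfolding B_def by blast
  then show "a g = b g"
  proof cases
    case 1
    then show ?thesis using assms(1,2) by (metis subsetD supp_iff)
  next
    case 2
    then show ?thesis by (rule assms(4))
  next
    case 3
    have "(\<Sum>g\<in>{g\<in>B. snd g = l}. a g) = (\<Sum>g\<in>{g\<in>B. snd g = l}. b g)" by (rule sum.cong) (use assms(4) in auto)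
    then show ?thesis using mass_split[OF assms(1) 3(2)] mass_split[OF assms(2) 3(2)] assms(3) 3(1) by simp
  qed
qed

text \<open>A combination of edges is a combination of generators with all masses zero. If its value
  is integral, its fractional parts form a box point and therefore vanish.\<close>

lemma saturated_edges:
  assumes i: "\<And>g. g \<in> S \<Longrightarrow> int_vec (fst g)" and b: "box_points S = {\<lambda>_. 0}"
  shows "saturated B E"
  unfolding saturated_def
proof (intro allI impI ballI)
  fix c g assume c: "int_vec (\<Sum>g\<in>B. c g *\<^sub>R E g)" and g: "g \<in> B"
  have "(\<lambda>g. frac (lift (\<lambda>_. 0) c g)) \<in> box_points S"
    by (rule frac_box[OF finS i supp_lift]) (use c in \<open>auto simp: ev_lift mass_lift\<close>)
  then have "(\<lambda>g. frac (lift (\<lambda>_. 0) c g)) = (\<lambda>_. 0)" using b by blast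
  then have "frac (lift (\<lambda>_. 0) c g) = 0" by (rule fun_cong)
  then show "c g \<in> \<int>" using g by (simp add: lift_B frac_eq_0_iff)
qed

lemma int_vec_E: "(\<And>g. g \<in> S \<Longrightarrow> int_vec (fst g)) \<Longrightarrow> g \<in> B \<Longrightarrow> int_vec (E g)"
  unfolding E_def using BS wS B_lab by (intro int_vec_diff) auto

end

text \<open>The forms \<open>u\<close> are the integral coordinates dual to the edges. In these
  coordinates the cell is the product over \<open>l\<close> of the simplices given by nonnegative
  coordinates of label \<open>l\<close> with sum at most \<open>lam l\<close>.\<close>

locale cell = frame S r w for S :: "'n::finite gen set" and r w +
  fixes lam :: "nat \<Rightarrow> real" and u :: "'n gen \<Rightarrow> int ^ 'n"
  assumes lam_pos: "\<And>l. l < r \<Longrightarrow> 0 < lam l" and lam_zero: "\<And>l. r \<le> l \<Longrightarrow> lam l = 0"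
    and intS: "\<And>g. g \<in> S \<Longrightarrow> int_vec (fst g)"
    and dual: "\<And>g g'. g \<in> B \<Longrightarrow> g' \<in> B \<Longrightarrow> int_form (u g) (E g') = (if g = g' then 1 else 0)"
begin

definition base where "base = (\<Sum>l<r. lam l *\<^sub>R fst (w l))"

lemma form_sum: "g \<in> B \<Longrightarrow> int_form (u g) (\<Sum>h\<in>B. t h *\<^sub>R E h) = t g"
proof -
  assume g: "g \<in> B"
  have "int_form (u g) (\<Sum>h\<in>B. t h *\<^sub>R E h) = (\<Sum>h\<in>B. if g = h then t h else 0)"
    unfolding int_form_sum int_form_scale by (rule sum.cong) (use dual g in auto)
  then show ?thesis using g finB by simp
qed

lemma ev_base: "supp a \<subseteq> S \<Longrightarrow> mass a = lam \<Longrightarrow> ev a = base + (\<Sum>g\<in>B. a g *\<^sub>R E g)"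
  using ev_rep[of a] by (simp add: base_def)

lemma form_ev: "supp a \<subseteq> S \<Longrightarrow> mass a = lam \<Longrightarrow> g \<in> B \<Longrightarrow> int_form (u g) (ev a - base) = a g"
  using ev_base form_sum by simp

lemma slice_unique:
  assumes "supp a \<subseteq> S" "supp b \<subseteq> S" "mass a = lam" "mass b = lam" "ev a = ev b"
  shows "a = b"
proof (rule eq_on_B[OF assms(1,2)])
  show "mass a = mass b" using assms by simp
  show "a g = b g" if "g \<in> B" for g
    using form_ev[OF assms(1,3) that] form_ev[OF assms(2,4) that] assms(5) by simp
qed

lemma lift_slice:
  assumes "\<And>g. g \<in> B \<Longrightarrow> 0 \<le> t g" "\<And>l. l < r \<Longrightarrow> (\<Sum>g\<in>{g\<in>B. snd g = l}. t g) \<le> lam l"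
  shows "base + (\<Sum>g\<in>B. t g *\<^sub>R E g) \<in> slice S lam"
proof -
  have "mass (lift lam t) = lam" using lam_zero by (auto simp: mass_lift fun_eq_iff)
  moreover have "0 \<le> lift lam t g" for g
    using assms lab by (auto simp: lift_def)
  ultimately have "ev (lift lam t) \<in> slice S lam" using supp_lift by (intro sliceI) auto
  then show ?thesis by (simp add: ev_lift base_def)
qed

lemma slice_rep:
  assumes "x \<in> slice S lam"
  obtains t where "\<And>g. 0 \<le> t g" "\<And>l. l < r \<Longrightarrow> (\<Sum>g\<in>{g\<in>B. snd g = l}. t g) \<le> lam l"
    "x = base + (\<Sum>g\<in>B. t g *\<^sub>R E g)" "supp t \<subseteq> S" "mass t = lam" "x = ev t"
proof -
  obtain a where a: "x = ev a" "supp a \<subseteq> S" "\<And>g. 0 \<le> a g" "mass a = lam" using assms by (rule sliceE) blast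
  have "(\<Sum>g\<in>{g\<in>B. snd g = l}. a g) \<le> lam l" if "l < r" for l
    using mass_split[OF a(2) that] a(3)[of "w l"] a(4) by simp
  then show ?thesis using that[of a] a ev_base[OF a(2,4)] by simp
qed

lemma base_slice: "base \<in> slice S lam"
  using lift_slice[of "\<lambda>_. 0"] lam_pos by (simp add: less_imp_le)

lemma edge_slice:
  assumes "g \<in> B" "0 \<le> t" "t \<le> lam (snd g)"
  shows "base + t *\<^sub>R E g \<in> slice S lam"
proof -
  have "base + (\<Sum>h\<in>B. (if h = g then t else 0) *\<^sub>R E h) \<in> slice S lam"
  proof (rule lift_slice)
    show "0 \<le> (if h = g then t else 0)" for h using assms by simp
    show "(\<Sum>h\<in>{h\<in>B. snd h = l}. if h = g then t else 0) \<le> lam l" if "l < r" for l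
      using assms finB lam_pos[OF that] by auto
  qed
  moreover have "(\<Sum>h\<in>B. (if h = g then t else 0) *\<^sub>R E h) = t *\<^sub>R E g"
    using assms(1) finB by (simp add: if_distrib[of "\<lambda>t. t *\<^sub>R _"] cong: if_cong)
  ultimately show ?thesis by simp
qed

lemma inj_E: "inj_on E B"
proof (rule inj_onI)
  fix g g' assume g: "g \<in> B" "g' \<in> B" "E g = E g'"
  have "int_form (u g) (E g) = 1" using dual g(1) by simp
  then show "g = g'" using dual[OF g(1,2)] g(3) by (simp split: if_splits)
qed

lemma indep_E: "independent (E ` B)"
proof (rule independent_if_scalars_zero)
  show "finite (E ` B)" using finB by simp
  fix f x assume f: "(\<Sum>x\<in>E ` B. f x *\<^sub>R x) = 0" and x: "x \<in> E ` B"
  obtain g where g: "g \<in> B" "x = E g" using x by blast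
  have "(\<Sum>h\<in>B. f (E h) *\<^sub>R E h) = 0" using f by (simp add: sum.reindex[OF inj_E])
  then show "f x = 0" using form_sum[OF g(1), of "\<lambda>h. f (E h)"] g(2) by (simp add: int_form_zero)
qed

lemma span_slice_diff: "span ((+) (- base) ` slice S lam) = span (E ` B)"
proof
  show "span ((+) (- base) ` slice S lam) \<subseteq> span (E ` B)"
  proof (rule span_minimal[OF _ subspace_span])
    show "(+) (- base) ` slice S lam \<subseteq> span (E ` B)"
    proof
      fix y assume "y \<in> (+) (- base) ` slice S lam"
      then obtain x where x: "x \<in> slice S lam" "y = - base + x" by blast
      obtain t where "x = base + (\<Sum>g\<in>B. t g *\<^sub>R E g)" using x(1) by (rule slice_rep) blast
      then show "y \<in> span (E ` B)" unfolding x(2) by (auto intro: span_sum span_scale span_base)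
    qed
  qed
  show "span (E ` B) \<subseteq> span ((+) (- base) ` slice S lam)"
  proof (rule span_minimal[OF _ subspace_span])
    show "E ` B \<subseteq> span ((+) (- base) ` slice S lam)"
    proof
      fix y assume "y \<in> E ` B"
      then obtain g where g: "g \<in> B" "y = E g" by blast
      have l: "0 < lam (snd g)" using lam_pos B_lab g by blast
      have "base + lam (snd g) *\<^sub>R E g \<in> slice S lam" using edge_slice[OF g(1)] l by simp
      then have "lam (snd g) *\<^sub>R E g \<in> (+) (- base) ` slice S lam" by force
      then have "(1 / lam (snd g)) *\<^sub>R lam (snd g) *\<^sub>R E g \<in> span ((+) (- base) ` slice S lam)"
        by (intro span_scale span_base)
      then show "y \<in> span ((+) (- base) ` slice S lam)" using l g(2) by simp
    qed
  qed
qed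

lemma affine_hull_slice: "affine hull (slice S lam) = (+) base ` span (E ` B)"
  using affine_hull_span_gen[of base "slice S lam"] base_slice span_slice_diff by (simp add: hull_inc)

lemma aff_dim_slice: "aff_dim (slice S lam) = int (card S) - int r"
proof -
  have "aff_dim (slice S lam) = int (dim ((+) (- base) ` slice S lam))"
    by (rule aff_dim_eq_dim) (simp add: base_slice hull_inc)
  also have "dim ((+) (- base) ` slice S lam) = dim (E ` B)" by (metis dim_span span_slice_diff)
  also have "dim (E ` B) = card B" using dim_eq_card_independent[OF indep_E] card_image[OF inj_E] by simp
  finally show ?thesis using card_S by simp
qed

lemma direction_slice: "direction_space (slice S lam) = span (E ` B)"
proof
  show "direction_space (slice S lam) \<subseteq> span (E ` B)"
    unfolding direction_space_def affine_hull_slice by (auto intro: span_diff)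
  show "span (E ` B) \<subseteq> direction_space (slice S lam)"
  proof
    fix v assume v: "v \<in> span (E ` B)"
    have "v = (base + v) - (base + 0)" by simp
    then show "v \<in> direction_space (slice S lam)"
      unfolding direction_space_def affine_hull_slice using v span_zero by blast
  qed
qed

text \<open>Dropping generators that were not chosen keeps the vertex and the dual forms, so faces
  through the vertex are cells in their own right.\<close>

lemma subframe:
  assumes "Z \<subseteq> B"
  shows "cell (S - Z) r w lam u" "frame.B (S - Z) r w = B - Z"
proof -
  have f: "frame (S - Z) r w"
    using finS lab wS wl assms by unfold_locales (auto simp: B_def)
  show b: "frame.B (S - Z) r w = B - Z" unfolding frame.B_def[OF f] B_def by blast
  show "cell (S - Z) r w lam u"
    by (rule cell.intro[OF f], unfold cell_axioms_def b) (use lam_pos lam_zero intS dual in auto)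
qed

text \<open>Coefficients in a cell are unique. If an inner point of a segment has none outside
  \<open>Q\<close>, the nonnegative coefficients of the two ends average to zero there and so
  vanish.\<close>

lemma face_slice:
  assumes "Q \<subseteq> S"
  shows "slice Q lam face_of slice S lam"
  unfolding face_of_def
proof (intro conjI ballI impI)
  show "slice Q lam \<subseteq> slice S lam" by (rule slice_mono[OF assms])
  show "convex (slice Q lam)" by (rule convex_slice[OF finite_subset[OF assms finS]])
  fix x y z assume x: "x \<in> slice S lam" and y: "y \<in> slice S lam" and z: "z \<in> slice Q lam" and o: "z \<in> open_segment x y"
  obtain a where a: "x = ev a" "supp a \<subseteq> S" "\<And>g. 0 \<le> a g" "mass a = lam" using x by (rule sliceE) blast
  obtain b where b: "y = ev b" "supp b \<subseteq> S" "\<And>g. 0 \<le> b g" "mass b = lam" using y by (rule sliceE) blast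
  obtain d where d: "z = ev d" "supp d \<subseteq> Q" "\<And>g. 0 \<le> d g" "mass d = lam" using z by (rule sliceE) blast
  obtain t where t: "0 < t" "t < 1" "z = (1 - t) *\<^sub>R x + t *\<^sub>R y" using o by (auto simp: in_segment)
  have c: "supp (\<lambda>g. (1 - t) * a g + t * b g) \<subseteq> supp a \<union> supp b \<and> (\<forall>g. 0 \<le> (1 - t) * a g + t * b g) \<and>
      mass (\<lambda>g. (1 - t) * a g + t * b g) = lam \<and> ev (\<lambda>g. (1 - t) * a g + t * b g) = (1 - t) *\<^sub>R ev a + t *\<^sub>R ev b"
    by (rule slice_comb[OF finS]) (use a b t in auto)
  have "d = (\<lambda>g. (1 - t) * a g + t * b g)"
    by (rule slice_unique) (use c d a b t assms in auto)
  then have z0: "(1 - t) * a g + t * b g = 0" if "g \<notin> Q" for g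
    using d(2) that by (metis subsetD supp_iff)
  have ab: "a g = 0 \<and> b g = 0" if "g \<notin> Q" for g
  proof -
    have "0 \<le> (1 - t) * a g" "0 \<le> t * b g" using a(3)[of g] b(3)[of g] t by auto
    then have "(1 - t) * a g = 0" "t * b g = 0" using z0[OF that] by linarith+
    then show ?thesis using t by simp
  qed
  then have "supp a \<subseteq> Q" "supp b \<subseteq> Q" unfolding supp_def by blast+
  then show "x \<in> slice Q lam" "y \<in> slice Q lam" using a b sliceI by blast+
qed

end

lemma rat_sub_int: "rat_subspace V \<Longrightarrow> t \<in> \<int> \<Longrightarrow> x \<in> V \<Longrightarrow> t * x \<in> V"
  using rat_sub_closed(1)[of V x "of_int _"] by (auto elim!: Ints_cases)

lemma rat_sub_sum: "rat_subspace V \<Longrightarrow> (\<And>i. i \<in> A \<Longrightarrow> f i \<in> V) \<Longrightarrow> sum f A \<in> V"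
  by (induction A rule: infinite_finite_induct) (auto intro: rat_sub_closed)

section \<open>Cells are polytopes over \<open>V\<close> and polysimplices\<close>

context cell
begin

lemma bounded_slice: "bounded (slice S lam)"
  unfolding bounded_iff
proof (intro exI ballI)
  fix x assume "x \<in> slice S lam"
  then obtain a where a: "x = ev a" "supp a \<subseteq> S" "\<And>g. 0 \<le> a g" "mass a = lam" by (rule sliceE) blast
  have "norm x \<le> (\<Sum>g\<in>S. norm (a g *\<^sub>R fst g))" unfolding a(1) ev_sum[OF finS a(2)] by (rule norm_sum)
  also have "\<dots> \<le> (\<Sum>g\<in>S. lam (snd g) * norm (fst g))"
  proof (rule sum_mono)
    fix g assume g: "g \<in> S"
    have "a g \<le> (\<Sum>h\<in>{h\<in>S. snd h = snd g}. a h)" by (rule member_le_sum) (use g finS a(3) in auto)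
    also have "\<dots> = lam (snd g)" unfolding mass_sum[OF finS a(2), symmetric] a(4) ..
    finally show "norm (a g *\<^sub>R fst g) \<le> lam (snd g) * norm (fst g)" using a(3)[of g] by (simp add: mult_right_mono)
  qed
  finally show "norm x \<le> (\<Sum>g\<in>S. lam (snd g) * norm (fst g))" .
qed

lemma ZV_slice:
  assumes V: "rat_subspace V" and lamV: "\<And>l. l < r \<Longrightarrow> lam l \<in> V"
  shows "ZV_polytope V (slice S lam)"
proof -
  \<comment> \<open>\<open>f g\<close> is the coordinate belonging to \<open>g\<close>,
    \<open>m l\<close> the mass left for the chosen generator of label \<open>l\<close>, and the
    functions \<open>k i\<close>, imposed with both signs, cut out the affine hull. Constants lie in
    \<open>V\<close> because \<open>base\<close> does, and the coefficients of \<open>k i\<close>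
    are integral because the edges are.\<close>
  define f where "f g x = int_form (u g) x - int_form (u g) base" for g x
  define m where "m l x = lam l - (\<Sum>g\<in>{g\<in>B. snd g = l}. f g x)" for l x
  define k where "k i x = x $ i - base $ i - (\<Sum>g\<in>B. E g $ i * f g x)" for i x
  have wi: "fst (w l) $ i \<in> \<int>" if "l < r" for l i using intS[OF wS[OF that]] by (simp add: int_vec_def)
  have bV: "base $ i \<in> V" for i
    unfolding base_def by (simp, rule rat_sub_sum[OF V]) (use rat_sub_int[OF V wi lamV] in \<open>auto simp: mult.commute\<close>)
  have uV: "int_form (u g) base \<in> V" for g
    unfolding int_form_def by (rule rat_sub_sum[OF V], rule rat_sub_int[OF V _ bV]) simp
  have fV: "V_affine V (f g)" for g
    unfolding f_def by (intro V_affine_diff[OF V] V_affine_form[OF V] V_affine_const uV)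
  have mV: "V_affine V (m l)" if "l < r" for l
    unfolding m_def by (intro V_affine_diff[OF V] V_affine_sum[OF V] V_affine_const lamV that fV)
  have kV: "V_affine V (k i)" for i
    unfolding k_def
    by (intro V_affine_diff[OF V] V_affine_sum[OF V] V_affine_const V_affine_coord[OF V] V_affine_mult[OF V fV] bV)
      (use int_vec_E[OF intS] in \<open>auto simp: int_vec_def\<close>)
  have kV': "V_affine V (\<lambda>x. - k i x)" for i
    using V_affine_mult[OF V kV, of "-1" i] by simp
  define F where "F = f ` B \<union> m ` {..<r} \<union> range k \<union> range (\<lambda>i x. - k i x)"
  have "slice S lam = {x. \<forall>h\<in>F. 0 \<le> h x}"
  proof
    show "slice S lam \<subseteq> {x. \<forall>h\<in>F. 0 \<le> h x}"
    proof
      fix x assume "x \<in> slice S lam"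
      then obtain t where t: "\<And>g. 0 \<le> t g" "\<And>l. l < r \<Longrightarrow> (\<Sum>g\<in>{g\<in>B. snd g = l}. t g) \<le> lam l"
        "x = base + (\<Sum>g\<in>B. t g *\<^sub>R E g)" by (rule slice_rep) blast
      have ft: "f g x = t g" if "g \<in> B" for g
        using form_sum[OF that, of t] t(3) by (simp add: f_def int_form_add)
      have "(\<Sum>g\<in>{g\<in>B. snd g = l}. f g x) = (\<Sum>g\<in>{g\<in>B. snd g = l}. t g)" for l
        by (rule sum.cong) (auto simp: ft)
      moreover have kk: "(\<Sum>g\<in>B. E g $ i * f g x) = (\<Sum>g\<in>B. t g *\<^sub>R E g) $ i" for i
        by (simp add: ft mult.commute)
      ultimately have mk: "0 \<le> m l x" if "l < r" for l
        using t(2)[OF that] by (simp add: m_def)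
      have k0: "k i x = 0" for i
        unfolding k_def kk using t(3) by simp
      show "x \<in> {x. \<forall>h\<in>F. 0 \<le> h x}"
        unfolding F_def using mk(1) k0 ft t(1) by auto
    qed
    show "{x. \<forall>h\<in>F. 0 \<le> h x} \<subseteq> slice S lam"
    proof
      fix x assume "x \<in> {x. \<forall>h\<in>F. 0 \<le> h x}"
      then have x: "\<forall>h\<in>F. 0 \<le> h x" by simp
      have f0: "0 \<le> f g x" if "g \<in> B" for g using x that unfolding F_def by blast
      have m0: "0 \<le> m l x" if "l < r" for l using x that unfolding F_def by blast
      have k0: "k i x = 0" for i
      proof -
        have "k i \<in> F" "(\<lambda>x. - k i x) \<in> F" unfolding F_def by blast+
        then have "0 \<le> k i x" "0 \<le> - k i x" using x by (blast, force)
        then show ?thesis by simp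
      qed
      have "x = base + (\<Sum>g\<in>B. f g x *\<^sub>R E g)"
        using k0 by (simp add: vec_eq_iff k_def algebra_simps)
      moreover have "base + (\<Sum>g\<in>B. f g x *\<^sub>R E g) \<in> slice S lam"
        by (rule lift_slice) (use f0 m0 in \<open>auto simp: m_def\<close>)
      ultimately show "x \<in> slice S lam" by simp
    qed
  qed
  moreover have "finite F" unfolding F_def using finB by simp
  moreover have "\<forall>h\<in>F. V_affine V h" unfolding F_def using fV mV kV kV' by auto
  ultimately show ?thesis unfolding ZV_polytope_def using base_slice bounded_slice by blast
qed

text \<open>The summand of label \<open>l\<close> is spanned by the points
  \<open>lam l *\<^sub>R fst g\<close>. An affine relation among them is a combination with all
  masses zero and value zero, so independence of the edges kills it. The dimensions add up because
  both sides are \<open>card S - r\<close>.\<close>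

lemma polysimplex_slice: "polysimplex (slice S lam)"
proof -
  define Sl where "Sl l = {g\<in>S. snd g = l}" for l
  define q where "q l g = lam l *\<^sub>R fst g" for l and g :: "'n gen"
  define A where "A l = convex hull (q l ` Sl l)" for l
  have fSl: "finite (Sl l)" for l using finS by (simp add: Sl_def)
  have wSl: "w l \<in> Sl l" if "l < r" for l using wS wl that by (simp add: Sl_def)
  have inj: "inj_on (q l) (Sl l)" if "l < r" for l
  proof (rule inj_onI)
    fix g g' assume g: "g \<in> Sl l" "g' \<in> Sl l" "q l g = q l g'"
    have "fst g = fst g'" using g(3) lam_pos[OF that] by (simp add: q_def)
    then show "g = g'" using g(1,2) by (auto simp: Sl_def prod_eq_iff)
  qed
  have ind: "\<not> affine_dependent (q l ` Sl l)" if l: "l < r" for l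
  proof
    assume "affine_dependent (q l ` Sl l)"
    then obtain U v where U: "sum U (q l ` Sl l) = 0" "v \<in> q l ` Sl l" "U v \<noteq> 0" "(\<Sum>v\<in>q l ` Sl l. U v *\<^sub>R v) = 0"
      using affine_dependent_explicit_finite[OF finite_imageI[OF fSl]] by blast
    define c where "c g = (if g \<in> Sl l then U (q l g) else 0)" for g
    have sc: "supp c \<subseteq> S" by (auto simp: c_def supp_def Sl_def)
    have sc': "supp c \<subseteq> Sl l" by (auto simp: c_def supp_def)
    have s1: "(\<Sum>g\<in>Sl l. U (q l g)) = 0" using U(1) by (simp add: sum.reindex[OF inj[OF l]])
    have s2: "(\<Sum>g\<in>Sl l. U (q l g) *\<^sub>R q l g) = 0" using U(4) by (simp add: sum.reindex[OF inj[OF l]])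
    have "lam l *\<^sub>R ev c = (\<Sum>g\<in>Sl l. U (q l g) *\<^sub>R q l g)"
      unfolding ev_sum[OF fSl sc'] scaleR_sum_right by (rule sum.cong) (auto simp: c_def q_def mult.commute)
    then have e: "ev c = 0" using s2 lam_pos[OF l] by simp
    have m: "mass c l' = 0" for l'
    proof (cases "l' = l")
      case True
      have "{g\<in>Sl l. snd g = l} = Sl l" by (auto simp: Sl_def)
      then have "mass c l = (\<Sum>g\<in>Sl l. c g)" unfolding mass_sum[OF fSl sc'] by simp
      also have "\<dots> = (\<Sum>g\<in>Sl l. U (q l g))" by (rule sum.cong) (auto simp: c_def)
      finally show ?thesis using s1 True by simp
    next
      case False
      then have "{g\<in>Sl l. snd g = l'} = {}" by (auto simp: Sl_def)
      then show ?thesis unfolding mass_sum[OF fSl sc'] by (simp only: sum.empty)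
    qed
    have "(\<Sum>g\<in>B. c g *\<^sub>R E g) = 0" using ev_rep[OF sc] e m by simp
    then have "c g = 0" if "g \<in> B" for g using form_sum[OF that, of c] by (simp add: int_form_zero)
    moreover have z: "supp (\<lambda>_::'n gen. 0 :: real) \<subseteq> S" "mass (\<lambda>_::'n gen. 0 :: real) l' = 0" for l' by (auto simp: supp_def mass_def)
    moreover have "mass c = mass (\<lambda>_::'n gen. 0 :: real)" unfolding fun_eq_iff m z(2) by simp
    ultimately have "c = (\<lambda>_. 0)" by (intro eq_on_B[OF sc]) auto
    then show False using U(2,3) by (auto simp: c_def fun_eq_iff) (metis)
  qed
  have card: "card (q l ` Sl l) = card (Sl l)" if "l < r" for l using card_image[OF inj[OF that]] .
  have pos: "0 < card (Sl l)" if "l < r" for l using wSl[OF that] fSl card_gt_0_iff by blast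
  have simp: "(int (card (Sl l)) - 1) simplex A l" if "l < r" for l
    unfolding simplex_def A_def using ind[OF that] card[OF that] by auto
  have dimA: "aff_dim (A l) = int (card (Sl l)) - 1" if "l < r" for l
    using aff_dim_simplex[OF simp[OF that]] .
  have "card S = (\<Sum>l<r. card (Sl l))"
  proof -
    have "(\<Sum>l<r. \<Sum>g\<in>{g\<in>S. snd g = l}. 1::nat) = (\<Sum>g\<in>S. 1)" by (rule sum.group) (use finS lab in auto)
    then show ?thesis by (simp add: Sl_def)
  qed
  then have d: "(\<Sum>l<r. aff_dim (A l)) = aff_dim (slice S lam)"
    unfolding aff_dim_slice using dimA by (simp add: sum_subtractf)
  have "slice S lam = {sum s {..<r} | s. \<forall>l\<in>{..<r}. s l \<in> A l}"
  proof (intro set_eqI iffI)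
    fix x assume "x \<in> slice S lam"
    then obtain a where a: "x = ev a" "supp a \<subseteq> S" "\<And>g. 0 \<le> a g" "mass a = lam" by (rule sliceE) blast
    define s where "s l = (\<Sum>g\<in>Sl l. a g *\<^sub>R fst g)" for l
    have "s l \<in> A l" if l: "l < r" for l
    proof -
      have "(\<Sum>g\<in>Sl l. a g / lam l) = 1"
        using mass_sum[OF finS a(2), of l] a(4) lam_pos[OF l] by (simp add: sum_divide_distrib[symmetric] Sl_def)
      then have "(\<Sum>g\<in>Sl l. (a g / lam l) *\<^sub>R q l g) \<in> A l"
        unfolding A_def by (intro convex_sum[OF fSl convex_convex_hull])
          (use a(3) lam_pos[OF l] in \<open>auto intro!: hull_inc\<close>)
      moreover have "(\<Sum>g\<in>Sl l. (a g / lam l) *\<^sub>R q l g) = s l"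
        unfolding s_def by (rule sum.cong) (use lam_pos[OF l] in \<open>auto simp: q_def\<close>)
      ultimately show ?thesis by simp
    qed
    moreover have "x = (\<Sum>l<r. s l)"
      unfolding a(1) ev_sum[OF finS a(2)] s_def Sl_def by (rule sum.group[symmetric]) (use finS lab in auto)
    ultimately show "x \<in> {sum s {..<r} | s. \<forall>l\<in>{..<r}. s l \<in> A l}" by auto
  next
    fix x assume "x \<in> {sum s {..<r} | s. \<forall>l\<in>{..<r}. s l \<in> A l}"
    then obtain s where s: "x = sum s {..<r}" "\<forall>l\<in>{..<r}. s l \<in> A l" by blast
    have "\<exists>U. (\<forall>g\<in>Sl l. 0 \<le> U g) \<and> sum U (Sl l) = 1 \<and> (\<Sum>g\<in>Sl l. U g *\<^sub>R q l g) = s l" if l: "l < r" for l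
    proof -
      obtain U where U: "\<forall>v\<in>q l ` Sl l. 0 \<le> U v" "sum U (q l ` Sl l) = 1" "(\<Sum>v\<in>q l ` Sl l. U v *\<^sub>R v) = s l"
        using s(2) l unfolding A_def convex_hull_finite[OF finite_imageI[OF fSl]] by blast
      show ?thesis by (rule exI[of _ "\<lambda>g. U (q l g)"]) (use U in \<open>auto simp: sum.reindex[OF inj[OF l]]\<close>)
    qed
    then obtain U where U: "\<And>l g. l < r \<Longrightarrow> g \<in> Sl l \<Longrightarrow> 0 \<le> U l g" "\<And>l. l < r \<Longrightarrow> sum (U l) (Sl l) = 1"
      "\<And>l. l < r \<Longrightarrow> (\<Sum>g\<in>Sl l. U l g *\<^sub>R q l g) = s l" by metis
    define a where "a g = (if g \<in> S then lam (snd g) * U (snd g) g else 0)" for g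
    have sa: "supp a \<subseteq> S" by (auto simp: a_def supp_def)
    have "0 \<le> a g" for g
      using U(1)[of "snd g" g] lab[of g] lam_pos[of "snd g"] by (auto simp: a_def Sl_def less_imp_le)
    moreover have "mass a = lam"
    proof
      fix l
      show "mass a l = lam l"
      proof (cases "l < r")
        case True
        have "mass a l = (\<Sum>g\<in>Sl l. lam l * U l g)"
          unfolding mass_sum[OF finS sa] Sl_def by (rule sum.cong) (auto simp: a_def)
        then show ?thesis using U(2)[OF True] by (simp add: sum_distrib_left[symmetric])
      next
        case False
        then show ?thesis using mass_high[OF sa] lam_zero by simp
      qed
    qed
    ultimately have "ev a \<in> slice S lam" using sa by (intro sliceI)
    moreover have "ev a = x"
    proof -
      have "ev a = (\<Sum>l<r. \<Sum>g\<in>Sl l. a g *\<^sub>R fst g)"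
        unfolding ev_sum[OF finS sa] Sl_def by (rule sum.group[symmetric]) (use finS lab in auto)
      also have "\<dots> = (\<Sum>l<r. s l)"
      proof (rule sum.cong[OF refl])
        fix l assume "l \<in> {..<r}"
        then have l: "l < r" by simp
        show "(\<Sum>g\<in>Sl l. a g *\<^sub>R fst g) = s l"
          unfolding U(3)[OF l, symmetric] by (rule sum.cong) (auto simp: a_def q_def Sl_def mult.commute)
      qed
      finally show ?thesis using s(1) by simp
    qed
    ultimately show "x \<in> slice S lam" by simp
  qed
  then have "slice S lam = (\<Sum>l<r. A l)" using set_sum_alt[of "{..<r}" A] by simp
  moreover have "\<forall>l<r. \<exists>m\<ge>0. m simplex A l" using simp pos by (metis int_one_le_iff_zero_less diff_ge_0_iff_ge of_nat_0_less_iff)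
  ultimately show ?thesis unfolding polysimplex_def using d by blast
qed

end

section \<open>Facet normals at the base vertex\<close>

context cell
begin

definition dform where "dform q = restrict (int_form q) (direction_space (slice S lam))"

lemma dform_lattice: "dform q \<in> form_lattice (slice S lam)"
  unfolding form_lattice_def dform_def by blast

lemma dform_eq: "x \<in> span (E ` B) \<Longrightarrow> dform q x = int_form q x"
  by (simp add: dform_def direction_slice)

lemma E_span: "g \<in> B \<Longrightarrow> E g \<in> span (E ` B)"
  by (simp add: span_base)

lemma diff_span: "x \<in> slice S lam \<Longrightarrow> y \<in> slice S lam \<Longrightarrow> x - y \<in> span (E ` B)"
  unfolding direction_slice[symmetric] direction_space_def
  using hull_inc[of x "slice S lam" affine] hull_inc[of y "slice S lam" affine] by blast

lemma form_expand:
  assumes "x \<in> span (E ` B)"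
  shows "int_form q x = (\<Sum>g\<in>B. int_form q (E g) * int_form (u g) x)"
proof -
  obtain c where "x = (\<Sum>v\<in>E ` B. c v *\<^sub>R v)" using assms finB by (auto simp: span_finite)
  then have x: "x = (\<Sum>g\<in>B. c (E g) *\<^sub>R E g)" by (simp add: sum.reindex[OF inj_E])
  have "int_form q x = (\<Sum>g\<in>B. c (E g) * int_form q (E g))" unfolding x int_form_sum int_form_scale ..
  also have "\<dots> = (\<Sum>g\<in>B. int_form q (E g) * int_form (u g) x)"
    by (rule sum.cong) (auto simp: x form_sum)
  finally show ?thesis .
qed

lemma form_E_int: "g \<in> B \<Longrightarrow> int_form q (E g) = of_int \<lfloor>int_form q (E g)\<rfloor>"
  using int_form_Ints[OF int_vec_E[OF intS]] by simp

text \<open>Integral forms are integral on the edge \<open>E g\<close>, where \<open>u g\<close> has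
  value one; a factor of \<open>u g\<close> must therefore be a unit.\<close>

lemma primitive_dual:
  assumes g: "g \<in> B"
  shows "primitive_form (slice S lam) (dform (u g))"
  unfolding primitive_form_def
proof (intro conjI allI ballI impI dform_lattice)
  fix c m assume m: "m \<in> form_lattice (slice S lam)"
    and e: "dform (u g) = restrict (\<lambda>x. of_int c * m x) (direction_space (slice S lam))"
  obtain q where q: "m = dform q" using m unfolding form_lattice_def dform_def by blast
  have "dform (u g) (E g) = of_int c * dform q (E g)" unfolding e q by (simp add: direction_slice E_span g)
  then have "1 = of_int c * int_form q (E g)" using dual[OF g g] by (simp add: dform_eq E_span g)
  then have "real_of_int (c * \<lfloor>int_form q (E g)\<rfloor>) = 1" using form_E_int[OF g, of q] by simp
  then have "c * \<lfloor>int_form q (E g)\<rfloor> = 1" by linarith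
  then show "\<bar>c\<bar> = 1" using abs_zmult_eq_1 by (metis abs_1)
qed

lemma slice_minus_iff:
  assumes "supp t \<subseteq> S" "\<And>g. 0 \<le> t g" "mass t = lam"
  shows "ev t \<in> slice (S - Z) lam \<longleftrightarrow> (\<forall>g\<in>Z. t g = 0)"
proof
  assume "ev t \<in> slice (S - Z) lam"
  then obtain a where a: "ev t = ev a" "supp a \<subseteq> S - Z" "mass a = lam" by (rule sliceE) blast
  have "t = a" by (rule slice_unique) (use assms a in auto)
  then show "\<forall>g\<in>Z. t g = 0" using a(2) by (auto simp: supp_def)
next
  assume "\<forall>g\<in>Z. t g = 0"
  then show "ev t \<in> slice (S - Z) lam" using assms by (intro sliceI) (auto simp: supp_def)
qed

lemma facet_minus:
  assumes Z: "Z \<subseteq> B"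
  shows "base \<in> slice (S - Z) lam" "aff_dim (slice (S - Z) lam) = aff_dim (slice S lam) - int (card Z)"
proof -
  interpret F: cell "S - Z" r w lam u by (rule subframe[OF Z])
  show "base \<in> slice (S - Z) lam" by (rule F.base_slice)
  have ZS: "Z \<subseteq> S" using Z BS by blast
  have "card (S - Z) = card S - card Z" "card Z \<le> card S"
    using card_Diff_subset[OF finite_subset[OF ZS finS] ZS] card_mono[OF finS ZS] by auto
  then show "aff_dim (slice (S - Z) lam) = aff_dim (slice S lam) - int (card Z)"
    unfolding F.aff_dim_slice aff_dim_slice by simp
qed

lemma dual_facet_normal:
  assumes g: "g \<in> B"
  shows "slice (S - {g}) lam facet_of slice S lam" "facet_normal (slice S lam) (slice (S - {g}) lam) (dform (u g))"
proof -
  have Z: "{g} \<subseteq> B" using g by simp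
  show "slice (S - {g}) lam facet_of slice S lam"
    unfolding facet_of_def using face_slice[of "S - {g}"] facet_minus[OF Z] by auto
  show "facet_normal (slice S lam) (slice (S - {g}) lam) (dform (u g))"
    unfolding facet_normal_def
  proof (intro conjI ballI primitive_dual[OF g])
    fix x y assume x: "x \<in> slice S lam" and y: "y \<in> slice (S - {g}) lam"
    have yC: "y \<in> slice S lam" using y slice_mono by blast
    obtain t where t: "\<And>g. 0 \<le> t g" "supp t \<subseteq> S" "mass t = lam" "x = ev t" using x by (rule slice_rep) blast
    obtain s where s: "\<And>g. 0 \<le> s g" "supp s \<subseteq> S" "mass s = lam" "y = ev s" using yC by (rule slice_rep) blast
    have "s g = 0" using y slice_minus_iff[OF s(2,1,3), of "{g}"] s(4) by simp
    then have "int_form (u g) (x - y) = t g"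
      using form_ev[OF t(2,3) g] form_ev[OF s(2,3) g] t(4) s(4) by (simp add: int_form_diff)
    then have e: "dform (u g) (x - y) = t g" using dform_eq diff_span[OF x yC] by simp
    show "0 \<le> dform (u g) (x - y)" using e t(1) by simp
    show "dform (u g) (x - y) = 0 \<longleftrightarrow> x \<in> slice (S - {g}) lam"
      unfolding e using slice_minus_iff[OF t(2,1,3), of "{g}"] t(4) by simp
  qed
qed

text \<open>The form is nonnegative on every edge at \<open>base\<close>, and its zero set in the
  cell is the face obtained by dropping the edges \<open>Z\<close> where it is positive. For a facet
  \<open>Z\<close> has one element \<open>g\<close>, so the form is a positive integral multiple of
  \<open>u g\<close>, and primitivity makes the factor one.\<close>

lemma facet_normal_dual:
  assumes F: "F facet_of slice S lam" "base \<in> F" "facet_normal (slice S lam) F l"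
  shows "\<exists>g\<in>B. l = dform (u g)"
proof -
  have prim: "primitive_form (slice S lam) l" and fn: "\<And>x y. x \<in> slice S lam \<Longrightarrow> y \<in> F \<Longrightarrow> 0 \<le> l (x - y) \<and> (l (x - y) = 0 \<longleftrightarrow> x \<in> F)"
    using F(3) unfolding facet_normal_def by blast+
  obtain q where q: "l = dform q" using prim unfolding primitive_form_def form_lattice_def dform_def by blast
  have lb: "l (ev t - base) = (\<Sum>g\<in>B. int_form q (E g) * t g)"
    if t: "supp t \<subseteq> S" "\<And>g. 0 \<le> t g" "mass t = lam" for t
  proof -
    have "ev t \<in> slice S lam" using t by (intro sliceI)
    then have sp: "ev t - base \<in> span (E ` B)" using diff_span base_slice by blast
    show ?thesis unfolding q dform_eq[OF sp] form_expand[OF sp, of q] by (rule sum.cong) (auto simp: form_ev[OF t(1,3)])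
  qed
  have q0: "0 \<le> int_form q (E g)" if g: "g \<in> B" for g
  proof -
    have lp: "0 < lam (snd g)" using lam_pos B_lab[OF g] by blast
    have "base + lam (snd g) *\<^sub>R E g \<in> slice S lam" using edge_slice[OF g] lp by simp
    then have "0 \<le> l (base + lam (snd g) *\<^sub>R E g - base)" using fn F(2) by blast
    then have "0 \<le> lam (snd g) * int_form q (E g)"
      unfolding q using dform_eq[of "lam (snd g) *\<^sub>R E g" q] E_span[OF g] by (simp add: span_scale int_form_scale)
    then show ?thesis using lp by (simp add: zero_le_mult_iff)
  qed
  define Z where "Z = {g\<in>B. int_form q (E g) \<noteq> 0}"
  have ZB: "Z \<subseteq> B" by (auto simp: Z_def)
  have FE: "F = slice (S - Z) lam"
  proof -
    have FC: "F \<subseteq> slice S lam" using F(1) facet_of_imp_subset by blast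
    have CC: "slice (S - Z) lam \<subseteq> slice S lam" by (rule slice_mono) blast
    have "x \<in> F \<longleftrightarrow> x \<in> slice (S - Z) lam" if x: "x \<in> slice S lam" for x
    proof -
      obtain t where t: "\<And>g. 0 \<le> t g" "supp t \<subseteq> S" "mass t = lam" "x = ev t" using x by (rule slice_rep) blast
      have "x \<in> F \<longleftrightarrow> l (x - base) = 0" using fn[OF x F(2)] by blast
      also have "\<dots> \<longleftrightarrow> (\<Sum>g\<in>B. int_form q (E g) * t g) = 0" unfolding t(4) lb[OF t(2,1,3)] ..
      also have "\<dots> \<longleftrightarrow> (\<forall>g\<in>B. int_form q (E g) * t g = 0)"
        by (rule sum_nonneg_eq_0_iff[OF finB]) (use q0 t(1) in simp)
      also have "\<dots> \<longleftrightarrow> (\<forall>g\<in>Z. t g = 0)" unfolding Z_def by auto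
      also have "\<dots> \<longleftrightarrow> x \<in> slice (S - Z) lam" using slice_minus_iff[OF t(2,1,3)] t(4) by simp
      finally show ?thesis .
    qed
    then show ?thesis using FC CC by blast
  qed
  have "aff_dim F = aff_dim (slice S lam) - 1" using F(1) by (simp add: facet_of_def)
  then have "card Z = 1" unfolding FE facet_minus(2)[OF ZB] by simp
  then obtain g where g: "Z = {g}" by (rule card_1_singletonE)
  have gB: "g \<in> B" using g ZB by blast
  have z: "int_form q (E h) = 0" if "h \<in> B" "h \<noteq> g" for h using that g unfolding Z_def by blast
  have lq: "dform q x = int_form q (E g) * dform (u g) x" if "x \<in> span (E ` B)" for x
  proof -
    have "(\<Sum>h\<in>B. int_form q (E h) * int_form (u h) x) = (\<Sum>h\<in>{g}. int_form q (E h) * int_form (u h) x)"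
      by (rule sum.mono_neutral_right[OF finB]) (use gB z in auto)
    then show ?thesis unfolding dform_eq[OF that] form_expand[OF that, of q] by simp
  qed
  have "l = restrict (\<lambda>x. of_int \<lfloor>int_form q (E g)\<rfloor> * dform (u g) x) (direction_space (slice S lam))"
  proof
    fix x
    show "l x = restrict (\<lambda>x. of_int \<lfloor>int_form q (E g)\<rfloor> * dform (u g) x) (direction_space (slice S lam)) x"
    proof (cases "x \<in> span (E ` B)")
      case True
      then show ?thesis unfolding q lq[OF True] using form_E_int[OF gB, of q] by (simp add: direction_slice)
    next
      case False
      then show ?thesis by (simp add: q dform_def direction_slice)
    qed
  qed
  then have "\<bar>\<lfloor>int_form q (E g)\<rfloor>\<bar> = 1" using prim dform_lattice unfolding primitive_form_def by blast
  then have "int_form q (E g) = 1" using q0[OF gB] form_E_int[OF gB, of q] by linarith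
  have "l = dform (u g)"
  proof
    fix x
    show "l x = dform (u g) x"
    proof (cases "x \<in> span (E ` B)")
      case True
      then show ?thesis unfolding q lq[OF True] using \<open>int_form q (E g) = 1\<close> by simp
    next
      case False
      then show ?thesis by (simp add: q dform_def direction_slice)
    qed
  qed
  then show ?thesis using gB by blast
qed

text \<open>The normals at \<open>base\<close> are exactly the restricted dual forms, and every
  integral form is their combination with its own values on the edges as coefficients.\<close>

lemma lattice_basis_base:
  "lattice_basis (slice S lam) {l. \<exists>F. F facet_of slice S lam \<and> base \<in> F \<and> facet_normal (slice S lam) F l}"
proof -
  let ?f = "\<lambda>g. dform (u g)"
  have N: "{l. \<exists>F. F facet_of slice S lam \<and> base \<in> F \<and> facet_normal (slice S lam) F l} = ?f ` B"
  proof
    show "{l. \<exists>F. F facet_of slice S lam \<and> base \<in> F \<and> facet_normal (slice S lam) F l} \<subseteq> ?f ` B"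
      using facet_normal_dual by blast
    have "base \<in> slice (S - {g}) lam" if "g \<in> B" for g using facet_minus(1)[of "{g}"] that by simp
    then show "?f ` B \<subseteq> {l. \<exists>F. F facet_of slice S lam \<and> base \<in> F \<and> facet_normal (slice S lam) F l}"
      using dual_facet_normal by blast
  qed
  have fE: "?f g (E h) = (if g = h then 1 else 0)" if "g \<in> B" "h \<in> B" for g h
    using that dual dform_eq[OF E_span] by simp
  have inj: "inj_on ?f B"
  proof (rule inj_onI)
    fix g h assume gh: "g \<in> B" "h \<in> B" "?f g = ?f h"
    have "?f h (E g) = 1" unfolding gh(3)[symmetric] using fE gh(1) by simp
    then show "g = h" using fE[OF gh(2,1)] by (simp split: if_splits)
  qed
  show ?thesis
    unfolding N lattice_basis_def sum.reindex[OF inj] comp_def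
  proof (intro conjI ballI allI impI)
    show "finite (?f ` B)" using finB by simp
    show "?f ` B \<subseteq> form_lattice (slice S lam)" using dform_lattice by blast
    show "\<exists>c :: (real ^ 'n \<Rightarrow> real) \<Rightarrow> int. \<forall>x\<in>direction_space (slice S lam). l x = (\<Sum>g\<in>B. of_int (c (?f g)) * ?f g x)"
      if l: "l \<in> form_lattice (slice S lam)" for l
    proof -
      obtain q where q: "l = dform q" using l unfolding form_lattice_def dform_def by blast
      \<comment> \<open>The coefficients of \<open>lattice_basis\<close> are indexed by the forms
        themselves, hence the detour through the inverse of \<open>?f\<close>.\<close>
      define c where "c m = \<lfloor>int_form q (E (inv_into B ?f m))\<rfloor>" for m
      have c: "c (?f g) = \<lfloor>int_form q (E g)\<rfloor>" if "g \<in> B" for g using inv_into_f_f[OF inj that] by (simp add: c_def)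
      have "l x = (\<Sum>g\<in>B. of_int (c (?f g)) * ?f g x)" if x: "x \<in> span (E ` B)" for x
        unfolding q dform_eq[OF x] form_expand[OF x, of q]
        by (rule sum.cong) (use c form_E_int[of _ q] in auto)
      then show ?thesis unfolding direction_slice by blast
    qed
    show "c b = 0" if c: "\<forall>x\<in>direction_space (slice S lam). (\<Sum>g\<in>B. of_int (c (?f g)) * ?f g x) = 0" and b: "b \<in> ?f ` B"
      for c :: "(real ^ 'n \<Rightarrow> real) \<Rightarrow> int" and b
    proof -
      obtain h where h: "h \<in> B" "b = ?f h" using b by blast
      have "(\<Sum>g\<in>B. of_int (c (?f g)) * ?f g (E h)) = 0" using c E_span[OF h(1)] unfolding direction_slice by blast
      moreover have "(\<Sum>g\<in>B. of_int (c (?f g)) * ?f g (E h)) = (\<Sum>g\<in>B. if g = h then real_of_int (c (?f g)) else 0)"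
        by (rule sum.cong) (use fE h(1) in auto)
      ultimately show ?thesis using h finB by simp
    qed
  qed
qed

end

text \<open>At an extreme point each label has its mass on one generator. Otherwise shifting mass
  \<open>e\<close> back and forth between two generators of a label spans a segment around the
  point, which is nondegenerate because generators of equal label have different vectors. Hence a
  frame can be based at every vertex.\<close>

lemma extreme_slice_vertex:
  fixes S :: "'n::finite gen set"
  assumes fin: "finite S" and lab: "\<And>g. g \<in> S \<Longrightarrow> snd g < r" and pos: "\<And>l. l < r \<Longrightarrow> 0 < lam l"
    and x: "x extreme_point_of slice S lam"
  obtains w where "\<And>l. l < r \<Longrightarrow> w l \<in> S" "\<And>l. l < r \<Longrightarrow> snd (w l) = l" "x = (\<Sum>l<r. lam l *\<^sub>R fst (w l))"
proof -
  have "x \<in> slice S lam" using x by (simp add: extreme_point_of_def)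
  then obtain a where a: "x = ev a" "supp a \<subseteq> S" "\<And>g. 0 \<le> a g" "mass a = lam" by (rule sliceE) blast
  have "\<exists>g. g \<in> S \<and> snd g = l \<and> 0 < a g" if "l < r" for l
  proof (rule ccontr)
    assume n: "\<not> (\<exists>g. g \<in> S \<and> snd g = l \<and> 0 < a g)"
    have "mass a l = (\<Sum>g\<in>{g\<in>S. snd g = l}. 0)"
      unfolding mass_sum[OF fin a(2)] by (rule sum.cong) (use n a(3) in \<open>auto simp: less_le\<close>)
    then show False using a(4) pos[OF that] by simp
  qed
  then obtain w where w: "\<And>l. l < r \<Longrightarrow> w l \<in> S \<and> snd (w l) = l \<and> 0 < a (w l)" by metis
  interpret frame S r w by unfold_locales (use fin lab w in auto)
  have z: "a g = 0" if g: "g \<in> B" for g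
  proof (rule ccontr)
    assume ne: "a g \<noteq> 0"
    define h where "h = w (snd g)"
    have l: "snd g < r" using B_lab[OF g] .
    have h: "h \<in> S" "snd h = snd g" "0 < a h" using w[OF l] by (auto simp: h_def)
    have gh: "g \<noteq> h" using g B_iff BS unfolding h_def by blast
    have gS: "g \<in> S" using BS[OF g] .
    define e where "e = min (a g) (a h)"
    have ep: "0 < e" "e \<le> a g" "e \<le> a h" using ne a(3)[of g] h(3) by (auto simp: e_def)
    define c where "c k = (if k = g then e else if k = h then - e else 0)" for k
    have sc: "supp c \<subseteq> S" using gS h(1) by (auto simp: supp_def c_def split: if_splits)
    have f: "finite (supp a)" "finite (supp c)" using a(2) sc fin finite_subset by blast+
    have evc: "ev c = e *\<^sub>R (fst g - fst h)"
    proof -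
      have "supp c \<subseteq> {g, h}" by (auto simp: supp_def c_def)
      then have "ev c = (\<Sum>k\<in>{g, h}. c k *\<^sub>R fst k)" by (intro ev_sum) auto
      then show ?thesis using gh by (simp add: c_def algebra_simps)
    qed
    have msc: "mass c l' = 0" for l'
    proof -
      have s: "supp c \<subseteq> {g, h}" by (auto simp: supp_def c_def)
      show ?thesis
      proof (cases "l' = snd g")
        case True
        then have "{k\<in>{g, h}. snd k = l'} = {g, h}" using h(2) by auto
        then have "mass c l' = (\<Sum>k\<in>{g, h}. c k)" using mass_sum[OF _ s, of l'] by simp
        then show ?thesis using gh by (simp add: c_def)
      next
        case False
        then have e: "{k\<in>{g, h}. snd k = l'} = {}" using h(2) by auto
        have "mass c l' = (\<Sum>k\<in>{k\<in>{g, h}. snd k = l'}. c k)" by (rule mass_sum[OF _ s]) simp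
        then show ?thesis unfolding e by (simp only: sum.empty)
      qed
    qed
    have p1: "ev (\<lambda>k. a k + c k) \<in> slice S lam"
    proof (rule sliceI)
      show "supp (\<lambda>k. a k + c k) \<subseteq> S" using supp_add[of a c] a(2) sc by blast
      show "0 \<le> a k + c k" for k using a(3)[of k] ep by (auto simp: c_def)
      show "mass (\<lambda>k. a k + c k) = lam" unfolding fun_eq_iff ev_add[OF f] msc a(4) by simp
    qed
    have p2: "ev (\<lambda>k. a k - c k) \<in> slice S lam"
    proof (rule sliceI)
      show "supp (\<lambda>k. a k - c k) \<subseteq> S" using supp_diff[of a c] a(2) sc by blast
      show "0 \<le> a k - c k" for k using a(3)[of k] ep by (auto simp: c_def)
      show "mass (\<lambda>k. a k - c k) = lam" unfolding fun_eq_iff ev_diff[OF f] msc a(4) by simp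
    qed
    have nz: "ev c \<noteq> 0" using ep gh h(2) by (auto simp: evc prod_eq_iff)
    have "x \<in> open_segment (x - ev c) (x + ev c)"
    proof -
      have "x = (1 - 1/2) *\<^sub>R (x - ev c) + (1/2) *\<^sub>R (x + ev c)"
        by (simp add: scaleR_add_right scaleR_diff_right flip: scaleR_add_left)
      moreover have "x - ev c \<noteq> x + ev c"
      proof
        assume "x - ev c = x + ev c"
        then have "ev c + ev c = 0" by (metis add_diff_cancel_left' add_diff_eq diff_add_cancel diff_diff_add cancel_comm_monoid_add_class.diff_cancel add.commute)
        then have "2 *\<^sub>R ev c = 0" by (simp add: scaleR_2)
        then show False using nz by simp
      qed
      ultimately show ?thesis unfolding in_segment by (intro conjI exI[of _ "1/2"]) auto
    qed
    moreover have "x - ev c \<in> slice S lam" "x + ev c \<in> slice S lam"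
      using p1 p2 unfolding ev_add[OF f] ev_diff[OF f] a(1)[symmetric] by auto
    ultimately show False using x unfolding extreme_point_of_def by blast
  qed
  have "x = (\<Sum>l<r. lam l *\<^sub>R fst (w l))"
    unfolding a(1) ev_rep[OF a(2)] a(4) using z by simp
  then show ?thesis using that[of w] w by blast
qed

lemma (in frame) cell_exists:
  assumes "\<And>l. l < r \<Longrightarrow> 0 < lam l" "\<And>l. r \<le> l \<Longrightarrow> lam l = 0" "\<And>g. g \<in> S \<Longrightarrow> int_vec (fst g)" "box_points S = {\<lambda>_. 0}"
  shows "\<exists>u. cell S r w lam u"
proof -
  have "\<exists>u. \<forall>g\<in>B. \<forall>g'\<in>B. int_form (u g) (E g') = (if g = g' then 1 else 0)"
    by (rule dual_forms[OF finB int_vec_E[OF assms(3)] saturated_edges[OF assms(3,4)]])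
  then obtain u where "\<forall>g\<in>B. \<forall>g'\<in>B. int_form (u g) (E g') = (if g = g' then 1 else 0)" by blast
  then have "cell S r w lam u" by unfold_locales (use assms in auto)
  then show ?thesis by blast
qed

lemma cell_polystable:
  fixes S :: "'n::finite gen set"
  assumes V: "rat_subspace V" and fin: "finite S" and lab: "\<And>g. g \<in> S \<Longrightarrow> snd g < r"
    and int: "\<And>g. g \<in> S \<Longrightarrow> int_vec (fst g)" and box_points: "box_points S = {\<lambda>_. 0}"
    and pos: "\<And>l. l < r \<Longrightarrow> 0 < lam l" and zero: "\<And>l. r \<le> l \<Longrightarrow> lam l = 0" and lamV: "\<And>l. l < r \<Longrightarrow> lam l \<in> V"
    and full: "\<And>l. l < r \<Longrightarrow> \<exists>g\<in>S. snd g = l"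
  shows "polystable V (slice S lam)" "Q \<subseteq> S \<Longrightarrow> slice Q lam face_of slice S lam"
proof -
  obtain w where w: "\<And>l. l < r \<Longrightarrow> w l \<in> S \<and> snd (w l) = l" using full by metis
  have f: "frame S r w" by unfold_locales (use fin lab w in auto)
  have "\<exists>u. cell S r w lam u" by (rule frame.cell_exists[OF f]) (assumption | rule pos zero int box_points)+
  then obtain u where c: "cell S r w lam u" ..
  show "Q \<subseteq> S \<Longrightarrow> slice Q lam face_of slice S lam" by (rule cell.face_slice[OF c])
  show "polystable V (slice S lam)"
    unfolding polystable_def
  proof (intro conjI allI impI)
    show "ZV_polytope V (slice S lam)" by (rule cell.ZV_slice[OF c V]) (rule lamV)
    show "polysimplex (slice S lam)" by (rule cell.polysimplex_slice[OF c])
    fix x assume ex: "x extreme_point_of slice S lam"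
    obtain w' where w': "\<And>l. l < r \<Longrightarrow> w' l \<in> S" "\<And>l. l < r \<Longrightarrow> snd (w' l) = l" "x = (\<Sum>l<r. lam l *\<^sub>R fst (w' l))"
      by (rule extreme_slice_vertex[OF fin, of r lam x]) (use lab pos ex in blast)+
    have f': "frame S r w'" by unfold_locales (use fin lab w' in auto)
    have "\<exists>u'. cell S r w' lam u'" by (rule frame.cell_exists[OF f']) (assumption | rule pos zero int box_points)+
    then obtain u' where c': "cell S r w' lam u'" ..
    show "lattice_basis (slice S lam) {l. \<exists>F. F facet_of slice S lam \<and> x \<in> F \<and> facet_normal (slice S lam) F l}"
      using cell.lattice_basis_base[OF c'] unfolding cell.base_def[OF c'] w'(3) .
  qed
qed

section \<open>From a unimodular system to a subdivision\<close>

lemma slice_empty: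
  assumes "finite S" "\<not> (\<exists>g\<in>S. snd g = l)" "0 < lam l"
  shows "slice S lam = {}"
proof (rule ccontr)
  assume "slice S lam \<noteq> {}"
  then obtain x where "x \<in> slice S lam" by blast
  then obtain a where a: "supp a \<subseteq> S" "mass a = lam" by (rule sliceE) blast
  have e: "{g\<in>S. snd g = l} = {}" using assms(2) by blast
  have "mass a l = 0" unfolding mass_sum[OF assms(1) a(1)] e by (simp only: sum.empty)
  then show False using a(2) assms(3) by simp
qed

text \<open>The cells of full dimension already cover \<open>P\<close>: a part of \<open>P\<close>
  inside a ball that avoids them is covered by the affine hulls of the finitely many other cells,
  hence contained in one of these hulls, whose dimension is too small for that. Intersections of
  cells are slices over common subsets because carried representations are unique.\<close>

theorem unimodular_subdivision:
  fixes P :: "(real ^ 'n::finite) set"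
  assumes V: "rat_subspace V" and represents: "represents r V P T lam" and box_points: "\<And>S. S \<in> T \<Longrightarrow> box_points S = {\<lambda>_. 0}"
    and P: "convex P" "P \<noteq> {}"
  shows "\<exists>\<C>. polystable_subdivision V \<C> P"
proof -
  have T: "simplicial T" "cone_unique T" and int_vec: "\<And>S g. S \<in> T \<Longrightarrow> g \<in> S \<Longrightarrow> int_vec (fst g)" and lab: "\<And>S g. S \<in> T \<Longrightarrow> g \<in> S \<Longrightarrow> snd g < r"
    and pos: "\<And>l. l < r \<Longrightarrow> 0 < lam l" and lamV: "\<And>l. l < r \<Longrightarrow> lam l \<in> V" and zero: "\<And>l. r \<le> l \<Longrightarrow> lam l = 0"
    and PE: "P = {ev a | a. carried T a \<and> mass a = lam}"
    using represents unfolding represents_def by blast+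
  have fT: "finite T" using T(1) by (simp add: simplicial_def)
  \<comment> \<open>Sets missing a label have an empty slice, as all \<open>lam l\<close> are
    positive, and cells have to be nonempty.\<close>
  define full where "full S \<longleftrightarrow> (\<forall>l<r. \<exists>g\<in>S. snd g = l)" for S :: "'n gen set"
  have cp: "polystable V (slice S lam) \<and> (\<forall>Q. Q \<subseteq> S \<longrightarrow> slice Q lam face_of slice S lam)"
    if S: "S \<in> T" and f: "full S" for S
  proof -
    have fl: "\<exists>g\<in>S. snd g = l" if "l < r" for l using f that unfolding full_def by blast
    have "polystable V (slice S lam)"
      by (rule cell_polystable(1)[OF V simplicial_fin[OF T(1) S]])
        (assumption | rule lab[OF S] int_vec[OF S] box_points[OF S] pos zero lamV fl)+
    moreover have "slice Q lam face_of slice S lam" if "Q \<subseteq> S" for Q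
      by (rule cell_polystable(2)[OF V simplicial_fin[OF T(1) S]])
        (assumption | rule lab[OF S] int_vec[OF S] box_points[OF S] pos zero lamV fl that)+
    ultimately show ?thesis by blast
  qed
  have cp1: "polystable V (slice S lam)"
    and cp2: "Q \<subseteq> S \<Longrightarrow> slice Q lam face_of slice S lam" if "S \<in> T" "full S" for S Q
    using cp[OF that] by blast+
  have fullI: "full S" if S: "S \<in> T" and x: "x \<in> slice S lam" for S x
  proof (rule ccontr)
    assume "\<not> full S"
    then obtain l where "l < r" "\<not> (\<exists>g\<in>S. snd g = l)" unfolding full_def by blast
    then show False using slice_empty[OF simplicial_fin[OF T(1) S]] pos x by blast
  qed
  have subP: "slice S lam \<subseteq> P" if "S \<in> T" for S
  proof
    fix x assume "x \<in> slice S lam"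
    then obtain a where a: "x = ev a" "supp a \<subseteq> S" "\<And>g. 0 \<le> a g" "mass a = lam" by (rule sliceE) blast
    have "carried T a" by (rule carriedI) (use a(3) simplicial_sub[OF T(1) that a(2)] in auto)
    then show "x \<in> P" unfolding PE using a(1,4) by blast
  qed
  have covP: "\<exists>S\<in>T. x \<in> slice S lam" if x: "x \<in> P" for x
  proof -
    obtain a where a: "x = ev a" "carried T a" "mass a = lam" using x unfolding PE by blast
    have "x \<in> slice (supp a) lam" unfolding a(1) by (rule sliceI) (use a(3) carried_nonneg[OF a(2)] in auto)
    then show ?thesis using carried_supp[OF a(2)] by blast
  qed
  define G where "G = {S\<in>T. full S \<and> aff_dim (slice S lam) = aff_dim P}"
  define \<C> where "\<C> = (\<lambda>S. slice S lam) ` G"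
  have poly: "polytope (slice S lam)" if "S \<in> T" "full S" for S
    using cp1[OF that] ZV_polytope_imp_polytope unfolding polystable_def by blast
  have inter: "slice S lam \<inter> slice S' lam = slice (S \<inter> S') lam" if "S \<in> T" "S' \<in> T" for S S'
  proof
    show "slice (S \<inter> S') lam \<subseteq> slice S lam \<inter> slice S' lam" using slice_mono[of "S \<inter> S'"] by blast
    show "slice S lam \<inter> slice S' lam \<subseteq> slice (S \<inter> S') lam"
    proof
      fix x assume "x \<in> slice S lam \<inter> slice S' lam"
      then have x: "x \<in> slice S lam" "x \<in> slice S' lam" by blast+
      obtain a where a: "x = ev a" "supp a \<subseteq> S" "\<And>g. 0 \<le> a g" "mass a = lam" using x(1) by (rule sliceE) blast
      obtain b where b: "x = ev b" "supp b \<subseteq> S'" "\<And>g. 0 \<le> b g" "mass b = lam" using x(2) by (rule sliceE) blast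
      have "a = b"
      proof (rule cone_uniqueD[OF T(2)])
        show "carried T a" by (rule carriedI) (use a(3) simplicial_sub[OF T(1) that(1) a(2)] in auto)
        show "carried T b" by (rule carriedI) (use b(3) simplicial_sub[OF T(1) that(2) b(2)] in auto)
      qed (use a b in auto)
      then have "supp a \<subseteq> S \<inter> S'" using a(2) b(2) by blast
      then show "x \<in> slice (S \<inter> S') lam" unfolding a(1) by (intro sliceI a(3,4))
    qed
  qed
  have "polyhedral_complex \<C>"
    unfolding polyhedral_complex_def
  proof (intro conjI exI[of _ "nat (aff_dim P)"] ballI)
    show "finite \<C>" unfolding \<C>_def G_def using fT by simp
    have "0 \<le> aff_dim P" using P(2) aff_dim_negative_iff[of P] by linarith
    then show "aff_dim C = int (nat (aff_dim P))" "polytope C" if "C \<in> \<C>" for C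
      using that poly unfolding \<C>_def G_def by auto
    fix C D assume "C \<in> \<C>" "D \<in> \<C>"
    then obtain S S' where S: "S \<in> T" "full S" "C = slice S lam" and S': "S' \<in> T" "full S'" "D = slice S' lam"
      unfolding \<C>_def G_def by blast
    show "C \<inter> D face_of C" unfolding S(3) S'(3) inter[OF S(1) S'(1)] by (rule cp2[OF S(1,2)]) blast
    show "C \<inter> D face_of D" unfolding S(3) S'(3) inter[OF S(1) S'(1)] by (rule cp2[OF S'(1,2)]) blast
  qed
  moreover have "\<Union>\<C> = P"
  proof
    show "\<Union>\<C> \<subseteq> P" unfolding \<C>_def G_def using subP by blast
    show "P \<subseteq> \<Union>\<C>"
    proof (rule ccontr)
      assume "\<not> P \<subseteq> \<Union>\<C>"
      then obtain x where x: "x \<in> P" "x \<notin> \<Union>\<C>" by blast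
      have "closed (\<Union>\<C>)"
      proof (rule closed_Union)
        show "finite \<C>" unfolding \<C>_def G_def using fT by simp
        show "\<forall>C\<in>\<C>. closed C" unfolding \<C>_def G_def using poly polytope_imp_closed by blast
      qed
      then have op: "open (- \<Union>\<C>)" by (simp add: open_Compl)
      then obtain e where e: "0 < e" "ball x e \<subseteq> - \<Union>\<C>" using x(2) open_contains_ball by (metis ComplI)
      have ne: "P \<inter> ball x e \<noteq> {}" using x(1) e(1) by auto
      define bad where "bad = {S\<in>T. full S \<and> S \<notin> G}"
      have "\<exists>A\<in>(\<lambda>S. affine hull (slice S lam)) ` bad. P \<inter> ball x e \<subseteq> A"
      proof (rule convex_covered_by_affine)
        show "finite ((\<lambda>S. affine hull (slice S lam)) ` bad)" unfolding bad_def using fT by simp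
        show "affine A" if "A \<in> (\<lambda>S. affine hull (slice S lam)) ` bad" for A using that by auto
        show "P \<inter> ball x e \<noteq> {}" by (rule ne)
        show "P \<inter> ball x e \<subseteq> \<Union>((\<lambda>S. affine hull (slice S lam)) ` bad)"
        proof
          fix y assume y: "y \<in> P \<inter> ball x e"
          then obtain S where S: "S \<in> T" "y \<in> slice S lam" using covP by blast
          have "S \<in> bad" unfolding bad_def using S fullI[OF S] y e(2) unfolding \<C>_def by blast
          then show "y \<in> \<Union>((\<lambda>S. affine hull (slice S lam)) ` bad)" using hull_inc[OF S(2), of affine] by blast
        qed
        show "convex (P \<inter> ball x e)" by (rule convex_Int[OF P(1) convex_ball])
      qed
      then obtain S where S: "S \<in> bad" "P \<inter> ball x e \<subseteq> affine hull (slice S lam)" by blast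
      have "aff_dim P = aff_dim (P \<inter> ball x e)" using aff_dim_convex_Int_open[OF P(1) open_ball ne] by simp
      also have "\<dots> \<le> aff_dim (slice S lam)" using aff_dim_subset[OF S(2)] by simp
      finally have "aff_dim P \<le> aff_dim (slice S lam)" .
      moreover have "aff_dim (slice S lam) \<le> aff_dim P" using aff_dim_subset[OF subP] S(1) unfolding bad_def by blast
      ultimately show False using S(1) unfolding bad_def G_def by auto
    qed
  qed
  ultimately have "subdivision \<C> P" unfolding subdivision_def by blast
  moreover have "\<forall>C\<in>\<C>. polystable V C" unfolding \<C>_def G_def using cp1 by blast
  moreover have "\<forall>C\<in>\<C>. ZV_polytope V C" using calculation(2) unfolding polystable_def by blast
  ultimately show ?thesis unfolding polystable_subdivision_def ZV_subdivision_def by blast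
qed

section \<open>Lexicographic triangulation\<close>

fun lexle :: "'b list \<Rightarrow> ('b \<Rightarrow> real) \<Rightarrow> ('b \<Rightarrow> real) \<Rightarrow> bool" where
  "lexle [] a b \<longleftrightarrow> True"
| "lexle (g # gs) a b \<longleftrightarrow> a g < b g \<or> a g = b g \<and> lexle gs a b"

lemma lexle_antisym: "lexle gs a b \<Longrightarrow> lexle gs b a \<Longrightarrow> g \<in> set gs \<Longrightarrow> a g = b g"
  by (induction gs) auto

text \<open>The comparison depends only on the first nonzero difference, which neither translation
  nor a positive factor affects.\<close>

lemma lexle_shift: "0 < e \<Longrightarrow> lexle gs b (\<lambda>g. b g + e * (c' g - c g)) \<Longrightarrow> lexle gs c c'"
  by (induction gs) (auto simp: zero_less_mult_iff)

lemma lexmin_exists: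
  fixes K :: "('b \<Rightarrow> real) set"
  shows "compact K \<Longrightarrow> K \<noteq> {} \<Longrightarrow> \<exists>b\<in>K. \<forall>b'\<in>K. lexle gs b b'"
proof (induction gs arbitrary: K)
  case Nil
  then show ?case by auto
next
  case (Cons g gs)
  have cont: "continuous_on K (\<lambda>b. b g)"
    by (rule continuous_on_subset[OF continuous_on_product_coordinates]) simp
  obtain b0 where b0: "b0 \<in> K" "\<And>b. b \<in> K \<Longrightarrow> b0 g \<le> b g"
    using continuous_attains_inf[OF Cons.prems cont] by blast
  have "closed {b :: 'b \<Rightarrow> real. b g = b0 g}"
    by (rule closed_Collect_eq[OF continuous_on_product_coordinates continuous_on_const])
  then have "compact (K \<inter> {b. b g = b0 g})" by (rule compact_Int_closed[OF Cons.prems(1)])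
  moreover have "K \<inter> {b. b g = b0 g} \<noteq> {}" using b0(1) by blast
  ultimately have "\<exists>b\<in>K \<inter> {b. b g = b0 g}. \<forall>b'\<in>K \<inter> {b. b g = b0 g}. lexle gs b b'" by (rule Cons.IH)
  then obtain b where b: "b \<in> K" "b g = b0 g" "\<forall>b'\<in>K \<inter> {b. b g = b0 g}. lexle gs b b'" by blast
  have "lexle (g # gs) b b'" if "b' \<in> K" for b'
    using b0(2)[OF that] b(2,3) that by auto
  then show ?case using b(1) by blast
qed

lemma compact_pi:
  fixes I :: "'b \<Rightarrow> real set"
  assumes "\<And>g. compact (I g)"
  shows "compact {b. \<forall>g. b g \<in> I g}"
proof -
  have "compactin (product_topology (\<lambda>i. euclidean) UNIV) (PiE UNIV I)"
    unfolding compactin_PiE using assms by simp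
  moreover have "PiE UNIV I = {b. \<forall>g. b g \<in> I g}" by (auto simp: PiE_iff)
  ultimately show ?thesis by (simp add: euclidean_product_topology)
qed

lemma small_multiple:
  fixes b c :: "'b \<Rightarrow> real"
  assumes fin: "finite A" and b: "\<And>g. g \<in> A \<Longrightarrow> 0 < b g" and c: "\<And>g. g \<in> A \<Longrightarrow> 0 \<le> c g"
  shows "\<exists>e>0. \<forall>g\<in>A. e * c g \<le> b g"
proof -
  define e where "e = Min (insert 1 ((\<lambda>g. b g / (c g + 1)) ` A))"
  have pos: "0 < b g / (c g + 1)" if "g \<in> A" for g using b[OF that] c[OF that] by simp
  have "0 < e" unfolding e_def using fin pos by (subst Min_gr_iff) auto
  moreover have "e * c g \<le> b g" if g: "g \<in> A" for g
  proof -
    have "e \<le> b g / (c g + 1)" unfolding e_def using fin g by (intro Min_le) auto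
    then have "e * (c g + 1) \<le> b g" using c[OF g] by (simp add: pos_le_divide_eq)
    then show ?thesis using \<open>0 < e\<close> by (simp add: algebra_simps)
  qed
  ultimately show ?thesis by blast
qed

definition fibre :: "'n::finite gen set \<Rightarrow> real ^ 'n \<Rightarrow> (nat \<Rightarrow> real) \<Rightarrow> ('n gen \<Rightarrow> real) set" where
  "fibre G x m = {b. supp b \<subseteq> G \<and> (\<forall>g. 0 \<le> b g) \<and> ev b = x \<and> mass b = m}"

lemma compact_fibre:
  fixes G :: "'n::finite gen set"
  assumes G: "finite G"
  shows "compact (fibre G x m)"
proof -
  define I where "I g = (if g \<in> G then {0..m (snd g)} else {0})" for g
  define H where "H = {b::'n gen \<Rightarrow> real. (\<Sum>g\<in>G. b g *\<^sub>R fst g) = x} \<inter> (\<Inter>l. {b. (\<Sum>g\<in>{g\<in>G. snd g = l}. b g) = m l})"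
  have "compact {b. \<forall>g. b g \<in> I g}" by (rule compact_pi) (simp add: I_def)
  moreover have "closed H"
    unfolding H_def
    by (intro closed_Int closed_INT ballI closed_Collect_eq continuous_on_sum continuous_on_scaleR
        continuous_on_const continuous_on_product_coordinates)
  ultimately have "compact ({b. \<forall>g. b g \<in> I g} \<inter> H)" by (rule compact_Int_closed)
  moreover have "fibre G x m = {b. \<forall>g. b g \<in> I g} \<inter> H"
  proof (intro set_eqI iffI)
    fix b assume "b \<in> fibre G x m"
    then have b: "supp b \<subseteq> G" "\<And>g. 0 \<le> b g" "ev b = x" "mass b = m" unfolding fibre_def by blast+
    have "b g \<in> I g" for g
    proof (cases "g \<in> G")
      case True
      have "b g \<le> (\<Sum>h\<in>{h\<in>G. snd h = snd g}. b h)" by (rule member_le_sum) (use True G b(2) in auto)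
      then show ?thesis using True b(2)[of g] b(4) mass_sum[OF G b(1), of "snd g"] by (simp add: I_def)
    next
      case False
      then have "g \<notin> supp b" using b(1) by blast
      then show ?thesis using False by (simp add: I_def supp_iff)
    qed
    moreover have "b \<in> H" unfolding H_def using ev_sum[OF G b(1)] mass_sum[OF G b(1)] b(3,4) by auto
    ultimately show "b \<in> {b. \<forall>g. b g \<in> I g} \<inter> H" by blast
  next
    fix b assume "b \<in> {b. \<forall>g. b g \<in> I g} \<inter> H"
    then have b: "\<And>g. b g \<in> I g" "b \<in> H" by blast+
    have s: "supp b \<subseteq> G"
    proof
      fix g assume "g \<in> supp b"
      then show "g \<in> G" using b(1)[of g] by (auto simp: I_def supp_iff split: if_splits)
    qed
    have nn: "0 \<le> b g" for g using b(1)[of g] by (auto simp: I_def split: if_splits)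
    have "ev b = x" unfolding ev_sum[OF G s] using b(2) unfolding H_def by blast
    moreover have "mass b l = m l" for l unfolding mass_sum[OF G s] using b(2) unfolding H_def by blast
    ultimately show "b \<in> fibre G x m" unfolding fibre_def using s nn by blast
  qed
  ultimately show ?thesis by simp
qed

text \<open>Lexicographic minimality replaces the generic height function of a regular
  triangulation: minimal representations are unique because the order is antisymmetric on
  \<open>G\<close>. The support of a minimal \<open>b\<close> belongs to \<open>T\<close>, for if
  some \<open>c\<close> on this support could be lowered to \<open>c'\<close>, then adding a small
  multiple of \<open>c' - c\<close> would lower \<open>b\<close> while keeping it
  nonnegative.\<close>

lemma lexmin_triangulation:
  fixes G :: "'n::finite gen set"
  assumes G: "finite G"
  obtains T where "simplicial T" "cone_unique T" "\<And>S. S \<in> T \<Longrightarrow> S \<subseteq> G"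
    "\<And>x m. fibre G x m \<noteq> {} \<Longrightarrow> \<exists>b. carried T b \<and> ev b = x \<and> mass b = m"
proof -
  obtain gs where gs: "set gs = G" using finite_list[OF G] by blast
  define lmin where "lmin a \<longleftrightarrow> (\<forall>b\<in>fibre G (ev a) (mass a). lexle gs a b)" for a
  \<comment> \<open>Asking for minimality of all combinations on \<open>S\<close> makes
    \<open>T\<close> closed under subsets by construction.\<close>
  define T where "T = {S. S \<subseteq> G \<and> (\<forall>a. (\<forall>g. 0 \<le> a g) \<and> supp a \<subseteq> S \<longrightarrow> lmin a)}"
  have TG: "S \<subseteq> G" if "S \<in> T" for S using that unfolding T_def by blast
  have Tl: "lmin a" if "carried T a" for a
    using that unfolding carried_def T_def by blast
  show ?thesis
  proof (rule that)
    show "simplicial T" unfolding simplicial_def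
    proof (intro conjI ballI allI impI)
      show "finite T" by (rule finite_subset[of _ "Pow G"]) (use TG G in auto)
      show "finite S" if "S \<in> T" for S using TG[OF that] G finite_subset by blast
      show "S' \<in> T" if "S \<in> T" "S' \<subseteq> S" for S S' using that unfolding T_def by blast
    qed
    show "cone_unique T" unfolding cone_unique_def
    proof (intro allI impI)
      fix a b assume "carried T a \<and> carried T b \<and> ev a = ev b \<and> mass a = mass b"
      then have a: "carried T a" and b: "carried T b" and e: "ev a = ev b" "mass a = mass b" by blast+
      have sa: "supp a \<subseteq> G" and sb: "supp b \<subseteq> G" using TG carried_supp a b by blast+
      have "a \<in> fibre G (ev b) (mass b)" "b \<in> fibre G (ev a) (mass a)"
        unfolding fibre_def using sa sb e carried_nonneg[OF a] carried_nonneg[OF b] by auto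
      then have "lexle gs a b" "lexle gs b a" using Tl[OF a] Tl[OF b] unfolding lmin_def by blast+
      then have g: "a g = b g" if "g \<in> G" for g using lexle_antisym that gs by metis
      show "a = b"
      proof
        fix g show "a g = b g"
        proof (cases "g \<in> G")
          case False
          then have "g \<notin> supp a" "g \<notin> supp b" using sa sb by blast+
          then show ?thesis by (simp add: supp_iff)
        qed (rule g)
      qed
    qed
    show "S \<subseteq> G" if "S \<in> T" for S by (rule TG[OF that])
    fix x m assume "fibre G x m \<noteq> {}"
    then obtain b where b: "b \<in> fibre G x m" "\<And>b'. b' \<in> fibre G x m \<Longrightarrow> lexle gs b b'"
      using lexmin_exists[OF compact_fibre[OF G]] by blast
    have bD: "supp b \<subseteq> G" "\<And>g. 0 \<le> b g" "ev b = x" "mass b = m" using b(1) unfolding fibre_def by blast+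
    have fb: "finite (supp b)" using bD(1) G finite_subset by blast
    have "lmin c" if c: "\<And>g. 0 \<le> c g" "supp c \<subseteq> supp b" for c
      unfolding lmin_def
    proof
      fix c' assume c': "c' \<in> fibre G (ev c) (mass c)"
      then have c'D: "supp c' \<subseteq> G" "\<And>g. 0 \<le> c' g" "ev c' = ev c" "mass c' = mass c" unfolding fibre_def by blast+
      have fc: "finite (supp c)" "finite (supp c')" using c(2) fb c'D(1) G finite_subset by blast+
      have "\<exists>e>0. \<forall>g\<in>supp b. e * c g \<le> b g"
        by (rule small_multiple[OF fb]) (use bD(2) c(1) in \<open>auto simp: supp_iff less_le\<close>)
      then obtain e where e: "0 < e" "\<And>g. g \<in> supp b \<Longrightarrow> e * c g \<le> b g" by blast
      define d where "d g = e * (c' g - c g)" for g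
      have sd: "supp (\<lambda>g. c' g - c g) \<subseteq> G" using supp_diff[of c' c] c'D(1) c(2) bD(1) by blast
      then have fd0: "finite (supp (\<lambda>g. c' g - c g))" using G finite_subset by blast
      have sd': "supp d \<subseteq> G" using sd by (auto simp: supp_def d_def)
      then have fd: "finite (supp d)" using G finite_subset by blast
      have evd: "ev d = 0" "mass d l = 0" for l
        unfolding d_def ev_scale[OF fd0] ev_diff[OF fc(2,1)] using c'D(3,4) by auto
      have "(\<lambda>g. b g + d g) \<in> fibre G x m"
        unfolding fibre_def
      proof (intro CollectI conjI allI)
        show "supp (\<lambda>g. b g + d g) \<subseteq> G" using supp_add[of b d] bD(1) sd' by blast
        show "0 \<le> b g + d g" for g
        proof (cases "g \<in> supp b")
          case True
          have "0 \<le> e * c' g" using e(1) c'D(2)[of g] by simp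
          then show ?thesis using e(2)[OF True] by (simp add: d_def algebra_simps)
        next
          case False
          then have "g \<notin> supp c" using c(2) by blast
          then have "c g = 0" by (simp add: supp_iff)
          then show ?thesis using bD(2)[of g] c'D(2)[of g] e(1) by (simp add: d_def)
        qed
        show "ev (\<lambda>g. b g + d g) = x" unfolding ev_add[OF fb fd] evd bD(3) by simp
        show "mass (\<lambda>g. b g + d g) = m" unfolding fun_eq_iff ev_add[OF fb fd] evd bD(4) by simp
      qed
      then have "lexle gs b (\<lambda>g. b g + d g)" by (rule b(2))
      then show "lexle gs c c'" unfolding d_def by (rule lexle_shift[OF e(1)])
    qed
    then have "supp b \<in> T" unfolding T_def using bD(1) by blast
    then have "carried T b" by (intro carriedI bD(2))
    then show "\<exists>b. carried T b \<and> ev b = x \<and> mass b = m" using bD(3,4) by blast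
  qed
qed

section \<open>Rational coefficient systems\<close>

lemma rat_sub_Rats: "rat_subspace V \<Longrightarrow> c \<in> \<rat> \<Longrightarrow> x \<in> V \<Longrightarrow> c * x \<in> V"
  by (elim Rats_cases) (simp add: rat_sub_closed(1))

text \<open>The indices are real numbers only because the initial system is indexed by
  \<open>K\<close> without zero; \<open>lam l\<close> does not stay tied to
  \<open>l\<close>.\<close>

definition coeff_system :: "real set \<Rightarrow> real set \<Rightarrow> real set \<Rightarrow> (real \<Rightarrow> real) \<Rightarrow> (real \<Rightarrow> real \<Rightarrow> real) \<Rightarrow> bool" where
  "coeff_system V K L lam M \<longleftrightarrow> finite L \<and> (\<forall>l\<in>L. 0 < lam l \<and> lam l \<in> V \<and> (\<forall>k\<in>K. M l k \<in> \<rat>)) \<and>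
     (\<forall>k\<in>K. k = (\<Sum>l\<in>L. lam l * M l k))"

text \<open>One step of Euclidean subtraction; \<open>j\<close> is dropped if \<open>c * lam i = lam j\<close>, so no rational independence of
  the \<open>lam l\<close> has to be maintained.\<close>

lemma coeff_system_transfer:
  assumes V: "rat_subspace V" and s: "coeff_system V K L lam M" and i: "i \<in> L" "j \<in> L" "i \<noteq> j"
    and c: "c \<in> \<rat>" "0 < c" "c * lam i \<le> lam j"
  shows "\<exists>L' lam'. L' \<subseteq> L \<and> coeff_system V K L' lam' (M(i := \<lambda>k. M i k + c * M j k))"
proof -
  define lam' where "lam' = lam(j := lam j - c * lam i)"
  define M' where "M' = M(i := \<lambda>k. M i k + c * M j k)"
  define L' where "L' = {l\<in>L. 0 < lam' l}"
  have fL: "finite L" and pos: "\<And>l. l \<in> L \<Longrightarrow> 0 < lam l" and lV: "\<And>l. l \<in> L \<Longrightarrow> lam l \<in> V"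
    and MQ: "\<And>l k. l \<in> L \<Longrightarrow> k \<in> K \<Longrightarrow> M l k \<in> \<rat>" and eq: "\<And>k. k \<in> K \<Longrightarrow> k = (\<Sum>l\<in>L. lam l * M l k)"
    using s unfolding coeff_system_def by blast+
  have nn: "0 \<le> lam' l" if "l \<in> L" for l using pos[OF that] c(3) by (simp add: lam'_def)
  have "coeff_system V K L' lam' M'"
    unfolding coeff_system_def
  proof (intro conjI ballI)
    show "finite L'" using fL by (simp add: L'_def)
    fix l assume l: "l \<in> L'"
    then have lL: "l \<in> L" by (simp add: L'_def)
    show "0 < lam' l" using l by (simp add: L'_def)
    show "lam' l \<in> V" using lV[OF lL] rat_sub_closed(4)[OF V lV[OF i(2)] rat_sub_Rats[OF V c(1) lV[OF i(1)]]]
      by (simp add: lam'_def)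
    show "M' l k \<in> \<rat>" if "k \<in> K" for k
      using MQ[OF lL that] MQ[OF i(1) that] MQ[OF i(2) that] c(1) by (simp add: M'_def)
  next
    fix k assume k: "k \<in> K"
    have L: "L = insert i (insert j (L - {i, j}))" using i by blast
    have "(\<Sum>l\<in>L'. lam' l * M' l k) = (\<Sum>l\<in>L. lam' l * M' l k)"
    proof (rule sum.mono_neutral_left[OF fL])
      show "\<forall>l\<in>L - L'. lam' l * M' l k = 0" using nn by (force simp: L'_def)
    qed (simp add: L'_def)
    also have "\<dots> = lam' i * M' i k + (lam' j * M' j k + (\<Sum>l\<in>L - {i, j}. lam' l * M' l k))"
      by (subst L) (use fL i(3) in simp)
    also have "(\<Sum>l\<in>L - {i, j}. lam' l * M' l k) = (\<Sum>l\<in>L - {i, j}. lam l * M l k)"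
      by (rule sum.cong) (auto simp: lam'_def M'_def)
    also have "lam' i * M' i k + (lam' j * M' j k + (\<Sum>l\<in>L - {i, j}. lam l * M l k)) =
        lam i * M i k + (lam j * M j k + (\<Sum>l\<in>L - {i, j}. lam l * M l k))"
      using i(3) by (simp add: lam'_def M'_def algebra_simps)
    also have "\<dots> = (\<Sum>l\<in>L. lam l * M l k)"
      by (subst (2) L) (use fL i(3) in simp)
    finally show "k = (\<Sum>l\<in>L'. lam' l * M' l k)" using eq[OF k] by simp
  qed
  moreover have "L' \<subseteq> L" by (auto simp: L'_def)
  ultimately show ?thesis unfolding M'_def by blast
qed

text \<open>The value of \<open>x\<close> is the sum of the \<open>lam l * q l\<close> and
  nonnegative, so a negative \<open>q j\<close> is accompanied by a positive \<open>q i\<close>. A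
  transfer with \<open>c = - (q i / q j)\<close> cancels the one of them with the smaller product of
  its absolute value and its \<open>lam\<close>; this is the condition for the reduced
  \<open>lam\<close> to stay nonnegative. Since \<open>c\<close> is positive, the relations in
  \<open>X\<close> remain nonnegative, and fewer values \<open>q l\<close> are nonzero.\<close>

lemma coeff_system_extend:
  assumes V: "rat_subspace V" and K: "finite K" and x: "\<And>k. k \<in> K \<Longrightarrow> x k \<in> \<rat>" "0 \<le> (\<Sum>k\<in>K. x k * k)"
  shows "coeff_system V K L lam M \<Longrightarrow> (\<forall>y\<in>X. \<forall>l\<in>L. 0 \<le> (\<Sum>k\<in>K. M l k * y k)) \<Longrightarrow>
    \<exists>L' lam' M'. coeff_system V K L' lam' M' \<and> (\<forall>y\<in>insert x X. \<forall>l\<in>L'. 0 \<le> (\<Sum>k\<in>K. M' l k * y k))"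
proof (induction "card {l\<in>L. (\<Sum>k\<in>K. M l k * x k) \<noteq> 0}" arbitrary: L lam M rule: less_induct)
  case less
  have s: "coeff_system V K L lam M" and nn: "\<And>y l. y \<in> X \<Longrightarrow> l \<in> L \<Longrightarrow> 0 \<le> (\<Sum>k\<in>K. M l k * y k)" using less.prems by blast+
  have fL: "finite L" and pos: "\<And>l. l \<in> L \<Longrightarrow> 0 < lam l"
    and MQ: "\<And>l k. l \<in> L \<Longrightarrow> k \<in> K \<Longrightarrow> M l k \<in> \<rat>" and eq: "\<And>k. k \<in> K \<Longrightarrow> k = (\<Sum>l\<in>L. lam l * M l k)"
    using s unfolding coeff_system_def by blast+
  define q where "q l = (\<Sum>k\<in>K. M l k * x k)" for l
  have qQ: "q l \<in> \<rat>" if "l \<in> L" for l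
    unfolding q_def using MQ[OF that] x(1) by (intro Rats_sum Rats_mult)
  have step: ?case if i: "i \<in> L" "j \<in> L" "q i * q j < 0" "\<bar>q i\<bar> * lam i \<le> \<bar>q j\<bar> * lam j" for i j
  proof -
    define c where "c = - (q i / q j)"
    have ij: "i \<noteq> j" using i(3) by (auto simp: mult_less_0_iff)
    have qj: "q j \<noteq> 0" using i(3) by auto
    have c: "c \<in> \<rat>" "0 < c" "c * lam i \<le> lam j"
    proof -
      show "c \<in> \<rat>" using qQ i(1,2) by (simp add: c_def)
      show c0: "0 < c" using i(3) by (auto simp: c_def mult_less_0_iff divide_less_0_iff)
      have "c = \<bar>q i\<bar> / \<bar>q j\<bar>" using c0 by (simp add: c_def flip: abs_divide)
      then show "c * lam i \<le> lam j" using i(4) qj by (simp add: divide_le_eq mult.commute)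
    qed
    define M' where "M' = M(i := \<lambda>k. M i k + c * M j k)"
    obtain L' lam' where t: "L' \<subseteq> L" "coeff_system V K L' lam' M'"
      using coeff_system_transfer[OF V s i(1,2) ij c] unfolding M'_def by blast
    have co: "(\<Sum>k\<in>K. M' l k * y k) = (\<Sum>k\<in>K. M l k * y k) + (if l = i then c * (\<Sum>k\<in>K. M j k * y k) else 0)" for l y
      by (simp add: M'_def distrib_right sum.distrib sum_distrib_left mult.assoc)
    have "q i + c * q j = 0" using qj by (simp add: c_def)
    then have q': "(\<Sum>k\<in>K. M' l k * x k) = (if l = i then 0 else q l)" for l
      unfolding co q_def[symmetric] by simp
    have qi: "q i \<noteq> 0" using i(3) by auto
    have "{l\<in>L'. (\<Sum>k\<in>K. M' l k * x k) \<noteq> 0} \<subset> {l\<in>L. (\<Sum>k\<in>K. M l k * x k) \<noteq> 0}"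
      unfolding q' q_def[symmetric] using t(1) qi i(1) by auto
    then have lt: "card {l\<in>L'. (\<Sum>k\<in>K. M' l k * x k) \<noteq> 0} < card {l\<in>L. (\<Sum>k\<in>K. M l k * x k) \<noteq> 0}"
      using fL by (intro psubset_card_mono) auto
    have "\<forall>y\<in>X. \<forall>l\<in>L'. 0 \<le> (\<Sum>k\<in>K. M' l k * y k)"
      unfolding co using nn t(1) i(1,2) c(2) by auto
    with less.hyps[OF lt t(2)] show ?thesis by blast
  qed
  show ?case
  proof (cases "\<forall>l\<in>L. 0 \<le> q l")
    case True
    then have "\<forall>y\<in>insert x X. \<forall>l\<in>L. 0 \<le> (\<Sum>k\<in>K. M l k * y k)" using nn unfolding q_def by blast
    then show ?thesis using s by blast
  next
    case False
    then obtain j where j: "j \<in> L" "q j < 0" by force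
    have val: "(\<Sum>k\<in>K. x k * k) = (\<Sum>l\<in>L. lam l * q l)"
    proof -
      have "(\<Sum>k\<in>K. x k * k) = (\<Sum>k\<in>K. \<Sum>l\<in>L. lam l * (M l k * x k))"
      proof (rule sum.cong[OF refl])
        fix k assume "k \<in> K"
        from eq[OF this] have "x k * k = x k * (\<Sum>l\<in>L. lam l * M l k)" by simp
        then show "x k * k = (\<Sum>l\<in>L. lam l * (M l k * x k))" by (simp add: sum_distrib_left mult_ac)
      qed
      then show ?thesis unfolding q_def sum_distrib_left by (subst sum.swap)
    qed
    have "\<exists>i\<in>L. 0 < q i"
    proof (rule ccontr)
      assume "\<not> (\<exists>i\<in>L. 0 < q i)"
      then have "lam l * q l \<le> 0" if "l \<in> L" for l using that pos[OF that] by (auto simp: mult_le_0_iff not_less)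
      moreover have "lam j * q j < 0" using j pos by (simp add: mult_pos_neg)
      ultimately have "(\<Sum>l\<in>L. lam l * q l) < (\<Sum>l\<in>L. 0)" using j(1) fL by (intro sum_strict_mono_ex1) auto
      then show False using x(2) val by simp
    qed
    then obtain i where i: "i \<in> L" "0 < q i" by blast
    have "q i * q j < 0" "q j * q i < 0" using i j by (simp_all add: mult_pos_neg mult_neg_pos)
    moreover have "\<bar>q i\<bar> * lam i \<le> \<bar>q j\<bar> * lam j \<or> \<bar>q j\<bar> * lam j \<le> \<bar>q i\<bar> * lam i" by linarith
    ultimately show ?thesis using step[OF i(1) j(1)] step[OF j(1) i(1)] by blast
  qed
qed

lemma common_denominator:
  assumes "finite Q" "Q \<subseteq> \<rat>"
  shows "\<exists>D::nat. 0 < D \<and> (\<forall>q\<in>Q. real D * q \<in> \<int>)"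
  using assms
proof (induction Q)
  case empty
  then show ?case by auto
next
  case (insert q Q)
  then obtain D :: nat where D: "0 < D" "\<forall>q\<in>Q. real D * q \<in> \<int>" by blast
  obtain a :: int and b :: nat where ab: "b \<noteq> 0" "q = of_int a / of_nat b"
    using insert.prems unfolding Rats_eq_int_div_nat by blast
  have "real (D * b) * q = of_int (int D * a)" using ab by simp
  then have "real (D * b) * q \<in> \<int>" by (simp only: Ints_of_int)
  moreover have "real (D * b) * p \<in> \<int>" if "p \<in> Q" for p
  proof -
    have "real b * (real D * p) \<in> \<int>" by (rule Ints_mult[OF Ints_of_nat bspec[OF D(2) that]])
    then show ?thesis by (simp add: mult_ac)
  qed
  ultimately show ?case using D(1) ab(1) by (intro exI[of _ "D * b"]) auto
qed

text \<open>Relations are made nonnegative one at a time. Denominators are cleared at the end by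
  moving the common factor \<open>D\<close> from the \<open>lam l\<close> to the coefficients, which
  division in \<open>V\<close> permits.\<close>

lemma coefficient_system:
  assumes V: "rat_subspace V" and K: "finite K" "K \<subseteq> V" and X: "finite X"
    "\<forall>x\<in>X. \<forall>k\<in>K. x k \<in> \<rat>" "\<forall>x\<in>X. 0 \<le> (\<Sum>k\<in>K. x k * k)"
  obtains r lam and M :: "nat \<Rightarrow> real \<Rightarrow> real" where "\<And>l. l < r \<Longrightarrow> 0 < lam l" "\<And>l. l < r \<Longrightarrow> lam l \<in> V"
    "\<And>l k. l < r \<Longrightarrow> k \<in> K \<Longrightarrow> M l k \<in> \<int>" "\<And>k. k \<in> K \<Longrightarrow> k = (\<Sum>l<r. lam l * M l k)"
    "\<And>x l. x \<in> X \<Longrightarrow> l < r \<Longrightarrow> 0 \<le> (\<Sum>k\<in>K. M l k * x k)"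
proof -
  have "\<exists>L lam M. coeff_system V K L lam M \<and> (\<forall>y\<in>X. \<forall>l\<in>L. 0 \<le> (\<Sum>k\<in>K. M l k * y k))"
    using X
  proof (induction X)
    case empty
    \<comment> \<open>At the start every nonzero element of \<open>K\<close> is its own unit, up to
      sign.\<close>
    have "coeff_system V K (K - {0}) abs (\<lambda>l k. if l = k then sgn k else 0)"
      unfolding coeff_system_def
    proof (intro conjI ballI)
      show "finite (K - {0})" using K by simp
      show "0 < \<bar>l\<bar>" if "l \<in> K - {0}" for l :: real using that by simp
      show "\<bar>l\<bar> \<in> V" if "l \<in> K - {0}" for l
        using that K(2) rat_sub_closed(4)[OF V rat_sub_closed(3)[OF V], of l] by (auto simp: abs_if)
      show "(if l = k then sgn k else 0) \<in> \<rat>" for l k :: real by (auto simp: sgn_if)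
      fix k assume k: "k \<in> K"
      have "(\<Sum>l\<in>K - {0}. \<bar>l\<bar> * (if l = k then sgn k else 0)) = (\<Sum>l\<in>K - {0}. if l = k then \<bar>l\<bar> * sgn k else 0)"
        by (rule sum.cong) auto
      also have "\<dots> = k" using K k by (simp add: abs_mult_sgn)
      finally show "k = (\<Sum>l\<in>K - {0}. \<bar>l\<bar> * (if l = k then sgn k else 0))" by simp
    qed
    then show ?case by blast
  next
    case (insert x X)
    then obtain L lam M where "coeff_system V K L lam M" "\<forall>y\<in>X. \<forall>l\<in>L. 0 \<le> (\<Sum>k\<in>K. M l k * y k)" by blast
    then show ?case by (intro coeff_system_extend[OF V K(1)]) (use insert.prems in auto)
  qed
  then obtain L lam M where s: "coeff_system V K L lam M" and nn: "\<forall>y\<in>X. \<forall>l\<in>L. 0 \<le> (\<Sum>k\<in>K. M l k * y k)" by blast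
  have fL: "finite L" and pos: "\<And>l. l \<in> L \<Longrightarrow> 0 < lam l" and lV: "\<And>l. l \<in> L \<Longrightarrow> lam l \<in> V"
    and MQ: "\<And>l k. l \<in> L \<Longrightarrow> k \<in> K \<Longrightarrow> M l k \<in> \<rat>" and eq: "\<And>k. k \<in> K \<Longrightarrow> k = (\<Sum>l\<in>L. lam l * M l k)"
    using s unfolding coeff_system_def by blast+
  obtain D :: nat where D: "0 < D" "\<forall>q\<in>(\<lambda>(l, k). M l k) ` (L \<times> K). real D * q \<in> \<int>"
  proof -
    have "(\<lambda>(l, k). M l k) ` (L \<times> K) \<subseteq> \<rat>" using MQ by auto
    from common_denominator[OF _ this] show ?thesis using that fL K(1) by blast
  qed
  obtain h where h: "bij_betw h {0..<card L} L" using ex_bij_betw_nat_finite[OF fL] by blast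
  have hL: "h l \<in> L" if "l < card L" for l using h that by (auto simp: bij_betw_def)
  show ?thesis
  proof (rule that[of "card L" "\<lambda>l. lam (h l) / real D" "\<lambda>l k. real D * M (h l) k"])
    show "0 < lam (h l) / real D" if "l < card L" for l using pos[OF hL[OF that]] D(1) by simp
    show "lam (h l) / real D \<in> V" if "l < card L" for l using rat_sub_closed(5)[OF V lV[OF hL[OF that]]] .
    show "real D * M (h l) k \<in> \<int>" if "l < card L" "k \<in> K" for l k using D(2) hL[OF that(1)] that(2) by auto
    show "k = (\<Sum>l<card L. lam (h l) / real D * (real D * M (h l) k))" if "k \<in> K" for k
    proof -
      have "(\<Sum>l<card L. lam (h l) * M (h l) k) = (\<Sum>l\<in>L. lam l * M l k)"
        using sum.reindex_bij_betw[OF h, of "\<lambda>l. lam l * M l k"] by (simp add: atLeast0LessThan)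
      then show ?thesis using eq[OF that] D(1) by simp
    qed
    show "0 \<le> (\<Sum>k\<in>K. real D * M (h l) k * x k)" if "x \<in> X" "l < card L" for x l
    proof -
      have "0 \<le> real D * (\<Sum>k\<in>K. M (h l) k * x k)" using nn that hL by auto
      then show ?thesis by (simp add: sum_distrib_left mult.assoc)
    qed
  qed
qed

section \<open>The initial system\<close>

text \<open>A retraction of the reals onto \<open>V\<close> that is linear over the rationals; it is
  a left inverse of the identity on \<open>V\<close>, with range in \<open>V\<close>.\<close>

lemma rational_projection:
  assumes V: "rat_subspace V"
  obtains pr :: "real \<Rightarrow> real" where "\<And>x y. pr (x + y) = pr x + pr y" "\<And>q x. pr (of_int q * x) = of_int q * pr x"
    "\<And>x. pr x \<in> V" "\<And>v. v \<in> V \<Longrightarrow> pr v = v"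
proof -
  let ?s = "\<lambda>(q::rat) (x::real). of_rat q * x"
  interpret vs: vector_space ?s
    by unfold_locales (simp_all add: algebra_simps of_rat_add of_rat_mult)
  interpret vp: vector_space_pair ?s ?s ..
  have "Vector_Spaces.linear ?s ?s id" by (rule vs.linear_id)
  moreover have "vs.subspace V" using V unfolding rat_subspace_def .
  ultimately obtain g where g: "range g \<subseteq> V" "Vector_Spaces.linear ?s ?s g" "\<forall>v\<in>V. g (id v) = v"
    using vp.linear_exists_left_inverse_on[of id V] by auto
  interpret g: Vector_Spaces.linear ?s ?s g by (rule g(2))
  show ?thesis
  proof (rule that)
    show "g (x + y) = g x + g y" for x y by (rule g.add)
    show "g (of_int q * x) = of_int q * g x" for q x using g.scale[of "of_int q" x] by simp
  qed (use g in auto)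
qed

text \<open>The retraction applied to all coordinates commutes with the functions in
  \<open>F\<close>, so inequalities tight at \<open>w\<close> are tight at \<open>w'\<close>. Then
  \<open>w\<close> can be moved slightly both ways along \<open>w' - w\<close> within
  \<open>P\<close>, and extremality gives \<open>w' = w\<close>.\<close>

lemma extreme_point_in_V:
  assumes V: "rat_subspace V" and F: "finite F" "\<And>f. f \<in> F \<Longrightarrow> V_affine V f" and P: "P = {x. \<forall>f\<in>F. 0 \<le> f x}"
    and w: "w extreme_point_of P"
  shows "w $ i \<in> V"
proof -
  obtain pr :: "real \<Rightarrow> real" where pr: "\<And>x y. pr (x + y) = pr x + pr y" "\<And>q x. pr (of_int q * x) = of_int q * pr x"
    "\<And>x. pr x \<in> V" "\<And>v. v \<in> V \<Longrightarrow> pr v = v"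
    using rational_projection[OF V] by blast
  have pr0: "pr 0 = 0" using pr(1)[of 0 0] by simp
  have prsum: "pr (sum h A) = (\<Sum>x\<in>A. pr (h x))" for h :: "'b \<Rightarrow> real" and A
    by (induction A rule: infinite_finite_induct) (simp_all add: pr0 pr(1))
  define w' where "w' = (\<chi> i. pr (w $ i))"
  define d where "d = w' - w"
  have wP: "\<And>f. f \<in> F \<Longrightarrow> 0 \<le> f w" using w unfolding extreme_point_of_def P by blast
  have fw': "f w' = pr (f w)" if fF: "f \<in> F" for f
  proof -
    obtain v a where va: "v \<in> V" "f = (\<lambda>x. v + int_form a x)" using F(2)[OF fF] unfolding V_affine_def by blast
    show ?thesis unfolding va(2) pr(1) pr(4)[OF va(1)] int_form_def prsum pr(2) by (simp add: w'_def)
  qed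
  have line: "f (w + t *\<^sub>R d) = f w + t * (f w' - f w)" if fF: "f \<in> F" for f t
  proof -
    obtain v a where "f = (\<lambda>x. v + int_form a x)" using F(2)[OF fF] unfolding V_affine_def by blast
    then show ?thesis by (simp add: d_def int_form_add int_form_scale int_form_diff)
  qed
  have "\<exists>e>0. \<forall>f\<in>{f\<in>F. f w \<noteq> 0}. e * \<bar>f w' - f w\<bar> \<le> f w"
    by (rule small_multiple) (use F(1) wP in \<open>auto simp: less_le\<close>)
  then obtain e where e: "0 < e" "\<And>f. f \<in> F \<Longrightarrow> f w \<noteq> 0 \<Longrightarrow> e * \<bar>f w' - f w\<bar> \<le> f w" by auto
  have inP: "w + s *\<^sub>R d \<in> P" if "\<bar>s\<bar> = e" for s
    unfolding P
  proof (intro CollectI ballI)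
    fix f assume f: "f \<in> F"
    show "0 \<le> f (w + s *\<^sub>R d)"
    proof (cases "f w = 0")
      case True
      then show ?thesis unfolding line[OF f] fw'[OF f] by (simp add: pr0)
    next
      case False
      have "\<bar>s * (f w' - f w)\<bar> \<le> f w" using e(2)[OF f False] that by (simp add: abs_mult)
      then show ?thesis unfolding line[OF f] by linarith
    qed
  qed
  have "d = 0"
  proof (rule ccontr)
    assume d: "d \<noteq> 0"
    have "w \<in> open_segment (w + (- e) *\<^sub>R d) (w + e *\<^sub>R d)"
    proof -
      have "w = (1 - 1/2) *\<^sub>R (w + (- e) *\<^sub>R d) + (1/2) *\<^sub>R (w + e *\<^sub>R d)"
        by (simp add: scaleR_add_right scaleR_diff_right flip: scaleR_add_left)
      moreover have "w + (- e) *\<^sub>R d \<noteq> w + e *\<^sub>R d"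
      proof
        assume eq: "w + (- e) *\<^sub>R d = w + e *\<^sub>R d"
        have "(e + e) *\<^sub>R d = (w + e *\<^sub>R d) - (w + (- e) *\<^sub>R d)" unfolding scaleR_add_left by simp
        also have "\<dots> = 0" unfolding eq by simp
        finally show False using d e(1) by (simp only: scaleR_eq_0_iff) simp
      qed
      ultimately show ?thesis unfolding in_segment by (intro conjI exI[of _ "1/2"]) auto
    qed
    moreover have "w + (- e) *\<^sub>R d \<in> P" "w + e *\<^sub>R d \<in> P" using inP[of "- e"] inP[of e] e(1) by auto
    ultimately show False using w unfolding extreme_point_of_def by blast
  qed
  then have "w $ i = pr (w $ i)" by (simp add: d_def w'_def vec_eq_iff)
  then show ?thesis using pr(3) by metis
qed

text \<open>Splitting the coordinates of each vertex \<open>w\<close> along the \<open>lam l\<close>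
  gives integral points \<open>p w l\<close> with \<open>w\<close> as their sum weighted by
  \<open>lam\<close>. Because the slacks have nonnegative coefficients, \<open>p w l\<close>
  satisfies the \<open>l\<close>-th component of each inequality of \<open>P\<close>; hence all
  weighted sums of points from different vertices stay in \<open>P\<close>, and \<open>P\<close> is
  the Minkowski sum.\<close>

lemma initial_system:
  fixes P :: "(real ^ 'n::finite) set"
  assumes V: "rat_subspace V" and ZV: "ZV_polytope V P"
  obtains r T lam where "represents r V P T lam"
proof -
  obtain F where F: "finite F" "\<And>f. f \<in> F \<Longrightarrow> V_affine V f" and PF: "P = {x. \<forall>f\<in>F. 0 \<le> f x}"
    using ZV unfolding ZV_polytope_def by blast
  have pt: "polytope P" by (rule ZV_polytope_imp_polytope[OF ZV])
  define W where "W = {w. w extreme_point_of P}"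
  have finW: "finite W" unfolding W_def by (rule finite_polyhedron_extreme_points[OF polytope_imp_polyhedron[OF pt]])
  have PW: "P = convex hull W"
    unfolding W_def by (rule Krein_Milman_Minkowski[OF polytope_imp_compact[OF pt] polytope_imp_convex[OF pt]])
  have WP: "w \<in> P" if "w \<in> W" for w using that unfolding W_def extreme_point_of_def by blast
  have WV: "w $ i \<in> V" if "w \<in> W" for w i
    by (rule extreme_point_in_V[OF V F PF]) (use that in \<open>simp_all add: W_def\<close>)
  have "\<forall>f\<in>F. \<exists>va. fst va \<in> V \<and> f = (\<lambda>x. fst va + int_form (snd va) x)"
    using F(2) unfolding V_affine_def by (metis fst_conv snd_conv)
  then obtain va where va: "\<And>f. f \<in> F \<Longrightarrow> fst (va f) \<in> V \<and> f = (\<lambda>x. fst (va f) + int_form (snd (va f)) x)"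
    by metis
  define vf where "vf f = fst (va f)" for f
  define af where "af f = snd (va f)" for f
  have vV: "vf f \<in> V" and fx: "f x = vf f + int_form (af f) x" if "f \<in> F" for f x
  proof -
    show "vf f \<in> V" using va[OF that] by (simp add: vf_def)
    have "f = (\<lambda>x. fst (va f) + int_form (snd (va f)) x)" using va[OF that] by blast
    then show "f x = vf f + int_form (af f) x" unfolding vf_def af_def by (rule fun_cong)
  qed
  define K where "K = (\<Union>w\<in>W. range (\<lambda>i. w $ i)) \<union> vf ` F"
  have K: "finite K" "K \<subseteq> V" unfolding K_def using finW F(1) WV vV by auto
  have wK: "w $ i \<in> K" if "w \<in> W" for w i using that unfolding K_def by blast
  have vK: "vf f \<in> K" if "f \<in> F" for f using that unfolding K_def by blast
  \<comment> \<open>The slack of \<open>f\<close> at \<open>w\<close> as a formal combination of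
    numbers in \<open>K\<close>. Coordinates of \<open>w\<close> that coincide with each other or
    with the constant term are accumulated at the same element.\<close>
  define xx :: "(real ^ 'n \<Rightarrow> real) \<Rightarrow> real ^ 'n \<Rightarrow> real \<Rightarrow> real"
    where "xx f w k = (if k = vf f then 1 else 0) + (\<Sum>i\<in>UNIV. of_int (af f $ i) * (if k = w $ i then 1 else 0))"
    for f w k
  have xsum: "(\<Sum>k\<in>K. N k * xx f w k) = N (vf f) + (\<Sum>i\<in>UNIV. of_int (af f $ i) * N (w $ i))"
    if "f \<in> F" "w \<in> W" for N f w
  proof -
    have "(\<Sum>k\<in>K. N k * xx f w k) = (\<Sum>k\<in>K. if k = vf f then N k else 0) +
        (\<Sum>k\<in>K. \<Sum>i\<in>UNIV. of_int (af f $ i) * (if k = w $ i then N k else 0))"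
      unfolding sum.distrib[symmetric]
      by (rule sum.cong) (auto simp: xx_def distrib_left sum_distrib_left mult.commute intro!: sum.cong)
    also have "(\<Sum>k\<in>K. \<Sum>i\<in>UNIV. of_int (af f $ i) * (if k = w $ i then N k else 0)) =
        (\<Sum>i\<in>UNIV. of_int (af f $ i) * (\<Sum>k\<in>K. if k = w $ i then N k else 0))"
      unfolding sum_distrib_left by (rule sum.swap)
    finally show ?thesis using K(1) vK[OF that(1)] wK[OF that(2)] by simp
  qed
  define X where "X = (\<lambda>(f, w). xx f w) ` (F \<times> W)"
  have X: "finite X" unfolding X_def using F(1) finW by simp
  have XQ: "\<forall>x\<in>X. \<forall>k\<in>K. x k \<in> \<rat>"
    unfolding X_def xx_def by (auto intro!: Rats_add Rats_sum Rats_mult)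
  have Xnn: "\<forall>x\<in>X. 0 \<le> (\<Sum>k\<in>K. x k * k)"
  proof
    fix x assume x: "x \<in> X"
    obtain f w where fw: "f \<in> F" "w \<in> W" "x = xx f w" using x unfolding X_def by auto
    have "(\<Sum>k\<in>K. x k * k) = (\<Sum>k\<in>K. k * xx f w k)" unfolding fw(3) by (rule sum.cong[OF refl]) (rule mult.commute)
    also have "\<dots> = vf f + (\<Sum>i\<in>UNIV. of_int (af f $ i) * w $ i)" by (rule xsum[OF fw(1,2), of "\<lambda>k. k"])
    also have "\<dots> = f w" by (rule fx[OF fw(1), of w, unfolded int_form_def, symmetric])
    finally show "0 \<le> (\<Sum>k\<in>K. x k * k)" using WP[OF fw(2)] fw(1) unfolding PF by simp
  qed
  obtain r lam and M :: "nat \<Rightarrow> real \<Rightarrow> real" where L: "\<And>l. l < r \<Longrightarrow> 0 < lam l" "\<And>l. l < r \<Longrightarrow> lam l \<in> V"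
    and M: "\<And>l k. l < r \<Longrightarrow> k \<in> K \<Longrightarrow> M l k \<in> \<int>" "\<And>k. k \<in> K \<Longrightarrow> k = (\<Sum>l<r. lam l * M l k)"
      "\<And>x l. x \<in> X \<Longrightarrow> l < r \<Longrightarrow> 0 \<le> (\<Sum>k\<in>K. M l k * x k)"
  proof (rule coefficient_system[OF V K X XQ Xnn])
    fix r lam and M :: "nat \<Rightarrow> real \<Rightarrow> real"
    assume "\<And>l. l < r \<Longrightarrow> 0 < lam l" "\<And>l. l < r \<Longrightarrow> lam l \<in> V"
      "\<And>l k. l < r \<Longrightarrow> k \<in> K \<Longrightarrow> M l k \<in> \<int>" "\<And>k. k \<in> K \<Longrightarrow> k = (\<Sum>l<r. lam l * M l k)"
      "\<And>x l. x \<in> X \<Longrightarrow> l < r \<Longrightarrow> 0 \<le> (\<Sum>k\<in>K. M l k * x k)"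
    then show thesis by (rule that)
  qed
  define m where "m l = (if l < r then lam l else 0)" for l
  define p where "p w l = (\<chi> i. M l (w $ i))" for w :: "real ^ 'n" and l
  define G where "G = (\<lambda>(w, l). (p w l, l)) ` (W \<times> {..<r})"
  have finG: "finite G" unfolding G_def using finW by simp
  have slack: "0 \<le> M l (vf f) + int_form (af f) (p w l)" if "f \<in> F" "w \<in> W" "l < r" for f w l
  proof -
    have "xx f w \<in> X" unfolding X_def using that by force
    then have "0 \<le> (\<Sum>k\<in>K. M l k * xx f w k)" by (rule M(3)[OF _ that(3)])
    then show ?thesis unfolding xsum[OF that(1,2)] by (simp add: int_form_def p_def)
  qed
  have Gr: "snd g < r" and Gi: "int_vec (fst g)" if g: "g \<in> G" for g
    using g M(1) wK unfolding G_def by (auto simp: int_vec_def p_def)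
  have W_slice: "w \<in> slice G m" if w: "w \<in> W" for w
  proof -
    \<comment> \<open>The points of a single vertex form a frame without edges, so that
      \<open>lift\<close> simply puts the mass of each label on its only point.\<close>
    have f: "frame ((\<lambda>l. (p w l, l)) ` {..<r}) r (\<lambda>l. (p w l, l))" by unfold_locales auto
    interpret frame "(\<lambda>l. (p w l, l)) ` {..<r}" r "\<lambda>l. (p w l, l)" by (rule f)
    have B: "B = {}" unfolding B_def by simp
    have "supp (lift m (\<lambda>_. 0)) \<subseteq> (\<lambda>l. (p w l, l)) ` {..<r}" by (rule supp_lift)
    moreover have "(\<lambda>l. (p w l, l)) ` {..<r} \<subseteq> G" unfolding G_def using w by auto
    ultimately have s: "supp (lift m (\<lambda>_. 0)) \<subseteq> G" by (rule order_trans)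
    have "ev (lift m (\<lambda>_. 0)) \<in> slice G m"
    proof (rule sliceI[OF s])
      show "0 \<le> lift m (\<lambda>_. 0) g" for g unfolding lift_def B by (simp add: m_def L(1) less_imp_le)
      show "mass (lift m (\<lambda>_. 0)) = m" by (simp add: fun_eq_iff mass_lift m_def)
    qed
    moreover have "ev (lift m (\<lambda>_. 0)) = w"
    proof -
      have "ev (lift m (\<lambda>_. 0)) = (\<Sum>l<r. m l *\<^sub>R p w l)" unfolding ev_lift B by simp
      also have "\<dots> = w" using M(2)[OF wK[OF w]] by (simp add: vec_eq_iff p_def m_def)
      finally show ?thesis .
    qed
    ultimately show ?thesis by simp
  qed
  have Pcel: "P = slice G m"
  proof
    show "P \<subseteq> slice G m" unfolding PW by (rule hull_minimal) (use W_slice convex_slice[OF finG] in auto)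
    show "slice G m \<subseteq> P"
    proof
      fix x assume "x \<in> slice G m"
      then obtain a where a: "x = ev a" "supp a \<subseteq> G" "\<And>g. 0 \<le> a g" "mass a = m" by (rule sliceE) blast
      have "0 \<le> f x" if f: "f \<in> F" for f
      proof -
        have "vf f = (\<Sum>l<r. lam l * M l (vf f))" by (rule M(2)[OF vK[OF f]])
        also have "\<dots> = (\<Sum>l<r. \<Sum>g\<in>{g\<in>G. snd g = l}. a g * M (snd g) (vf f))"
        proof (rule sum.cong[OF refl])
          fix l assume "l \<in> {..<r}"
          then have "lam l = (\<Sum>g\<in>{g\<in>G. snd g = l}. a g)" using mass_sum[OF finG a(2), of l] a(4) by (simp add: m_def)
          then show "lam l * M l (vf f) = (\<Sum>g\<in>{g\<in>G. snd g = l}. a g * M (snd g) (vf f))"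
            by (simp add: sum_distrib_right)
        qed
        also have "\<dots> = (\<Sum>g\<in>G. a g * M (snd g) (vf f))" by (rule sum.group) (use finG Gr in auto)
        finally have v: "vf f = (\<Sum>g\<in>G. a g * M (snd g) (vf f))" .
        have "(\<Sum>g\<in>G. a g * (M (snd g) (vf f) + int_form (af f) (fst g))) =
            (\<Sum>g\<in>G. a g * M (snd g) (vf f)) + (\<Sum>g\<in>G. a g * int_form (af f) (fst g))"
          by (simp only: distrib_left sum.distrib)
        also have "(\<Sum>g\<in>G. a g * M (snd g) (vf f)) = vf f" by (rule v[symmetric])
        also have "(\<Sum>g\<in>G. a g * int_form (af f) (fst g)) = int_form (af f) x"
          unfolding a(1) ev_sum[OF finG a(2)] int_form_sum int_form_scale ..
        also have "vf f + int_form (af f) x = f x" by (rule fx[OF f, symmetric])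
        finally have "f x = (\<Sum>g\<in>G. a g * (M (snd g) (vf f) + int_form (af f) (fst g)))" by (rule sym)
        moreover have "0 \<le> a g * (M (snd g) (vf f) + int_form (af f) (fst g))" if "g \<in> G" for g
          using that slack[OF f] a(3)[of g] unfolding G_def by auto
        ultimately show ?thesis by (simp add: sum_nonneg)
      qed
      then show "x \<in> P" unfolding PF by blast
    qed
  qed
  obtain T where T: "simplicial T" "cone_unique T" "\<And>S. S \<in> T \<Longrightarrow> S \<subseteq> G" "\<And>x m. fibre G x m \<noteq> {} \<Longrightarrow> \<exists>b. carried T b \<and> ev b = x \<and> mass b = m"
    using lexmin_triangulation[OF finG] by blast
  have "represents r V P T m"
    unfolding represents_def
  proof (intro conjI ballI allI impI)
    show "simplicial T" "cone_unique T" by (rule T)+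
    show "int_vec (fst g)" "snd g < r" if "S \<in> T" "g \<in> S" for S g using T(3)[OF that(1)] that(2) Gi Gr by blast+
    show "0 < m l" "m l \<in> V" if "l < r" for l using L that by (auto simp: m_def)
    show "m l = 0" if "r \<le> l" for l using that by (simp add: m_def)
    show "P = {ev a | a. carried T a \<and> mass a = m}"
    proof
      show "P \<subseteq> {ev a | a. carried T a \<and> mass a = m}"
      proof
        fix x assume "x \<in> P"
        then have "x \<in> slice G m" by (simp add: Pcel)
        then have "fibre G x m \<noteq> {}" unfolding slice_def fibre_def by blast
        then show "x \<in> {ev a | a. carried T a \<and> mass a = m}" using T(4) by blast
      qed
      show "{ev a | a. carried T a \<and> mass a = m} \<subseteq> P"
      proof
        fix x assume "x \<in> {ev a | a. carried T a \<and> mass a = m}"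
        then obtain a where a: "x = ev a" "carried T a" "mass a = m" by blast
        show "x \<in> P" unfolding Pcel a(1)
          by (rule sliceI[OF T(3)[OF carried_supp[OF a(2)]] carried_nonneg[OF a(2)] a(3)])
      qed
    qed
  qed
  then show ?thesis by (rule that)
qed

theorem theorem4p1p3:
  fixes V :: "real set" and P :: "(real ^ 'n) set"
  assumes "rat_subspace V" and "ZV_polytope V P"
  shows "\<exists>\<C>. polystable_subdivision V \<C> P"
proof -
  have P: "convex P" "P \<noteq> {}"
    using polytope_imp_convex[OF ZV_polytope_imp_polytope[OF assms(2)]] assms(2) by (auto simp: ZV_polytope_def)
  obtain r T lam where represents: "represents r V P T lam" by (rule initial_system[OF assms])
  show ?thesis
  proof (rule unimodular_refinement[OF assms(1) represents])
    fix T2 lam2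
    assume St2: "represents r V P T2 lam2" and box_points: "\<And>S. S \<in> T2 \<Longrightarrow> box_points S = {\<lambda>_. 0}"
    show ?thesis by (rule unimodular_subdivision[OF assms(1) St2 box_points P])
  qed
qed

end
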